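(* Let $M|N$ be an extension of $R$-algebras, where $R=C_M(N)$ is a field which is the ground field and is trivial (it coincides with the centers of $M$ and of $N$). Suppose $M|N$ is a biseparable Frobenius extension of depth two. Then $A=\mathrm{End}({}_NM_N)$ and $B=(M\otimes_NM)^N$, with the bialgebra structures in the context, are semisimple Hopf algebras over $R$, dual to one another via the nondegenerate pairing $\langle b,\alpha\rangle=b^1\alpha(b^2)$, and they are isomorphic as Hopf algebras to $\hat A=C_{M_1}(N)$ and $\hat B=C_{M_2}(M)$, respectively.
   Context: A ring extension $M|N$ (a unital ring homomorphism $N\to M$) is D2 (depth two) if $M\otimes_NM$ is isomorphic to a direct summand of $\oplus^n\,{}_NM_M$ as an $N$-$M$-bimodule and of $\oplus^m\,{}_MM_N$ as an $M$-$N$-bimodule, for some $n,m\ge1$. It is Frobenius if there are an $N$-$N$-bimodule map $E:M\to N$ and finitely many $x_i,y_i\in M$ with $\sum_ix_iE(y_im)=m=\sum_iE(mx_i)y_i$ for all $m$. It is biseparable if $M_N$ and ${}_NM$ are finitely generated projective, $M|N$ is separable (multiplication $M\otimes_NM\to M$ is a split $M$-$M$-bimodule epimorphism) and split ($M\cong N\oplus V$ as $N$-bimodules for some $N$-bimodule $V$). Elements of $B=\{b\in M\otimes_NM:nb=bn\ \forall n\in N\}$ are written $b=b^1\otimes b^2$. Let $b_i\in B$, $\beta_i\in A$ be a left D2 quasibasis, i.e. finite families with $\sum_ib_i^1\otimes b_i^2\beta_i(m)=m\otimes1$ for all $m\in M$ (it exists since $M|N$ is D2). Bialgebra structure of $A$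 over $R$: composition, $\Delta(\alpha)=\sum_i\alpha(-\,b_i^1)b_i^2\otimes\beta_i$, $\varepsilon(\alpha)=\alpha(1)$. Bialgebra structure of $B$: $bb'={b'}^1b^1\otimes b^2{b'}^2$, unit $1\otimes1$, $\Delta(b)=\sum_ib_i\otimes(\beta_i(b^1)\otimes b^2)$, $\varepsilon(b)=b^1b^2$. Jones tower: $M_1=M\otimes_NM$ with multiplication $(m\otimes m')(m''\otimes m''')=mE(m'm'')\otimes m'''$ and unit $\sum_ix_i\otimes y_i$; $M\subset M_1$ via $m\mapsto\sum_imx_i\otimes y_i$; $e_1=1\otimes1$; $E_M:M_1\to M$, $E_M(m\otimes m')=mm'$, is a Frobenius homomorphism with dual bases $\{x_i\otimes 1\},\{1\otimes y_i\}$. $M_2=M_1\otimes_MM_1$ is built in the same way from $M_1|M$ and $E_M$, with $e_2=1_{M_1}\otimes1_{M_1}$ and $E_{M_1}:M_2\to M_1$ the multiplication. The algebras $\hat A=C_{M_1}(N)$ and $\hat B=C_{M_2}(M)$ carry the Hopf algebra structures of Kadison–Nikshych: the bilinear form $\langle a,b\rangle''=E_ME_{M_1}(a e_2e_1b)$ on $\hat A\times\hat B$ takes values in $R$ and is nondegenerate; the coproduct of $\hat B$ is determined by $\langle aa',b\rangle''=\langle a,b_{(1)}\rangle''\langle a',b_{(2)}\rangle''$ and its counit by $E_{M_1}(e_2b)=\varepsilon(b)1_{M_1}$; with these $\hat B$ is a Hopf algebra, and $\hat A$ has the Hopf algebra structure dual to $\hat B$ with respect to this form. *)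

theory Defs
  imports "HOL-Algebra.Algebra"
begin

section \<open>Bimodules\<close>

text \<open>As in \<^locale>\<open>module\<close>, the multiplicative part of the underlying ring record plays no role.\<close>

record ('s, 't, 'x) bimod = "'x ring" +
  lact :: "'s \<Rightarrow> 'x \<Rightarrow> 'x"
  ract :: "'x \<Rightarrow> 't \<Rightarrow> 'x"

definition bimodule ::
    "('s, 'p) ring_scheme \<Rightarrow> ('t, 'q) ring_scheme \<Rightarrow> ('s, 't, 'x) bimod \<Rightarrow> bool" where
  "bimodule S T U \<longleftrightarrow> ring S \<and> ring T \<and> abelian_group U \<and>
     (\<forall>s\<in>carrier S. \<forall>x\<in>carrier U. lact U s x \<in> carrier U) \<and>
     (\<forall>x\<in>carrier U. \<forall>t\<in>carrier T. ract U x t \<in> carrier U) \<and>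
     (\<forall>s\<in>carrier S. \<forall>x\<in>carrier U. \<forall>y\<in>carrier U.
        lact U s (x \<oplus>\<^bsub>U\<^esub> y) = lact U s x \<oplus>\<^bsub>U\<^esub> lact U s y) \<and>
     (\<forall>s\<in>carrier S. \<forall>s'\<in>carrier S. \<forall>x\<in>carrier U.
        lact U (s \<oplus>\<^bsub>S\<^esub> s') x = lact U s x \<oplus>\<^bsub>U\<^esub> lact U s' x \<and>
        lact U (s \<otimes>\<^bsub>S\<^esub> s') x = lact U s (lact U s' x)) \<and>
     (\<forall>x\<in>carrier U. lact U \<one>\<^bsub>S\<^esub> x = x) \<and>
     (\<forall>x\<in>carrier U. \<forall>y\<in>carrier U. \<forall>t\<in>carrier T.
        ract U (x \<oplus>\<^bsub>U\<^esub> y) t = ract U x t \<oplus>\<^bsub>U\<^esub> ract U y t) \<and>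
     (\<forall>x\<in>carrier U. \<forall>t\<in>carrier T. \<forall>t'\<in>carrier T.
        ract U x (t \<oplus>\<^bsub>T\<^esub> t') = ract U x t \<oplus>\<^bsub>U\<^esub> ract U x t' \<and>
        ract U x (t \<otimes>\<^bsub>T\<^esub> t') = ract U (ract U x t) t') \<and>
     (\<forall>x\<in>carrier U. ract U x \<one>\<^bsub>T\<^esub> = x) \<and>
     (\<forall>s\<in>carrier S. \<forall>x\<in>carrier U. \<forall>t\<in>carrier T.
        lact U s (ract U x t) = ract U (lact U s x) t)"

definition bimod_hom ::
    "('s, 'p) ring_scheme \<Rightarrow> ('t, 'q) ring_scheme \<Rightarrow> ('s, 't, 'x) bimod \<Rightarrow> ('s, 't, 'y) bimod
      \<Rightarrow> ('x \<Rightarrow> 'y) set" where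
  "bimod_hom S T U Y = {f \<in> carrier U \<rightarrow> carrier Y.
     (\<forall>x\<in>carrier U. \<forall>y\<in>carrier U. f (x \<oplus>\<^bsub>U\<^esub> y) = f x \<oplus>\<^bsub>Y\<^esub> f y) \<and>
     (\<forall>s\<in>carrier S. \<forall>x\<in>carrier U. f (lact U s x) = lact Y s (f x)) \<and>
     (\<forall>x\<in>carrier U. \<forall>t\<in>carrier T. f (ract U x t) = ract Y (f x) t)}"

definition bimod_iso ::
    "('s, 'p) ring_scheme \<Rightarrow> ('t, 'q) ring_scheme \<Rightarrow> ('s, 't, 'x) bimod \<Rightarrow> ('s, 't, 'y) bimod
      \<Rightarrow> bool" where
  "bimod_iso S T U Y \<longleftrightarrow> (\<exists>f\<in>bimod_hom S T U Y. bij_betw f (carrier U) (carrier Y))"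

definition bimod_sum ::
    "('s, 't, 'x) bimod \<Rightarrow> ('s, 't, 'y) bimod \<Rightarrow> ('s, 't, 'x \<times> 'y) bimod" where
  "bimod_sum U Y =
    \<lparr>carrier = carrier U \<times> carrier Y, monoid.mult = undefined, one = undefined,
     ring.zero = (\<zero>\<^bsub>U\<^esub>, \<zero>\<^bsub>Y\<^esub>), add = (\<lambda>(x, y) (x', y'). (x \<oplus>\<^bsub>U\<^esub> x', y \<oplus>\<^bsub>Y\<^esub> y')),
     lact = (\<lambda>s (x, y). (lact U s x, lact Y s y)),
     ract = (\<lambda>(x, y) t. (ract U x t, ract Y y t))\<rparr>"

definition bimod_power :: "nat \<Rightarrow> ('s, 't, 'x) bimod \<Rightarrow> ('s, 't, nat \<Rightarrow> 'x) bimod" where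
  "bimod_power n U =
    \<lparr>carrier = {..<n} \<rightarrow>\<^sub>E carrier U, monoid.mult = undefined, one = undefined,
     ring.zero = (\<lambda>i\<in>{..<n}. \<zero>\<^bsub>U\<^esub>), add = (\<lambda>f g. \<lambda>i\<in>{..<n}. f i \<oplus>\<^bsub>U\<^esub> g i),
     lact = (\<lambda>s f. \<lambda>i\<in>{..<n}. lact U s (f i)),
     ract = (\<lambda>f t. \<lambda>i\<in>{..<n}. ract U (f i) t)\<rparr>"

text \<open>The complement \<open>V\<close> embeds into \<open>Y\<close>, so it is no restriction to let its elements have the
  same type as those of \<open>Y\<close>.\<close>

definition direct_summand ::
    "('s, 'p) ring_scheme \<Rightarrow> ('t, 'q) ring_scheme \<Rightarrow> ('s, 't, 'x) bimod \<Rightarrow> ('s, 't, 'y) bimod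
      \<Rightarrow> bool" where
  "direct_summand S T U Y \<longleftrightarrow>
     (\<exists>V :: ('s, 't, 'y) bimod. bimodule S T V \<and> bimod_iso S T (bimod_sum U V) Y)"

definition ring_bimod ::
    "('x, 'p) ring_scheme \<Rightarrow> ('s \<Rightarrow> 'x) \<Rightarrow> ('t \<Rightarrow> 'x) \<Rightarrow> ('s, 't, 'x) bimod" where
  "ring_bimod M l r =
    \<lparr>carrier = carrier M, monoid.mult = monoid.mult M, one = one M, ring.zero = ring.zero M, add = add M,
     lact = (\<lambda>s x. l s \<otimes>\<^bsub>M\<^esub> x), ract = (\<lambda>x t. x \<otimes>\<^bsub>M\<^esub> r t)\<rparr>"

text \<open>One-sided modules are bimodules over the integers on the other side.\<close>

definition int_hom :: "('x, 'p) ring_scheme \<Rightarrow> int \<Rightarrow> 'x" where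
  "int_hom M k = [k] \<cdot>\<^bsub>M\<^esub> \<one>\<^bsub>M\<^esub>"

section \<open>Tensor products\<close>

text \<open>An element of a tensor product over \<open>T\<close> is a coset, in the free abelian group on pairs, of
  the subgroup generated by the bilinearity and balancing relations.\<close>

type_synonym ('x, 'y) tens = "(('x \<times> 'y) \<Rightarrow>\<^sub>0 int) set"

definition tensor_rels ::
    "('t, 'p) ring_scheme \<Rightarrow> ('s, 't, 'x) bimod \<Rightarrow> ('t, 'u, 'y) bimod
      \<Rightarrow> (('x \<times> 'y) \<Rightarrow>\<^sub>0 int) set" where
  "tensor_rels T U Y =
     {frag_of (x \<oplus>\<^bsub>U\<^esub> x', y) - frag_of (x, y) - frag_of (x', y) | x x' y.
        x \<in> carrier U \<and> x' \<in> carrier U \<and> y \<in> carrier Y} \<union>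
     {frag_of (x, y \<oplus>\<^bsub>Y\<^esub> y') - frag_of (x, y) - frag_of (x, y') | x y y'.
        x \<in> carrier U \<and> y \<in> carrier Y \<and> y' \<in> carrier Y} \<union>
     {frag_of (ract U x t, y) - frag_of (x, lact Y t y) | x t y.
        x \<in> carrier U \<and> t \<in> carrier T \<and> y \<in> carrier Y}"

definition tensor_ker ::
    "('t, 'p) ring_scheme \<Rightarrow> ('s, 't, 'x) bimod \<Rightarrow> ('t, 'u, 'y) bimod
      \<Rightarrow> (('x \<times> 'y) \<Rightarrow>\<^sub>0 int) set" where
  "tensor_ker T U Y =
     generate (free_Abelian_group (carrier U \<times> carrier Y)) (tensor_rels T U Y)"

definition pure_tensor ::
    "('t, 'p) ring_scheme \<Rightarrow> ('s, 't, 'x) bimod \<Rightarrow> ('t, 'u, 'y) bimod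
      \<Rightarrow> 'x \<Rightarrow> 'y \<Rightarrow> ('x, 'y) tens" where
  "pure_tensor T U Y x y =
     tensor_ker T U Y #>\<^bsub>free_Abelian_group (carrier U \<times> carrier Y)\<^esub> frag_of (x, y)"

text \<open>The additive map on a tensor product induced by a balanced map \<open>f\<close> into \<open>Z\<close>: for such \<open>f\<close>
  all representatives of the coset \<open>t\<close> yield the same value.\<close>

definition tensor_lift ::
    "('z, 'p) ring_scheme \<Rightarrow> ('x \<Rightarrow> 'y \<Rightarrow> 'z) \<Rightarrow> ('x, 'y) tens \<Rightarrow> 'z" where
  "tensor_lift Z f t = the_elem
     ((\<lambda>c. \<Oplus>\<^bsub>Z\<^esub>p\<in>Poly_Mapping.keys c. [Poly_Mapping.lookup c p] \<cdot>\<^bsub>Z\<^esub> f (fst p) (snd p)) ` t)"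

definition tensor_grp ::
    "('t, 'p) ring_scheme \<Rightarrow> ('s, 't, 'x) bimod \<Rightarrow> ('t, 'u, 'y) bimod \<Rightarrow> ('x, 'y) tens ring" where
  "tensor_grp T U Y =
    (let Q = free_Abelian_group (carrier U \<times> carrier Y) Mod tensor_ker T U Y in
      \<lparr>carrier = carrier Q, monoid.mult = undefined, one = undefined,
       ring.zero = \<one>\<^bsub>Q\<^esub>, add = monoid.mult Q\<rparr>)"

definition tensor ::
    "('t, 'p) ring_scheme \<Rightarrow> ('s, 't, 'x) bimod \<Rightarrow> ('t, 'u, 'y) bimod
      \<Rightarrow> ('s, 'u, ('x, 'y) tens) bimod" where
  "tensor T U Y =
    ring.extend (tensor_grp T U Y)
      (bimod.fields
        (\<lambda>s. tensor_lift (tensor_grp T U Y) (\<lambda>x y. pure_tensor T U Y (lact U s x) y))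
        (\<lambda>w u. tensor_lift (tensor_grp T U Y) (\<lambda>x y. pure_tensor T U Y x (ract Y y u)) w))"

section \<open>Hopf algebras\<close>

definition sym_bimod :: "('r, 'a, 'p) module_scheme \<Rightarrow> ('r, 'r, 'a) bimod" where
  "sym_bimod H =
    \<lparr>carrier = carrier H, monoid.mult = monoid.mult H, one = one H, ring.zero = ring.zero H, add = add H,
     lact = smult H, ract = (\<lambda>x r. r \<odot>\<^bsub>H\<^esub> x)\<rparr>"

abbreviation tensor2 ::
    "'r ring \<Rightarrow> ('r, 'a, 'p) module_scheme \<Rightarrow> ('r, 'r, ('a, 'a) tens) bimod" where
  "tensor2 R H \<equiv> tensor R (sym_bimod H) (sym_bimod H)"

abbreviation pure2 ::
    "'r ring \<Rightarrow> ('r, 'a, 'p) module_scheme \<Rightarrow> 'a \<Rightarrow> 'a \<Rightarrow> ('a, 'a) tens" where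
  "pure2 R H \<equiv> pure_tensor R (sym_bimod H) (sym_bimod H)"

record ('r, 'a) bialg = "('r, 'a) module" +
  comult :: "'a \<Rightarrow> ('a, 'a) tens"
  counit :: "'a \<Rightarrow> 'r"

definition linear_maps ::
    "'r ring \<Rightarrow> ('r, 'r, 'a) bimod \<Rightarrow> ('r, 'r, 'b) bimod \<Rightarrow> ('a \<Rightarrow> 'b) set" where
  "linear_maps R U Y = bimod_hom R R U Y"

text \<open>The library locale \<^locale>\<open>algebra\<close> demands commutativity.\<close>

definition assoc_algebra :: "'r ring \<Rightarrow> ('r, 'a, 'p) module_scheme \<Rightarrow> bool" where
  "assoc_algebra R H \<longleftrightarrow> ring H \<and> module R H \<and>
     (\<forall>r\<in>carrier R. \<forall>x\<in>carrier H. \<forall>y\<in>carrier H.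
        (r \<odot>\<^bsub>H\<^esub> x) \<otimes>\<^bsub>H\<^esub> y = r \<odot>\<^bsub>H\<^esub> (x \<otimes>\<^bsub>H\<^esub> y) \<and>
        x \<otimes>\<^bsub>H\<^esub> (r \<odot>\<^bsub>H\<^esub> y) = r \<odot>\<^bsub>H\<^esub> (x \<otimes>\<^bsub>H\<^esub> y))"

definition tensor2_mult ::
    "'r ring \<Rightarrow> ('r, 'a, 'p) module_scheme \<Rightarrow> ('a, 'a) tens \<Rightarrow> ('a, 'a) tens
      \<Rightarrow> ('a, 'a) tens" where
  "tensor2_mult R H s t =
     tensor_lift (tensor2 R H)
       (\<lambda>x y. tensor_lift (tensor2 R H) (\<lambda>x' y'. pure2 R H (x \<otimes>\<^bsub>H\<^esub> x') (y \<otimes>\<^bsub>H\<^esub> y')) t) s"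

definition coalgebra :: "'r ring \<Rightarrow> ('r, 'a) bialg \<Rightarrow> bool" where
  "coalgebra R H \<longleftrightarrow>
     comult H \<in> linear_maps R (sym_bimod H) (tensor2 R H) \<and>
     counit H \<in> linear_maps R (sym_bimod H) (ring_bimod R id id) \<and>
     (let V = sym_bimod H; VV = tensor R V V; V_VV = tensor R V VV; VV_V = tensor R VV V;
          \<comment> \<open>the canonical map from \<open>(H \<otimes> H) \<otimes> H\<close> to \<open>H \<otimes> (H \<otimes> H)\<close>\<close>
          assoc = tensor_lift V_VV (\<lambda>s z. tensor_lift V_VV
                    (\<lambda>x y. pure_tensor R V VV x (pure_tensor R V V y z)) s)
      in \<forall>h\<in>carrier H.
        assoc (tensor_lift VV_V (\<lambda>x y. pure_tensor R VV V (comult H x) y) (comult H h)) =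
        tensor_lift V_VV (\<lambda>x y. pure_tensor R V VV x (comult H y)) (comult H h)) \<and>
     (\<forall>h\<in>carrier H.
        tensor_lift H (\<lambda>x y. counit H x \<odot>\<^bsub>H\<^esub> y) (comult H h) = h \<and>
        tensor_lift H (\<lambda>x y. counit H y \<odot>\<^bsub>H\<^esub> x) (comult H h) = h)"

definition bialgebra :: "'r ring \<Rightarrow> ('r, 'a) bialg \<Rightarrow> bool" where
  "bialgebra R H \<longleftrightarrow> assoc_algebra R H \<and> coalgebra R H \<and>
     (\<forall>x\<in>carrier H. \<forall>y\<in>carrier H.
        comult H (x \<otimes>\<^bsub>H\<^esub> y) = tensor2_mult R H (comult H x) (comult H y) \<and>
        counit H (x \<otimes>\<^bsub>H\<^esub> y) = counit H x \<otimes>\<^bsub>R\<^esub> counit H y) \<and>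
     comult H \<one>\<^bsub>H\<^esub> = pure2 R H \<one>\<^bsub>H\<^esub> \<one>\<^bsub>H\<^esub> \<and>
     counit H \<one>\<^bsub>H\<^esub> = \<one>\<^bsub>R\<^esub>"

definition antipode :: "'r ring \<Rightarrow> ('r, 'a) bialg \<Rightarrow> ('a \<Rightarrow> 'a) \<Rightarrow> bool" where
  "antipode R H S \<longleftrightarrow> S \<in> linear_maps R (sym_bimod H) (sym_bimod H) \<and>
     (\<forall>h\<in>carrier H.
        tensor_lift H (\<lambda>x y. S x \<otimes>\<^bsub>H\<^esub> y) (comult H h) = counit H h \<odot>\<^bsub>H\<^esub> \<one>\<^bsub>H\<^esub> \<and>
        tensor_lift H (\<lambda>x y. x \<otimes>\<^bsub>H\<^esub> S y) (comult H h) = counit H h \<odot>\<^bsub>H\<^esub> \<one>\<^bsub>H\<^esub>)"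

definition hopf_algebra :: "'r ring \<Rightarrow> ('r, 'a) bialg \<Rightarrow> bool" where
  "hopf_algebra R H \<longleftrightarrow> bialgebra R H \<and> (\<exists>S. antipode R H S)"

definition left_ideal :: "'a set \<Rightarrow> ('a, 'p) ring_scheme \<Rightarrow> bool" where
  "left_ideal I H \<longleftrightarrow> additive_subgroup I H \<and> (\<forall>h\<in>carrier H. \<forall>x\<in>I. h \<otimes>\<^bsub>H\<^esub> x \<in> I)"

definition semisimple_ring :: "('a, 'p) ring_scheme \<Rightarrow> bool" where
  "semisimple_ring H \<longleftrightarrow> ring H \<and>
     (\<forall>I. left_ideal I H \<longrightarrow>
        (\<exists>J. left_ideal J H \<and> I <+>\<^bsub>H\<^esub> J = carrier H \<and> I \<inter> J = {\<zero>\<^bsub>H\<^esub>}))"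

definition semisimple_hopf_algebra :: "'r ring \<Rightarrow> ('r, 'a) bialg \<Rightarrow> bool" where
  "semisimple_hopf_algebra R H \<longleftrightarrow> hopf_algebra R H \<and> semisimple_ring H"

definition hopf_hom :: "'r ring \<Rightarrow> ('r, 'a) bialg \<Rightarrow> ('r, 'b) bialg \<Rightarrow> ('a \<Rightarrow> 'b) set" where
  "hopf_hom R H K = {f \<in> linear_maps R (sym_bimod H) (sym_bimod K).
     (\<forall>x\<in>carrier H. \<forall>y\<in>carrier H. f (x \<otimes>\<^bsub>H\<^esub> y) = f x \<otimes>\<^bsub>K\<^esub> f y) \<and>
     f \<one>\<^bsub>H\<^esub> = \<one>\<^bsub>K\<^esub> \<and>
     (\<forall>x\<in>carrier H.
        comult K (f x) = tensor_lift (tensor2 R K) (\<lambda>y z. pure2 R K (f y) (f z)) (comult H x) \<and>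
        counit K (f x) = counit H x) \<and>
     (\<forall>S S'. antipode R H S \<longrightarrow> antipode R K S' \<longrightarrow> (\<forall>x\<in>carrier H. f (S x) = S' (f x)))}"

definition hopf_isomorphic :: "'r ring \<Rightarrow> ('r, 'a) bialg \<Rightarrow> ('r, 'b) bialg \<Rightarrow> bool" where
  "hopf_isomorphic R H K \<longleftrightarrow> hopf_algebra R H \<and> hopf_algebra R K \<and>
     (\<exists>f\<in>hopf_hom R H K. bij_betw f (carrier H) (carrier K))"

subsection \<open>Duality pairings\<close>

definition finite_dim :: "'r ring \<Rightarrow> ('r, 'a, 'p) module_scheme \<Rightarrow> bool" where
  "finite_dim R H \<longleftrightarrow> (\<exists>U. finite U \<and> U \<subseteq> carrier H \<and>
     carrier H = {\<Oplus>\<^bsub>H\<^esub>u\<in>U. c u \<odot>\<^bsub>H\<^esub> u | c. c \<in> U \<rightarrow> carrier R})"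

definition nondegenerate_form ::
    "'r ring \<Rightarrow> ('r, 'a, 'p) module_scheme \<Rightarrow> ('r, 'b, 'q) module_scheme \<Rightarrow> ('a \<Rightarrow> 'b \<Rightarrow> 'r)
      \<Rightarrow> bool" where
  "nondegenerate_form R H K p \<longleftrightarrow>
     (\<forall>x\<in>carrier H. p x \<in> linear_maps R (sym_bimod K) (ring_bimod R id id)) \<and>
     (\<forall>y\<in>carrier K. (\<lambda>x. p x y) \<in> linear_maps R (sym_bimod H) (ring_bimod R id id)) \<and>
     (\<forall>x\<in>carrier H. (\<forall>y\<in>carrier K. p x y = \<zero>\<^bsub>R\<^esub>) \<longrightarrow> x = \<zero>\<^bsub>H\<^esub>) \<and>
     (\<forall>y\<in>carrier K. (\<forall>x\<in>carrier H. p x y = \<zero>\<^bsub>R\<^esub>) \<longrightarrow> y = \<zero>\<^bsub>K\<^esub>)"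

definition hopf_dual ::
    "'r ring \<Rightarrow> ('r, 'a) bialg \<Rightarrow> ('r, 'b) bialg \<Rightarrow> ('a \<Rightarrow> 'b \<Rightarrow> 'r) \<Rightarrow> bool" where
  "hopf_dual R H K p \<longleftrightarrow> hopf_algebra R H \<and> hopf_algebra R K \<and>
     finite_dim R H \<and> finite_dim R K \<and> nondegenerate_form R H K p \<and>
     (\<forall>x\<in>carrier H. \<forall>x'\<in>carrier H. \<forall>y\<in>carrier K.
        p (x \<otimes>\<^bsub>H\<^esub> x') y = tensor_lift R (\<lambda>y1 y2. p x y1 \<otimes>\<^bsub>R\<^esub> p x' y2) (comult K y)) \<and>
     (\<forall>x\<in>carrier H. \<forall>y\<in>carrier K. \<forall>y'\<in>carrier K.
        p x (y \<otimes>\<^bsub>K\<^esub> y') = tensor_lift R (\<lambda>x1 x2. p x1 y \<otimes>\<^bsub>R\<^esub> p x2 y') (comult H x)) \<and>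
     (\<forall>y\<in>carrier K. p \<one>\<^bsub>H\<^esub> y = counit K y) \<and>
     (\<forall>x\<in>carrier H. p x \<one>\<^bsub>K\<^esub> = counit H x) \<and>
     (\<forall>S S'. antipode R H S \<longrightarrow> antipode R K S' \<longrightarrow>
        (\<forall>x\<in>carrier H. \<forall>y\<in>carrier K. p (S x) y = p x (S' y)))"

section \<open>Ring extensions\<close>

definition ring_extension :: "'n ring \<Rightarrow> 'm ring \<Rightarrow> ('n \<Rightarrow> 'm) \<Rightarrow> bool" where
  "ring_extension N M \<iota> \<longleftrightarrow> ring N \<and> ring M \<and> \<iota> \<in> ring_hom N M"

definition ring_center :: "'m ring \<Rightarrow> 'm set" where
  "ring_center M = {z \<in> carrier M. \<forall>m\<in>carrier M. z \<otimes>\<^bsub>M\<^esub> m = m \<otimes>\<^bsub>M\<^esub> z}"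

definition ext_centralizer :: "'n ring \<Rightarrow> 'm ring \<Rightarrow> ('n \<Rightarrow> 'm) \<Rightarrow> 'm set" where
  "ext_centralizer N M \<iota> =
     {z \<in> carrier M. \<forall>n\<in>carrier N. z \<otimes>\<^bsub>M\<^esub> \<iota> n = \<iota> n \<otimes>\<^bsub>M\<^esub> z}"

definition cent_ring :: "'n ring \<Rightarrow> 'm ring \<Rightarrow> ('n \<Rightarrow> 'm) \<Rightarrow> 'm ring" where
  "cent_ring N M \<iota> = M\<lparr>carrier := ext_centralizer N M \<iota>\<rparr>"

text \<open>The centralizer is a field and equals both centers; the two rings are algebras over it
  through their centers, and \<open>\<iota>\<close> is then linear.\<close>

definition trivial_centralizer :: "'n ring \<Rightarrow> 'm ring \<Rightarrow> ('n \<Rightarrow> 'm) \<Rightarrow> bool" where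
  "trivial_centralizer N M \<iota> \<longleftrightarrow> field (cent_ring N M \<iota>) \<and>
     ext_centralizer N M \<iota> = ring_center M \<and>
     bij_betw \<iota> (ring_center N) (ext_centralizer N M \<iota>)"

abbreviation sq :: "'n ring \<Rightarrow> 'm ring \<Rightarrow> ('n \<Rightarrow> 'm) \<Rightarrow> ('m, 'm, ('m, 'm) tens) bimod" where
  "sq N M \<iota> \<equiv> tensor N (ring_bimod M id \<iota>) (ring_bimod M \<iota> id)"

abbreviation sq_pure :: "'n ring \<Rightarrow> 'm ring \<Rightarrow> ('n \<Rightarrow> 'm) \<Rightarrow> 'm \<Rightarrow> 'm \<Rightarrow> ('m, 'm) tens" where
  "sq_pure N M \<iota> \<equiv> pure_tensor N (ring_bimod M id \<iota>) (ring_bimod M \<iota> id)"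

definition sq_mult :: "'m ring \<Rightarrow> ('m, 'm) tens \<Rightarrow> 'm" where
  "sq_mult M = tensor_lift M (\<lambda>x y. x \<otimes>\<^bsub>M\<^esub> y)"

definition depth_two :: "'n ring \<Rightarrow> 'm ring \<Rightarrow> ('n \<Rightarrow> 'm) \<Rightarrow> bool" where
  "depth_two N M \<iota> \<longleftrightarrow>
     (\<exists>n\<ge>1. direct_summand N M (tensor N (ring_bimod M \<iota> \<iota>) (ring_bimod M \<iota> id))
        (bimod_power n (ring_bimod M \<iota> id))) \<and>
     (\<exists>m\<ge>1. direct_summand M N (tensor N (ring_bimod M id \<iota>) (ring_bimod M \<iota> \<iota>))
        (bimod_power m (ring_bimod M id \<iota>)))"

definition frobenius_system ::
    "'n ring \<Rightarrow> 'm ring \<Rightarrow> ('n \<Rightarrow> 'm) \<Rightarrow> ('m \<Rightarrow> 'n) \<Rightarrow> nat \<Rightarrow> (nat \<Rightarrow> 'm) \<Rightarrow> (nat \<Rightarrow> 'm)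
      \<Rightarrow> bool" where
  "frobenius_system N M \<iota> E k x y \<longleftrightarrow>
     E \<in> bimod_hom N N (ring_bimod M \<iota> \<iota>) (ring_bimod N id id) \<and>
     x \<in> {..<k} \<rightarrow> carrier M \<and> y \<in> {..<k} \<rightarrow> carrier M \<and>
     (\<forall>m\<in>carrier M.
        (\<Oplus>\<^bsub>M\<^esub>i\<in>{..<k}. x i \<otimes>\<^bsub>M\<^esub> \<iota> (E (y i \<otimes>\<^bsub>M\<^esub> m))) = m \<and>
        (\<Oplus>\<^bsub>M\<^esub>i\<in>{..<k}. \<iota> (E (m \<otimes>\<^bsub>M\<^esub> x i)) \<otimes>\<^bsub>M\<^esub> y i) = m)"

definition separable_ext :: "'n ring \<Rightarrow> 'm ring \<Rightarrow> ('n \<Rightarrow> 'm) \<Rightarrow> bool" where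
  "separable_ext N M \<iota> \<longleftrightarrow>
     (\<exists>\<sigma>\<in>bimod_hom M M (ring_bimod M id id) (sq N M \<iota>). \<forall>m\<in>carrier M. sq_mult M (\<sigma> m) = m)"

definition split_ext :: "'n ring \<Rightarrow> 'm ring \<Rightarrow> ('n \<Rightarrow> 'm) \<Rightarrow> bool" where
  "split_ext N M \<iota> \<longleftrightarrow> direct_summand N N (ring_bimod N id id) (ring_bimod M \<iota> \<iota>)"

text \<open>Finitely generated projective means: isomorphic to a direct summand of a free module of
  finite rank.\<close>

definition fg_projective_left :: "'n ring \<Rightarrow> 'm ring \<Rightarrow> ('n \<Rightarrow> 'm) \<Rightarrow> bool" where
  "fg_projective_left N M \<iota> \<longleftrightarrow>
     (\<exists>n. direct_summand N \<Z> (ring_bimod M \<iota> (int_hom M))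
        (bimod_power n (ring_bimod N id (int_hom N))))"

definition fg_projective_right :: "'n ring \<Rightarrow> 'm ring \<Rightarrow> ('n \<Rightarrow> 'm) \<Rightarrow> bool" where
  "fg_projective_right N M \<iota> \<longleftrightarrow>
     (\<exists>n. direct_summand \<Z> N (ring_bimod M (int_hom M) \<iota>)
        (bimod_power n (ring_bimod N (int_hom N) id)))"

definition biseparable :: "'n ring \<Rightarrow> 'm ring \<Rightarrow> ('n \<Rightarrow> 'm) \<Rightarrow> bool" where
  "biseparable N M \<iota> \<longleftrightarrow> fg_projective_right N M \<iota> \<and> fg_projective_left N M \<iota> \<and>
     separable_ext N M \<iota> \<and> split_ext N M \<iota>"

section \<open>The bialgebras \<open>A\<close> and \<open>B\<close>\<close>

definition End_alg :: "'n ring \<Rightarrow> 'm ring \<Rightarrow> ('n \<Rightarrow> 'm) \<Rightarrow> ('m, 'm \<Rightarrow> 'm) module" where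
  "End_alg N M \<iota> =
    \<lparr>carrier = bimod_hom N N (ring_bimod M \<iota> \<iota>) (ring_bimod M \<iota> \<iota>) \<inter> extensional (carrier M),
     monoid.mult = (\<lambda>f g. compose (carrier M) f g),
     one = (\<lambda>m\<in>carrier M. m),
     ring.zero = (\<lambda>m\<in>carrier M. \<zero>\<^bsub>M\<^esub>),
     add = (\<lambda>f g. \<lambda>m\<in>carrier M. f m \<oplus>\<^bsub>M\<^esub> g m),
     smult = (\<lambda>r f. \<lambda>m\<in>carrier M. r \<otimes>\<^bsub>M\<^esub> f m)\<rparr>"

definition Cas_alg :: "'n ring \<Rightarrow> 'm ring \<Rightarrow> ('n \<Rightarrow> 'm) \<Rightarrow> ('m, ('m, 'm) tens) module" where
  "Cas_alg N M \<iota> =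
    \<lparr>carrier = {t \<in> carrier (sq N M \<iota>). \<forall>n\<in>carrier N.
                  lact (sq N M \<iota>) (\<iota> n) t = ract (sq N M \<iota>) t (\<iota> n)},
     monoid.mult = (\<lambda>b b'. tensor_lift (sq N M \<iota>)
                     (\<lambda>x' y'. tensor_lift (sq N M \<iota>)
                       (\<lambda>x y. sq_pure N M \<iota> (x' \<otimes>\<^bsub>M\<^esub> x) (y \<otimes>\<^bsub>M\<^esub> y')) b) b'),
     one = sq_pure N M \<iota> \<one>\<^bsub>M\<^esub> \<one>\<^bsub>M\<^esub>,
     ring.zero = \<zero>\<^bsub>sq N M \<iota>\<^esub>,
     add = add (sq N M \<iota>),
     smult = lact (sq N M \<iota>)\<rparr>"

definition left_D2_quasibasis ::
    "'n ring \<Rightarrow> 'm ring \<Rightarrow> ('n \<Rightarrow> 'm) \<Rightarrow> nat \<Rightarrow> (nat \<Rightarrow> ('m, 'm) tens) \<Rightarrow> (nat \<Rightarrow> 'm \<Rightarrow> 'm)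
      \<Rightarrow> bool" where
  "left_D2_quasibasis N M \<iota> q b \<beta> \<longleftrightarrow>
     b \<in> {..<q} \<rightarrow> carrier (Cas_alg N M \<iota>) \<and> \<beta> \<in> {..<q} \<rightarrow> carrier (End_alg N M \<iota>) \<and>
     (\<forall>m\<in>carrier M.
        (\<Oplus>\<^bsub>sq N M \<iota>\<^esub>i\<in>{..<q}. ract (sq N M \<iota>) (b i) (\<beta> i m)) = sq_pure N M \<iota> m \<one>\<^bsub>M\<^esub>)"

definition End_bialg ::
    "'n ring \<Rightarrow> 'm ring \<Rightarrow> ('n \<Rightarrow> 'm) \<Rightarrow> nat \<Rightarrow> (nat \<Rightarrow> ('m, 'm) tens) \<Rightarrow> (nat \<Rightarrow> 'm \<Rightarrow> 'm)
      \<Rightarrow> ('m, 'm \<Rightarrow> 'm) bialg" where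
  "End_bialg N M \<iota> q b \<beta> =
    (let R = cent_ring N M \<iota>; A = End_alg N M \<iota> in
      module.extend A (bialg.fields
        (\<lambda>\<alpha>. \<Oplus>\<^bsub>tensor2 R A\<^esub>i\<in>{..<q}. pure2 R A
           (\<lambda>m\<in>carrier M. tensor_lift M (\<lambda>x y. \<alpha> (m \<otimes>\<^bsub>M\<^esub> x) \<otimes>\<^bsub>M\<^esub> y) (b i)) (\<beta> i))
        (\<lambda>\<alpha>. \<alpha> \<one>\<^bsub>M\<^esub>)))"

definition Cas_bialg ::
    "'n ring \<Rightarrow> 'm ring \<Rightarrow> ('n \<Rightarrow> 'm) \<Rightarrow> nat \<Rightarrow> (nat \<Rightarrow> ('m, 'm) tens) \<Rightarrow> (nat \<Rightarrow> 'm \<Rightarrow> 'm)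
      \<Rightarrow> ('m, ('m, 'm) tens) bialg" where
  "Cas_bialg N M \<iota> q b \<beta> =
    (let R = cent_ring N M \<iota>; B = Cas_alg N M \<iota> in
      module.extend B (bialg.fields
        (\<lambda>c. \<Oplus>\<^bsub>tensor2 R B\<^esub>i\<in>{..<q}. pure2 R B
           (b i) (tensor_lift (sq N M \<iota>) (\<lambda>x y. sq_pure N M \<iota> (\<beta> i x) y) c))
        (sq_mult M)))"

definition BA_pairing :: "'m ring \<Rightarrow> ('m, 'm) tens \<Rightarrow> ('m \<Rightarrow> 'm) \<Rightarrow> 'm" where
  "BA_pairing M b \<alpha> = tensor_lift M (\<lambda>x y. x \<otimes>\<^bsub>M\<^esub> \<alpha> y) b"

section \<open>The Jones tower\<close>

definition jones_ring ::
    "'n ring \<Rightarrow> 'm ring \<Rightarrow> ('n \<Rightarrow> 'm) \<Rightarrow> ('m \<Rightarrow> 'n) \<Rightarrow> nat \<Rightarrow> (nat \<Rightarrow> 'm) \<Rightarrow> (nat \<Rightarrow> 'm)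
      \<Rightarrow> ('m, 'm) tens ring" where
  "jones_ring N M \<iota> E k x y =
    \<lparr>carrier = carrier (sq N M \<iota>),
     monoid.mult = (\<lambda>s t. tensor_lift (sq N M \<iota>)
        (\<lambda>a b. tensor_lift (sq N M \<iota>)
          (\<lambda>c d. sq_pure N M \<iota> (a \<otimes>\<^bsub>M\<^esub> \<iota> (E (b \<otimes>\<^bsub>M\<^esub> c))) d) t) s),
     one = (\<Oplus>\<^bsub>sq N M \<iota>\<^esub>i\<in>{..<k}. sq_pure N M \<iota> (x i) (y i)),
     ring.zero = \<zero>\<^bsub>sq N M \<iota>\<^esub>,
     add = add (sq N M \<iota>)\<rparr>"

definition jones_incl ::
    "'n ring \<Rightarrow> 'm ring \<Rightarrow> ('n \<Rightarrow> 'm) \<Rightarrow> nat \<Rightarrow> (nat \<Rightarrow> 'm) \<Rightarrow> (nat \<Rightarrow> 'm)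
      \<Rightarrow> 'm \<Rightarrow> ('m, 'm) tens" where
  "jones_incl N M \<iota> k x y m = (\<Oplus>\<^bsub>sq N M \<iota>\<^esub>i\<in>{..<k}. sq_pure N M \<iota> (m \<otimes>\<^bsub>M\<^esub> x i) (y i))"

definition jones_elt :: "'n ring \<Rightarrow> 'm ring \<Rightarrow> ('n \<Rightarrow> 'm) \<Rightarrow> ('m, 'm) tens" where
  "jones_elt N M \<iota> = sq_pure N M \<iota> \<one>\<^bsub>M\<^esub> \<one>\<^bsub>M\<^esub>"

definition jones_ring2 ::
    "'n ring \<Rightarrow> 'm ring \<Rightarrow> ('n \<Rightarrow> 'm) \<Rightarrow> ('m \<Rightarrow> 'n) \<Rightarrow> nat \<Rightarrow> (nat \<Rightarrow> 'm) \<Rightarrow> (nat \<Rightarrow> 'm)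
      \<Rightarrow> (('m, 'm) tens, ('m, 'm) tens) tens ring" where
  "jones_ring2 N M \<iota> E k x y =
     jones_ring M (jones_ring N M \<iota> E k x y) (jones_incl N M \<iota> k x y) (sq_mult M) k
       (\<lambda>i. sq_pure N M \<iota> (x i) \<one>\<^bsub>M\<^esub>) (\<lambda>i. sq_pure N M \<iota> \<one>\<^bsub>M\<^esub> (y i))"

definition jones_incl2 ::
    "'n ring \<Rightarrow> 'm ring \<Rightarrow> ('n \<Rightarrow> 'm) \<Rightarrow> ('m \<Rightarrow> 'n) \<Rightarrow> nat \<Rightarrow> (nat \<Rightarrow> 'm) \<Rightarrow> (nat \<Rightarrow> 'm)
      \<Rightarrow> ('m, 'm) tens \<Rightarrow> (('m, 'm) tens, ('m, 'm) tens) tens" where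
  "jones_incl2 N M \<iota> E k x y =
     jones_incl M (jones_ring N M \<iota> E k x y) (jones_incl N M \<iota> k x y) k
       (\<lambda>i. sq_pure N M \<iota> (x i) \<one>\<^bsub>M\<^esub>) (\<lambda>i. sq_pure N M \<iota> \<one>\<^bsub>M\<^esub> (y i))"

definition jones_elt2 ::
    "'n ring \<Rightarrow> 'm ring \<Rightarrow> ('n \<Rightarrow> 'm) \<Rightarrow> ('m \<Rightarrow> 'n) \<Rightarrow> nat \<Rightarrow> (nat \<Rightarrow> 'm) \<Rightarrow> (nat \<Rightarrow> 'm)
      \<Rightarrow> (('m, 'm) tens, ('m, 'm) tens) tens" where
  "jones_elt2 N M \<iota> E k x y =
     jones_elt M (jones_ring N M \<iota> E k x y) (jones_incl N M \<iota> k x y)"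

definition cent_alg :: "'s ring \<Rightarrow> 'x ring \<Rightarrow> ('s \<Rightarrow> 'x) \<Rightarrow> ('r \<Rightarrow> 'x) \<Rightarrow> ('r, 'x) module" where
  "cent_alg S U \<kappa> l =
    \<lparr>carrier = ext_centralizer S U \<kappa>, monoid.mult = monoid.mult U, one = one U,
     ring.zero = ring.zero U, add = add U, smult = (\<lambda>r a. l r \<otimes>\<^bsub>U\<^esub> a)\<rparr>"

definition hatA_alg ::
    "'n ring \<Rightarrow> 'm ring \<Rightarrow> ('n \<Rightarrow> 'm) \<Rightarrow> ('m \<Rightarrow> 'n) \<Rightarrow> nat \<Rightarrow> (nat \<Rightarrow> 'm) \<Rightarrow> (nat \<Rightarrow> 'm)
      \<Rightarrow> ('m, ('m, 'm) tens) module" where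
  "hatA_alg N M \<iota> E k x y =
     cent_alg N (jones_ring N M \<iota> E k x y) (jones_incl N M \<iota> k x y \<circ> \<iota>) (jones_incl N M \<iota> k x y)"

definition hatB_alg ::
    "'n ring \<Rightarrow> 'm ring \<Rightarrow> ('n \<Rightarrow> 'm) \<Rightarrow> ('m \<Rightarrow> 'n) \<Rightarrow> nat \<Rightarrow> (nat \<Rightarrow> 'm) \<Rightarrow> (nat \<Rightarrow> 'm)
      \<Rightarrow> ('m, (('m, 'm) tens, ('m, 'm) tens) tens) module" where
  "hatB_alg N M \<iota> E k x y =
    (let j = jones_incl2 N M \<iota> E k x y \<circ> jones_incl N M \<iota> k x y in
      cent_alg M (jones_ring2 N M \<iota> E k x y) j j)"

definition KN_form ::
    "'n ring \<Rightarrow> 'm ring \<Rightarrow> ('n \<Rightarrow> 'm) \<Rightarrow> ('m \<Rightarrow> 'n) \<Rightarrow> nat \<Rightarrow> (nat \<Rightarrow> 'm) \<Rightarrow> (nat \<Rightarrow> 'm)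
      \<Rightarrow> ('m, 'm) tens \<Rightarrow> (('m, 'm) tens, ('m, 'm) tens) tens \<Rightarrow> 'm" where
  "KN_form N M \<iota> E k x y a b =
    (let M1 = jones_ring N M \<iota> E k x y; M2 = jones_ring2 N M \<iota> E k x y;
         j = jones_incl2 N M \<iota> E k x y; e1 = jones_elt N M \<iota>; e2 = jones_elt2 N M \<iota> E k x y in
      sq_mult M (sq_mult M1 (j a \<otimes>\<^bsub>M2\<^esub> e2 \<otimes>\<^bsub>M2\<^esub> j e1 \<otimes>\<^bsub>M2\<^esub> b)))"

text \<open>Since the form is nondegenerate, the descriptions below determine at most one value;
  that the resulting structures are Hopf algebras in duality is not built into them.\<close>

definition hatB_bialg ::
    "'n ring \<Rightarrow> 'm ring \<Rightarrow> ('n \<Rightarrow> 'm) \<Rightarrow> ('m \<Rightarrow> 'n) \<Rightarrow> nat \<Rightarrow> (nat \<Rightarrow> 'm) \<Rightarrow> (nat \<Rightarrow> 'm)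
      \<Rightarrow> ('m, (('m, 'm) tens, ('m, 'm) tens) tens) bialg" where
  "hatB_bialg N M \<iota> E k x y =
    (let R = cent_ring N M \<iota>; A' = hatA_alg N M \<iota> E k x y; B' = hatB_alg N M \<iota> E k x y;
         M1 = jones_ring N M \<iota> E k x y; M2 = jones_ring2 N M \<iota> E k x y;
         p = KN_form N M \<iota> E k x y in
      module.extend B' (bialg.fields
        (\<lambda>b. THE t. t \<in> carrier (tensor2 R B') \<and>
           (\<forall>a\<in>carrier A'. \<forall>a'\<in>carrier A'.
              p (a \<otimes>\<^bsub>A'\<^esub> a') b = tensor_lift R (\<lambda>b1 b2. p a b1 \<otimes>\<^bsub>R\<^esub> p a' b2) t))
        (\<lambda>b. THE r. r \<in> carrier R \<and>
           sq_mult M1 (jones_elt2 N M \<iota> E k x y \<otimes>\<^bsub>M2\<^esub> b) = r \<odot>\<^bsub>A'\<^esub> \<one>\<^bsub>M1\<^esub>)))"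

definition hatA_bialg ::
    "'n ring \<Rightarrow> 'm ring \<Rightarrow> ('n \<Rightarrow> 'm) \<Rightarrow> ('m \<Rightarrow> 'n) \<Rightarrow> nat \<Rightarrow> (nat \<Rightarrow> 'm) \<Rightarrow> (nat \<Rightarrow> 'm)
      \<Rightarrow> ('m, ('m, 'm) tens) bialg" where
  "hatA_bialg N M \<iota> E k x y =
    (let R = cent_ring N M \<iota>; A' = hatA_alg N M \<iota> E k x y; B' = hatB_alg N M \<iota> E k x y;
         p = KN_form N M \<iota> E k x y in
      module.extend A' (bialg.fields
        (\<lambda>a. THE t. t \<in> carrier (tensor2 R A') \<and>
           (\<forall>b\<in>carrier B'. \<forall>b'\<in>carrier B'.
              p a (b \<otimes>\<^bsub>B'\<^esub> b') = tensor_lift R (\<lambda>a1 a2. p a1 b \<otimes>\<^bsub>R\<^esub> p a2 b') t))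
        (\<lambda>a. p a \<one>\<^bsub>B'\<^esub>)))"

end

theory Submission
  imports Defs
begin

text \<open>
  As \<open>R\<close> is central, \<open>\<langle>b, \<alpha>\<rangle> = b\<^sup>1 \<alpha>(b\<^sup>2)\<close> and \<open>[\<alpha>, b] = \<alpha>(b\<^sup>1) b\<^sup>2\<close> are bilinear forms with values in \<open>R\<close>. The
  quasibasis says \<open>\<alpha> = \<Sum> [\<alpha>, b\<^sub>i] \<beta>\<^sub>i\<close> and \<open>b = \<Sum> [\<beta>\<^sub>i, b] b\<^sub>i\<close>. The Frobenius system provides bijections
  \<open>\<alpha> \<mapsto> \<Sum> \<alpha>(x\<^sub>i) \<otimes> y\<^sub>i\<close> and \<open>\<alpha> \<mapsto> \<Sum> x\<^sub>i \<otimes> \<alpha>(y\<^sub>i)\<close> from \<open>A\<close> to \<open>B\<close>, and since \<open>\<Sum> \<alpha>(x\<^sub>i) y\<^sub>i = \<Sum> x\<^sub>i \<alpha>(y\<^sub>i)\<close>,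
  they yield \<open>S : B \<rightarrow> B\<close> with \<open>\<langle>S b, \<alpha>\<rangle> = [\<alpha>, b]\<close>. Hence \<open>\<beta>\<^sub>i\<close> and \<open>S b\<^sub>i\<close> are dual bases for \<open>\<langle>_, _\<rangle>\<close>, the two
  coproducts are the transposes of the two multiplications, and the remaining Hopf algebra axioms
  become identities between values of the form, with \<open>S\<close> as antipode.

  Both algebras are Frobenius algebras whose Casimir element multiplies to a scalar: \<open>E(1)\<close> for \<open>A\<close>
  and the index \<open>\<Sum> x\<^sub>i y\<^sub>i\<close> for \<open>B\<close>. These are nonzero because the extension is split and separable, so
  averaging over the Casimir element as in Maschke's theorem gives semisimplicity.

  Finally, \<open>\<alpha> \<mapsto> \<Sum> \<alpha>(x\<^sub>i) \<otimes> y\<^sub>i\<close> identifies \<open>A\<close> with the centralizer of \<open>N\<close> in \<open>M\<^sub>1\<close>. The same map for the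
  extension \<open>M\<^sub>1|M\<close>, together with the isomorphism of \<open>B\<close> with the bimodule endomorphisms of \<open>M\<^sub>1\<close>, identifies
  \<open>B\<close> with the centralizer of \<open>M\<close> in \<open>M\<^sub>2\<close>, and under these identifications the Kadison--Nikshych form
  is \<open>\<langle>b, \<alpha>\<rangle>\<close>.
\<close>

text \<open>Tensors are cosets in a free abelian group, so a coproduct cannot be handled through
  representatives in Sweedler style. The way around: a form with finite dual bases separates the
  elements of \<open>H \<otimes> H\<close>, hence every Hopf algebra axiom can be tested by pairing
  with the dual algebra, where it becomes an equation between finite sums in R. The list of these
  equations is self-dual, so it is verified for A alone, and B receives it with the adjoint
  antipode. Besides the antipode the equations mention only products, units and the form; hence the
  structures in the Jones tower, which are given by descriptions, are reached by algebra
  isomorphisms that match the forms. The field enters at the equality of the two traces, obtained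
  first after multiplication by the index, and in the averaging. The index is invertible because a
  separability element is a scalar multiple of \<open>\<Sum> x\<^sub>i \<otimes> y\<^sub>i\<close>,
  and E(1) because a bimodule projection onto N takes a scalar multiple of E(1) at 1. Duality and
  homomorphisms have to respect every antipode, so antipodes must be shown to be unique.\<close>

definition additive :: "('x, 'p) ring_scheme \<Rightarrow> ('y, 'q) ring_scheme \<Rightarrow> ('x \<Rightarrow> 'y) \<Rightarrow> bool" where
  "additive W Z f \<longleftrightarrow> f \<in> carrier W \<rightarrow> carrier Z \<and>
     (\<forall>x\<in>carrier W. \<forall>y\<in>carrier W. f (x \<oplus>\<^bsub>W\<^esub> y) = f x \<oplus>\<^bsub>Z\<^esub> f y)"

lemma additiveI:
  assumes "\<And>x. x \<in> carrier W \<Longrightarrow> f x \<in> carrier Z"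
    and "\<And>x y. x \<in> carrier W \<Longrightarrow> y \<in> carrier W \<Longrightarrow> f (x \<oplus>\<^bsub>W\<^esub> y) = f x \<oplus>\<^bsub>Z\<^esub> f y"
  shows "additive W Z f"
  using assms by (auto simp: additive_def)

lemma additive_closed: "additive W Z f \<Longrightarrow> x \<in> carrier W \<Longrightarrow> f x \<in> carrier Z"
  by (auto simp: additive_def)

lemma additive_add:
  "additive W Z f \<Longrightarrow> x \<in> carrier W \<Longrightarrow> y \<in> carrier W \<Longrightarrow> f (x \<oplus>\<^bsub>W\<^esub> y) = f x \<oplus>\<^bsub>Z\<^esub> f y"
  by (auto simp: additive_def)

lemma additive_zero:
  assumes "abelian_group W" "abelian_group Z" "additive W Z f"
  shows "f \<zero>\<^bsub>W\<^esub> = \<zero>\<^bsub>Z\<^esub>"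
proof -
  interpret W: abelian_group W by fact
  interpret Z: abelian_group Z by fact
  have f: "f \<zero>\<^bsub>W\<^esub> \<in> carrier Z" by (rule additive_closed[OF assms(3)]) simp
  have "f \<zero>\<^bsub>W\<^esub> \<oplus>\<^bsub>Z\<^esub> f \<zero>\<^bsub>W\<^esub> = f \<zero>\<^bsub>W\<^esub>"
    using additive_add[OF assms(3), of "\<zero>\<^bsub>W\<^esub>" "\<zero>\<^bsub>W\<^esub>"] by simp
  then show ?thesis using f Z.add.r_cancel_one[OF f f] by simp
qed

lemma additive_compose:
  "additive W Y f \<Longrightarrow> additive Y Z g \<Longrightarrow> additive W Z (\<lambda>x. g (f x))"
  by (auto simp: additive_def Pi_def)

lemma additive_finsum:
  assumes "abelian_group W" "abelian_group Z" "additive W Z f" "g \<in> I \<rightarrow> carrier W"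
  shows "f (\<Oplus>\<^bsub>W\<^esub>i\<in>I. g i) = (\<Oplus>\<^bsub>Z\<^esub>i\<in>I. f (g i))"
proof -
  interpret W: abelian_group W by fact
  interpret Z: abelian_group Z by fact
  have cl: "\<And>x. x \<in> carrier W \<Longrightarrow> f x \<in> carrier Z" using assms(3) by (rule additive_closed)
  show ?thesis using assms(4)
  proof (induction I rule: infinite_finite_induct)
    case (infinite A)
    then show ?case using additive_zero[OF assms(1-3)] by simp
  next
    case empty
    then show ?case using additive_zero[OF assms(1-3)] by simp
  next
    case (insert i I)
    then have "g i \<in> carrier W" "g \<in> I \<rightarrow> carrier W" by auto
    then show ?case using insert.hyps insert.IH cl
      by (simp add: additive_add[OF assms(3)] Pi_def)
  qed
qed

lemma additive_add_pw:
  assumes "abelian_group Z" "additive W Z f" "additive W Z g"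
  shows "additive W Z (\<lambda>x. f x \<oplus>\<^bsub>Z\<^esub> g x)"
proof -
  interpret Z: abelian_group Z by fact
  note cl = assms(2,3)[THEN additive_closed] and ad = assms(2,3)[THEN additive_add]
  show ?thesis
    by (rule additiveI) (simp_all add: cl ad Z.a_ac)
qed

lemma additive_finsum_pw:
  assumes Z: "abelian_group Z" and f: "\<And>i. i \<in> I \<Longrightarrow> additive W Z (f i)"
  shows "additive W Z (\<lambda>x. \<Oplus>\<^bsub>Z\<^esub>i\<in>I. f i x)"
proof -
  interpret Z: abelian_group Z by fact
  show ?thesis
  proof (rule additiveI)
    fix x y assume x: "x \<in> carrier W" and y: "y \<in> carrier W"
    have "(\<Oplus>\<^bsub>Z\<^esub>i\<in>I. f i (x \<oplus>\<^bsub>W\<^esub> y)) = (\<Oplus>\<^bsub>Z\<^esub>i\<in>I. f i x \<oplus>\<^bsub>Z\<^esub> f i y)"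
      using x y f additive_closed[OF f] by (intro Z.finsum_cong') (auto simp: additive_add)
    then show "(\<Oplus>\<^bsub>Z\<^esub>i\<in>I. f i (x \<oplus>\<^bsub>W\<^esub> y)) = (\<Oplus>\<^bsub>Z\<^esub>i\<in>I. f i x) \<oplus>\<^bsub>Z\<^esub> (\<Oplus>\<^bsub>Z\<^esub>i\<in>I. f i y)"
      using x y additive_closed[OF f] by (simp add: Z.finsum_addf)
  qed (use additive_closed[OF f] in \<open>auto intro!: Z.finsum_closed\<close>)
qed

lemma (in abelian_group) finsum_swap:
  assumes "\<And>i j. i \<in> I \<Longrightarrow> j \<in> J \<Longrightarrow> f i j \<in> carrier G" "finite I"
  shows "(\<Oplus>i\<in>I. \<Oplus>j\<in>J. f i j) = (\<Oplus>j\<in>J. \<Oplus>i\<in>I. f i j)"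
  using assms(2,1)
proof (induction I)
  case (insert i I)
  then have "(\<lambda>j. f i j) \<in> J \<rightarrow> carrier G" "(\<lambda>j. \<Oplus>i\<in>I. f i j) \<in> J \<rightarrow> carrier G"
    by (auto intro!: finsum_closed)
  then have "(\<Oplus>j\<in>J. f i j) \<oplus> (\<Oplus>j\<in>J. \<Oplus>i\<in>I. f i j) = (\<Oplus>j\<in>J. f i j \<oplus> (\<Oplus>i\<in>I. f i j))"
    by (rule finsum_addf[symmetric])
  also have "\<dots> = (\<Oplus>j\<in>J. \<Oplus>i\<in>insert i I. f i j)"
    using insert by (intro finsum_cong') (auto simp: Pi_def intro!: finsum_closed)
  finally show ?case using insert by (simp add: Pi_def)
qed simp

section \<open>Tensor products\<close>

text \<open>Collects just what the quotient construction and its universal property use of the two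
  modules, so that it is cheap to establish for iterated tensor products.\<close>

definition tensorable :: "('t, 'p) ring_scheme \<Rightarrow> ('s, 't, 'x) bimod \<Rightarrow> ('t, 'u, 'y) bimod \<Rightarrow> bool" where
  "tensorable T U Y \<longleftrightarrow> abelian_group U \<and> abelian_group Y \<and>
     (\<forall>x\<in>carrier U. \<forall>t\<in>carrier T. ract U x t \<in> carrier U) \<and>
     (\<forall>t\<in>carrier T. \<forall>y\<in>carrier Y. lact Y t y \<in> carrier Y)"

definition balanced :: "('t, 'p) ring_scheme \<Rightarrow> ('s, 't, 'x) bimod \<Rightarrow> ('t, 'u, 'y) bimod
    \<Rightarrow> ('z, 'q) ring_scheme \<Rightarrow> ('x \<Rightarrow> 'y \<Rightarrow> 'z) \<Rightarrow> bool" where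
  "balanced T U Y Z f \<longleftrightarrow> (\<forall>x\<in>carrier U. additive Y Z (f x)) \<and>
     (\<forall>y\<in>carrier Y. additive U Z (\<lambda>x. f x y)) \<and>
     (\<forall>x\<in>carrier U. \<forall>t\<in>carrier T. \<forall>y\<in>carrier Y. f (ract U x t) y = f x (lact Y t y))"

lemma balancedI:
  assumes "\<And>x. x \<in> carrier U \<Longrightarrow> additive Y Z (f x)"
    and "\<And>y. y \<in> carrier Y \<Longrightarrow> additive U Z (\<lambda>x. f x y)"
    and "\<And>x t y. x \<in> carrier U \<Longrightarrow> t \<in> carrier T \<Longrightarrow> y \<in> carrier Y \<Longrightarrow>
           f (ract U x t) y = f x (lact Y t y)"
  shows "balanced T U Y Z f"
  using assms by (auto simp: balanced_def)

lemma balanced_closed: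
  "balanced T U Y Z f \<Longrightarrow> x \<in> carrier U \<Longrightarrow> y \<in> carrier Y \<Longrightarrow> f x y \<in> carrier Z"
  unfolding balanced_def by (metis additive_closed)

text \<open>The homomorphism on the free abelian group that \<open>tensor_lift\<close> evaluates on
  a coset; split off so that its values on sums and generators are known before passing to the
  quotient.\<close>

definition free_ext :: "('z, 'q) ring_scheme \<Rightarrow> ('c \<Rightarrow> 'z) \<Rightarrow> ('c \<Rightarrow>\<^sub>0 int) \<Rightarrow> 'z" where
  "free_ext Z f c = (\<Oplus>\<^bsub>Z\<^esub>p\<in>Poly_Mapping.keys c. [Poly_Mapping.lookup c p] \<cdot>\<^bsub>Z\<^esub> f p)"

text \<open>Keys may cancel in a sum of two chains, so additivity requires summing all chains over
  one common finite set; the additional terms have coefficient 0.\<close>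

lemma free_ext_superset:
  assumes Z: "abelian_group Z" and f: "f \<in> S \<rightarrow> carrier Z" 
    and c: "Poly_Mapping.keys c \<subseteq> D" "D \<subseteq> S" "finite D"
  shows "free_ext Z f c = (\<Oplus>\<^bsub>Z\<^esub>p\<in>D. [Poly_Mapping.lookup c p] \<cdot>\<^bsub>Z\<^esub> f p)"
proof -
  interpret Z: abelian_group Z by fact
  have "\<And>p. p \<in> D \<Longrightarrow> f p \<in> carrier Z" using f c by auto
  moreover have "[(0::int)] \<cdot>\<^bsub>Z\<^esub> f p = \<zero>\<^bsub>Z\<^esub>" for p
    by (simp add: add_pow_def int_pow_def nat_pow_def)
  ultimately show ?thesis unfolding free_ext_def using c
    by (intro Z.add.finprod_mono_neutral_cong_left) (auto simp: in_keys_iff)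
qed

lemma free_ext_hom:
  assumes Z: "abelian_group Z" and f: "f \<in> S \<rightarrow> carrier Z"
  shows "free_ext Z f \<in> hom (free_Abelian_group S) (add_monoid Z)"
proof (rule homI)
  interpret Z: abelian_group Z by fact
  fix c d assume c: "c \<in> carrier (free_Abelian_group S)" and d: "d \<in> carrier (free_Abelian_group S)"
  show "free_ext Z f c \<in> carrier (add_monoid Z)"
    using c f unfolding free_ext_def by (auto intro!: Z.finsum_closed)
  let ?D = "Poly_Mapping.keys c \<union> Poly_Mapping.keys d"
  have D: "?D \<subseteq> S" "finite ?D" "Poly_Mapping.keys (c + d) \<subseteq> ?D" 
    using c d keys_add[of c d] by auto
  have fp: "\<And>p. p \<in> ?D \<Longrightarrow> f p \<in> carrier Z" using f D by auto
  have "free_ext Z f (c + d) = (\<Oplus>\<^bsub>Z\<^esub>p\<in>?D. [Poly_Mapping.lookup (c + d) p] \<cdot>\<^bsub>Z\<^esub> f p)"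
    using free_ext_superset[OF Z f D(3,1,2)] .
  also have "\<dots> = (\<Oplus>\<^bsub>Z\<^esub>p\<in>?D. [Poly_Mapping.lookup c p] \<cdot>\<^bsub>Z\<^esub> f p \<oplus>\<^bsub>Z\<^esub> [Poly_Mapping.lookup d p] \<cdot>\<^bsub>Z\<^esub> f p)"
    using fp by (intro Z.finsum_cong') (auto simp: lookup_add Z.add.int_pow_mult)
  also have "\<dots> = free_ext Z f c \<oplus>\<^bsub>Z\<^esub> free_ext Z f d"
    using fp D by (subst Z.finsum_addf) (auto simp: free_ext_superset[OF Z f, of _ ?D])
  finally show "free_ext Z f (c \<otimes>\<^bsub>free_Abelian_group S\<^esub> d) = free_ext Z f c \<otimes>\<^bsub>add_monoid Z\<^esub> free_ext Z f d"
    by simp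
qed

lemma free_ext_frag_of:
  assumes Z: "abelian_group Z" and f: "f p \<in> carrier Z"
  shows "free_ext Z f (frag_of p) = f p"
proof -
  interpret Z: abelian_group Z by fact
  show ?thesis using f by (simp add: free_ext_def)
qed

lemma tensor_lift_eq: "tensor_lift Z f t = the_elem (free_ext Z (\<lambda>p. f (fst p) (snd p)) ` t)"
  by (simp add: tensor_lift_def free_ext_def)

lemma tensor_simps [simp]:
  "carrier (tensor T U Y) = carrier (tensor_grp T U Y)"
  "\<zero>\<^bsub>tensor T U Y\<^esub> = \<zero>\<^bsub>tensor_grp T U Y\<^esub>"
  "add (tensor T U Y) = add (tensor_grp T U Y)"
  by (simp_all add: tensor_def ring.extend_def bimod.fields_def)

lemma abelian_group_cong:
  assumes "abelian_group W" "carrier Y = carrier W" "add Y = add W" "\<zero>\<^bsub>Y\<^esub> = \<zero>\<^bsub>W\<^esub>"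
  shows "abelian_group Y"
proof -
  interpret W: abelian_group W by fact
  show ?thesis
    using assms(2-4) W.add.l_inv_ex
    by (intro abelian_groupI) (auto simp: W.a_ac)
qed

text \<open>A finite sum sees only the additive monoid. The same group occurs as a ring, as a
  bimodule and inside a bialgebra record, and this moves sums between them.\<close>

lemma finsum_cong_struct:
  assumes "carrier Y = carrier W" "add Y = add W" "\<zero>\<^bsub>Y\<^esub> = \<zero>\<^bsub>W\<^esub>"
  shows "finsum Y = finsum W"
  using assms by (intro ext) (simp add: finsum_def finprod_def)

section \<open>The universal property of the tensor product\<close>

context
  fixes T :: "('t, 'p) ring_scheme" and U :: "('s, 't, 'x) bimod" and Y :: "('t, 'u, 'y) bimod"
  assumes ok: "tensorable T U Y"
begin

abbreviation (input) "FG \<equiv> free_Abelian_group (carrier U \<times> carrier Y)"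
abbreviation (input) "TK \<equiv> tensor_ker T U Y"

lemma tensor_rels_sub: "tensor_rels T U Y \<subseteq> carrier FG"
proof -
  interpret U: abelian_group U using ok by (simp add: tensorable_def)
  interpret Y: abelian_group Y using ok by (simp add: tensorable_def)
  have k3: "Poly_Mapping.keys (frag_of a - frag_of b - frag_of c) \<subseteq> {a, b, c}" for a b c :: "'x \<times> 'y"
    using keys_diff[of "frag_of a - frag_of b" "frag_of c"] keys_diff[of "frag_of a" "frag_of b"] by auto
  have k2: "Poly_Mapping.keys (frag_of a - frag_of b) \<subseteq> {a, b}" for a b :: "'x \<times> 'y"
    using keys_diff[of "frag_of a" "frag_of b"] by auto
  show ?thesis
  proof
    fix c assume "c \<in> tensor_rels T U Y"
    then show "c \<in> carrier FG"
      unfolding tensor_rels_def using ok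
      by (auto simp: tensorable_def dest!: subsetD[OF k3] subsetD[OF k2])
  qed
qed

lemma tensor_ker_normal: "TK \<lhd> FG"
proof -
  interpret F: comm_group FG by (rule abelian_free_Abelian_group)
  show ?thesis unfolding tensor_ker_def
    by (intro F.subgroup_imp_normal F.generate_is_subgroup tensor_rels_sub)
qed

lemma tensor_grp_carrier: "carrier (tensor_grp T U Y) = rcosets\<^bsub>FG\<^esub> TK"
  by (simp add: tensor_grp_def Let_def FactGroup_def)

lemma tensor_add_cosets:
  assumes "c \<in> carrier FG" "d \<in> carrier FG"
  shows "(TK #>\<^bsub>FG\<^esub> c) \<oplus>\<^bsub>tensor_grp T U Y\<^esub> (TK #>\<^bsub>FG\<^esub> d) = TK #>\<^bsub>FG\<^esub> (c + d)"
  using normal.rcos_sum[OF tensor_ker_normal assms]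
  by (simp add: tensor_grp_def Let_def FactGroup_def)

lemma tensor_grp_abelian: "abelian_group (tensor_grp T U Y)"
proof -
  interpret F: comm_group FG by (rule abelian_free_Abelian_group)
  have "comm_group (FG Mod TK)"
    by (rule F.abelian_FactGroup) (use tensor_ker_normal normal_def in blast)
  moreover have "add_monoid (tensor_grp T U Y) = FG Mod TK" 
    by (simp add: tensor_grp_def Let_def FactGroup_def)
  ultimately show ?thesis
    by (metis comm_group.axioms(1) comm_group.axioms(2) abelian_group_axioms_def abelian_group_def abelian_monoid_def)
qed

lemma tensor_abelian [simp]: "abelian_group (tensor T U Y)"
  by (rule abelian_group_cong[OF tensor_grp_abelian]) auto

lemma pure_closed_grp: "x \<in> carrier U \<Longrightarrow> y \<in> carrier Y \<Longrightarrow> pure_tensor T U Y x y \<in> carrier (tensor_grp T U Y)"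
  unfolding tensor_grp_carrier pure_tensor_def
  by (metis (no_types, lifting) RCOSETS_def SigmaI UN_iff frag_of_in_free_Abelian_group insertI1)

lemma pure_closed: "x \<in> carrier U \<Longrightarrow> y \<in> carrier Y \<Longrightarrow> pure_tensor T U Y x y \<in> carrier (tensor T U Y)"
  by (simp add: pure_closed_grp)

text \<open>Pure tensors generate the tensor product, so an equation between additive maps has to be
  tested only on them. Nearly every later identity on a tensor product is proved this way.\<close>

lemma tensor_additive_eqI:
  assumes Z: "abelian_group Z" and F: "additive (tensor T U Y) Z F" and G: "additive (tensor T U Y) Z G"
    and eq: "\<And>x y. x \<in> carrier U \<Longrightarrow> y \<in> carrier Y \<Longrightarrow> F (pure_tensor T U Y x y) = G (pure_tensor T U Y x y)"
    and t: "t \<in> carrier (tensor T U Y)"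
  shows "F t = G t"
proof -
  interpret Z: abelian_group Z by fact
  interpret W: abelian_group "tensor_grp T U Y" by (rule tensor_grp_abelian)
  obtain c where c: "Poly_Mapping.keys c \<subseteq> carrier U \<times> carrier Y" and tc: "t = TK #>\<^bsub>FG\<^esub> c"
    using t tensor_grp_carrier by (auto simp: RCOSETS_def)
  have zero: "TK #>\<^bsub>FG\<^esub> 0 = \<zero>\<^bsub>tensor_grp T U Y\<^esub>"
    using normal.rcosets_mult_eq tensor_ker_normal 
    by (metis (no_types, lifting) tensor_grp_def Let_def FactGroup_def ring.select_convs(1) monoid.select_convs(2) group.coset_join2 group_free_Abelian_group normal_imp_subgroup one_free_Abelian_group subgroup.one_closed group.coset_mult_one subgroup.subset)
  have AG: "abelian_group (tensor T U Y)" by simp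
  have cosc: "TK #>\<^bsub>FG\<^esub> c \<in> carrier (tensor_grp T U Y)" if "Poly_Mapping.keys c \<subseteq> carrier U \<times> carrier Y" for c
    unfolding tensor_grp_carrier using that by (auto simp: RCOSETS_def)
  have "F (TK #>\<^bsub>FG\<^esub> c) = G (TK #>\<^bsub>FG\<^esub> c)" using c
  proof (rule free_Abelian_group_induct)
    show "F (TK #>\<^bsub>FG\<^esub> 0) = G (TK #>\<^bsub>FG\<^esub> 0)" 
      unfolding zero using additive_zero[OF AG Z F] additive_zero[OF AG Z G] by simp
  next
    fix a :: "'x \<times> 'y" assume "a \<in> carrier U \<times> carrier Y"
    then show "F (TK #>\<^bsub>FG\<^esub> frag_of a) = G (TK #>\<^bsub>FG\<^esub> frag_of a)"
      using eq[of "fst a" "snd a"] by (auto simp: pure_tensor_def)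
  next
    fix c d assume c: "Poly_Mapping.keys c \<subseteq> carrier U \<times> carrier Y" and d: "Poly_Mapping.keys d \<subseteq> carrier U \<times> carrier Y"
      and IH: "F (TK #>\<^bsub>FG\<^esub> c) = G (TK #>\<^bsub>FG\<^esub> c)" "F (TK #>\<^bsub>FG\<^esub> d) = G (TK #>\<^bsub>FG\<^esub> d)"
    have cd: "Poly_Mapping.keys (c - d) \<subseteq> carrier U \<times> carrier Y" using c d keys_diff[of c d] by auto
    \<comment> \<open>Induction on the free abelian group proceeds by differences, so the value at
      \<open>c - d\<close> is recovered from those at \<open>c\<close> and \<open>d\<close> by
      cancellation.\<close>
    have s: "(TK #>\<^bsub>FG\<^esub> (c - d)) \<oplus>\<^bsub>tensor_grp T U Y\<^esub> (TK #>\<^bsub>FG\<^esub> d) = TK #>\<^bsub>FG\<^esub> c"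
      using tensor_add_cosets[of "c - d" d] cd d by simp
    have "F (TK #>\<^bsub>FG\<^esub> (c - d)) \<oplus>\<^bsub>Z\<^esub> F (TK #>\<^bsub>FG\<^esub> d) = G (TK #>\<^bsub>FG\<^esub> (c - d)) \<oplus>\<^bsub>Z\<^esub> G (TK #>\<^bsub>FG\<^esub> d)"
      using additive_add[OF F, of "TK #>\<^bsub>FG\<^esub> (c - d)" "TK #>\<^bsub>FG\<^esub> d"] 
        additive_add[OF G, of "TK #>\<^bsub>FG\<^esub> (c - d)" "TK #>\<^bsub>FG\<^esub> d"] cosc[OF cd] cosc[OF d] s IH by simp
    then show "F (TK #>\<^bsub>FG\<^esub> (c - d)) = G (TK #>\<^bsub>FG\<^esub> (c - d))"
      using IH cosc[OF cd] cosc[OF d] additive_closed[OF F] additive_closed[OF G] 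
      by (metis Z.add.r_cancel tensor_simps(1))
  qed
  then show ?thesis using tc by simp
qed

lemma pure_eqI:
  assumes a: "a \<in> carrier FG" and d: "d \<in> carrier FG" and ad: "a - d \<in> TK"
  shows "TK #>\<^bsub>FG\<^esub> a = TK #>\<^bsub>FG\<^esub> d"
proof -
  interpret F: comm_group FG by (rule abelian_free_Abelian_group)
  have sub: "subgroup TK FG" using tensor_ker_normal by (rule normal_imp_subgroup)
  have "a \<in> TK #>\<^bsub>FG\<^esub> d" unfolding r_coset_def using ad by (auto intro!: bexI[of _ "a - d"])
  then show ?thesis using F.repr_independence[OF _ _ sub] d by blast
qed

lemma pure_add_left:
  assumes "x \<in> carrier U" "x' \<in> carrier U" "y \<in> carrier Y"
  shows "pure_tensor T U Y (x \<oplus>\<^bsub>U\<^esub> x') y = pure_tensor T U Y x y \<oplus>\<^bsub>tensor_grp T U Y\<^esub> pure_tensor T U Y x' y"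
proof -
  interpret U: abelian_group U using ok by (simp add: tensorable_def)
  have "frag_of (x \<oplus>\<^bsub>U\<^esub> x', y) - frag_of (x, y) - frag_of (x', y) \<in> TK" 
    unfolding tensor_ker_def tensor_rels_def using assms by (intro generate.incl) auto
  moreover have "frag_of (x, y) + frag_of (x', y) \<in> carrier FG" 
    using assms keys_add[of "frag_of (x, y)" "frag_of (x', y)"] by auto
  ultimately have "TK #>\<^bsub>FG\<^esub> frag_of (x \<oplus>\<^bsub>U\<^esub> x', y) = TK #>\<^bsub>FG\<^esub> (frag_of (x, y) + frag_of (x', y))"
    using assms by (intro pure_eqI) (auto simp: diff_diff_eq)
  also have "\<dots> = (TK #>\<^bsub>FG\<^esub> frag_of (x, y)) \<oplus>\<^bsub>tensor_grp T U Y\<^esub> (TK #>\<^bsub>FG\<^esub> frag_of (x', y))"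
    using assms by (intro tensor_add_cosets[symmetric]) auto
  finally show ?thesis by (simp add: pure_tensor_def)
qed

lemma pure_add_right:
  assumes "x \<in> carrier U" "y \<in> carrier Y" "y' \<in> carrier Y"
  shows "pure_tensor T U Y x (y \<oplus>\<^bsub>Y\<^esub> y') = pure_tensor T U Y x y \<oplus>\<^bsub>tensor_grp T U Y\<^esub> pure_tensor T U Y x y'"
proof -
  interpret Y: abelian_group Y using ok by (simp add: tensorable_def)
  have "frag_of (x, y \<oplus>\<^bsub>Y\<^esub> y') - frag_of (x, y) - frag_of (x, y') \<in> TK" 
    unfolding tensor_ker_def tensor_rels_def using assms by (intro generate.incl) auto
  moreover have "frag_of (x, y) + frag_of (x, y') \<in> carrier FG" 
    using assms keys_add[of "frag_of (x, y)" "frag_of (x, y')"] by auto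
  ultimately have "TK #>\<^bsub>FG\<^esub> frag_of (x, y \<oplus>\<^bsub>Y\<^esub> y') = TK #>\<^bsub>FG\<^esub> (frag_of (x, y) + frag_of (x, y'))"
    using assms by (intro pure_eqI) (auto simp: diff_diff_eq)
  also have "\<dots> = (TK #>\<^bsub>FG\<^esub> frag_of (x, y)) \<oplus>\<^bsub>tensor_grp T U Y\<^esub> (TK #>\<^bsub>FG\<^esub> frag_of (x, y'))"
    using assms by (intro tensor_add_cosets[symmetric]) auto
  finally show ?thesis by (simp add: pure_tensor_def)
qed

lemma pure_balance:
  assumes "x \<in> carrier U" "t \<in> carrier T" "y \<in> carrier Y"
  shows "pure_tensor T U Y (ract U x t) y = pure_tensor T U Y x (lact Y t y)"
proof -
  have "frag_of (ract U x t, y) - frag_of (x, lact Y t y) \<in> TK" 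
    unfolding tensor_ker_def tensor_rels_def using assms by (intro generate.incl) auto
  then show ?thesis unfolding pure_tensor_def
    using assms ok by (intro pure_eqI) (auto simp: tensorable_def)
qed

lemma pure_balanced: "balanced T U Y (tensor T U Y) (pure_tensor T U Y)"
  by (intro balancedI additiveI) (auto simp: pure_closed_grp pure_add_left pure_add_right pure_balance)

text \<open>The additive extension of a balanced map vanishes on the three families of relations,
  hence on the subgroup they generate, and is constant on each coset. This is what gives
  \<open>the_elem\<close> in \<open>tensor_lift\<close> its meaning.\<close>

lemma lift_coset:
  assumes Z: "abelian_group Z" and f: "balanced T U Y Z f" and c: "Poly_Mapping.keys c \<subseteq> carrier U \<times> carrier Y"
  shows "tensor_lift Z f (TK #>\<^bsub>FG\<^esub> c) = free_ext Z (\<lambda>p. f (fst p) (snd p)) c"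
proof -
  let ?f = "\<lambda>p. f (fst p) (snd p)" and ?F = "free_ext Z (\<lambda>p. f (fst p) (snd p))"
  interpret U: abelian_group U using ok by (simp add: tensorable_def)
  interpret Y: abelian_group Y using ok by (simp add: tensorable_def)
  interpret Z: abelian_group Z by fact
  interpret F: comm_group FG by (rule abelian_free_Abelian_group)
  have fc: "f x y \<in> carrier Z" if "x \<in> carrier U" "y \<in> carrier Y" for x y
    using f that by (auto simp: balanced_def additive_def)
  then have fS: "?f \<in> carrier U \<times> carrier Y \<rightarrow> carrier Z" by auto
  interpret h: group_hom FG "add_monoid Z" ?F
    by (intro group_hom.intro group_hom_axioms.intro free_ext_hom[OF Z fS] F.is_group Z.a_group)
  have fdiff: "?F (a - d) = ?F a \<ominus>\<^bsub>Z\<^esub> ?F d" if "a \<in> carrier FG" "d \<in> carrier FG" for a d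
  proof -
    have "a - d \<in> carrier FG" using that keys_diff[of a d] by auto
    then have "?F (a - d) \<oplus>\<^bsub>Z\<^esub> ?F d = ?F a" using h.hom_mult[of "a - d" d] that by simp
    then show ?thesis using h.hom_closed[OF that(2)] h.hom_closed[OF \<open>a - d \<in> carrier FG\<close>] 
      by (metis Z.add.inv_solve_right' Z.minus_eq h.hom_closed partial_object.select_convs(1) that(1))
  qed
  have "tensor_rels T U Y \<subseteq> kernel FG (add_monoid Z) ?F"
  proof
    fix r assume r: "r \<in> tensor_rels T U Y"
    then have rc: "r \<in> carrier FG" using tensor_rels_sub by blast
    have kd: "frag_of a - frag_of d \<in> carrier FG" if "a \<in> carrier U \<times> carrier Y" "d \<in> carrier U \<times> carrier Y" for a d
      using that keys_diff[of "frag_of a" "frag_of d"] by auto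
    have z3: "a \<oplus>\<^bsub>Z\<^esub> d \<ominus>\<^bsub>Z\<^esub> a \<ominus>\<^bsub>Z\<^esub> d = \<zero>\<^bsub>Z\<^esub>" if "a \<in> carrier Z" "d \<in> carrier Z" for a d
      using that by (metis Z.a_comm Z.add.inv_closed Z.add.inv_solve_right' Z.add.m_closed Z.minus_closed Z.minus_eq Z.r_neg)
    have "?F r = \<zero>\<^bsub>Z\<^esub>"
      using r unfolding tensor_rels_def 
    proof (elim UnE CollectE exE conjE)
      fix x x' y assume "r = frag_of (x \<oplus>\<^bsub>U\<^esub> x', y) - frag_of (x, y) - frag_of (x', y)"
        and "x \<in> carrier U" "x' \<in> carrier U" "y \<in> carrier Y"
      then show ?thesis using f z3
        by (simp add: fdiff kd free_ext_frag_of Z fc balanced_def additive_def del: carrier_free_Abelian_group_iff)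
    next
      fix x y y' assume "r = frag_of (x, y \<oplus>\<^bsub>Y\<^esub> y') - frag_of (x, y) - frag_of (x, y')"
        and "x \<in> carrier U" "y' \<in> carrier Y" "y \<in> carrier Y"
      then show ?thesis using f z3
        by (simp add: fdiff kd free_ext_frag_of Z fc balanced_def additive_def del: carrier_free_Abelian_group_iff)
    next
      fix x t y assume "r = frag_of (ract U x t, y) - frag_of (x, lact Y t y)"
        and "x \<in> carrier U" "t \<in> carrier T" "y \<in> carrier Y"
      then show ?thesis using f ok 
        by (simp add: fdiff free_ext_frag_of Z fc balanced_def tensorable_def Z.r_neg Z.minus_eq del: carrier_free_Abelian_group_iff)
    qed
    then show "r \<in> kernel FG (add_monoid Z) ?F" using rc by (simp add: kernel_def)
  qed
  then have "TK \<subseteq> kernel FG (add_monoid Z) ?F"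
    unfolding tensor_ker_def by (rule F.generate_subgroup_incl) (rule h.subgroup_kernel)
  then have k0: "\<And>h. h \<in> TK \<Longrightarrow> h \<in> carrier FG \<and> ?F h = \<zero>\<^bsub>Z\<^esub>" by (auto simp: kernel_def)
  have z0: "0 \<in> TK" using tensor_ker_normal 
    by (metis normal_imp_subgroup one_free_Abelian_group subgroup.one_closed)
  have "?F ` (TK #>\<^bsub>FG\<^esub> c) = {?F c}"
  proof -
    have "?F (h + c) = ?F c" if "h \<in> TK" for h
      using k0[OF that] h.hom_mult[of h c] c h.hom_closed[of c] by simp
    then show ?thesis using z0 unfolding r_coset_def by auto
  qed
  then show ?thesis by (simp add: tensor_lift_eq)
qed

lemma lift_pure:
  assumes Z: "abelian_group Z" and f: "balanced T U Y Z f" and "x \<in> carrier U" "y \<in> carrier Y"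
  shows "tensor_lift Z f (pure_tensor T U Y x y) = f x y"
proof -
  have "f x y \<in> carrier Z" using assms by (auto simp: balanced_def additive_def)
  then show ?thesis unfolding pure_tensor_def
    using assms by (simp add: lift_coset free_ext_frag_of)
qed

lemma lift_additive:
  assumes Z: "abelian_group Z" and f: "balanced T U Y Z f"
  shows "additive (tensor T U Y) Z (tensor_lift Z f)"
proof -
  let ?f = "\<lambda>p. f (fst p) (snd p)"
  interpret F: comm_group FG by (rule abelian_free_Abelian_group)
  have fS: "?f \<in> carrier U \<times> carrier Y \<rightarrow> carrier Z" 
    using balanced_closed[OF f] by auto
  note h = free_ext_hom[OF Z fS]
  have co: "\<exists>c. Poly_Mapping.keys c \<subseteq> carrier U \<times> carrier Y \<and> t = TK #>\<^bsub>FG\<^esub> c" if "t \<in> carrier (tensor_grp T U Y)" for t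
    using that unfolding tensor_grp_carrier RCOSETS_def
    by (simp add: Bex_def)
  show ?thesis
  proof (rule additiveI)
    fix s assume s: "s \<in> carrier (tensor T U Y)"
    obtain c where c: "Poly_Mapping.keys c \<subseteq> carrier U \<times> carrier Y" "s = TK #>\<^bsub>FG\<^esub> c" using co s by auto
    show "tensor_lift Z f s \<in> carrier Z"
      using c h by (simp add: lift_coset[OF Z f] hom_def Pi_def)
    fix t assume t: "t \<in> carrier (tensor T U Y)"
    obtain d where d: "Poly_Mapping.keys d \<subseteq> carrier U \<times> carrier Y" "t = TK #>\<^bsub>FG\<^esub> d" using co t by auto
    have cd: "Poly_Mapping.keys (c + d) \<subseteq> carrier U \<times> carrier Y" using c d keys_add[of c d] by auto
    show "tensor_lift Z f (s \<oplus>\<^bsub>tensor T U Y\<^esub> t) = tensor_lift Z f s \<oplus>\<^bsub>Z\<^esub> tensor_lift Z f t"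
      using c d cd h by (simp add: tensor_add_cosets lift_coset[OF Z f] hom_def)
  qed
qed

text \<open>\<open>tensor_lift\<close> takes total functions, while identities between integrands
  hold only on the carriers; this permits replacing one integrand by the other.\<close>

lemma lift_cong:
  assumes Z: "abelian_group Z" and f: "balanced T U Y Z f" 
    and eq: "\<And>x y. x \<in> carrier U \<Longrightarrow> y \<in> carrier Y \<Longrightarrow> f x y = g x y"
    and t: "t \<in> carrier (tensor T U Y)"
  shows "tensor_lift Z f t = tensor_lift Z g t"
proof -
  interpret U: abelian_group U using ok by (simp add: tensorable_def)
  interpret Y: abelian_group Y using ok by (simp add: tensorable_def)
  have g: "balanced T U Y Z g" using f ok
    by (auto simp: balanced_def additive_def Pi_def eq[symmetric] tensorable_def)
  show ?thesis
    by (rule tensor_additive_eqI[OF Z lift_additive[OF Z f] lift_additive[OF Z g] _ t])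
       (simp add: lift_pure Z f g eq)
qed

end

section \<open>Modules over a commutative ring\<close>

text \<open>The target enters \<open>tensor_lift\<close> only through its additive group. Thus a
  lift into \<open>H\<close> and one into \<open>sym_bimod H\<close> coincide, and likewise for the
  ground ring regarded as a bimodule.\<close>

lemma tensor_lift_struct:
  assumes "carrier Z' = carrier Z" "add Z' = add Z" "\<zero>\<^bsub>Z'\<^esub> = \<zero>\<^bsub>Z\<^esub>"
  shows "tensor_lift Z' f = tensor_lift Z f"
proof -
  have "add_pow Z' j a = add_pow Z j a" for j :: int and a
    using assms by (simp add: add_pow_def int_pow_def nat_pow_def m_inv_def Let_def)
  then show ?thesis
    by (intro ext) (simp add: tensor_lift_def finsum_cong_struct[OF assms])
qed

text \<open>Modules over a commutative ring in the shape of bimodules with equal actions. This is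
  the shape in which tensor products come, so \<open>H\<close>, \<open>H \<otimes> H\<close> and
  threefold products are treated alike.\<close>

definition sym_mod :: "('r, 'p) ring_scheme \<Rightarrow> ('r, 'r, 'x) bimod \<Rightarrow> bool" where
  "sym_mod R W \<longleftrightarrow> cring R \<and> abelian_group W \<and>
     (\<forall>r\<in>carrier R. additive W W (lact W r)) \<and>
     (\<forall>x\<in>carrier W. additive R W (\<lambda>r. lact W r x)) \<and>
     (\<forall>r\<in>carrier R. \<forall>s\<in>carrier R. \<forall>x\<in>carrier W. lact W (r \<otimes>\<^bsub>R\<^esub> s) x = lact W r (lact W s x)) \<and>
     (\<forall>x\<in>carrier W. lact W \<one>\<^bsub>R\<^esub> x = x) \<and>
     (\<forall>r\<in>carrier R. \<forall>x\<in>carrier W. ract W x r = lact W r x)"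

lemma sym_modD:
  assumes "sym_mod R W"
  shows "cring R" "abelian_group W" "r \<in> carrier R \<Longrightarrow> additive W W (lact W r)"
    "x \<in> carrier W \<Longrightarrow> additive R W (\<lambda>r. lact W r x)"
    "r \<in> carrier R \<Longrightarrow> s \<in> carrier R \<Longrightarrow> x \<in> carrier W \<Longrightarrow> lact W (r \<otimes>\<^bsub>R\<^esub> s) x = lact W r (lact W s x)"
    "x \<in> carrier W \<Longrightarrow> lact W \<one>\<^bsub>R\<^esub> x = x"
    "r \<in> carrier R \<Longrightarrow> x \<in> carrier W \<Longrightarrow> ract W x r = lact W r x"
    "r \<in> carrier R \<Longrightarrow> x \<in> carrier W \<Longrightarrow> lact W r x \<in> carrier W"
  using assms by (auto simp: sym_mod_def additive_def)

lemma tensorable_sym: "sym_mod R U \<Longrightarrow> sym_mod R Y \<Longrightarrow> tensorable R U Y"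
  by (simp add: tensorable_def sym_modD)

definition lin :: "('r, 'p) ring_scheme \<Rightarrow> ('r, 'r, 'x) bimod \<Rightarrow> ('r, 'r, 'y) bimod \<Rightarrow> ('x \<Rightarrow> 'y) \<Rightarrow> bool" where
  "lin R U W f \<longleftrightarrow> additive U W f \<and> (\<forall>r\<in>carrier R. \<forall>x\<in>carrier U. f (lact U r x) = lact W r (f x))"

definition bilin :: "('r, 'p) ring_scheme \<Rightarrow> ('r, 'r, 'x) bimod \<Rightarrow> ('r, 'r, 'y) bimod \<Rightarrow> ('r, 'r, 'z) bimod
    \<Rightarrow> ('x \<Rightarrow> 'y \<Rightarrow> 'z) \<Rightarrow> bool" where
  "bilin R U Y W f \<longleftrightarrow> (\<forall>x\<in>carrier U. lin R Y W (f x)) \<and> (\<forall>y\<in>carrier Y. lin R U W (\<lambda>x. f x y))"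

lemma linI:
  assumes "\<And>x. x \<in> carrier U \<Longrightarrow> f x \<in> carrier W"
    and "\<And>x y. x \<in> carrier U \<Longrightarrow> y \<in> carrier U \<Longrightarrow> f (x \<oplus>\<^bsub>U\<^esub> y) = f x \<oplus>\<^bsub>W\<^esub> f y"
    and "\<And>r x. r \<in> carrier R \<Longrightarrow> x \<in> carrier U \<Longrightarrow> f (lact U r x) = lact W r (f x)"
  shows "lin R U W f"
  using assms by (auto simp: lin_def additive_def)

lemma linD:
  assumes "lin R U W f"
  shows "additive U W f" "x \<in> carrier U \<Longrightarrow> f x \<in> carrier W"
    "x \<in> carrier U \<Longrightarrow> y \<in> carrier U \<Longrightarrow> f (x \<oplus>\<^bsub>U\<^esub> y) = f x \<oplus>\<^bsub>W\<^esub> f y"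
    "r \<in> carrier R \<Longrightarrow> x \<in> carrier U \<Longrightarrow> f (lact U r x) = lact W r (f x)"
  using assms by (auto simp: lin_def additive_def)

lemma lin_cong:
  assumes "lin R U W f" "abelian_group U" "\<And>x. x \<in> carrier U \<Longrightarrow> f x = g x"
    "\<And>r x. r \<in> carrier R \<Longrightarrow> x \<in> carrier U \<Longrightarrow> lact U r x \<in> carrier U"
  shows "lin R U W g"
proof -
  interpret U: abelian_group U by fact
  show ?thesis using assms(1,3,4) by (auto simp: lin_def additive_def Pi_def)
qed

lemma lin_compose: "lin R U W f \<Longrightarrow> lin R W Z g \<Longrightarrow> lin R U Z (\<lambda>x. g (f x))"
  by (auto simp: lin_def additive_def Pi_def)

lemma lin_id: "lin R U U (\<lambda>x. x)"
  by (auto simp: lin_def additive_def)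

lemma linear_maps_iff:
  assumes "sym_mod R U" "sym_mod R W"
  shows "f \<in> linear_maps R U W \<longleftrightarrow> lin R U W f"
  by (auto simp: linear_maps_def bimod_hom_def lin_def additive_def sym_modD[OF assms(1)] sym_modD[OF assms(2)] Pi_def)

lemma bilin_balanced:
  assumes "sym_mod R U" "sym_mod R Y" "bilin R U Y W f"
  shows "balanced R U Y W f"
  using assms(3) by (auto intro!: balancedI simp: bilin_def lin_def sym_modD[OF assms(1)] sym_modD[OF assms(2)])

lemma bilin_lift:
  assumes U: "sym_mod R U" and Y: "sym_mod R Y" and W: "sym_mod R W" and f: "bilin R U Y W f"
  shows "x \<in> carrier U \<Longrightarrow> y \<in> carrier Y \<Longrightarrow> tensor_lift W f (pure_tensor R U Y x y) = f x y"
    and "additive (tensor R U Y) W (tensor_lift W f)"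
  using lift_pure[OF tensorable_sym[OF U Y] sym_modD(2)[OF W] bilin_balanced[OF U Y f]]
    lift_additive[OF tensorable_sym[OF U Y] sym_modD(2)[OF W] bilin_balanced[OF U Y f]] by auto

text \<open>The action is defined by a lift into the bare group, since the bimodule is only being
  constructed there; with the bimodule as target the universal property applies directly.\<close>

lemma tensor_lact_eq: "lact (tensor T U Y) s = 
    tensor_lift (tensor T U Y) (\<lambda>x y. pure_tensor T U Y (lact U s x) y)"
  by (subst tensor_lift_struct[where Z = "tensor_grp T U Y"])
     (auto simp: tensor_def ring.extend_def bimod.fields_def)

lemma tensor_ract_eq: "ract (tensor T U Y) w u = 
    tensor_lift (tensor T U Y) (\<lambda>x y. pure_tensor T U Y x (ract Y y u)) w"
  by (subst tensor_lift_struct[where Z = "tensor_grp T U Y"])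
     (auto simp: tensor_def ring.extend_def bimod.fields_def)

lemma tensor_lact:
  assumes ok: "tensorable T U Y" and s: "additive U U (lact U s)"
    and c: "\<And>x t. x \<in> carrier U \<Longrightarrow> t \<in> carrier T \<Longrightarrow> lact U s (ract U x t) = ract U (lact U s x) t"
  shows "additive (tensor T U Y) (tensor T U Y) (lact (tensor T U Y) s)"
    and "x \<in> carrier U \<Longrightarrow> y \<in> carrier Y \<Longrightarrow>
      lact (tensor T U Y) s (pure_tensor T U Y x y) = pure_tensor T U Y (lact U s x) y"
proof -
  have b: "balanced T U Y (tensor T U Y) (\<lambda>x y. pure_tensor T U Y (lact U s x) y)"
    using pure_balanced[OF ok] s c by (auto simp: balanced_def additive_def Pi_def)
  show "additive (tensor T U Y) (tensor T U Y) (lact (tensor T U Y) s)"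
    unfolding tensor_lact_eq by (rule lift_additive[OF ok tensor_abelian[OF ok] b])
  show "x \<in> carrier U \<Longrightarrow> y \<in> carrier Y \<Longrightarrow>
      lact (tensor T U Y) s (pure_tensor T U Y x y) = pure_tensor T U Y (lact U s x) y"
    unfolding tensor_lact_eq by (rule lift_pure[OF ok tensor_abelian[OF ok] b])
qed

lemma tensor_ract:
  assumes ok: "tensorable T U Y" and s: "additive Y Y (\<lambda>y. ract Y y s)"
    and c: "\<And>y t. y \<in> carrier Y \<Longrightarrow> t \<in> carrier T \<Longrightarrow> ract Y (lact Y t y) s = lact Y t (ract Y y s)"
  shows "additive (tensor T U Y) (tensor T U Y) (\<lambda>w. ract (tensor T U Y) w s)"
    and "x \<in> carrier U \<Longrightarrow> y \<in> carrier Y \<Longrightarrow>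
      ract (tensor T U Y) (pure_tensor T U Y x y) s = pure_tensor T U Y x (ract Y y s)"
proof -
  have b: "balanced T U Y (tensor T U Y) (\<lambda>x y. pure_tensor T U Y x (ract Y y s))"
    using pure_balanced[OF ok] s c by (auto simp: balanced_def additive_def Pi_def)
  show "additive (tensor T U Y) (tensor T U Y) (\<lambda>w. ract (tensor T U Y) w s)"
    unfolding tensor_ract_eq by (rule lift_additive[OF ok tensor_abelian[OF ok] b])
  show "x \<in> carrier U \<Longrightarrow> y \<in> carrier Y \<Longrightarrow>
      ract (tensor T U Y) (pure_tensor T U Y x y) s = pure_tensor T U Y x (ract Y y s)"
    unfolding tensor_ract_eq by (rule lift_pure[OF ok tensor_abelian[OF ok] b])
qed

lemma sym_tensor_lact:
  assumes U: "sym_mod R U" and Y: "sym_mod R Y" and r: "r \<in> carrier R"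
  shows "additive (tensor R U Y) (tensor R U Y) (lact (tensor R U Y) r)"
    and "x \<in> carrier U \<Longrightarrow> y \<in> carrier Y \<Longrightarrow>
      lact (tensor R U Y) r (pure_tensor R U Y x y) = pure_tensor R U Y (lact U r x) y"
    and "additive (tensor R U Y) (tensor R U Y) (\<lambda>w. ract (tensor R U Y) w r)"
    and "x \<in> carrier U \<Longrightarrow> y \<in> carrier Y \<Longrightarrow>
      ract (tensor R U Y) (pure_tensor R U Y x y) r = pure_tensor R U Y x (lact Y r y)"
proof -
  interpret R: cring R using U by (rule sym_modD)
  note ok = tensorable_sym[OF U Y]
  have c1: "\<And>x t. x \<in> carrier U \<Longrightarrow> t \<in> carrier R \<Longrightarrow> lact U r (ract U x t) = ract U (lact U r x) t"
    using r by (metis (no_types, lifting) R.m_comm U sym_modD(5,7,8))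
  have c2: "\<And>y t. y \<in> carrier Y \<Longrightarrow> t \<in> carrier R \<Longrightarrow> ract Y (lact Y t y) r = lact Y t (ract Y y r)"
    using r by (metis (no_types, lifting) R.m_comm Y sym_modD(5,7,8))
  have a2: "additive Y Y (\<lambda>y. ract Y y r)" 
    using sym_modD(3)[OF Y r] r 
    by (auto simp: additive_def sym_modD[OF Y] abelian_monoid.a_closed abelian_group.axioms(1))
  note l = tensor_lact[OF ok sym_modD(3)[OF U r] c1] and rr = tensor_ract[OF ok a2 c2]
  show "additive (tensor R U Y) (tensor R U Y) (lact (tensor R U Y) r)"
    "additive (tensor R U Y) (tensor R U Y) (\<lambda>w. ract (tensor R U Y) w r)"
    using l(1) rr(1) by auto
  show "x \<in> carrier U \<Longrightarrow> y \<in> carrier Y \<Longrightarrow>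
      lact (tensor R U Y) r (pure_tensor R U Y x y) = pure_tensor R U Y (lact U r x) y"
    "x \<in> carrier U \<Longrightarrow> y \<in> carrier Y \<Longrightarrow>
      ract (tensor R U Y) (pure_tensor R U Y x y) r = pure_tensor R U Y x (lact Y r y)"
    using l(2) rr(2) r by (simp_all add: sym_modD(7)[OF Y])
qed

lemma pure_smult:
  assumes U: "sym_mod R U" and Y: "sym_mod R Y" and "r \<in> carrier R" "x \<in> carrier U" "y \<in> carrier Y"
  shows "pure_tensor R U Y x (lact Y r y) = pure_tensor R U Y (lact U r x) y"
  using pure_balance[OF tensorable_sym[OF U Y], of x r y] assms by (simp add: sym_modD(7)[OF U])

text \<open>All axioms are equations between additive maps in the tensor and are tested on pure
  tensors. Closure of this class under tensor products is what makes threefold products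
  accessible.\<close>

lemma tensor_sym_mod:
  assumes U: "sym_mod R U" and Y: "sym_mod R Y"
  shows "sym_mod R (tensor R U Y)"
proof -
  interpret R: cring R using U by (rule sym_modD)
  interpret U: abelian_group U using U by (rule sym_modD)
  note ok = tensorable_sym[OF U Y]
  let ?T = "tensor R U Y"
  note AG = tensor_abelian[OF ok]
  interpret T: abelian_group ?T by (rule AG)
  note l = sym_tensor_lact[OF U Y]
  note pb = pure_balanced[OF ok]
  note eqI = tensor_additive_eqI[OF ok AG]
  have lc: "r \<in> carrier R \<Longrightarrow> t \<in> carrier ?T \<Longrightarrow> lact ?T r t \<in> carrier ?T" for r t
    using additive_closed[OF l(1)] by blast
  note Ucl = sym_modD(8)[OF U] 
  have add_r: "lact ?T (r \<oplus>\<^bsub>R\<^esub> s) t = lact ?T r t \<oplus>\<^bsub>?T\<^esub> lact ?T s t" if "r \<in> carrier R" "s \<in> carrier R" "t \<in> carrier ?T" for r s t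
  proof (rule eqI[OF _ _ _ that(3)])
    show "additive ?T ?T (lact ?T (r \<oplus>\<^bsub>R\<^esub> s))" using l(1) that by blast
    show "additive ?T ?T (\<lambda>t. lact ?T r t \<oplus>\<^bsub>?T\<^esub> lact ?T s t)" 
      using additive_add_pw[OF AG l(1)[OF that(1)] l(1)[OF that(2)]] .
    fix x y assume "x \<in> carrier U" "y \<in> carrier Y"
    then show "lact ?T (r \<oplus>\<^bsub>R\<^esub> s) (pure_tensor R U Y x y) = 
      lact ?T r (pure_tensor R U Y x y) \<oplus>\<^bsub>?T\<^esub> lact ?T s (pure_tensor R U Y x y)"
      using that l(2) additive_add[OF sym_modD(4)[OF U], of x r s]
      by (simp add: pure_add_left[OF ok] Ucl)
  qed
  have mult_r: "lact ?T (r \<otimes>\<^bsub>R\<^esub> s) t = lact ?T r (lact ?T s t)" if "r \<in> carrier R" "s \<in> carrier R" "t \<in> carrier ?T" for r s t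
  proof (rule eqI[OF _ _ _ that(3)])
    show "additive ?T ?T (lact ?T (r \<otimes>\<^bsub>R\<^esub> s))" using l(1) that by blast
    show "additive ?T ?T (\<lambda>t. lact ?T r (lact ?T s t))" 
      using additive_compose[OF l(1)[OF that(2)] l(1)[OF that(1)]] .
    fix x y assume "x \<in> carrier U" "y \<in> carrier Y"
    then show "lact ?T (r \<otimes>\<^bsub>R\<^esub> s) (pure_tensor R U Y x y) = lact ?T r (lact ?T s (pure_tensor R U Y x y))"
      using that l(2) by (simp add: Ucl sym_modD(5)[OF U])
  qed
  have one_r: "lact ?T \<one>\<^bsub>R\<^esub> t = t" if "t \<in> carrier ?T" for t
  proof (rule eqI[OF _ _ _ that])
    show "additive ?T ?T (lact ?T \<one>\<^bsub>R\<^esub>)" "additive ?T ?T (\<lambda>t. t)" using l(1) by (auto simp: additive_def)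
  qed (simp add: l sym_modD(6)[OF U])
  have rl: "ract ?T t r = lact ?T r t" if "r \<in> carrier R" "t \<in> carrier ?T" for r t
    by (rule eqI[OF l(3)[OF that(1)] l(1)[OF that(1)] _ that(2)])
       (use that in \<open>simp add: l pure_smult[OF U Y]\<close>)
  show ?thesis unfolding sym_mod_def
    using R.cring_axioms AG l(1) add_r mult_r one_r rl lc by (auto simp: additive_def)
qed

lemma tensor_lift_lin:
  assumes U: "sym_mod R U" and Y: "sym_mod R Y" and W: "sym_mod R W" and f: "bilin R U Y W f"
  shows "lin R (tensor R U Y) W (tensor_lift W f)"
  unfolding lin_def
proof (intro conjI ballI)
  note ok = tensorable_sym[OF U Y] 
  interpret W: abelian_group W using W by (rule sym_modD)
  note b = bilin_lift[OF U Y W f]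
  show "additive (tensor R U Y) W (tensor_lift W f)" by (rule b)
  fix r t assume r: "r \<in> carrier R" and t: "t \<in> carrier (tensor R U Y)"
  show "tensor_lift W f (lact (tensor R U Y) r t) = lact W r (tensor_lift W f t)"
  proof (rule tensor_additive_eqI[OF ok W.abelian_group_axioms _ _ _ t])
    show "additive (tensor R U Y) W (\<lambda>t. tensor_lift W f (lact (tensor R U Y) r t))"
      by (rule additive_compose[OF sym_tensor_lact(1)[OF U Y r] b(2)])
    show "additive (tensor R U Y) W (\<lambda>t. lact W r (tensor_lift W f t))"
      by (rule additive_compose[OF b(2) sym_modD(3)[OF W r]])
    fix x y assume x: "x \<in> carrier U" "y \<in> carrier Y"
    have "lact U r x \<in> carrier U" by (rule sym_modD(8)[OF U r x(1)])
    then show "tensor_lift W f (lact (tensor R U Y) r (pure_tensor R U Y x y)) = lact W r (tensor_lift W f (pure_tensor R U Y x y))"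
      using f x r by (simp add: sym_tensor_lact(2)[OF U Y r] b bilin_def lin_def)
  qed
qed

lemma tensor_lin_eqI:
  assumes "sym_mod R U" "sym_mod R Y" "abelian_group W"
    and "lin R (tensor R U Y) W F" "lin R (tensor R U Y) W G"
    and "\<And>x y. x \<in> carrier U \<Longrightarrow> y \<in> carrier Y \<Longrightarrow> F (pure_tensor R U Y x y) = G (pure_tensor R U Y x y)"
    and "t \<in> carrier (tensor R U Y)"
  shows "F t = G t"
  by (rule tensor_additive_eqI[OF tensorable_sym[OF assms(1,2)] assms(3)
        linD(1)[OF assms(4)] linD(1)[OF assms(5)] _ assms(7)]) (rule assms(6))

lemma pure_bilin:
  assumes U: "sym_mod R U" and Y: "sym_mod R Y"
  shows "bilin R U Y (tensor R U Y) (pure_tensor R U Y)"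
  using pure_balanced[OF tensorable_sym[OF U Y]]
  by (auto simp: bilin_def lin_def balanced_def sym_tensor_lact[OF U Y] pure_smult[OF U Y])

lemma bilin_compose:
  assumes "bilin R U Y W f" "lin R U' U g" "lin R Y' Y h"
  shows "bilin R U' Y' W (\<lambda>x y. f (g x) (h y))"
  using assms by (auto simp: bilin_def lin_def additive_def Pi_def)

lemma sym_bimod_simps [simp]:
  "carrier (sym_bimod H) = carrier H" "add (sym_bimod H) = add H" "\<zero>\<^bsub>sym_bimod H\<^esub> = \<zero>\<^bsub>H\<^esub>"
  "lact (sym_bimod H) = smult H" "ract (sym_bimod H) x r = r \<odot>\<^bsub>H\<^esub> x"
  by (simp_all add: sym_bimod_def)

lemma ring_bimod_simps [simp]:
  "carrier (ring_bimod M l r) = carrier M" "add (ring_bimod M l r) = add M" "\<zero>\<^bsub>ring_bimod M l r\<^esub> = \<zero>\<^bsub>M\<^esub>"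
  "lact (ring_bimod M l r) s x = l s \<otimes>\<^bsub>M\<^esub> x" "ract (ring_bimod M l r) x t = x \<otimes>\<^bsub>M\<^esub> r t"
  by (simp_all add: ring_bimod_def)

lemma sym_bimod_sym_mod:
  assumes "module R H"
  shows "sym_mod R (sym_bimod H)"
proof -
  interpret module R H by fact
  show ?thesis unfolding sym_mod_def
    using R.is_cring abelian_group_cong[OF M.abelian_group_axioms, of "sym_bimod H"]
    by (auto simp: additive_def smult_l_distr smult_r_distr smult_assoc1)
qed

lemma base_sym_mod:
  assumes "cring R"
  shows "sym_mod R (ring_bimod R id id)"
proof -
  interpret cring R by fact
  show ?thesis unfolding sym_mod_def
    using is_cring abelian_group_cong[OF abelian_group_axioms, of "ring_bimod R id id"]
    by (auto simp: additive_def l_distr r_distr m_ac)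
qed

section \<open>Algebras in duality\<close>

text \<open>Nested lifts occur in the product of \<open>H \<otimes> H\<close> and in the
  associativity map: the inner integrand depends on the outer variable, and the inner value must be
  linear in that variable before the outer lift makes sense. For a fixed parameter this is tested on
  pure tensors.\<close>

lemma linear_lift_param:
  assumes U: "sym_mod R U" and Y: "sym_mod R Y" and W: "sym_mod R W"
    and b: "\<And>z. z \<in> carrier Z \<Longrightarrow> bilin R U Y W (g z)"
    and l: "\<And>x y. x \<in> carrier U \<Longrightarrow> y \<in> carrier Y \<Longrightarrow> lin R Z W (\<lambda>z. g z x y)"
    and Z: "sym_mod R Z" and s: "s \<in> carrier (tensor R U Y)"
  shows "lin R Z W (\<lambda>z. tensor_lift W (g z) s)"
proof (rule linI)
  interpret Z: abelian_group Z using Z by (rule sym_modD)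
  note bl = tensor_lift_lin[OF U Y W b]
  have v: "z \<in> carrier Z \<Longrightarrow> x \<in> carrier U \<Longrightarrow> y \<in> carrier Y \<Longrightarrow> tensor_lift W (g z) (pure_tensor R U Y x y) = g z x y" for z x y
    by (rule bilin_lift(1)[OF U Y W b])
  note Wab = sym_modD(2)[OF W]
  show "z \<in> carrier Z \<Longrightarrow> tensor_lift W (g z) s \<in> carrier W" for z
    using linD(2)[OF bl] s by blast
  show "tensor_lift W (g (z \<oplus>\<^bsub>Z\<^esub> z')) s = tensor_lift W (g z) s \<oplus>\<^bsub>W\<^esub> tensor_lift W (g z') s"
    if z: "z \<in> carrier Z" and z': "z' \<in> carrier Z" for z z'
  proof (rule tensor_additive_eqI[OF tensorable_sym[OF U Y] Wab _ _ _ s])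
    show "additive (tensor R U Y) W (tensor_lift W (g (z \<oplus>\<^bsub>Z\<^esub> z')))"
      using bl[of "z \<oplus>\<^bsub>Z\<^esub> z'"] z z' by (simp add: linD(1))
    show "additive (tensor R U Y) W (\<lambda>s. tensor_lift W (g z) s \<oplus>\<^bsub>W\<^esub> tensor_lift W (g z') s)"
      by (rule additive_add_pw[OF Wab linD(1)[OF bl[OF z]] linD(1)[OF bl[OF z']]])
  qed (use z z' in \<open>simp add: v linD(3)[OF l]\<close>)
  show "tensor_lift W (g (lact Z r z)) s = lact W r (tensor_lift W (g z) s)"
    if r: "r \<in> carrier R" and z: "z \<in> carrier Z" for r z
  proof (rule tensor_additive_eqI[OF tensorable_sym[OF U Y] Wab _ _ _ s])
    have rz: "lact Z r z \<in> carrier Z" using r z by (rule sym_modD(8)[OF Z])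
    show "additive (tensor R U Y) W (tensor_lift W (g (lact Z r z)))"
      by (rule linD(1)[OF bl[OF rz]])
    show "additive (tensor R U Y) W (\<lambda>s. lact W r (tensor_lift W (g z) s))"
      by (rule additive_compose[OF linD(1)[OF bl[OF z]] sym_modD(3)[OF W r]])
  qed (use r z sym_modD(8)[OF Z r z] in \<open>simp add: v linD(4)[OF l]\<close>)
qed

lemma lin_finsum_pw:
  assumes U: "sym_mod R U" and W: "sym_mod R W" and f: "\<And>i. i \<in> I \<Longrightarrow> lin R U W (f i)"
  shows "lin R U W (\<lambda>x. \<Oplus>\<^bsub>W\<^esub>i\<in>I. f i x)"
  unfolding lin_def
proof (intro conjI ballI)
  interpret W: abelian_group W using W by (rule sym_modD)
  show "additive U W (\<lambda>x. \<Oplus>\<^bsub>W\<^esub>i\<in>I. f i x)"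
    by (rule additive_finsum_pw[OF sym_modD(2)[OF W] linD(1)[OF f]])
  fix r x assume r: "r \<in> carrier R" and x: "x \<in> carrier U"
  have "(\<Oplus>\<^bsub>W\<^esub>i\<in>I. f i (lact U r x)) = (\<Oplus>\<^bsub>W\<^esub>i\<in>I. lact W r (f i x))"
    using r x linD(2)[OF f] sym_modD(8)[OF U r x] sym_modD(8)[OF W r]
    by (intro W.finsum_cong') (auto simp: linD(4)[OF f])
  also have "\<dots> = lact W r (\<Oplus>\<^bsub>W\<^esub>i\<in>I. f i x)"
    by (rule additive_finsum[OF sym_modD(2)[OF W] sym_modD(2)[OF W] sym_modD(3)[OF W r], symmetric])
       (use x linD(2)[OF f] in auto)
  finally show "(\<Oplus>\<^bsub>W\<^esub>i\<in>I. f i (lact U r x)) = lact W r (\<Oplus>\<^bsub>W\<^esub>i\<in>I. f i x)" .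
qed

lemma mult_bilin:
  assumes "assoc_algebra R H"
  shows "bilin R (sym_bimod H) (sym_bimod H) (sym_bimod H) (\<lambda>x y. x \<otimes>\<^bsub>H\<^esub> y)"
proof -
  interpret H: ring H using assms by (simp add: assoc_algebra_def)
  interpret HM: module R H using assms by (simp add: assoc_algebra_def)
  show ?thesis using assms
    by (auto simp: bilin_def assoc_algebra_def H.l_distr H.r_distr intro!: linI)
qed

text \<open>Nondegeneracy is encoded by the dual bases \<open>d\<close> and \<open>e\<close>: the
  two expansions give at once finite dimension, separation of elements by the form and
  representability of functionals. The assumptions are symmetric under exchange of \<open>H\<close>
  and \<open>K\<close>.\<close>

locale dual_alg = R?: cring R for R :: "'r ring" (structure) +
  fixes H :: "('r, 'a) bialg" and K :: "('r, 'b) bialg" and p :: "'a \<Rightarrow> 'b \<Rightarrow> 'r"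
    and n :: nat and d :: "nat \<Rightarrow> 'a" and e :: "nat \<Rightarrow> 'b"
  assumes H: "assoc_algebra R H" and K: "assoc_algebra R K"
    and p_closed: "\<And>h k. h \<in> carrier H \<Longrightarrow> k \<in> carrier K \<Longrightarrow> p h k \<in> carrier R"
    and p_add_left: "\<And>h h' k. h \<in> carrier H \<Longrightarrow> h' \<in> carrier H \<Longrightarrow> k \<in> carrier K \<Longrightarrow>
      p (h \<oplus>\<^bsub>H\<^esub> h') k = p h k \<oplus> p h' k"
    and p_add_right: "\<And>h k k'. h \<in> carrier H \<Longrightarrow> k \<in> carrier K \<Longrightarrow> k' \<in> carrier K \<Longrightarrow>
      p h (k \<oplus>\<^bsub>K\<^esub> k') = p h k \<oplus> p h k'"
    and p_smult_left: "\<And>r h k. r \<in> carrier R \<Longrightarrow> h \<in> carrier H \<Longrightarrow> k \<in> carrier K \<Longrightarrow>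
      p (r \<odot>\<^bsub>H\<^esub> h) k = r \<otimes> p h k"
    and p_smult_right: "\<And>r h k. r \<in> carrier R \<Longrightarrow> h \<in> carrier H \<Longrightarrow> k \<in> carrier K \<Longrightarrow>
      p h (r \<odot>\<^bsub>K\<^esub> k) = r \<otimes> p h k"
    and d_closed: "\<And>i. i < n \<Longrightarrow> d i \<in> carrier H" and e_closed: "\<And>i. i < n \<Longrightarrow> e i \<in> carrier K"
    and expand_H: "\<And>h. h \<in> carrier H \<Longrightarrow> (\<Oplus>\<^bsub>H\<^esub>i\<in>{..<n}. p h (e i) \<odot>\<^bsub>H\<^esub> d i) = h"
    and expand_K: "\<And>k. k \<in> carrier K \<Longrightarrow> (\<Oplus>\<^bsub>K\<^esub>i\<in>{..<n}. p (d i) k \<odot>\<^bsub>K\<^esub> e i) = k"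
begin

sublocale H: ring H using H by (simp add: assoc_algebra_def)
sublocale K: ring K using K by (simp add: assoc_algebra_def)
sublocale HM: module R H using H by (simp add: assoc_algebra_def)
sublocale KM: module R K using K by (simp add: assoc_algebra_def)

lemmas [simp] = p_closed d_closed e_closed

lemma dual_alg_swap: "dual_alg R K H (\<lambda>k h. p h k) n e d"
  by unfold_locales (simp_all add: H K p_add_left p_add_right p_smult_left p_smult_right expand_H expand_K)

abbreviation "V \<equiv> sym_bimod H"
abbreviation "VV \<equiv> tensor R V V"
abbreviation "RR \<equiv> ring_bimod R id id"

lemma V_sym [simp]: "sym_mod R V" by (rule sym_bimod_sym_mod[OF HM.module_axioms])
lemma VV_sym [simp]: "sym_mod R VV" by (rule tensor_sym_mod[OF V_sym V_sym])
lemma R_sym [simp]: "sym_mod R RR" by (rule base_sym_mod[OF R.is_cring])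

lemma p_lin_left [simp]: "k \<in> carrier K \<Longrightarrow> lin R V RR (\<lambda>h. p h k)"
  by (rule linI) (auto simp: p_add_left p_smult_left)

lemma p_lin_right: "h \<in> carrier H \<Longrightarrow> lin R (sym_bimod K) RR (p h)"
  by (rule linI) (auto simp: p_add_right p_smult_right)

lemma lin_finsum:
  assumes U: "sym_mod R U" and W: "sym_mod R W" and f: "lin R U W f" and g: "g \<in> I \<rightarrow> carrier U"
  shows "f (\<Oplus>\<^bsub>U\<^esub>i\<in>I. g i) = (\<Oplus>\<^bsub>W\<^esub>i\<in>I. f (g i))"
  by (rule additive_finsum[OF sym_modD(2)[OF U] sym_modD(2)[OF W] linD(1)[OF f] g])

lemma finsum_V: "finsum V = finsum H" by (rule finsum_cong_struct) auto
lemma finsum_RR: "finsum RR = finsum R" by (rule finsum_cong_struct) auto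

lemma lin_expand:
  assumes W: "sym_mod R W" and f: "lin R V W f" and h: "h \<in> carrier H"
  shows "f h = (\<Oplus>\<^bsub>W\<^esub>i\<in>{..<n}. lact W (p h (e i)) (f (d i)))"
proof -
  interpret W: abelian_group W using W by (rule sym_modD)
  have "f h = f (\<Oplus>\<^bsub>V\<^esub>i\<in>{..<n}. p h (e i) \<odot>\<^bsub>H\<^esub> d i)"
    using h by (simp add: expand_H finsum_V)
  also have "\<dots> = (\<Oplus>\<^bsub>W\<^esub>i\<in>{..<n}. f (p h (e i) \<odot>\<^bsub>H\<^esub> d i))"
    using h by (intro lin_finsum[OF V_sym W f]) auto
  also have "\<dots> = (\<Oplus>\<^bsub>W\<^esub>i\<in>{..<n}. lact W (p h (e i)) (f (d i)))"
    using h linD(4)[OF f] linD(2)[OF f] by (intro W.finsum_cong') (auto intro: sym_modD(8)[OF W])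
  finally show ?thesis .
qed

lemma form_expand:
  assumes f: "lin R V RR f" and h: "h \<in> carrier H"
  shows "f h = (\<Oplus>i\<in>{..<n}. p h (e i) \<otimes> f (d i))"
  using lin_expand[OF R_sym f h] by (simp add: finsum_RR)

lemma p_expand:
  assumes "h \<in> carrier H" "k \<in> carrier K"
  shows "p h k = (\<Oplus>i\<in>{..<n}. p h (e i) \<otimes> p (d i) k)"
  by (rule form_expand[OF p_lin_left]) (use assms in auto)

lemma H_eqI:
  assumes "h \<in> carrier H" "h' \<in> carrier H" "\<And>k. k \<in> carrier K \<Longrightarrow> p h k = p h' k"
  shows "h = h'"
proof -
  have "(\<Oplus>\<^bsub>H\<^esub>i\<in>{..<n}. p h (e i) \<odot>\<^bsub>H\<^esub> d i) = (\<Oplus>\<^bsub>H\<^esub>i\<in>{..<n}. p h' (e i) \<odot>\<^bsub>H\<^esub> d i)"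
    using assms by (intro H.finsum_cong') auto
  then show ?thesis using assms by (simp add: expand_H)
qed

text \<open>The element of \<open>H\<close> that represents the functional \<open>f\<close> on
  \<open>K\<close>; its coordinates along \<open>d\<close> are the values of \<open>f\<close> on the
  dual basis. Adjoints with respect to the form, such as transposed multiplications and transposed
  antipodes, are built this way.\<close>

definition rep :: "('b \<Rightarrow> 'r) \<Rightarrow> 'a" where
  "rep f = (\<Oplus>\<^bsub>H\<^esub>i\<in>{..<n}. f (e i) \<odot>\<^bsub>H\<^esub> d i)"

lemma rep_closed: "(\<And>k. k \<in> carrier K \<Longrightarrow> f k \<in> carrier R) \<Longrightarrow> rep f \<in> carrier H"
  unfolding rep_def by (rule H.finsum_closed) auto

lemma p_rep:
  assumes f: "lin R (sym_bimod K) RR f" and k: "k \<in> carrier K"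
  shows "p (rep f) k = f k"
proof -
  interpret s: dual_alg R K H "\<lambda>k h. p h k" n e d by (rule dual_alg_swap)
  have cl: "\<And>k. k \<in> carrier K \<Longrightarrow> f k \<in> carrier R" using linD(2)[OF f] by simp
  have "p (rep f) k = (\<Oplus>i\<in>{..<n}. p (f (e i) \<odot>\<^bsub>H\<^esub> d i) k)"
    unfolding rep_def finsum_V[symmetric] finsum_RR[symmetric]
    by (rule lin_finsum[OF V_sym R_sym p_lin_left[OF k]]) (use cl in auto)
  also have "\<dots> = (\<Oplus>i\<in>{..<n}. p (d i) k \<otimes> f (e i))"
    using k cl by (intro finsum_cong') (auto simp: p_smult_left R.m_comm)
  also have "\<dots> = f k" using s.form_expand[OF f k] by simp
  finally show ?thesis .
qed

text \<open>The two actions of \<open>K\<close> on \<open>H\<close> transposed to right and left multiplication.\<close>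

definition hr :: "'a \<Rightarrow> 'b \<Rightarrow> 'a" where "hr h c = rep (\<lambda>k. p h (k \<otimes>\<^bsub>K\<^esub> c))"
definition hl :: "'b \<Rightarrow> 'a \<Rightarrow> 'a" where "hl c h = rep (\<lambda>k. p h (c \<otimes>\<^bsub>K\<^esub> k))"

lemma hr_closed [simp]: "h \<in> carrier H \<Longrightarrow> c \<in> carrier K \<Longrightarrow> hr h c \<in> carrier H"
  unfolding hr_def by (rule rep_closed) auto

lemma hl_closed [simp]: "h \<in> carrier H \<Longrightarrow> c \<in> carrier K \<Longrightarrow> hl c h \<in> carrier H"
  unfolding hl_def by (rule rep_closed) auto

lemma K_smult_mult:
  assumes "r \<in> carrier R" "x \<in> carrier K" "y \<in> carrier K"
  shows "(r \<odot>\<^bsub>K\<^esub> x) \<otimes>\<^bsub>K\<^esub> y = r \<odot>\<^bsub>K\<^esub> (x \<otimes>\<^bsub>K\<^esub> y)" "x \<otimes>\<^bsub>K\<^esub> (r \<odot>\<^bsub>K\<^esub> y) = r \<odot>\<^bsub>K\<^esub> (x \<otimes>\<^bsub>K\<^esub> y)"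
  using K assms by (auto simp: assoc_algebra_def)

lemma p_hr: "h \<in> carrier H \<Longrightarrow> c \<in> carrier K \<Longrightarrow> k \<in> carrier K \<Longrightarrow> p (hr h c) k = p h (k \<otimes>\<^bsub>K\<^esub> c)"
  unfolding hr_def by (rule p_rep)
    (auto intro!: linI simp: K.l_distr p_add_right K_smult_mult p_smult_right)

lemma p_hl: "h \<in> carrier H \<Longrightarrow> c \<in> carrier K \<Longrightarrow> k \<in> carrier K \<Longrightarrow> p (hl c h) k = p h (c \<otimes>\<^bsub>K\<^esub> k)"
  unfolding hl_def by (rule p_rep)
    (auto intro!: linI simp: K.r_distr p_add_right K_smult_mult p_smult_right)

text \<open>Contraction of the first tensor factor with \<open>k\<close>. The second factor is an
  arbitrary module because coassociativity needs the case \<open>W = H \<otimes> H\<close>.\<close>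

definition slice :: "('r, 'r, 'w) bimod \<Rightarrow> 'b \<Rightarrow> ('a, 'w) tens \<Rightarrow> 'w" where
  "slice W k = tensor_lift W (\<lambda>x w. lact W (p x k) w)"

lemma slice_bilin:
  assumes W: "sym_mod R W" and k: "k \<in> carrier K"
  shows "bilin R V W W (\<lambda>x w. lact W (p x k) w)"
  unfolding bilin_def
proof (intro conjI ballI)
  fix x assume x: "x \<in> carrier V"
  then have pk: "p x k \<in> carrier R" using k by simp
  show "lin R W W (lact W (p x k))"
    using sym_modD(3)[OF W pk] sym_modD(5)[OF W] pk
    by (auto simp: lin_def) (metis R.m_comm)
next
  fix w assume w: "w \<in> carrier W"
  show "lin R V W (\<lambda>x. lact W (p x k) w)"
    using k sym_modD(8)[OF W _ w] sym_modD(5)[OF W _ _ w] additive_add[OF sym_modD(4)[OF W w]]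
    by (intro linI) (auto simp: p_add_left p_smult_left)
qed

lemma slice_lin: "sym_mod R W \<Longrightarrow> k \<in> carrier K \<Longrightarrow> lin R (tensor R V W) W (slice W k)"
  unfolding slice_def by (rule tensor_lift_lin[OF V_sym _ _ slice_bilin])

lemma slice_pure: "sym_mod R W \<Longrightarrow> k \<in> carrier K \<Longrightarrow> x \<in> carrier H \<Longrightarrow> w \<in> carrier W \<Longrightarrow>
   slice W k (pure_tensor R V W x w) = lact W (p x k) w"
  unfolding slice_def by (rule bilin_lift(1)[OF V_sym _ _ slice_bilin]) auto

text \<open>On a pure tensor this is the expansion of the first factor along \<open>d\<close>, with
  the scalar coefficients passed over to the second factor.\<close>

lemma slice_expand:
  assumes W: "sym_mod R W" and t: "t \<in> carrier (tensor R V W)"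
  shows "t = (\<Oplus>\<^bsub>tensor R V W\<^esub>i\<in>{..<n}. pure_tensor R V W (d i) (slice W (e i) t))"
proof (rule tensor_lin_eqI[OF V_sym W _ _ _ _ t])
  let ?T = "tensor R V W"
  have T: "sym_mod R ?T" by (rule tensor_sym_mod[OF V_sym W])
  show "abelian_group ?T" by (rule sym_modD[OF T])
  interpret T: abelian_group ?T by fact
  note pb = pure_bilin[OF V_sym W]
  show "lin R ?T ?T (\<lambda>t. t)" by (rule lin_id)
  show "lin R ?T ?T (\<lambda>t. \<Oplus>\<^bsub>?T\<^esub>i\<in>{..<n}. pure_tensor R V W (d i) (slice W (e i) t))"
    by (rule lin_finsum_pw[OF T T], rule lin_compose[OF slice_lin[OF W]])
       (use pb in \<open>auto simp: bilin_def\<close>)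
  fix x w assume x: "x \<in> carrier V" and w: "w \<in> carrier W"
  have "pure_tensor R V W x w = (\<Oplus>\<^bsub>?T\<^esub>i\<in>{..<n}. lact ?T (p x (e i)) (pure_tensor R V W (d i) w))"
    by (rule lin_expand[OF T]) (use pb x w in \<open>auto simp: bilin_def\<close>)
  also have "\<dots> = (\<Oplus>\<^bsub>?T\<^esub>i\<in>{..<n}. pure_tensor R V W (d i) (slice W (e i) (pure_tensor R V W x w)))"
    using x w sym_modD(8)[OF W] pure_closed[OF tensorable_sym[OF V_sym W]]
    by (intro T.finsum_cong') (auto simp: slice_pure[OF W] sym_tensor_lact(2)[OF V_sym W] pure_smult[OF V_sym W, simplified])
  finally show "pure_tensor R V W x w = (\<Oplus>\<^bsub>?T\<^esub>i\<in>{..<n}. pure_tensor R V W (d i) (slice W (e i) (pure_tensor R V W x w)))" .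
qed

lemma slice_eqI:
  assumes W: "sym_mod R W" and s: "s \<in> carrier (tensor R V W)" and t: "t \<in> carrier (tensor R V W)"
    and eq: "\<And>k. k \<in> carrier K \<Longrightarrow> slice W k s = slice W k t"
  shows "s = t"
proof -
  interpret T: abelian_group "tensor R V W" by (rule sym_modD[OF tensor_sym_mod[OF V_sym W]])
  have "(\<Oplus>\<^bsub>tensor R V W\<^esub>i\<in>{..<n}. pure_tensor R V W (d i) (slice W (e i) s)) = 
     (\<Oplus>\<^bsub>tensor R V W\<^esub>i\<in>{..<n}. pure_tensor R V W (d i) (slice W (e i) t))"
    using eq linD(2)[OF slice_lin[OF W] t] 
    by (intro T.finsum_cong') (auto intro!: pure_closed[OF tensorable_sym[OF V_sym W], simplified])
  then show ?thesis using slice_expand[OF W s] slice_expand[OF W t] by simp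
qed

definition P2 :: "'b \<Rightarrow> 'b \<Rightarrow> ('a, 'a) tens \<Rightarrow> 'r" where
  "P2 k k' = tensor_lift R (\<lambda>x y. p x k \<otimes> p y k')"

lemma tensor_lift_RR: "tensor_lift R f = tensor_lift RR f"
  by (rule tensor_lift_struct[symmetric]) auto

lemma tensor_lift_H: "tensor_lift H f = tensor_lift V f"
  by (rule tensor_lift_struct[symmetric]) auto

lemma P2_bilin:
  assumes "k \<in> carrier K" "k' \<in> carrier K"
  shows "bilin R V V RR (\<lambda>x y. p x k \<otimes> p y k')"
  using assms by (auto simp: bilin_def p_add_left p_smult_left R.l_distr R.r_distr R.m_ac intro!: linI)

lemma P2_lin [simp]: "k \<in> carrier K \<Longrightarrow> k' \<in> carrier K \<Longrightarrow> lin R VV RR (P2 k k')"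
  unfolding P2_def tensor_lift_RR by (rule tensor_lift_lin[OF V_sym V_sym R_sym P2_bilin])

lemma P2_pure [simp]: "k \<in> carrier K \<Longrightarrow> k' \<in> carrier K \<Longrightarrow> x \<in> carrier H \<Longrightarrow> y \<in> carrier H \<Longrightarrow>
    P2 k k' (pure2 R H x y) = p x k \<otimes> p y k'"
  unfolding P2_def tensor_lift_RR by (rule bilin_lift(1)[OF V_sym V_sym R_sym P2_bilin]) auto

lemma P2_slice:
  assumes k: "k \<in> carrier K" "k' \<in> carrier K" and t: "t \<in> carrier VV"
  shows "P2 k k' t = p (slice V k t) k'"
proof (rule tensor_lin_eqI[OF V_sym V_sym sym_modD(2)[OF R_sym] P2_lin[OF k] _ _ t])
  show "lin R VV RR (\<lambda>t. p (slice V k t) k')"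
    by (rule lin_compose[OF slice_lin[OF V_sym k(1)] p_lin_left[OF k(2)]])
qed (use k in \<open>simp_all add: slice_pure p_smult_left\<close>)

text \<open>Slicing at \<open>k\<close> leaves an element of \<open>H\<close>, which the form
  separates. This is the substitute for Sweedler calculations: two coproducts are compared through
  their values under \<open>P2\<close>.\<close>

lemma tensor2_eqI:
  assumes s: "s \<in> carrier VV" and t: "t \<in> carrier VV"
    and eq: "\<And>k k'. k \<in> carrier K \<Longrightarrow> k' \<in> carrier K \<Longrightarrow> P2 k k' s = P2 k k' t"
  shows "s = t"
proof (rule slice_eqI[OF V_sym s t])
  fix k assume k: "k \<in> carrier K"
  have "slice V k u \<in> carrier H" if "u \<in> carrier VV" for u
    using linD(2)[OF slice_lin[OF V_sym k] that] by simp
  then show "slice V k s = slice V k t"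
    using s t eq k by (intro H_eqI) (auto simp: P2_slice[symmetric])
qed

lemma pure2_closed [simp]: "x \<in> carrier H \<Longrightarrow> y \<in> carrier H \<Longrightarrow> pure2 R H x y \<in> carrier (tensor_grp R V V)"
  using pure_closed[OF tensorable_sym[OF V_sym V_sym], of x y] by simp

definition rslice :: "'b \<Rightarrow> ('a, 'a) tens \<Rightarrow> 'a" where
  "rslice k = tensor_lift V (\<lambda>x y. p y k \<odot>\<^bsub>H\<^esub> x)"

lemma rslice_bilin:
  assumes k: "k \<in> carrier K"
  shows "bilin R V V V (\<lambda>x y. p y k \<odot>\<^bsub>H\<^esub> x)"
  using assms by (auto simp: bilin_def p_add_left p_smult_left HM.smult_l_distr HM.smult_r_distr
      HM.smult_assoc1[symmetric] R.m_comm intro!: linI)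

lemma rslice_lin: "k \<in> carrier K \<Longrightarrow> lin R VV V (rslice k)"
  unfolding rslice_def by (rule tensor_lift_lin[OF V_sym _ _ rslice_bilin]) auto

lemma rslice_pure: "k \<in> carrier K \<Longrightarrow> x \<in> carrier H \<Longrightarrow> y \<in> carrier H \<Longrightarrow>
   rslice k (pure2 R H x y) = p y k \<odot>\<^bsub>H\<^esub> x"
  unfolding rslice_def by (rule bilin_lift(1)[OF V_sym _ _ rslice_bilin]) auto

lemma P2_rslice:
  assumes k: "k \<in> carrier K" "k' \<in> carrier K" and t: "t \<in> carrier VV"
  shows "P2 k k' t = p (rslice k' t) k"
proof (rule tensor_lin_eqI[OF V_sym V_sym sym_modD(2)[OF R_sym] P2_lin[OF k] _ _ t])
  show "lin R VV RR (\<lambda>t. p (rslice k' t) k)"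
    by (rule lin_compose[OF rslice_lin[OF k(2)] p_lin_left[OF k(1)]])
qed (use k in \<open>simp_all add: rslice_pure p_smult_left R.m_comm\<close>)

lemma rslice_closed [simp]: "k \<in> carrier K \<Longrightarrow> t \<in> carrier (tensor_grp R V V) \<Longrightarrow> rslice k t \<in> carrier H"
  using linD(2)[OF rslice_lin, of k t] by simp

lemma slice_closed [simp]: "k \<in> carrier K \<Longrightarrow> t \<in> carrier (tensor_grp R V V) \<Longrightarrow> slice V k t \<in> carrier H"
  using linD(2)[OF slice_lin[OF V_sym], of k t] by simp

text \<open>The expansion of the second factor along \<open>d\<close>. For a coproduct its
  coefficients are \<open>hr h (e i)\<close>, so products of coproducts become explicit double
  sums.\<close>

lemma rslice_expand:
  assumes t: "t \<in> carrier VV"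
  shows "t = (\<Oplus>\<^bsub>VV\<^esub>i\<in>{..<n}. pure2 R H (rslice (e i) t) (d i))"
proof (rule tensor2_eqI[OF t])
  interpret T: abelian_group VV by (rule sym_modD[OF VV_sym])
  have cl: "(\<lambda>i. pure2 R H (rslice (e i) t) (d i)) \<in> {..<n} \<rightarrow> carrier VV" using t by auto
  show "(\<Oplus>\<^bsub>VV\<^esub>i\<in>{..<n}. pure2 R H (rslice (e i) t) (d i)) \<in> carrier VV"
    by (rule T.finsum_closed[OF cl])
  fix k k' assume k: "k \<in> carrier K" "k' \<in> carrier K"
  have "P2 k k' (\<Oplus>\<^bsub>VV\<^esub>i\<in>{..<n}. pure2 R H (rslice (e i) t) (d i)) = 
     (\<Oplus>i\<in>{..<n}. P2 k k' (pure2 R H (rslice (e i) t) (d i)))"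
    unfolding finsum_RR[symmetric] by (rule lin_finsum[OF VV_sym R_sym P2_lin[OF k] cl])
  \<comment> \<open>\<open>P2 k (e i) t\<close> is read once with the right slice and once with the
    left one; the sum is then the expansion of \<open>p (slice V k t) k'\<close> in the dual
    bases.\<close>
  also have "\<dots> = (\<Oplus>i\<in>{..<n}. p (slice V k t) (e i) \<otimes> p (d i) k')"
    using k t P2_rslice[OF k(1) _ t] P2_slice[OF k(1) _ t] by (intro finsum_cong') auto
  also have "\<dots> = p (slice V k t) k'" using p_expand[of "slice V k t" k'] k t by simp
  finally show "P2 k k' t = P2 k k' (\<Oplus>\<^bsub>VV\<^esub>i\<in>{..<n}. pure2 R H (rslice (e i) t) (d i))" 
    using P2_slice[OF k t] by simp
qed

end

lemma lift_struct_sym_bimod: "tensor_lift (sym_bimod H) f = tensor_lift H f"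
  by (rule tensor_lift_struct) auto

text \<open>The canonical map from \<open>(U \<otimes> Y) \<otimes> W\<close> to \<open>U \<otimes> (Y \<otimes> W)\<close>.\<close>

definition assoc_map :: "'r ring \<Rightarrow> ('r, 'r, 'x) bimod \<Rightarrow> (('x, 'x) tens, 'x) tens \<Rightarrow> ('x, ('x, 'x) tens) tens" where
  "assoc_map R V = tensor_lift (tensor R V (tensor R V V)) (\<lambda>s z. tensor_lift (tensor R V (tensor R V V))
       (\<lambda>x y. pure_tensor R V (tensor R V V) x (pure_tensor R V V y z)) s)"

context
  fixes R :: "'r ring" and V :: "('r, 'r, 'x) bimod"
  assumes V: "sym_mod R V"
begin

lemma VV: "sym_mod R (tensor R V V)" by (rule tensor_sym_mod[OF V V])
lemma V_VV: "sym_mod R (tensor R V (tensor R V V))" by (rule tensor_sym_mod[OF V VV])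

lemma assoc_inner_bilin:
  assumes z: "z \<in> carrier V"
  shows "bilin R V V (tensor R V (tensor R V V)) (\<lambda>x y. pure_tensor R V (tensor R V V) x (pure_tensor R V V y z))"
  by (rule bilin_compose[OF pure_bilin[OF V VV] lin_id, where h = "\<lambda>y. pure_tensor R V V y z"])
     (use pure_bilin[OF V V] z in \<open>auto simp: bilin_def\<close>)

lemma assoc_bilin:
  "bilin R (tensor R V V) V (tensor R V (tensor R V V)) (\<lambda>s z. tensor_lift (tensor R V (tensor R V V))
       (\<lambda>x y. pure_tensor R V (tensor R V V) x (pure_tensor R V V y z)) s)"
  unfolding bilin_def
proof (intro conjI ballI)
  fix s assume s: "s \<in> carrier (tensor R V V)"
  show "lin R V (tensor R V (tensor R V V)) (\<lambda>z. tensor_lift (tensor R V (tensor R V V))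
       (\<lambda>x y. pure_tensor R V (tensor R V V) x (pure_tensor R V V y z)) s)"
  proof (rule linear_lift_param[OF V V V_VV assoc_inner_bilin _ V s])
    fix x y assume x: "x \<in> carrier V" and y: "y \<in> carrier V"
    show "lin R V (tensor R V (tensor R V V)) (\<lambda>z. pure_tensor R V (tensor R V V) x (pure_tensor R V V y z))"
      by (rule lin_compose[where W = "tensor R V V"]) 
         (use pure_bilin[OF V V] pure_bilin[OF V VV] x y in \<open>auto simp: bilin_def\<close>)
  qed
next
  fix z assume "z \<in> carrier V"
  then show "lin R (tensor R V V) (tensor R V (tensor R V V)) (tensor_lift (tensor R V (tensor R V V))
       (\<lambda>x y. pure_tensor R V (tensor R V V) x (pure_tensor R V V y z)))"
    by (intro tensor_lift_lin[OF V V V_VV assoc_inner_bilin])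
qed

lemma assoc_lin: "lin R (tensor R (tensor R V V) V) (tensor R V (tensor R V V)) (assoc_map R V)"
  unfolding assoc_map_def by (rule tensor_lift_lin[OF VV V V_VV assoc_bilin])

lemma assoc_pure_right: 
  assumes "s \<in> carrier (tensor R V V)" "z \<in> carrier V"
  shows "assoc_map R V (pure_tensor R (tensor R V V) V s z) = tensor_lift (tensor R V (tensor R V V))
       (\<lambda>x y. pure_tensor R V (tensor R V V) x (pure_tensor R V V y z)) s"
  unfolding assoc_map_def using assms by (intro bilin_lift(1)[OF VV V V_VV assoc_bilin])

lemma assoc_pure:
  assumes "x \<in> carrier V" "y \<in> carrier V" "z \<in> carrier V"
  shows "assoc_map R V (pure_tensor R (tensor R V V) V (pure_tensor R V V x y) z) =
     pure_tensor R V (tensor R V V) x (pure_tensor R V V y z)"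
  using assms pure_closed[OF tensorable_sym[OF V V]]
  by (simp add: assoc_pure_right bilin_lift(1)[OF V V V_VV assoc_inner_bilin])

lemma map_left_lin:
  assumes U: "sym_mod R U" and f: "lin R V U f"
  shows "lin R (tensor R V V) (tensor R U V) (tensor_lift (tensor R U V) (\<lambda>x y. pure_tensor R U V (f x) y))"
    and "x \<in> carrier V \<Longrightarrow> y \<in> carrier V \<Longrightarrow> 
      tensor_lift (tensor R U V) (\<lambda>x y. pure_tensor R U V (f x) y) (pure_tensor R V V x y) = pure_tensor R U V (f x) y"
proof -
  have b: "bilin R V V (tensor R U V) (\<lambda>x y. pure_tensor R U V (f x) y)"
    by (rule bilin_compose[OF pure_bilin[OF U V] f lin_id])
  show "lin R (tensor R V V) (tensor R U V) (tensor_lift (tensor R U V) (\<lambda>x y. pure_tensor R U V (f x) y))"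
    by (rule tensor_lift_lin[OF V V tensor_sym_mod[OF U V] b])
  show "x \<in> carrier V \<Longrightarrow> y \<in> carrier V \<Longrightarrow> 
      tensor_lift (tensor R U V) (\<lambda>x y. pure_tensor R U V (f x) y) (pure_tensor R V V x y) = pure_tensor R U V (f x) y"
    by (rule bilin_lift(1)[OF V V tensor_sym_mod[OF U V] b])
qed

lemma map_right_lin:
  assumes U: "sym_mod R U" and f: "lin R V U f"
  shows "lin R (tensor R V V) (tensor R V U) (tensor_lift (tensor R V U) (\<lambda>x y. pure_tensor R V U x (f y)))"
    and "x \<in> carrier V \<Longrightarrow> y \<in> carrier V \<Longrightarrow> 
      tensor_lift (tensor R V U) (\<lambda>x y. pure_tensor R V U x (f y)) (pure_tensor R V V x y) = pure_tensor R V U x (f y)"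
proof -
  have b: "bilin R V V (tensor R V U) (\<lambda>x y. pure_tensor R V U x (f y))"
    by (rule bilin_compose[OF pure_bilin[OF V U] lin_id f])
  show "lin R (tensor R V V) (tensor R V U) (tensor_lift (tensor R V U) (\<lambda>x y. pure_tensor R V U x (f y)))"
    by (rule tensor_lift_lin[OF V V tensor_sym_mod[OF V U] b])
  show "x \<in> carrier V \<Longrightarrow> y \<in> carrier V \<Longrightarrow> 
      tensor_lift (tensor R V U) (\<lambda>x y. pure_tensor R V U x (f y)) (pure_tensor R V V x y) = pure_tensor R V U x (f y)"
    by (rule bilin_lift(1)[OF V V tensor_sym_mod[OF V U] b])
qed

end

section \<open>Coalgebras and antipodes\<close>

lemma coalgebra_eq:
  "coalgebra R H \<longleftrightarrow>
     comult H \<in> linear_maps R (sym_bimod H) (tensor2 R H) \<and>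
     counit H \<in> linear_maps R (sym_bimod H) (ring_bimod R id id) \<and>
     (\<forall>h\<in>carrier H.
        assoc_map R (sym_bimod H) (tensor_lift (tensor R (tensor2 R H) (sym_bimod H))
            (\<lambda>x y. pure_tensor R (tensor2 R H) (sym_bimod H) (comult H x) y) (comult H h)) =
        tensor_lift (tensor R (sym_bimod H) (tensor2 R H))
            (\<lambda>x y. pure_tensor R (sym_bimod H) (tensor2 R H) x (comult H y)) (comult H h)) \<and>
     (\<forall>h\<in>carrier H.
        tensor_lift H (\<lambda>x y. counit H x \<odot>\<^bsub>H\<^esub> y) (comult H h) = h \<and>
        tensor_lift H (\<lambda>x y. counit H y \<odot>\<^bsub>H\<^esub> x) (comult H h) = h)"
  by (simp add: coalgebra_def Let_def assoc_map_def)

text \<open>Both maps are convolution inverses of the identity: \<open>S(x) y S'(z)\<close>, summed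
  over the twofold coproduct, collapses to \<open>S\<close> from one side and to \<open>S'\<close>
  from the other. Needed because Hopf homomorphisms and Hopf duals have to respect every
  antipode.\<close>

lemma antipode_unique:
  assumes A: "assoc_algebra R H" and C: "coalgebra R H" and S: "antipode R H S" and S': "antipode R H S'"
    and h: "h \<in> carrier H"
  shows "S h = S' h"
proof -
  interpret H: ring H using A by (simp add: assoc_algebra_def)
  interpret HM: module R H using A by (simp add: assoc_algebra_def)
  let ?V = "sym_bimod H" let ?VV = "tensor2 R H"
  note V = sym_bimod_sym_mod[OF HM.module_axioms]
  note VV = VV[OF V] and V_VV = V_VV[OF V]
  have RR: "sym_mod R (ring_bimod R id id)" by (rule base_sym_mod[OF HM.R.is_cring])
  have D: "lin R ?V ?VV (comult H)" using C unfolding coalgebra_eq linear_maps_iff[OF V VV] by blast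
  have ep: "lin R ?V (ring_bimod R id id) (counit H)" using C unfolding coalgebra_eq linear_maps_iff[OF V RR] by blast
  have Sl: "lin R ?V ?V S" "lin R ?V ?V S'" using S S' unfolding antipode_def linear_maps_iff[OF V V] by auto
  note mb = mult_bilin[OF A]
  have b1: "bilin R ?V ?V ?V (\<lambda>y z. y \<otimes>\<^bsub>H\<^esub> S' z)" by (rule bilin_compose[OF mb lin_id Sl(2)])
  have b2: "bilin R ?V ?V ?V (\<lambda>y z. S y \<otimes>\<^bsub>H\<^esub> z)" by (rule bilin_compose[OF mb Sl(1) lin_id])
  define L1 where "L1 = tensor_lift ?V (\<lambda>y z. y \<otimes>\<^bsub>H\<^esub> S' z)"
  define L2 where "L2 = tensor_lift ?V (\<lambda>y z. S y \<otimes>\<^bsub>H\<^esub> z)"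
  note L1 = tensor_lift_lin[OF V V V b1, folded L1_def] bilin_lift(1)[OF V V V b1, folded L1_def]
  note L2 = tensor_lift_lin[OF V V V b2, folded L2_def] bilin_lift(1)[OF V V V b2, folded L2_def]
  have b3: "bilin R ?V ?VV ?V (\<lambda>x w. S x \<otimes>\<^bsub>H\<^esub> L1 w)" by (rule bilin_compose[OF mb Sl(1) L1(1)])
  \<comment> \<open>\<open>L3\<close> is the map
    \<open>x \<otimes> (y \<otimes> z) \<mapsto> S(x) y S'(z)\<close>; it will be applied to both
    sides of coassociativity.\<close>
  define L3 where "L3 = tensor_lift ?V (\<lambda>x w. S x \<otimes>\<^bsub>H\<^esub> L1 w)"
  note L3 = tensor_lift_lin[OF V VV V b3, folded L3_def] bilin_lift(1)[OF V VV V b3, folded L3_def]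
  have L1D: "L1 (comult H h) = counit H h \<odot>\<^bsub>H\<^esub> \<one>\<^bsub>H\<^esub>" if "h \<in> carrier H" for h
    using S' that unfolding antipode_def L1_def lift_struct_sym_bimod by blast
  have L2D: "L2 (comult H h) = counit H h \<odot>\<^bsub>H\<^esub> \<one>\<^bsub>H\<^esub>" if "h \<in> carrier H" for h
    using S that unfolding antipode_def L2_def lift_struct_sym_bimod by blast
  note Dcl = linD(2)[OF D, simplified] and epcl = linD(2)[OF ep, simplified]
  note Scl = linD(2)[OF Sl(1), simplified] linD(2)[OF Sl(2), simplified]
  have sm: "(r \<odot>\<^bsub>H\<^esub> x) \<otimes>\<^bsub>H\<^esub> y = r \<odot>\<^bsub>H\<^esub> (x \<otimes>\<^bsub>H\<^esub> y)" "x \<otimes>\<^bsub>H\<^esub> (r \<odot>\<^bsub>H\<^esub> y) = r \<odot>\<^bsub>H\<^esub> (x \<otimes>\<^bsub>H\<^esub> y)"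
    if "r \<in> carrier R" "x \<in> carrier H" "y \<in> carrier H" for r x y
    using A that by (auto simp: assoc_algebra_def)
  note ml = map_left_lin[OF V VV D] and mr = map_right_lin[OF V VV D]
  have cb: "bilin R ?V ?V ?V (\<lambda>x y. counit H y \<odot>\<^bsub>H\<^esub> x)" "bilin R ?V ?V ?V (\<lambda>x y. counit H x \<odot>\<^bsub>H\<^esub> y)"
    using linD[OF ep] by (auto simp: bilin_def HM.smult_l_distr HM.smult_r_distr HM.smult_assoc1[symmetric] HM.R.m_comm intro!: linI)
  note c1 = tensor_lift_lin[OF V V V cb(1)] bilin_lift(1)[OF V V V cb(1)]
  note c2 = tensor_lift_lin[OF V V V cb(2)] bilin_lift(1)[OF V V V cb(2)]
  \<comment> \<open>In this bracketing \<open>y S'(z)\<close> collapses to a counit, and only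
    \<open>S\<close> remains.\<close>
  have 1: "L3 (tensor_lift (tensor R ?V ?VV) (\<lambda>x y. pure_tensor R ?V ?VV x (comult H y)) t) = 
      S (tensor_lift ?V (\<lambda>x y. counit H y \<odot>\<^bsub>H\<^esub> x) t)" if t: "t \<in> carrier ?VV" for t
    by (rule tensor_lin_eqI[OF V V sym_modD(2)[OF V] lin_compose[OF mr(1) L3(1)] lin_compose[OF c1(1) Sl(1)] _ t])
       (simp add: mr(2) L3(2) c1(2) Dcl L1D sm epcl Scl linD(4)[OF Sl(1), simplified])
  have 2: "L3 (assoc_map R ?V (pure_tensor R ?VV ?V s z)) = L2 s \<otimes>\<^bsub>H\<^esub> S' z" 
    if s: "s \<in> carrier ?VV" and z: "z \<in> carrier ?V" for s z
  proof (rule tensor_lin_eqI[OF V V sym_modD(2)[OF V] _ _ _ s])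
    show "lin R ?VV ?V (\<lambda>s. L3 (assoc_map R ?V (pure_tensor R ?VV ?V s z)))"
      by (rule lin_compose[OF lin_compose[OF _ assoc_lin[OF V]] L3(1)]) 
         (use pure_bilin[OF VV V] z in \<open>auto simp: bilin_def\<close>)
    show "lin R ?VV ?V (\<lambda>s. L2 s \<otimes>\<^bsub>H\<^esub> S' z)"
      by (rule lin_compose[OF L2(1)]) (use mb Scl z in \<open>auto simp: bilin_def\<close>)
  next
    fix x y assume "x \<in> carrier ?V" "y \<in> carrier ?V"
    then show "L3 (assoc_map R ?V (pure_tensor R ?VV ?V (pure2 R H x y) z)) = L2 (pure2 R H x y) \<otimes>\<^bsub>H\<^esub> S' z"
      using z pure_closed[OF tensorable_sym[OF V V]]
      by (simp add: assoc_pure[OF V] L3(2) L2(2) L1(2) Scl H.m_assoc)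
  qed
  \<comment> \<open>In the other bracketing \<open>S(x) y\<close> collapses, and only
    \<open>S'\<close> remains.\<close>
  have 3: "L3 (assoc_map R ?V (tensor_lift (tensor R ?VV ?V) (\<lambda>x y. pure_tensor R ?VV ?V (comult H x) y) t)) = 
      S' (tensor_lift ?V (\<lambda>x y. counit H x \<odot>\<^bsub>H\<^esub> y) t)" if t: "t \<in> carrier ?VV" for t
    by (rule tensor_lin_eqI[OF V V sym_modD(2)[OF V] lin_compose[OF lin_compose[OF ml(1) assoc_lin[OF V]] L3(1)] lin_compose[OF c2(1) Sl(2)] _ t])
       (simp add: ml(2) 2 c2(2) Dcl L2D sm epcl Scl linD(4)[OF Sl(2), simplified])
  have "S (tensor_lift ?V (\<lambda>x y. counit H y \<odot>\<^bsub>H\<^esub> x) (comult H h)) = S' (tensor_lift ?V (\<lambda>x y. counit H x \<odot>\<^bsub>H\<^esub> y) (comult H h))"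
    using C h Dcl unfolding coalgebra_eq by (simp flip: 1 3)
  then show ?thesis using C h unfolding coalgebra_eq lift_struct_sym_bimod by simp
qed

text \<open>The coproduct is pinned down by its values under \<open>P2\<close> and not by a formula.
  This covers both kinds that occur: the explicit coproducts built from the quasibasis and those
  given by a description.\<close>

locale dual_coalg = dual_alg +
  assumes comult_closed: "\<And>h. h \<in> carrier H \<Longrightarrow> comult H h \<in> carrier (tensor2 R H)"
    and P2_comult: "\<And>h k k'. h \<in> carrier H \<Longrightarrow> k \<in> carrier K \<Longrightarrow> k' \<in> carrier K \<Longrightarrow>
      P2 k k' (comult H h) = p h (k \<otimes>\<^bsub>K\<^esub> k')"
    and counit: "\<And>h. h \<in> carrier H \<Longrightarrow> counit H h = p h \<one>\<^bsub>K\<^esub>"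
begin

lemma comult_cl [simp]: "h \<in> carrier H \<Longrightarrow> comult H h \<in> carrier (tensor_grp R V V)"
  using comult_closed by simp

lemma comult_lin: "lin R V VV (comult H)"
proof (rule linI)
  interpret T: abelian_group VV by (rule sym_modD[OF VV_sym])
  show "comult H (x \<oplus>\<^bsub>V\<^esub> y) = comult H x \<oplus>\<^bsub>VV\<^esub> comult H y" if "x \<in> carrier V" "y \<in> carrier V" for x y
    by (rule tensor2_eqI) (use that T.a_closed linD(3)[OF P2_lin] in \<open>auto simp: P2_comult p_add_left\<close>)
  show "comult H (lact V r x) = lact VV r (comult H x)" if "x \<in> carrier V" "r \<in> carrier R" for x r
    by (rule tensor2_eqI) (use that linD(4)[OF P2_lin] sym_modD(8)[OF VV_sym] in \<open>auto simp: P2_comult p_smult_left\<close>)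
qed auto

lemma counit_lin: "lin R V RR (counit H)"
  by (rule linI) (auto simp: counit p_add_left p_smult_left)

lemma slice_comult: "h \<in> carrier H \<Longrightarrow> k \<in> carrier K \<Longrightarrow> slice V k (comult H h) = hl k h"
  by (rule H_eqI) (auto simp: P2_slice[symmetric] P2_comult p_hl)

lemma rslice_comult: "h \<in> carrier H \<Longrightarrow> k \<in> carrier K \<Longrightarrow> rslice k (comult H h) = hr h k"
  by (rule H_eqI) (auto simp: P2_rslice[symmetric] P2_comult p_hr)

text \<open>Paired with three elements of \<open>K\<close>, both sides become \<open>p h\<close> of
  their product, so coassociativity of \<open>H\<close> is associativity of \<open>K\<close>. The
  first pairing is a slice with values in \<open>H \<otimes> H\<close>, the other two are done by
  \<open>P2\<close>.\<close>

lemma coassoc: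
  assumes h: "h \<in> carrier H"
  shows "assoc_map R V (tensor_lift (tensor R VV V) (\<lambda>x y. pure_tensor R VV V (comult H x) y) (comult H h)) =
        tensor_lift (tensor R V VV) (\<lambda>x y. pure_tensor R V VV x (comult H y)) (comult H h)" (is "?l = ?r")
proof (rule slice_eqI[OF VV_sym])
  note ml = map_left_lin[OF V_sym VV_sym comult_lin] and mr = map_right_lin[OF V_sym VV_sym comult_lin]
  have D: "comult H h \<in> carrier VV" using h by simp
  show "?l \<in> carrier (tensor R V VV)" "?r \<in> carrier (tensor R V VV)" 
    using D linD(2)[OF lin_compose[OF ml(1) assoc_lin[OF V_sym]]] linD(2)[OF mr(1)] by blast+
  fix k assume k: "k \<in> carrier K"
  note sl = slice_lin[OF VV_sym k]
  \<comment> \<open>Slicing the first factor commutes with applying the coproduct to the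
    second.\<close>
  have 1: "slice VV k (tensor_lift (tensor R V VV) (\<lambda>x y. pure_tensor R V VV x (comult H y)) t) = comult H (slice V k t)"
    if t: "t \<in> carrier VV" for t
    by (rule tensor_lin_eqI[OF V_sym V_sym sym_modD(2)[OF VV_sym] lin_compose[OF mr(1) sl] lin_compose[OF slice_lin[OF V_sym k] comult_lin] _ t])
       (use k in \<open>simp add: mr(2) slice_pure linD(4)[OF comult_lin, simplified]\<close>)
  have 2: "slice VV k (assoc_map R V (pure_tensor R VV V s z)) = pure2 R H (slice V k s) z" 
    if s: "s \<in> carrier VV" and z: "z \<in> carrier V" for s z
  proof (rule tensor_lin_eqI[OF V_sym V_sym sym_modD(2)[OF VV_sym] _ _ _ s])
    show "lin R VV VV (\<lambda>s. slice VV k (assoc_map R V (pure_tensor R VV V s z)))"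
      by (rule lin_compose[OF lin_compose[OF _ assoc_lin[OF V_sym]] sl]) 
         (use pure_bilin[OF VV_sym V_sym] z in \<open>auto simp: bilin_def\<close>)
    show "lin R VV VV (\<lambda>s. pure2 R H (slice V k s) z)"
      by (rule lin_compose[OF slice_lin[OF V_sym k]]) (use pure_bilin[OF V_sym V_sym] z in \<open>auto simp: bilin_def\<close>)
  next
    fix x y assume "x \<in> carrier V" "y \<in> carrier V"
    then show "slice VV k (assoc_map R V (pure_tensor R VV V (pure2 R H x y) z)) = pure2 R H (slice V k (pure2 R H x y)) z"
      using z k by (simp add: assoc_pure[OF V_sym] slice_pure sym_tensor_lact(2)[OF V_sym V_sym])
  qed
  show "slice VV k ?l = slice VV k ?r"
  proof (rule tensor2_eqI)
    show "slice VV k ?l \<in> carrier VV" "slice VV k ?r \<in> carrier VV"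
      using D linD(2)[OF lin_compose[OF lin_compose[OF ml(1) assoc_lin[OF V_sym]] sl]] linD(2)[OF lin_compose[OF mr(1) sl]] by blast+
    fix k' k'' assume k': "k' \<in> carrier K" "k'' \<in> carrier K"
    \<comment> \<open>On the other side the coproduct sits in the first factor, and pairing it with
      \<open>k\<close> and \<open>k'\<close> amounts to pairing that factor with their
      product.\<close>
    have 3: "P2 k' k'' (slice VV k (assoc_map R V (tensor_lift (tensor R VV V) (\<lambda>x y. pure_tensor R VV V (comult H x) y) t)))
       = P2 (k \<otimes>\<^bsub>K\<^esub> k') k'' t" if t: "t \<in> carrier VV" for t
    proof (rule tensor_lin_eqI[OF V_sym V_sym sym_modD(2)[OF R_sym] 
          lin_compose[OF lin_compose[OF lin_compose[OF ml(1) assoc_lin[OF V_sym]] sl] P2_lin[OF k']] _ _ t])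
      show "lin R VV RR (P2 (k \<otimes>\<^bsub>K\<^esub> k') k'')" using k k' by simp
    qed (use k k' in \<open>simp add: ml(2) 2 slice_comult p_hl\<close>)
    show "P2 k' k'' (slice VV k ?l) = P2 k' k'' (slice VV k ?r)"
      using h k k' by (simp add: 3 1 slice_comult P2_comult p_hl K.m_assoc)
  qed
qed

text \<open>Contracting with the counit is slicing at the unit of \<open>K\<close>, so the two laws
  are the unit laws of \<open>K\<close>.\<close>

lemma counit_laws:
  assumes h: "h \<in> carrier H"
  shows "tensor_lift H (\<lambda>x y. counit H x \<odot>\<^bsub>H\<^esub> y) (comult H h) = h"
    and "tensor_lift H (\<lambda>x y. counit H y \<odot>\<^bsub>H\<^esub> x) (comult H h) = h"
proof -
  have D: "comult H h \<in> carrier VV" using h by simp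
  have "tensor_lift V (\<lambda>x y. lact V (p x \<one>\<^bsub>K\<^esub>) y) (comult H h) = tensor_lift V (\<lambda>x y. counit H x \<odot>\<^bsub>H\<^esub> y) (comult H h)"
    by (rule lift_cong[OF tensorable_sym[OF V_sym V_sym] sym_modD(2)[OF V_sym] bilin_balanced[OF V_sym V_sym slice_bilin] _ D])
       (auto simp: counit)
  then have "tensor_lift H (\<lambda>x y. counit H x \<odot>\<^bsub>H\<^esub> y) (comult H h) = slice V \<one>\<^bsub>K\<^esub> (comult H h)"
    by (simp add: slice_def tensor_lift_H)
  also have "\<dots> = h" by (rule H_eqI) (use h in \<open>auto simp: slice_comult p_hl\<close>)
  finally show "tensor_lift H (\<lambda>x y. counit H x \<odot>\<^bsub>H\<^esub> y) (comult H h) = h" .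
  have "tensor_lift V (\<lambda>x y. p y \<one>\<^bsub>K\<^esub> \<odot>\<^bsub>H\<^esub> x) (comult H h) = tensor_lift V (\<lambda>x y. counit H y \<odot>\<^bsub>H\<^esub> x) (comult H h)"
    by (rule lift_cong[OF tensorable_sym[OF V_sym V_sym] sym_modD(2)[OF V_sym] bilin_balanced[OF V_sym V_sym rslice_bilin] _ D])
       (auto simp: counit)
  then have "tensor_lift H (\<lambda>x y. counit H y \<odot>\<^bsub>H\<^esub> x) (comult H h) = rslice \<one>\<^bsub>K\<^esub> (comult H h)"
    by (simp add: rslice_def tensor_lift_H)
  also have "\<dots> = h" by (rule H_eqI) (use h in \<open>auto simp: rslice_comult p_hr\<close>)
  finally show "tensor_lift H (\<lambda>x y. counit H y \<odot>\<^bsub>H\<^esub> x) (comult H h) = h" .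
qed

lemma coalgebra: "coalgebra R H"
  unfolding coalgebra_eq linear_maps_iff[OF V_sym VV_sym] linear_maps_iff[OF V_sym R_sym]
  using comult_lin counit_lin coassoc counit_laws by blast

end

lemma (in abelian_group) finsum2_cong:
  assumes "\<And>i j. i < n \<Longrightarrow> j < m \<Longrightarrow> f i j = g i j"
    and "\<And>i j. i < n \<Longrightarrow> j < m \<Longrightarrow> g i j \<in> carrier G"
  shows "(\<Oplus>i\<in>{..<n::nat}. \<Oplus>j\<in>{..<m::nat}. f i j) = (\<Oplus>i\<in>{..<n}. \<Oplus>j\<in>{..<m}. g i j)"
proof (rule finsum_cong'[OF refl])
  show "(\<lambda>i. \<Oplus>j\<in>{..<m}. g i j) \<in> {..<n} \<rightarrow> carrier G"
    by (rule Pi_I, rule finsum_closed) (simp add: assms(2))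
  show "(\<Oplus>j\<in>{..<m}. f i j) = (\<Oplus>j\<in>{..<m}. g i j)" if "i \<in> {..<n}" for i
    by (rule finsum_cong'[OF refl]) (use that in \<open>simp_all add: assms\<close>)
qed

text \<open>The Hopf algebra axioms for \<open>H\<close>, with the coproduct transposed from the multiplication of
  \<open>K\<close>, as identities between values of the form. In this shape they are symmetric in \<open>H\<close> and \<open>K\<close>.\<close>

locale dual_hopf = dual_alg +
  fixes S :: "'b \<Rightarrow> 'b"
  assumes S_lin: "lin R V V S"
    and compat: "\<And>h h' k k'. h \<in> carrier H \<Longrightarrow> h' \<in> carrier H \<Longrightarrow> k \<in> carrier K \<Longrightarrow> k' \<in> carrier K \<Longrightarrow>
      p (h \<otimes>\<^bsub>H\<^esub> h') (k \<otimes>\<^bsub>K\<^esub> k') =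
        (\<Oplus>i\<in>{..<n}. \<Oplus>j\<in>{..<n}. p (hr h (e i) \<otimes>\<^bsub>H\<^esub> hr h' (e j)) k \<otimes> p (d i \<otimes>\<^bsub>H\<^esub> d j) k')"
    and left_antipode: "\<And>h k. h \<in> carrier H \<Longrightarrow> k \<in> carrier K \<Longrightarrow>
      (\<Oplus>j\<in>{..<n}. p (S (hr h (e j)) \<otimes>\<^bsub>H\<^esub> d j) k) = p h \<one>\<^bsub>K\<^esub> \<otimes> p \<one>\<^bsub>H\<^esub> k"
    and right_antipode: "\<And>h k. h \<in> carrier H \<Longrightarrow> k \<in> carrier K \<Longrightarrow>
      (\<Oplus>j\<in>{..<n}. p (d j \<otimes>\<^bsub>H\<^esub> S (hl (e j) h)) k) = p h \<one>\<^bsub>K\<^esub> \<otimes> p \<one>\<^bsub>H\<^esub> k"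
    and unit_left: "\<And>k k'. k \<in> carrier K \<Longrightarrow> k' \<in> carrier K \<Longrightarrow>
      p \<one>\<^bsub>H\<^esub> (k \<otimes>\<^bsub>K\<^esub> k') = p \<one>\<^bsub>H\<^esub> k \<otimes> p \<one>\<^bsub>H\<^esub> k'"
    and unit_right: "\<And>h h'. h \<in> carrier H \<Longrightarrow> h' \<in> carrier H \<Longrightarrow>
      p (h \<otimes>\<^bsub>H\<^esub> h') \<one>\<^bsub>K\<^esub> = p h \<one>\<^bsub>K\<^esub> \<otimes> p h' \<one>\<^bsub>K\<^esub>"
    and unit_unit: "p \<one>\<^bsub>H\<^esub> \<one>\<^bsub>K\<^esub> = \<one>"
begin

lemma S_closed [simp]: "h \<in> carrier H \<Longrightarrow> S h \<in> carrier H"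
  using linD(2)[OF S_lin] by simp

sublocale sw: dual_alg R K H "\<lambda>k h. p h k" n e d by (rule dual_alg_swap)

definition ST :: "'c \<Rightarrow> 'c" where
  "ST k = sw.rep (\<lambda>h. p (S h) k)"

lemma ST_closed [simp]: "k \<in> carrier K \<Longrightarrow> ST k \<in> carrier K"
  unfolding ST_def by (rule sw.rep_closed) auto

lemma p_ST:
  assumes h: "h \<in> carrier H" and k: "k \<in> carrier K"
  shows "p h (ST k) = p (S h) k"
  unfolding ST_def
  by (rule sw.p_rep[OF lin_compose[OF S_lin p_lin_left[OF k]] h])

lemma H_mult_lin:
  assumes "x \<in> carrier H" "k \<in> carrier K"
  shows "lin R V RR (\<lambda>y. p (x \<otimes>\<^bsub>H\<^esub> y) k)" "lin R V RR (\<lambda>y. p (y \<otimes>\<^bsub>H\<^esub> x) k)"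
  by (rule lin_compose[OF _ p_lin_left[OF assms(2)]], use mult_bilin[OF H] assms in \<open>simp add: bilin_def\<close>)+

text \<open>The compatibility identity is self-dual: expanding one more factor on each side leads to
  the same triple sum. The antipode identities are exchanged term by term, by moving
  \<open>S\<close> and the transposed multiplications across the form.\<close>

lemma dual_hopf_swap: "dual_hopf R K H (\<lambda>k h. p h k) n e d ST"
proof (rule dual_hopf.intro[OF dual_alg_swap], unfold_locales)
  show "lin R (sym_bimod K) (sym_bimod K) ST"
  proof (rule linI)
    show "ST (x \<oplus>\<^bsub>sym_bimod K\<^esub> y) = ST x \<oplus>\<^bsub>sym_bimod K\<^esub> ST y" if "x \<in> carrier (sym_bimod K)" "y \<in> carrier (sym_bimod K)" for x y
      by (rule sw.H_eqI) (use that in \<open>auto simp: p_ST p_add_right\<close>)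
    show "ST (lact (sym_bimod K) r x) = lact (sym_bimod K) r (ST x)" if "x \<in> carrier (sym_bimod K)" "r \<in> carrier R" for x r
      by (rule sw.H_eqI) (use that in \<open>auto simp: p_ST p_smult_right\<close>)
  qed auto
next
  fix k k' h h' assume k: "k \<in> carrier K" "k' \<in> carrier K" and h: "h \<in> carrier H" "h' \<in> carrier H"
  \<comment> \<open>The common refinement: summed over \<open>l\<close>, \<open>?t\<close> gives the
    terms of the identity for \<open>K\<close>; summed over \<open>i\<close>, those of the identity
    for \<open>H\<close>. What remains is exchange of finite sums.\<close>
  let ?t = "\<lambda>i j l. p h' (e i \<otimes>\<^bsub>K\<^esub> e j) \<otimes> p (hr h (e l) \<otimes>\<^bsub>H\<^esub> d i) k \<otimes> p (d l \<otimes>\<^bsub>H\<^esub> d j) k'"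
  have 1: "p h (sw.hr k (d i) \<otimes>\<^bsub>K\<^esub> sw.hr k' (d j)) \<otimes> p h' (e i \<otimes>\<^bsub>K\<^esub> e j) = (\<Oplus>l\<in>{..<n}. ?t i j l)"
    if ij: "i < n" "j < n" for i j
  proof -
    have "p h (sw.hr k (d i) \<otimes>\<^bsub>K\<^esub> sw.hr k' (d j)) = 
       (\<Oplus>l\<in>{..<n}. p (d l) (sw.hr k' (d j)) \<otimes> p h (sw.hr k (d i) \<otimes>\<^bsub>K\<^esub> e l))"
      by (rule sw.form_expand) 
         (use h k ij in \<open>auto intro!: linI simp: K.r_distr p_add_right K_smult_mult p_smult_right\<close>)
    also have "\<dots> = (\<Oplus>l\<in>{..<n}. p (d l \<otimes>\<^bsub>H\<^esub> d j) k' \<otimes> p (hr h (e l) \<otimes>\<^bsub>H\<^esub> d i) k)"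
      using h k ij by (intro finsum_cong') (auto simp: sw.p_hr p_hr[symmetric])
    finally have "p h (sw.hr k (d i) \<otimes>\<^bsub>K\<^esub> sw.hr k' (d j)) \<otimes> p h' (e i \<otimes>\<^bsub>K\<^esub> e j) =
       (\<Oplus>l\<in>{..<n}. p (d l \<otimes>\<^bsub>H\<^esub> d j) k' \<otimes> p (hr h (e l) \<otimes>\<^bsub>H\<^esub> d i) k \<otimes> p h' (e i \<otimes>\<^bsub>K\<^esub> e j))"
      using h k ij by (simp add: finsum_ldistr Pi_def)
    also have "\<dots> = (\<Oplus>l\<in>{..<n}. ?t i j l)"
      using h k ij by (intro finsum_cong') (auto simp: R.m_ac)
    finally show ?thesis .
  qed
  have 2: "p (hr h (e l) \<otimes>\<^bsub>H\<^esub> hr h' (e j)) k \<otimes> p (d l \<otimes>\<^bsub>H\<^esub> d j) k' = (\<Oplus>i\<in>{..<n}. ?t i j l)"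
    if lj: "l < n" "j < n" for l j
  proof -
    have "p (hr h (e l) \<otimes>\<^bsub>H\<^esub> hr h' (e j)) k = (\<Oplus>i\<in>{..<n}. p (hr h' (e j)) (e i) \<otimes> p (hr h (e l) \<otimes>\<^bsub>H\<^esub> d i) k)"
      by (rule form_expand[OF H_mult_lin(1)]) (use h k lj in auto)
    also have "\<dots> = (\<Oplus>i\<in>{..<n}. p h' (e i \<otimes>\<^bsub>K\<^esub> e j) \<otimes> p (hr h (e l) \<otimes>\<^bsub>H\<^esub> d i) k)"
      using h k lj by (intro finsum_cong') (auto simp: p_hr)
    finally show ?thesis using h k lj by (simp add: finsum_ldistr Pi_def)
  qed
  have t: "?t i j l \<in> carrier R" if "i < n" "j < n" "l < n" for i j l using that h k by auto
  have t': "(\<Oplus>j\<in>{..<n}. ?t i j l) \<in> carrier R" "(\<Oplus>l\<in>{..<n}. ?t i j l) \<in> carrier R"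
    "(\<Oplus>i\<in>{..<n}. ?t i j l) \<in> carrier R" if "i < n" "j < n" "l < n" for i j l
    using t that by (auto intro!: finsum_closed)
  have "p (h \<otimes>\<^bsub>H\<^esub> h') (k \<otimes>\<^bsub>K\<^esub> k') = (\<Oplus>l\<in>{..<n}. \<Oplus>j\<in>{..<n}. \<Oplus>i\<in>{..<n}. ?t i j l)"
    unfolding compat[OF h k] by (rule finsum2_cong[OF 2 t'(3)])
  also have "\<dots> = (\<Oplus>l\<in>{..<n}. \<Oplus>i\<in>{..<n}. \<Oplus>j\<in>{..<n}. ?t i j l)"
  proof (rule finsum_cong'[OF refl])
    show "(\<lambda>l. \<Oplus>i\<in>{..<n}. \<Oplus>j\<in>{..<n}. ?t i j l) \<in> {..<n} \<rightarrow> carrier R" using t' by (auto intro!: finsum_closed)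
    show "(\<Oplus>j\<in>{..<n}. \<Oplus>i\<in>{..<n}. ?t i j l) = (\<Oplus>i\<in>{..<n}. \<Oplus>j\<in>{..<n}. ?t i j l)" if "l \<in> {..<n}" for l
      by (rule finsum_swap) (use t that in auto)
  qed
  also have "\<dots> = (\<Oplus>i\<in>{..<n}. \<Oplus>l\<in>{..<n}. \<Oplus>j\<in>{..<n}. ?t i j l)"
    by (rule finsum_swap) (use t' in auto)
  also have "\<dots> = (\<Oplus>i\<in>{..<n}. \<Oplus>j\<in>{..<n}. \<Oplus>l\<in>{..<n}. ?t i j l)"
  proof (rule finsum_cong'[OF refl])
    show "(\<lambda>i. \<Oplus>j\<in>{..<n}. \<Oplus>l\<in>{..<n}. ?t i j l) \<in> {..<n} \<rightarrow> carrier R" using t' by (auto intro!: finsum_closed)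
    show "(\<Oplus>l\<in>{..<n}. \<Oplus>j\<in>{..<n}. ?t i j l) = (\<Oplus>j\<in>{..<n}. \<Oplus>l\<in>{..<n}. ?t i j l)" if "i \<in> {..<n}" for i
      by (rule finsum_swap) (use t that in auto)
  qed
  also have "\<dots> = (\<Oplus>i\<in>{..<n}. \<Oplus>j\<in>{..<n}. p h (sw.hr k (d i) \<otimes>\<^bsub>K\<^esub> sw.hr k' (d j)) \<otimes> p h' (e i \<otimes>\<^bsub>K\<^esub> e j))"
    by (rule finsum2_cong[OF 1[symmetric]]) (use h k in auto)
  finally show "p (h \<otimes>\<^bsub>H\<^esub> h') (k \<otimes>\<^bsub>K\<^esub> k') = 
    (\<Oplus>i\<in>{..<n}. \<Oplus>j\<in>{..<n}. p h (sw.hr k (d i) \<otimes>\<^bsub>K\<^esub> sw.hr k' (d j)) \<otimes> p h' (e i \<otimes>\<^bsub>K\<^esub> e j))" .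
next
  fix k h assume k: "k \<in> carrier K" and h: "h \<in> carrier H"
  have "(\<Oplus>j\<in>{..<n}. p h (ST (sw.hr k (d j)) \<otimes>\<^bsub>K\<^esub> e j)) = (\<Oplus>j\<in>{..<n}. p (S (hr h (e j)) \<otimes>\<^bsub>H\<^esub> d j) k)"
    using h k by (intro finsum_cong') (auto simp: p_hr[symmetric] p_ST sw.p_hr)
  then show "(\<Oplus>j\<in>{..<n}. p h (ST (sw.hr k (d j)) \<otimes>\<^bsub>K\<^esub> e j)) = p \<one>\<^bsub>H\<^esub> k \<otimes> p h \<one>\<^bsub>K\<^esub>"
    using left_antipode[OF h k] h k by (simp add: R.m_comm)
  have "(\<Oplus>j\<in>{..<n}. p h (e j \<otimes>\<^bsub>K\<^esub> ST (sw.hl (d j) k))) = (\<Oplus>j\<in>{..<n}. p (d j \<otimes>\<^bsub>H\<^esub> S (hl (e j) h)) k)"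
    using h k by (intro finsum_cong') (auto simp: p_hl[symmetric] p_ST sw.p_hl)
  then show "(\<Oplus>j\<in>{..<n}. p h (e j \<otimes>\<^bsub>K\<^esub> ST (sw.hl (d j) k))) = p \<one>\<^bsub>H\<^esub> k \<otimes> p h \<one>\<^bsub>K\<^esub>"
    using right_antipode[OF h k] h k by (simp add: R.m_comm)
qed (auto simp: unit_left unit_right unit_unit)

end

section \<open>Bialgebra and antipode axioms read off from the form\<close>

locale dual_hopf_coalg = dual_hopf + dual_coalg
begin

lemma H_mult_bilin: "bilin R V V V (\<lambda>x y. x \<otimes>\<^bsub>H\<^esub> y)" by (rule mult_bilin[OF H])

lemma mult_inner_bilin:
  assumes "x \<in> carrier V" "y \<in> carrier V"
  shows "bilin R V V VV (\<lambda>x' y'. pure2 R H (x \<otimes>\<^bsub>H\<^esub> x') (y \<otimes>\<^bsub>H\<^esub> y'))"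
  by (rule bilin_compose[OF pure_bilin[OF V_sym V_sym], where g = "\<lambda>x'. x \<otimes>\<^bsub>H\<^esub> x'" and h = "\<lambda>y'. y \<otimes>\<^bsub>H\<^esub> y'"])
     (use H_mult_bilin assms in \<open>auto simp: bilin_def\<close>)

lemma mult_outer_bilin:
  assumes t: "t \<in> carrier VV"
  shows "bilin R V V VV (\<lambda>x y. tensor_lift VV (\<lambda>x' y'. pure2 R H (x \<otimes>\<^bsub>H\<^esub> x') (y \<otimes>\<^bsub>H\<^esub> y')) t)"
  unfolding bilin_def
proof (intro conjI ballI)
  note pb = pure_bilin[OF V_sym V_sym]
  fix x assume x: "x \<in> carrier V"
  show "lin R V VV (\<lambda>y. tensor_lift VV (\<lambda>x' y'. pure2 R H (x \<otimes>\<^bsub>H\<^esub> x') (y \<otimes>\<^bsub>H\<^esub> y')) t)"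
    by (rule linear_lift_param[OF V_sym V_sym VV_sym mult_inner_bilin[OF x] _ V_sym t], assumption)
       (rule lin_compose[where W = V], use pb H_mult_bilin x in \<open>auto simp: bilin_def\<close>)
  show "lin R V VV (\<lambda>y. tensor_lift VV (\<lambda>x' y'. pure2 R H (y \<otimes>\<^bsub>H\<^esub> x') (x \<otimes>\<^bsub>H\<^esub> y')) t)"
    by (rule linear_lift_param[OF V_sym V_sym VV_sym mult_inner_bilin[OF _ x] _ V_sym t], assumption)
       (rule lin_compose[where W = V], use pb H_mult_bilin x in \<open>auto simp: bilin_def\<close>)
qed

lemma tensor2_mult_lin_left: "t \<in> carrier VV \<Longrightarrow> lin R VV VV (\<lambda>s. tensor2_mult R H s t)"
  unfolding tensor2_mult_def by (rule tensor_lift_lin[OF V_sym V_sym VV_sym mult_outer_bilin])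

lemma tensor2_mult_pure_left:
  assumes "x \<in> carrier H" "y \<in> carrier H" "t \<in> carrier VV"
  shows "tensor2_mult R H (pure2 R H x y) t = tensor_lift VV (\<lambda>x' y'. pure2 R H (x \<otimes>\<^bsub>H\<^esub> x') (y \<otimes>\<^bsub>H\<^esub> y')) t"
  unfolding tensor2_mult_def using assms by (intro bilin_lift(1)[OF V_sym V_sym VV_sym mult_outer_bilin]) auto

lemma tensor2_mult_pure:
  assumes "x \<in> carrier H" "y \<in> carrier H" "x' \<in> carrier H" "y' \<in> carrier H"
  shows "tensor2_mult R H (pure2 R H x y) (pure2 R H x' y') = pure2 R H (x \<otimes>\<^bsub>H\<^esub> x') (y \<otimes>\<^bsub>H\<^esub> y')"
  using assms by (simp add: tensor2_mult_pure_left bilin_lift(1)[OF V_sym V_sym VV_sym mult_inner_bilin])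

lemma tensor2_mult_pure_lin_right:
  assumes "x \<in> carrier H" "y \<in> carrier H"
  shows "lin R VV VV (\<lambda>t. tensor2_mult R H (pure2 R H x y) t)"
proof (rule lin_cong)
  show "lin R VV VV (tensor_lift VV (\<lambda>x' y'. pure2 R H (x \<otimes>\<^bsub>H\<^esub> x') (y \<otimes>\<^bsub>H\<^esub> y')))"
    by (rule tensor_lift_lin[OF V_sym V_sym VV_sym mult_inner_bilin]) (use assms in auto)
qed (use assms sym_modD[OF VV_sym] in \<open>auto simp: tensor2_mult_pure_left\<close>)

text \<open>Both tensors are expanded along \<open>d\<close> in the second factor. For coproducts
  the slices are the \<open>hr\<close> terms, and the double sum is the one in
  \<open>compat\<close>.\<close>

lemma P2_mult:
  assumes s: "s \<in> carrier VV" and t: "t \<in> carrier VV" and k: "k \<in> carrier K" "k' \<in> carrier K"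
  shows "P2 k k' (tensor2_mult R H s t) = (\<Oplus>i\<in>{..<n}. \<Oplus>j\<in>{..<n}. 
    p (rslice (e i) s \<otimes>\<^bsub>H\<^esub> rslice (e j) t) k \<otimes> p (d i \<otimes>\<^bsub>H\<^esub> d j) k')"
proof -
  have "P2 k k' (tensor2_mult R H (\<Oplus>\<^bsub>VV\<^esub>i\<in>{..<n}. pure2 R H (rslice (e i) s) (d i)) t) =
    (\<Oplus>i\<in>{..<n}. P2 k k' (tensor2_mult R H (pure2 R H (rslice (e i) s) (d i)) t))"
    unfolding finsum_RR[symmetric]
    by (rule lin_finsum[OF VV_sym R_sym lin_compose[OF tensor2_mult_lin_left[OF t] P2_lin[OF k]]])
       (use s in auto)
  then have "P2 k k' (tensor2_mult R H s t) = (\<Oplus>i\<in>{..<n}. P2 k k' (tensor2_mult R H (pure2 R H (rslice (e i) s) (d i)) t))"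
    using rslice_expand[OF s] by simp
  also have "\<dots> = (\<Oplus>i\<in>{..<n}. \<Oplus>j\<in>{..<n}. 
    p (rslice (e i) s \<otimes>\<^bsub>H\<^esub> rslice (e j) t) k \<otimes> p (d i \<otimes>\<^bsub>H\<^esub> d j) k')"
  proof (rule finsum_cong')
    fix i assume i: "i \<in> {..<n}"
    let ?F = "\<lambda>t. P2 k k' (tensor2_mult R H (pure2 R H (rslice (e i) s) (d i)) t)"
    have "?F (\<Oplus>\<^bsub>VV\<^esub>j\<in>{..<n}. pure2 R H (rslice (e j) t) (d j)) =
      (\<Oplus>j\<in>{..<n}. ?F (pure2 R H (rslice (e j) t) (d j)))"
      unfolding finsum_RR[symmetric]
      by (rule lin_finsum[OF VV_sym R_sym lin_compose[OF tensor2_mult_pure_lin_right P2_lin[OF k]]])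
         (use s t i in auto)
    also have "\<dots> = (\<Oplus>j\<in>{..<n}. p (rslice (e i) s \<otimes>\<^bsub>H\<^esub> rslice (e j) t) k \<otimes> p (d i \<otimes>\<^bsub>H\<^esub> d j) k')"
      using s t i k by (intro finsum_cong') (auto simp: tensor2_mult_pure)
    finally show "?F t = (\<Oplus>j\<in>{..<n}. p (rslice (e i) s \<otimes>\<^bsub>H\<^esub> rslice (e j) t) k \<otimes> p (d i \<otimes>\<^bsub>H\<^esub> d j) k')"
      using rslice_expand[OF t] by simp
  qed (use s t k in \<open>auto intro!: finsum_closed\<close>)
  finally show ?thesis .
qed

lemma tensor2_mult_closed: "s \<in> carrier VV \<Longrightarrow> t \<in> carrier VV \<Longrightarrow> tensor2_mult R H s t \<in> carrier VV"
  using linD(2)[OF tensor2_mult_lin_left] by blast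

lemma bialgebra: "bialgebra R H"
  unfolding bialgebra_def
proof (intro conjI ballI)
  show "assoc_algebra R H" by (rule H)
  show "coalgebra R H" by (rule coalgebra)
  show "comult H \<one>\<^bsub>H\<^esub> = pure2 R H \<one>\<^bsub>H\<^esub> \<one>\<^bsub>H\<^esub>"
    by (rule tensor2_eqI) (auto simp: P2_comult unit_left)
  show "counit H \<one>\<^bsub>H\<^esub> = \<one>" by (simp add: counit unit_unit)
  fix x y assume xy: "x \<in> carrier H" "y \<in> carrier H"
  then show "counit H (x \<otimes>\<^bsub>H\<^esub> y) = counit H x \<otimes> counit H y" by (simp add: counit unit_right)
  show "comult H (x \<otimes>\<^bsub>H\<^esub> y) = tensor2_mult R H (comult H x) (comult H y)"
  proof (rule tensor2_eqI)
    show "tensor2_mult R H (comult H x) (comult H y) \<in> carrier VV"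
      using xy by (intro tensor2_mult_closed) auto
    fix k k' assume k: "k \<in> carrier K" "k' \<in> carrier K"
    have "P2 k k' (tensor2_mult R H (comult H x) (comult H y)) = 
       (\<Oplus>i\<in>{..<n}. \<Oplus>j\<in>{..<n}. p (hr x (e i) \<otimes>\<^bsub>H\<^esub> hr y (e j)) k \<otimes> p (d i \<otimes>\<^bsub>H\<^esub> d j) k')"
      using xy k by (subst P2_mult) (auto simp: rslice_comult intro!: finsum2_cong)
    then show "P2 k k' (comult H (x \<otimes>\<^bsub>H\<^esub> y)) = P2 k k' (tensor2_mult R H (comult H x) (comult H y))"
      using xy k compat by (simp add: P2_comult)
  qed (use xy in auto)
qed

lemma antipode: "antipode R H S"
  unfolding antipode_def linear_maps_iff[OF V_sym V_sym]
proof (intro conjI ballI)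
  show "lin R V V S" by (rule S_lin)
  interpret T: abelian_group VV by (rule sym_modD[OF VV_sym])
  fix h assume h: "h \<in> carrier H"
  have D: "comult H h \<in> carrier VV" using h by simp
  have b1: "bilin R V V V (\<lambda>x y. S x \<otimes>\<^bsub>H\<^esub> y)" by (rule bilin_compose[OF H_mult_bilin S_lin lin_id])
  have b2: "bilin R V V V (\<lambda>x y. x \<otimes>\<^bsub>H\<^esub> S y)" by (rule bilin_compose[OF H_mult_bilin lin_id S_lin])
  note l1 = tensor_lift_lin[OF V_sym V_sym V_sym b1] and l2 = tensor_lift_lin[OF V_sym V_sym V_sym b2]
  show "tensor_lift H (\<lambda>x y. S x \<otimes>\<^bsub>H\<^esub> y) (comult H h) = counit H h \<odot>\<^bsub>H\<^esub> \<one>\<^bsub>H\<^esub>"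
    unfolding tensor_lift_H
  proof (rule H_eqI)
    show "tensor_lift V (\<lambda>x y. S x \<otimes>\<^bsub>H\<^esub> y) (comult H h) \<in> carrier H" using linD(2)[OF l1 D] by simp
    fix k assume k: "k \<in> carrier K"
    let ?F = "\<lambda>t. p (tensor_lift V (\<lambda>x y. S x \<otimes>\<^bsub>H\<^esub> y) t) k"
    have "?F (\<Oplus>\<^bsub>VV\<^esub>i\<in>{..<n}. pure2 R H (rslice (e i) (comult H h)) (d i)) =
      (\<Oplus>i\<in>{..<n}. ?F (pure2 R H (rslice (e i) (comult H h)) (d i)))"
      unfolding finsum_RR[symmetric]
      by (rule lin_finsum[OF VV_sym R_sym lin_compose[OF l1 p_lin_left[OF k]]]) (use h in auto)
    also have "\<dots> = (\<Oplus>i\<in>{..<n}. p (S (hr h (e i)) \<otimes>\<^bsub>H\<^esub> d i) k)"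
      using h k by (intro finsum_cong') (auto simp: rslice_comult bilin_lift(1)[OF V_sym V_sym V_sym b1])
    finally show "?F (comult H h) = p (counit H h \<odot>\<^bsub>H\<^esub> \<one>\<^bsub>H\<^esub>) k"
      using h k rslice_expand[OF D] by (simp add: left_antipode counit p_smult_left)
  qed (use h counit in auto)
  show "tensor_lift H (\<lambda>x y. x \<otimes>\<^bsub>H\<^esub> S y) (comult H h) = counit H h \<odot>\<^bsub>H\<^esub> \<one>\<^bsub>H\<^esub>"
    unfolding tensor_lift_H
  proof (rule H_eqI)
    show "tensor_lift V (\<lambda>x y. x \<otimes>\<^bsub>H\<^esub> S y) (comult H h) \<in> carrier H" using linD(2)[OF l2 D] by simp
    fix k assume k: "k \<in> carrier K"
    let ?F = "\<lambda>t. p (tensor_lift V (\<lambda>x y. x \<otimes>\<^bsub>H\<^esub> S y) t) k"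
    \<comment> \<open>The right antipode identity is phrased with \<open>hl\<close>, so the
      coproduct is expanded in its first factor here.\<close>
    have "?F (\<Oplus>\<^bsub>VV\<^esub>i\<in>{..<n}. pure2 R H (d i) (slice V (e i) (comult H h))) =
      (\<Oplus>i\<in>{..<n}. ?F (pure2 R H (d i) (slice V (e i) (comult H h))))"
      unfolding finsum_RR[symmetric]
      by (rule lin_finsum[OF VV_sym R_sym lin_compose[OF l2 p_lin_left[OF k]]]) (use h in auto)
    also have "\<dots> = (\<Oplus>i\<in>{..<n}. p (d i \<otimes>\<^bsub>H\<^esub> S (hl (e i) h)) k)"
      using h k by (intro finsum_cong') (auto simp: slice_comult bilin_lift(1)[OF V_sym V_sym V_sym b2])
    finally show "?F (comult H h) = p (counit H h \<odot>\<^bsub>H\<^esub> \<one>\<^bsub>H\<^esub>) k"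
      using h k slice_expand[OF V_sym D] by (simp add: right_antipode counit p_smult_left)
  qed (use h counit in auto)
qed

lemma hopf_algebra: "hopf_algebra R H"
  unfolding hopf_algebra_def using bialgebra antipode by blast

end

text \<open>The definition asks for a set of generators with one coefficient for each of them, while
  the family \<open>d\<close> may have repetitions. Hence the span of the set is shown to be closed
  under addition, and the expansion along \<open>d\<close> is built up one term at a time.\<close>

lemma (in dual_alg) finite_dim: "finite_dim R H"
proof -
  let ?U = "d ` {..<n}"
  let ?W = "{\<Oplus>\<^bsub>H\<^esub>u\<in>?U. c u \<odot>\<^bsub>H\<^esub> u | c. c \<in> ?U \<rightarrow> carrier R}"
  have U: "finite ?U" "?U \<subseteq> carrier H" by auto
  have add: "x \<oplus>\<^bsub>H\<^esub> y \<in> ?W" if xy: "x \<in> ?W" "y \<in> ?W" for x y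
  proof -
    obtain c c' where c: "c \<in> ?U \<rightarrow> carrier R" "x = (\<Oplus>\<^bsub>H\<^esub>u\<in>?U. c u \<odot>\<^bsub>H\<^esub> u)"
      and c': "c' \<in> ?U \<rightarrow> carrier R" "y = (\<Oplus>\<^bsub>H\<^esub>u\<in>?U. c' u \<odot>\<^bsub>H\<^esub> u)" using xy by auto
    have "x \<oplus>\<^bsub>H\<^esub> y = (\<Oplus>\<^bsub>H\<^esub>u\<in>?U. c u \<odot>\<^bsub>H\<^esub> u \<oplus>\<^bsub>H\<^esub> c' u \<odot>\<^bsub>H\<^esub> u)"
      unfolding c c' using c c' U by (intro H.finsum_addf[symmetric]) (auto intro!: HM.smult_closed)
    also have "\<dots> = (\<Oplus>\<^bsub>H\<^esub>u\<in>?U. (c u \<oplus> c' u) \<odot>\<^bsub>H\<^esub> u)"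
      using c(1) c'(1) U by (intro H.finsum_cong') (auto simp: Pi_def HM.smult_l_distr)
    finally show ?thesis using c c' by (auto intro!: exI[of _ "\<lambda>u. c u \<oplus> c' u"])
  qed
  have single: "r \<odot>\<^bsub>H\<^esub> u \<in> ?W" if r: "r \<in> carrier R" and u: "u \<in> ?U" for r u
  proof -
    have "(\<Oplus>\<^bsub>H\<^esub>v\<in>?U. (if u = v then r else \<zero>) \<odot>\<^bsub>H\<^esub> v) = (\<Oplus>\<^bsub>H\<^esub>v\<in>?U. if u = v then r \<odot>\<^bsub>H\<^esub> v else \<zero>\<^bsub>H\<^esub>)"
      using r U by (intro H.finsum_cong') (auto simp: HM.smult_l_null)
    also have "\<dots> = r \<odot>\<^bsub>H\<^esub> u"
      using r U u by (intro H.finsum_singleton) auto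
    finally show ?thesis using r by (auto intro!: exI[of _ "\<lambda>v. if u = v then r else \<zero>"])
  qed
  have zero: "\<zero>\<^bsub>H\<^esub> \<in> ?W"
  proof -
    have "(\<Oplus>\<^bsub>H\<^esub>u\<in>?U. \<zero> \<odot>\<^bsub>H\<^esub> u) = \<zero>\<^bsub>H\<^esub>"
      using U by (intro H.add.finprod_one_eqI) auto
    then show ?thesis by (auto intro!: exI[of _ "\<lambda>u. \<zero>"])
  qed
  have "(\<Oplus>\<^bsub>H\<^esub>i\<in>{..<m}. p h (e i) \<odot>\<^bsub>H\<^esub> d i) \<in> ?W" if "m \<le> n" "h \<in> carrier H" for m h
    using that(1)
  proof (induction m)
    case 0
    then show ?case using zero by simp
  next
    case (Suc m)
    then have m: "m < n" and IH: "(\<Oplus>\<^bsub>H\<^esub>i\<in>{..<m}. p h (e i) \<odot>\<^bsub>H\<^esub> d i) \<in> ?W" by auto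
    have "(\<Oplus>\<^bsub>H\<^esub>i\<in>{..<Suc m}. p h (e i) \<odot>\<^bsub>H\<^esub> d i) = p h (e m) \<odot>\<^bsub>H\<^esub> d m \<oplus>\<^bsub>H\<^esub> (\<Oplus>\<^bsub>H\<^esub>i\<in>{..<m}. p h (e i) \<odot>\<^bsub>H\<^esub> d i)"
      unfolding lessThan_Suc using m that(2) by (intro H.finsum_insert) auto
    then show ?case using add[OF single IH, of "p h (e m)" "d m"] m that(2) by simp
  qed
  from this[OF le_refl] have "carrier H \<subseteq> ?W" by (auto simp: expand_H)
  moreover have "?W \<subseteq> carrier H" using U by (auto intro!: H.finsum_closed HM.smult_closed)
  ultimately show ?thesis unfolding finite_dim_def using U by (intro exI[of _ ?U]) blast
qed

text \<open>The last clause of Hopf duality quantifies over all antipodes of both algebras;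
  uniqueness reduces these to \<open>S\<close> and its adjoint.\<close>

lemma hopf_dual_if_dual_hopf:
  assumes "dual_hopf R H K p n d e S" and C: "dual_coalg R H K p n d e"
    and D: "dual_coalg R K H (\<lambda>k h. p h k) n e d"
  shows "hopf_dual R H K p" 
proof -
  interpret h: dual_hopf R H K p n d e S by fact
  interpret hc: dual_hopf_coalg R H K p n d e S
    by (intro dual_hopf_coalg.intro h.dual_hopf_axioms C)
  interpret kc: dual_hopf_coalg R K H "\<lambda>k h. p h k" n e d h.ST
    by (intro dual_hopf_coalg.intro h.dual_hopf_swap D)
  have ST: "p (S1 x) y = p x (S2 y)" 
    if "antipode R H S1" "antipode R K S2" "x \<in> carrier H" "y \<in> carrier K" for S1 S2 x y
  proof -
    have "S1 x = S x" using that by (intro antipode_unique[OF h.H hc.coalgebra _ hc.antipode]) auto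
    moreover have "S2 y = h.ST y" using that by (intro antipode_unique[OF h.K kc.coalgebra _ kc.antipode]) auto
    ultimately show ?thesis using that h.p_ST by simp
  qed
  show ?thesis
    unfolding hopf_dual_def nondegenerate_form_def
  proof (intro conjI ballI impI allI)
    show "hopf_algebra R H" "hopf_algebra R K" by (rule hc.hopf_algebra kc.hopf_algebra)+
    show "finite_dim R H" "finite_dim R K" by (rule h.finite_dim h.sw.finite_dim)+
    show "p x \<in> linear_maps R (sym_bimod K) (ring_bimod R id id)" if "x \<in> carrier H" for x
      unfolding linear_maps_iff[OF h.sw.V_sym h.R_sym] using h.p_lin_right[OF that] .
    show "(\<lambda>x. p x y) \<in> linear_maps R (sym_bimod H) (ring_bimod R id id)" if "y \<in> carrier K" for y
      unfolding linear_maps_iff[OF h.V_sym h.R_sym] using h.p_lin_left[OF that] .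
    show "x = \<zero>\<^bsub>H\<^esub>" if "x \<in> carrier H" "\<forall>y\<in>carrier K. p x y = \<zero>\<^bsub>R\<^esub>" for x
      by (rule h.H_eqI) (use that h.p_smult_left[of "\<zero>\<^bsub>R\<^esub>" "\<zero>\<^bsub>H\<^esub>"] in auto)
    show "y = \<zero>\<^bsub>K\<^esub>" if "y \<in> carrier K" "\<forall>x\<in>carrier H. p x y = \<zero>\<^bsub>R\<^esub>" for y
      by (rule h.sw.H_eqI) (use that h.p_smult_right[of "\<zero>\<^bsub>R\<^esub>" _ "\<zero>\<^bsub>K\<^esub>"] in auto)
    show "p (x \<otimes>\<^bsub>H\<^esub> x') y = tensor_lift R (\<lambda>y1 y2. p x y1 \<otimes>\<^bsub>R\<^esub> p x' y2) (comult K y)"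
      if "x \<in> carrier H" "x' \<in> carrier H" "y \<in> carrier K" for x x' y
      using kc.P2_comult[OF that(3,1,2)] by (simp add: h.sw.P2_def)
    show "p x (y \<otimes>\<^bsub>K\<^esub> y') = tensor_lift R (\<lambda>x1 x2. p x1 y \<otimes>\<^bsub>R\<^esub> p x2 y') (comult H x)"
      if "x \<in> carrier H" "y \<in> carrier K" "y' \<in> carrier K" for x y y'
      using hc.P2_comult[OF that] by (simp add: h.P2_def)
    show "p \<one>\<^bsub>H\<^esub> y = counit K y" if "y \<in> carrier K" for y using kc.counit that by simp
    show "p x \<one>\<^bsub>K\<^esub> = counit H x" if "x \<in> carrier H" for x using hc.counit that by simp
  qed (rule ST)
qed

section \<open>Transport along algebra isomorphisms\<close>

definition alg_iso :: "'r ring \<Rightarrow> ('r, 'a, 'p) module_scheme \<Rightarrow> ('r, 'b, 'q) module_scheme \<Rightarrow> ('a \<Rightarrow> 'b) \<Rightarrow> bool" where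
  "alg_iso R H H' f \<longleftrightarrow> bij_betw f (carrier H) (carrier H') \<and>
     (\<forall>x\<in>carrier H. \<forall>y\<in>carrier H. f (x \<oplus>\<^bsub>H\<^esub> y) = f x \<oplus>\<^bsub>H'\<^esub> f y \<and> f (x \<otimes>\<^bsub>H\<^esub> y) = f x \<otimes>\<^bsub>H'\<^esub> f y) \<and>
     f \<one>\<^bsub>H\<^esub> = \<one>\<^bsub>H'\<^esub> \<and> f \<zero>\<^bsub>H\<^esub> = \<zero>\<^bsub>H'\<^esub> \<and>
     (\<forall>r\<in>carrier R. \<forall>x\<in>carrier H. f (r \<odot>\<^bsub>H\<^esub> x) = r \<odot>\<^bsub>H'\<^esub> f x)"

lemma alg_isoD:
  assumes "alg_iso R H H' f"
  shows "bij_betw f (carrier H) (carrier H')" "x \<in> carrier H \<Longrightarrow> f x \<in> carrier H'"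
    "x \<in> carrier H \<Longrightarrow> y \<in> carrier H \<Longrightarrow> f x \<oplus>\<^bsub>H'\<^esub> f y = f (x \<oplus>\<^bsub>H\<^esub> y)"
    "x \<in> carrier H \<Longrightarrow> y \<in> carrier H \<Longrightarrow> f x \<otimes>\<^bsub>H'\<^esub> f y = f (x \<otimes>\<^bsub>H\<^esub> y)"
    "\<one>\<^bsub>H'\<^esub> = f \<one>\<^bsub>H\<^esub>" "\<zero>\<^bsub>H'\<^esub> = f \<zero>\<^bsub>H\<^esub>"
    "r \<in> carrier R \<Longrightarrow> x \<in> carrier H \<Longrightarrow> r \<odot>\<^bsub>H'\<^esub> f x = f (r \<odot>\<^bsub>H\<^esub> x)"
  using assms by (auto simp: alg_iso_def bij_betw_def)

lemma alg_iso_obtain: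
  assumes "alg_iso R H H' f" "y \<in> carrier H'"
  obtains x where "x \<in> carrier H" "y = f x"
  using assms unfolding alg_iso_def bij_betw_def by blast

text \<open>The target is a bare record that inherits its laws through \<open>f\<close>. Since it is
  not yet known to be a group, \<open>alg_iso\<close> asks explicitly that zero goes to
  zero.\<close>

lemma assoc_algebra_iso:
  assumes A: "assoc_algebra R H" and f: "alg_iso R H H' f"
  shows "assoc_algebra R H'"
proof -
  interpret H: ring H using A by (simp add: assoc_algebra_def)
  interpret HM: module R H using A by (simp add: assoc_algebra_def)
  note D = alg_isoD[OF f]
  have ag: "abelian_group H'"
  proof (rule abelian_groupI)
    show "\<exists>y\<in>carrier H'. y \<oplus>\<^bsub>H'\<^esub> x = \<zero>\<^bsub>H'\<^esub>" if "x \<in> carrier H'" for x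
      using f that
    proof (rule alg_iso_obtain)
      fix u assume u: "u \<in> carrier H" "x = f u"
      show ?thesis by (rule bexI[of _ "f (\<ominus>\<^bsub>H\<^esub> u)"]) (use u in \<open>auto simp: D H.l_neg\<close>)
    qed
  qed (use D(2-) in \<open>auto elim!: alg_iso_obtain[OF f] simp: H.a_ac\<close>)
  interpret H': abelian_group H' by (rule ag)
  have "ring H'"
    by (rule ringI, rule ag, rule monoidI)
       (use D(2-) in \<open>auto elim!: alg_iso_obtain[OF f] simp: H.m_assoc H.l_distr H.r_distr\<close>)
  moreover have "module R H'"
    by (rule moduleI[OF HM.R.is_cring ag])
       (use D(2-) in \<open>auto elim!: alg_iso_obtain[OF f] simp: HM.smult_assoc1 HM.smult_l_distr HM.smult_r_distr\<close>)
  ultimately show ?thesis using A D(2-)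
    unfolding assoc_algebra_def by (auto elim!: alg_iso_obtain[OF f])
qed

lemma alg_iso_lin:
  assumes "alg_iso R H H' f"
  shows "lin R (sym_bimod H) (sym_bimod H') f"
  by (rule linI) (use alg_isoD[OF assms] in auto)

lemma alg_iso_inv_lin:
  assumes "assoc_algebra R H" "alg_iso R H H' f"
  shows "lin R (sym_bimod H') (sym_bimod H) (inv_into (carrier H) f)"
    and "x \<in> carrier H \<Longrightarrow> inv_into (carrier H) f (f x) = x"
proof -
  interpret H: ring H using assms(1) by (simp add: assoc_algebra_def)
  interpret HM: module R H using assms(1) by (simp add: assoc_algebra_def)
  note D = alg_isoD[OF assms(2)]
  have i: "x \<in> carrier H \<Longrightarrow> inv_into (carrier H) f (f x) = x" for x
    using D(1) by (auto simp: bij_betw_def inv_into_f_f)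
  then show "x \<in> carrier H \<Longrightarrow> inv_into (carrier H) f (f x) = x" .
  show "lin R (sym_bimod H') (sym_bimod H) (inv_into (carrier H) f)"
    by (rule linI) (auto elim!: alg_iso_obtain[OF assms(2)] simp: i D)
qed

text \<open>Besides the antipode the identities involve products, units and the form, so algebra
  isomorphisms that match the forms suffice. The operators \<open>hr\<close> and \<open>hl\<close>
  follow along because the form determines them.\<close>

lemma dual_hopf_transport:
  assumes "dual_hopf R H K p n d e S" and f: "alg_iso R H H' f" and g: "alg_iso R K K' g"
    and p': "\<And>h k. h \<in> carrier H \<Longrightarrow> k \<in> carrier K \<Longrightarrow> p' (f h) (g k) = p h k"
  shows "dual_hopf R H' K' p' n (f \<circ> d) (g \<circ> e) (\<lambda>x. f (S (inv_into (carrier H) f x)))"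
proof -
  interpret h: dual_hopf R H K p n d e S by fact
  have H': "assoc_algebra R H'" by (rule assoc_algebra_iso[OF h.H f])
  have K': "assoc_algebra R K'" by (rule assoc_algebra_iso[OF h.K g])
  interpret H': ring H' using H' by (simp add: assoc_algebra_def)
  interpret K': ring K' using K' by (simp add: assoc_algebra_def)
  interpret HM': module R H' using H' by (simp add: assoc_algebra_def)
  interpret KM': module R K' using K' by (simp add: assoc_algebra_def)
  note F = alg_isoD[OF f] and G = alg_isoD[OF g]
  note ob = alg_iso_obtain[OF f] alg_iso_obtain[OF g]
  have fs: "(\<Oplus>\<^bsub>H'\<^esub>i\<in>{..<n}. f (u i)) = f (\<Oplus>\<^bsub>H\<^esub>i\<in>{..<n}. u i)" if "\<And>i. i < n \<Longrightarrow> u i \<in> carrier H" for u :: "nat \<Rightarrow> _"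
    by (rule additive_finsum[OF h.H.abelian_group_axioms H'.abelian_group_axioms, symmetric])
       (use F that in \<open>auto intro: additiveI\<close>)
  have gs: "(\<Oplus>\<^bsub>K'\<^esub>i\<in>{..<n}. g (u i)) = g (\<Oplus>\<^bsub>K\<^esub>i\<in>{..<n}. u i)" if "\<And>i. i < n \<Longrightarrow> u i \<in> carrier K" for u :: "nat \<Rightarrow> _"
    by (rule additive_finsum[OF h.K.abelian_group_axioms K'.abelian_group_axioms, symmetric])
       (use G that in \<open>auto intro: additiveI\<close>)
  interpret t: dual_alg R H' K' p' n "f \<circ> d" "g \<circ> e"
  proof
    fix x assume x: "x \<in> carrier H'"
    then obtain u where u: "u \<in> carrier H" "x = f u" by (rule ob)
    have "(\<Oplus>\<^bsub>H'\<^esub>i\<in>{..<n}. p' x ((g \<circ> e) i) \<odot>\<^bsub>H'\<^esub> (f \<circ> d) i) = (\<Oplus>\<^bsub>H'\<^esub>i\<in>{..<n}. f (p u (e i) \<odot>\<^bsub>H\<^esub> d i))"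
      using u F by (intro H'.finsum_cong') (auto simp: p')
    then show "(\<Oplus>\<^bsub>H'\<^esub>i\<in>{..<n}. p' x ((g \<circ> e) i) \<odot>\<^bsub>H'\<^esub> (f \<circ> d) i) = x"
      using u by (simp add: fs h.expand_H)
  next
    fix x assume x: "x \<in> carrier K'"
    then obtain u where u: "u \<in> carrier K" "x = g u" by (rule ob)
    have "(\<Oplus>\<^bsub>K'\<^esub>i\<in>{..<n}. p' ((f \<circ> d) i) x \<odot>\<^bsub>K'\<^esub> (g \<circ> e) i) = (\<Oplus>\<^bsub>K'\<^esub>i\<in>{..<n}. g (p (d i) u \<odot>\<^bsub>K\<^esub> e i))"
      using u G by (intro K'.finsum_cong') (auto simp: p')
    then show "(\<Oplus>\<^bsub>K'\<^esub>i\<in>{..<n}. p' ((f \<circ> d) i) x \<odot>\<^bsub>K'\<^esub> (g \<circ> e) i) = x"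
      using u by (simp add: gs h.expand_K)
  qed (use F(2-) G(2-) in \<open>auto simp: H' K' p' h.p_add_left h.p_add_right h.p_smult_left h.p_smult_right elim!: ob\<close>)
  have hr: "t.hr (f x) (g c) = f (h.hr x c)" if "x \<in> carrier H" "c \<in> carrier K" for x c
    by (rule t.H_eqI) (use that F(2) G(2,4) in \<open>auto simp: t.p_hr h.p_hr p' elim!: ob\<close>)
  have hl: "t.hl (g c) (f x) = f (h.hl c x)" if "x \<in> carrier H" "c \<in> carrier K" for x c
    by (rule t.H_eqI) (use that F(2) G(2,4) in \<open>auto simp: t.p_hl h.p_hl p' elim!: ob\<close>)
  note inv = alg_iso_inv_lin[OF h.H f]
  note [simp] = inv(2) hr hl F(4,5) G(4,5) p'
  show ?thesis
  proof
    show "lin R (sym_bimod H') (sym_bimod H') (\<lambda>x. f (S (inv_into (carrier H) f x)))"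
      by (rule lin_compose[OF lin_compose[OF inv(1) h.S_lin] alg_iso_lin[OF f]])
  next
    fix x x' k k' assume "x \<in> carrier H'" "x' \<in> carrier H'" "k \<in> carrier K'" "k' \<in> carrier K'"
    then obtain u u' c c' where u: "u \<in> carrier H" "u' \<in> carrier H" "c \<in> carrier K" "c' \<in> carrier K"
      "x = f u" "x' = f u'" "k = g c" "k' = g c'" by (metis ob)
    have "p' (x \<otimes>\<^bsub>H'\<^esub> x') (k \<otimes>\<^bsub>K'\<^esub> k') = p (u \<otimes>\<^bsub>H\<^esub> u') (c \<otimes>\<^bsub>K\<^esub> c')" using u by simp
    also have "\<dots> = (\<Oplus>\<^bsub>R\<^esub>i\<in>{..<n}. \<Oplus>\<^bsub>R\<^esub>j\<in>{..<n}. p (h.hr u (e i) \<otimes>\<^bsub>H\<^esub> h.hr u' (e j)) c \<otimes>\<^bsub>R\<^esub> p (d i \<otimes>\<^bsub>H\<^esub> d j) c')"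
      using u h.compat by blast
    also have "\<dots> = (\<Oplus>\<^bsub>R\<^esub>i\<in>{..<n}. \<Oplus>\<^bsub>R\<^esub>j\<in>{..<n}. p' (t.hr x ((g \<circ> e) i) \<otimes>\<^bsub>H'\<^esub> t.hr x' ((g \<circ> e) j)) k \<otimes>\<^bsub>R\<^esub>
        p' ((f \<circ> d) i \<otimes>\<^bsub>H'\<^esub> (f \<circ> d) j) k')"
      by (rule h.finsum2_cong) (use u F(2) G(2) in simp_all)
    finally show "p' (x \<otimes>\<^bsub>H'\<^esub> x') (k \<otimes>\<^bsub>K'\<^esub> k') = (\<Oplus>\<^bsub>R\<^esub>i\<in>{..<n}. \<Oplus>\<^bsub>R\<^esub>j\<in>{..<n}. p' (t.hr x ((g \<circ> e) i) \<otimes>\<^bsub>H'\<^esub> t.hr x' ((g \<circ> e) j)) k \<otimes>\<^bsub>R\<^esub>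
        p' ((f \<circ> d) i \<otimes>\<^bsub>H'\<^esub> (f \<circ> d) j) k')" .
  next
    fix x k assume "x \<in> carrier H'" "k \<in> carrier K'"
    then obtain u c where u: "u \<in> carrier H" "c \<in> carrier K" "x = f u" "k = g c" by (metis ob)
    have "(\<Oplus>\<^bsub>R\<^esub>j\<in>{..<n}. p' (f (S (inv_into (carrier H) f (t.hr x ((g \<circ> e) j)))) \<otimes>\<^bsub>H'\<^esub> (f \<circ> d) j) k) =
      (\<Oplus>\<^bsub>R\<^esub>j\<in>{..<n}. p (S (h.hr u (e j)) \<otimes>\<^bsub>H\<^esub> d j) c)"
      using u by (intro h.R.finsum_cong') auto
    then show "(\<Oplus>\<^bsub>R\<^esub>j\<in>{..<n}. p' (f (S (inv_into (carrier H) f (t.hr x ((g \<circ> e) j)))) \<otimes>\<^bsub>H'\<^esub> (f \<circ> d) j) k) =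
      p' x \<one>\<^bsub>K'\<^esub> \<otimes>\<^bsub>R\<^esub> p' \<one>\<^bsub>H'\<^esub> k" using u h.left_antipode by simp
    have "(\<Oplus>\<^bsub>R\<^esub>j\<in>{..<n}. p' ((f \<circ> d) j \<otimes>\<^bsub>H'\<^esub> f (S (inv_into (carrier H) f (t.hl ((g \<circ> e) j) x)))) k) =
      (\<Oplus>\<^bsub>R\<^esub>j\<in>{..<n}. p (d j \<otimes>\<^bsub>H\<^esub> S (h.hl (e j) u)) c)"
      using u by (intro h.R.finsum_cong') auto
    then show "(\<Oplus>\<^bsub>R\<^esub>j\<in>{..<n}. p' ((f \<circ> d) j \<otimes>\<^bsub>H'\<^esub> f (S (inv_into (carrier H) f (t.hl ((g \<circ> e) j) x)))) k) =
      p' x \<one>\<^bsub>K'\<^esub> \<otimes>\<^bsub>R\<^esub> p' \<one>\<^bsub>H'\<^esub> k" using u h.right_antipode by simp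
  qed (auto elim!: ob simp: h.unit_left h.unit_right h.unit_unit)
qed

text \<open>Compatibility with the coproducts is automatic: each of them is the transpose of a
  multiplication, and \<open>g\<close> respects these multiplications.\<close>

lemma hopf_isomorphic_transport:
  assumes h: "dual_hopf R H K p n d e S" and C: "dual_coalg R H K p n d e"
    and f: "alg_iso R H H' f" and g: "alg_iso R K K' g"
    and p': "\<And>h k. h \<in> carrier H \<Longrightarrow> k \<in> carrier K \<Longrightarrow> p' (f h) (g k) = p h k"
    and C': "dual_coalg R H' K' p' n (f \<circ> d) (g \<circ> e)"
  shows "hopf_isomorphic R H H'"
proof -
  let ?S' = "\<lambda>x. f (S (inv_into (carrier H) f x))"
  interpret h: dual_hopf_coalg R H K p n d e S by (rule dual_hopf_coalg.intro[OF h C])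
  interpret t: dual_hopf_coalg R H' K' p' n "f \<circ> d" "g \<circ> e" ?S'
    by (rule dual_hopf_coalg.intro[OF dual_hopf_transport[OF h f g p'] C'])
  note F = alg_isoD[OF f] and G = alg_isoD[OF g]
  note ob = alg_iso_obtain[OF f] alg_iso_obtain[OF g]
  have ff: "bilin R h.V h.V t.VV (\<lambda>y z. pure2 R H' (f y) (f z))"
    by (rule bilin_compose[OF pure_bilin[OF t.V_sym t.V_sym] alg_iso_lin[OF f] alg_iso_lin[OF f]])
  note l = tensor_lift_lin[OF h.V_sym h.V_sym t.VV_sym ff] bilin_lift(1)[OF h.V_sym h.V_sym t.VV_sym ff]
  have P: "t.P2 (g k) (g k') (tensor_lift t.VV (\<lambda>y z. pure2 R H' (f y) (f z)) s) = h.P2 k k' s"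
    if k: "k \<in> carrier K" "k' \<in> carrier K" and s: "s \<in> carrier h.VV" for k k' s
    by (rule tensor_lin_eqI[OF h.V_sym h.V_sym sym_modD(2)[OF h.R_sym] lin_compose[OF l(1) t.P2_lin] h.P2_lin[OF k] _ s])
       (use k F(2) G(2) in \<open>simp_all add: l(2) p'\<close>)
  have "f \<in> hopf_hom R H H'"
    unfolding hopf_hom_def linear_maps_iff[OF h.V_sym t.V_sym]
  proof (intro CollectI conjI ballI allI impI)
    show "lin R h.V t.V f" by (rule alg_iso_lin[OF f])
    show "f (x \<otimes>\<^bsub>H\<^esub> y) = f x \<otimes>\<^bsub>H'\<^esub> f y" if "x \<in> carrier H" "y \<in> carrier H" for x y
      using F(4)[OF that] by simp
    show "f \<one>\<^bsub>H\<^esub> = \<one>\<^bsub>H'\<^esub>" using F(5) by simp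
    fix x assume x: "x \<in> carrier H"
    show "comult H' (f x) = tensor_lift t.VV (\<lambda>y z. pure2 R H' (f y) (f z)) (comult H x)"
    proof (rule t.tensor2_eqI)
      show "comult H' (f x) \<in> carrier t.VV" using F(2)[OF x] t.comult_closed by simp
      show "tensor_lift t.VV (\<lambda>y z. pure2 R H' (f y) (f z)) (comult H x) \<in> carrier t.VV"
        using linD(2)[OF l(1)] h.comult_closed[OF x] by blast
      fix k k' assume "k \<in> carrier K'" "k' \<in> carrier K'"
      then obtain c c' where c: "c \<in> carrier K" "c' \<in> carrier K" "k = g c" "k' = g c'" by (metis ob)
      show "t.P2 k k' (comult H' (f x)) = t.P2 k k' (tensor_lift t.VV (\<lambda>y z. pure2 R H' (f y) (f z)) (comult H x))"
        using c x F(2) G(2) P[OF c(1,2) h.comult_closed[OF x]] by (simp add: t.P2_comult h.P2_comult G(4) p')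
    qed
    show "counit H' (f x) = counit H x" using x F(2) by (simp add: t.counit h.counit G(5) p')
    fix S1 S2 assume S: "antipode R H S1" "antipode R H' S2"
    have "S1 x = S x" using x S by (intro antipode_unique[OF h.H h.coalgebra _ h.antipode]) auto
    moreover have "S2 (f x) = ?S' (f x)" using S x F(2) by (intro antipode_unique[OF t.H t.coalgebra _ t.antipode]) auto
    ultimately show "f (S1 x) = S2 (f x)" using alg_iso_inv_lin(2)[OF h.H f x] by simp
  qed
  then show ?thesis unfolding hopf_isomorphic_def
    using h.hopf_algebra t.hopf_algebra F(1) by blast
qed

text \<open>The description has a value because the transpose of the multiplication of
  \<open>K\<close> exists, and it has only one by \<open>tensor2_eqI\<close>.\<close>

lemma (in dual_alg) dual_coalgI:
  assumes comult: "\<And>h. h \<in> carrier H \<Longrightarrow> comult H h = (THE t. t \<in> carrier (tensor2 R H) \<and>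
      (\<forall>c\<in>carrier K. \<forall>c'\<in>carrier K. p h (c \<otimes>\<^bsub>K\<^esub> c') = tensor_lift R (\<lambda>u v. p u c \<otimes> p v c') t))"
    and counit: "\<And>h. h \<in> carrier H \<Longrightarrow> counit H h = p h \<one>\<^bsub>K\<^esub>"
  shows "dual_coalg R H K p n d e"
proof unfold_locales
  interpret s: dual_alg R K H "\<lambda>k h. p h k" n e d by (rule dual_alg_swap)
  interpret TH: abelian_group VV by (rule sym_modD[OF VV_sym])
  fix h assume h: "h \<in> carrier H"
  \<comment> \<open>The witness is what \<open>rslice_expand\<close> predicts: the right slices of
    the coproduct sought are the elements \<open>hr h (e i)\<close>.\<close>
  let ?t = "\<Oplus>\<^bsub>VV\<^esub>i\<in>{..<n}. pure2 R H (hr h (e i)) (d i)"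
  have cl: "(\<lambda>i. pure2 R H (hr h (e i)) (d i)) \<in> {..<n} \<rightarrow> carrier VV" using h by (simp add: tensor_simps)
  have t: "?t \<in> carrier VV" by (rule TH.finsum_closed[OF cl])
  have P: "P2 c c' ?t = p h (c \<otimes>\<^bsub>K\<^esub> c')" if c: "c \<in> carrier K" "c' \<in> carrier K" for c c'
  proof -
    have "P2 c c' ?t = (\<Oplus>i\<in>{..<n}. P2 c c' (pure2 R H (hr h (e i)) (d i)))"
      unfolding finsum_RR[symmetric] by (rule lin_finsum[OF VV_sym R_sym P2_lin[OF c] cl])
    also have "\<dots> = (\<Oplus>i\<in>{..<n}. p (d i) c' \<otimes> p h (c \<otimes>\<^bsub>K\<^esub> e i))"
      by (rule finsum_cong') (use c h in \<open>simp_all add: p_hr R.m_comm Pi_def\<close>)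
    also have "\<dots> = p h (c \<otimes>\<^bsub>K\<^esub> c')"
      by (rule s.form_expand[symmetric])
         (use c h in \<open>auto intro!: linI simp: K.r_distr p_add_right K_smult_mult p_smult_right id_apply\<close>)
    finally show ?thesis .
  qed
  have "comult H h = ?t" unfolding comult[OF h]
  proof (rule the_equality)
    fix s assume s: "s \<in> carrier VV \<and> (\<forall>c\<in>carrier K. \<forall>c'\<in>carrier K.
      p h (c \<otimes>\<^bsub>K\<^esub> c') = tensor_lift R (\<lambda>u v. p u c \<otimes> p v c') s)"
    show "s = ?t" by (rule tensor2_eqI[OF conjunct1[OF s] t]) (use s P in \<open>simp add: P2_def\<close>)
  qed (use t P in \<open>simp add: P2_def\<close>)
  then show "comult H h \<in> carrier VV" 
    and "\<And>c c'. c \<in> carrier K \<Longrightarrow> c' \<in> carrier K \<Longrightarrow> P2 c c' (comult H h) = p h (c \<otimes>\<^bsub>K\<^esub> c')"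
    using t P by simp_all
  show "counit H h = p h \<one>\<^bsub>K\<^esub>" by (rule counit[OF h])
qed

text \<open>Exchanges forms that agree on the carriers. Since \<open>P2\<close> is built from the
  form as a total function, its two versions are compared on pure tensors.\<close>

lemma dual_coalg_cong:
  assumes "dual_coalg R H K p n d e" and "dual_alg R H K p' n d e"
    and eq: "\<And>h k. h \<in> carrier H \<Longrightarrow> k \<in> carrier K \<Longrightarrow> p' h k = p h k"
  shows "dual_coalg R H K p' n d e"
proof -
  interpret c: dual_coalg R H K p n d e by fact
  interpret c': dual_alg R H K p' n d e by fact
  have "c'.P2 k k' t = c.P2 k k' t" if k: "k \<in> carrier K" "k' \<in> carrier K" and t: "t \<in> carrier c.VV" for k k' t
    by (rule tensor_lin_eqI[OF c.V_sym c.V_sym sym_modD(2)[OF c.R_sym] c'.P2_lin[OF k] c.P2_lin[OF k] _ t])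
       (use k in \<open>simp_all add: eq\<close>)
  then show ?thesis
    by unfold_locales (use c.comult_closed c.P2_comult c.counit eq in \<open>simp_all\<close>)
qed

section \<open>Maschke's argument for Frobenius algebras\<close>

definition subspace_of :: "'r ring \<Rightarrow> ('r, 'a, 'p) module_scheme \<Rightarrow> 'a set \<Rightarrow> bool" where
  "subspace_of R H J \<longleftrightarrow> J \<subseteq> carrier H \<and> \<zero>\<^bsub>H\<^esub> \<in> J \<and> (\<forall>x\<in>J. \<forall>y\<in>J. x \<oplus>\<^bsub>H\<^esub> y \<in> J) \<and>
     (\<forall>r\<in>carrier R. \<forall>x\<in>J. r \<odot>\<^bsub>H\<^esub> x \<in> J)"

text \<open>Complements without bases or dimensions: the vectors of the finite set \<open>T\<close>
  are adjoined to \<open>J\<close> one by one, each time that \<open>I + J\<close> does not contain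
  the next one yet.\<close>

lemma subspace_complement:
  assumes "field R" "module R H" and I: "subspace_of R H I" and T: "finite T" "T \<subseteq> carrier H"
  shows "\<exists>J. subspace_of R H J \<and> I \<inter> J = {\<zero>\<^bsub>H\<^esub>} \<and> (\<forall>x\<in>T. \<exists>i\<in>I. \<exists>j\<in>J. x = i \<oplus>\<^bsub>H\<^esub> j)"
proof -
  interpret R: field R by fact
  interpret H: abelian_group H using assms(2) by (simp add: module_def)
  interpret HM: module R H by fact
  have I': "I \<subseteq> carrier H" "\<zero>\<^bsub>H\<^esub> \<in> I" "\<And>x y. x \<in> I \<Longrightarrow> y \<in> I \<Longrightarrow> x \<oplus>\<^bsub>H\<^esub> y \<in> I"
    "\<And>r x. r \<in> carrier R \<Longrightarrow> x \<in> I \<Longrightarrow> r \<odot>\<^bsub>H\<^esub> x \<in> I" using I by (auto simp: subspace_of_def)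
  show ?thesis using T
  proof (induction T)
    case empty
    show ?case by (rule exI[of _ "{\<zero>\<^bsub>H\<^esub>}"]) (use I' in \<open>auto simp: subspace_of_def\<close>)
  next
    case (insert t T)
    then obtain J where J: "subspace_of R H J" "I \<inter> J = {\<zero>\<^bsub>H\<^esub>}" "\<And>x. x \<in> T \<Longrightarrow> \<exists>i\<in>I. \<exists>j\<in>J. x = i \<oplus>\<^bsub>H\<^esub> j"
      by auto
    have J': "J \<subseteq> carrier H" "\<zero>\<^bsub>H\<^esub> \<in> J" "\<And>x y. x \<in> J \<Longrightarrow> y \<in> J \<Longrightarrow> x \<oplus>\<^bsub>H\<^esub> y \<in> J"
      "\<And>r x. r \<in> carrier R \<Longrightarrow> x \<in> J \<Longrightarrow> r \<odot>\<^bsub>H\<^esub> x \<in> J" using J by (auto simp: subspace_of_def)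
    have t: "t \<in> carrier H" using insert by auto
    show ?case
    proof (cases "\<exists>i\<in>I. \<exists>j\<in>J. t = i \<oplus>\<^bsub>H\<^esub> j")
      case True
      then show ?thesis using J by blast
    next
      case False
      let ?J = "{j \<oplus>\<^bsub>H\<^esub> r \<odot>\<^bsub>H\<^esub> t | j r. j \<in> J \<and> r \<in> carrier R}"
      have "subspace_of R H ?J" unfolding subspace_of_def
      proof (intro conjI ballI)
        show "?J \<subseteq> carrier H" using J'(1) t by auto
        show "\<zero>\<^bsub>H\<^esub> \<in> ?J" using J'(2) t by (auto intro!: exI[of _ "\<zero>\<^bsub>H\<^esub>"] exI[of _ "\<zero>\<^bsub>R\<^esub>"])
        fix x assume x: "x \<in> ?J"
        then obtain j r where jr: "j \<in> J" "r \<in> carrier R" "x = j \<oplus>\<^bsub>H\<^esub> r \<odot>\<^bsub>H\<^esub> t" by auto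
        show "s \<odot>\<^bsub>H\<^esub> x \<in> ?J" if s: "s \<in> carrier R" for s
          using jr J' t s by (auto intro!: exI[of _ "s \<odot>\<^bsub>H\<^esub> j"] exI[of _ "s \<otimes>\<^bsub>R\<^esub> r"] simp: HM.smult_r_distr HM.smult_assoc1 subsetD[OF J'(1)])
        fix y assume y: "y \<in> ?J"
        then obtain j' r' where jr': "j' \<in> J" "r' \<in> carrier R" "y = j' \<oplus>\<^bsub>H\<^esub> r' \<odot>\<^bsub>H\<^esub> t" by auto
        have "x \<oplus>\<^bsub>H\<^esub> y = (j \<oplus>\<^bsub>H\<^esub> j') \<oplus>\<^bsub>H\<^esub> (r \<oplus>\<^bsub>R\<^esub> r') \<odot>\<^bsub>H\<^esub> t"
          using jr jr' t subsetD[OF J'(1)] by (simp add: HM.smult_l_distr H.a_ac)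
        then show "x \<oplus>\<^bsub>H\<^esub> y \<in> ?J" using jr jr' J'(3) by blast
      qed
      moreover have "I \<inter> ?J = {\<zero>\<^bsub>H\<^esub>}"
      proof
        show "{\<zero>\<^bsub>H\<^esub>} \<subseteq> I \<inter> ?J" using \<open>subspace_of R H ?J\<close> I' by (auto simp only: subspace_of_def)
        show "I \<inter> ?J \<subseteq> {\<zero>\<^bsub>H\<^esub>}"
        proof
          fix x assume "x \<in> I \<inter> ?J"
          then obtain j r where x: "x \<in> I" "j \<in> J" "r \<in> carrier R" "x = j \<oplus>\<^bsub>H\<^esub> r \<odot>\<^bsub>H\<^esub> t" by auto
          note c = subsetD[OF I'(1) x(1)] subsetD[OF J'(1) x(2)]
          \<comment> \<open>A nonzero coefficient \<open>r\<close> could be inverted, and then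
            \<open>t\<close> would already lie in \<open>I + J\<close>.\<close>
          have "r = \<zero>\<^bsub>R\<^esub>"
          proof (rule ccontr)
            assume r0: "r \<noteq> \<zero>\<^bsub>R\<^esub>"
            define r' where "r' = inv\<^bsub>R\<^esub> r"
            have r': "r' \<in> carrier R" "r' \<otimes>\<^bsub>R\<^esub> r = \<one>\<^bsub>R\<^esub>"
              using x(3) r0 R.field_Units unfolding r'_def by auto
            have "r \<odot>\<^bsub>H\<^esub> t = x \<oplus>\<^bsub>H\<^esub> \<ominus>\<^bsub>H\<^esub> j" using x c t 
              by (simp add: H.a_comm H.a_assoc[symmetric] H.r_neg1 H.r_neg H.l_neg)
            also have "\<ominus>\<^bsub>H\<^esub> j = (\<ominus>\<^bsub>R\<^esub> \<one>\<^bsub>R\<^esub>) \<odot>\<^bsub>H\<^esub> j" using c by (simp add: HM.smult_l_minus)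
            finally have "r' \<odot>\<^bsub>H\<^esub> (r \<odot>\<^bsub>H\<^esub> t) = r' \<odot>\<^bsub>H\<^esub> x \<oplus>\<^bsub>H\<^esub> r' \<odot>\<^bsub>H\<^esub> ((\<ominus>\<^bsub>R\<^esub> \<one>\<^bsub>R\<^esub>) \<odot>\<^bsub>H\<^esub> j)"
              using c r' by (simp add: HM.smult_r_distr)
            then have "t = r' \<odot>\<^bsub>H\<^esub> x \<oplus>\<^bsub>H\<^esub> r' \<odot>\<^bsub>H\<^esub> ((\<ominus>\<^bsub>R\<^esub> \<one>\<^bsub>R\<^esub>) \<odot>\<^bsub>H\<^esub> j)"
              using r' x t by (simp add: HM.smult_assoc1[symmetric])
            moreover have "r' \<odot>\<^bsub>H\<^esub> x \<in> I" "r' \<odot>\<^bsub>H\<^esub> ((\<ominus>\<^bsub>R\<^esub> \<one>\<^bsub>R\<^esub>) \<odot>\<^bsub>H\<^esub> j) \<in> J"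
              using x r' I'(4) J'(4) by auto
            ultimately show False using False by blast
          qed
          then have "x = j" using x c t by simp
          then show "x \<in> {\<zero>\<^bsub>H\<^esub>}" using x J(2) by blast
        qed
      qed
      moreover have "\<exists>i\<in>I. \<exists>j\<in>?J. x = i \<oplus>\<^bsub>H\<^esub> j" if x: "x \<in> insert t T" for x
      proof (cases "x = t")
        case True
        have "t = \<zero>\<^bsub>H\<^esub> \<oplus>\<^bsub>H\<^esub> (\<zero>\<^bsub>H\<^esub> \<oplus>\<^bsub>H\<^esub> \<one>\<^bsub>R\<^esub> \<odot>\<^bsub>H\<^esub> t)" using t by simp
        then show ?thesis unfolding True using I'(2) J'(2) by blast
      next
        case False
        then obtain i j where ij: "i \<in> I" "j \<in> J" "x = i \<oplus>\<^bsub>H\<^esub> j" using J(3) x by blast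
        have "j = j \<oplus>\<^bsub>H\<^esub> \<zero>\<^bsub>R\<^esub> \<odot>\<^bsub>H\<^esub> t" using t subsetD[OF J'(1) ij(2)] by simp
        then have "j \<in> ?J" using ij by blast
        then show ?thesis using ij by blast
      qed
      ultimately show ?thesis by (intro exI[of _ ?J]) blast
    qed
  qed
qed

text \<open>\<open>\<tau>\<close> is a Frobenius functional with dual bases \<open>s\<close> and
  \<open>t\<close>. A linear projection \<open>\<pi>\<close> onto a left ideal is averaged to
  \<open>\<rho> h = \<Sum> s\<^sub>i \<pi>(t\<^sub>i h)\<close>, which commutes with left
  multiplication, has values in the ideal and is multiplication by \<open>c\<close> on it. Its
  kernel is the complement sought.\<close>

lemma semisimple_if_frobenius:
  assumes R: "field R" and A: "assoc_algebra R H"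
    and s: "\<And>i. i < n \<Longrightarrow> s i \<in> carrier H" and t: "\<And>i. i < n \<Longrightarrow> t i \<in> carrier H"
    and \<tau>: "\<And>h. h \<in> carrier H \<Longrightarrow> \<tau> h \<in> carrier R"
    and expand_t: "\<And>h. h \<in> carrier H \<Longrightarrow> (\<Oplus>\<^bsub>H\<^esub>i\<in>{..<n::nat}. \<tau> (h \<otimes>\<^bsub>H\<^esub> s i) \<odot>\<^bsub>H\<^esub> t i) = h"
    and expand_s: "\<And>h. h \<in> carrier H \<Longrightarrow> (\<Oplus>\<^bsub>H\<^esub>i\<in>{..<n}. \<tau> (t i \<otimes>\<^bsub>H\<^esub> h) \<odot>\<^bsub>H\<^esub> s i) = h"
    and casimir: "(\<Oplus>\<^bsub>H\<^esub>i\<in>{..<n}. s i \<otimes>\<^bsub>H\<^esub> t i) = c \<odot>\<^bsub>H\<^esub> \<one>\<^bsub>H\<^esub>"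
    and c: "c \<in> carrier R" "c \<noteq> \<zero>\<^bsub>R\<^esub>"
  shows "semisimple_ring H"
  unfolding semisimple_ring_def
proof (intro conjI allI impI)
  interpret R: field R by fact
  interpret H: ring H using A by (simp add: assoc_algebra_def)
  interpret HM: module R H using A by (simp add: assoc_algebra_def)
  show "ring H" by (rule H.ring_axioms)
  have sm: "(r \<odot>\<^bsub>H\<^esub> x) \<otimes>\<^bsub>H\<^esub> y = r \<odot>\<^bsub>H\<^esub> (x \<otimes>\<^bsub>H\<^esub> y)" "x \<otimes>\<^bsub>H\<^esub> (r \<odot>\<^bsub>H\<^esub> y) = r \<odot>\<^bsub>H\<^esub> (x \<otimes>\<^bsub>H\<^esub> y)"
    if "r \<in> carrier R" "x \<in> carrier H" "y \<in> carrier H" for r x y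
    using A that by (auto simp: assoc_algebra_def)
  define c' where "c' = inv\<^bsub>R\<^esub> c"
  have c': "c' \<in> carrier R" "c' \<otimes>\<^bsub>R\<^esub> c = \<one>\<^bsub>R\<^esub>" using c R.field_Units unfolding c'_def by auto
  fix I assume LI: "left_ideal I H"
  then interpret I: additive_subgroup I H by (simp add: left_ideal_def)
  have Im: "h \<otimes>\<^bsub>H\<^esub> x \<in> I" if "h \<in> carrier H" "x \<in> I" for h x using LI that by (auto simp: left_ideal_def)
  note Ic = I.a_subset[THEN subsetD]
  \<comment> \<open>Left ideals are subspaces because scalars act as multiples of the unit.\<close>
  have Is: "r \<odot>\<^bsub>H\<^esub> x \<in> I" if "r \<in> carrier R" "x \<in> I" for r x
    using Im[of "r \<odot>\<^bsub>H\<^esub> \<one>\<^bsub>H\<^esub>" x] that Ic by (simp add: sm)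
  have Isub: "subspace_of R H I" using Ic Is by (auto simp: subspace_of_def)
  obtain J where J: "subspace_of R H J" "I \<inter> J = {\<zero>\<^bsub>H\<^esub>}"
    "\<And>x. x \<in> t ` {..<n} \<Longrightarrow> \<exists>i\<in>I. \<exists>j\<in>J. x = i \<oplus>\<^bsub>H\<^esub> j"
    using subspace_complement[OF R HM.module_axioms Isub, of "t ` {..<n}"] t by (metis finite_imageI finite_lessThan image_subsetI lessThan_iff)
  have J': "J \<subseteq> carrier H" "\<zero>\<^bsub>H\<^esub> \<in> J" "\<And>x y. x \<in> J \<Longrightarrow> y \<in> J \<Longrightarrow> x \<oplus>\<^bsub>H\<^esub> y \<in> J"
    "\<And>r x. r \<in> carrier R \<Longrightarrow> x \<in> J \<Longrightarrow> r \<odot>\<^bsub>H\<^esub> x \<in> J" using J by (auto simp: subspace_of_def)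
  have ex: "\<exists>i\<in>I. \<exists>j\<in>J. h = i \<oplus>\<^bsub>H\<^esub> j" if h: "h \<in> carrier H" for h
  proof -
    have addc: "\<exists>i\<in>I. \<exists>j\<in>J. u \<oplus>\<^bsub>H\<^esub> v = i \<oplus>\<^bsub>H\<^esub> j" 
      if uv: "\<exists>i\<in>I. \<exists>j\<in>J. u = i \<oplus>\<^bsub>H\<^esub> j" "\<exists>i\<in>I. \<exists>j\<in>J. v = i \<oplus>\<^bsub>H\<^esub> j" for u v
    proof -
      obtain i j i' j' where "i \<in> I" "j \<in> J" "i' \<in> I" "j' \<in> J" "u = i \<oplus>\<^bsub>H\<^esub> j" "v = i' \<oplus>\<^bsub>H\<^esub> j'"
        using uv by auto
      moreover from this have "u \<oplus>\<^bsub>H\<^esub> v = (i \<oplus>\<^bsub>H\<^esub> i') \<oplus>\<^bsub>H\<^esub> (j \<oplus>\<^bsub>H\<^esub> j')"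
        using Ic subsetD[OF J'(1)] by (simp add: H.a_ac)
      ultimately show ?thesis using J'(3) by blast
    qed
    have "\<exists>i\<in>I. \<exists>j\<in>J. (\<Oplus>\<^bsub>H\<^esub>i\<in>{..<m}. \<tau> (h \<otimes>\<^bsub>H\<^esub> s i) \<odot>\<^bsub>H\<^esub> t i) = i \<oplus>\<^bsub>H\<^esub> j" if "m \<le> n" for m
      using that
    proof (induction m)
      case 0
      then show ?case using J'(2) I.zero_closed by (auto intro!: bexI[of _ "\<zero>\<^bsub>H\<^esub>"])
    next
      case (Suc m)
      have r: "\<tau> (h \<otimes>\<^bsub>H\<^esub> s m) \<in> carrier R" using Suc h s \<tau> by simp
      obtain i j where ij: "i \<in> I" "j \<in> J" "t m = i \<oplus>\<^bsub>H\<^esub> j" using J(3)[of "t m"] Suc by auto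
      have "\<tau> (h \<otimes>\<^bsub>H\<^esub> s m) \<odot>\<^bsub>H\<^esub> t m = \<tau> (h \<otimes>\<^bsub>H\<^esub> s m) \<odot>\<^bsub>H\<^esub> i \<oplus>\<^bsub>H\<^esub> \<tau> (h \<otimes>\<^bsub>H\<^esub> s m) \<odot>\<^bsub>H\<^esub> j"
        using r ij Ic subsetD[OF J'(1)] by (simp add: HM.smult_r_distr)
      then have e: "\<exists>i\<in>I. \<exists>j\<in>J. \<tau> (h \<otimes>\<^bsub>H\<^esub> s m) \<odot>\<^bsub>H\<^esub> t m = i \<oplus>\<^bsub>H\<^esub> j" using r ij Is J'(4) by blast
      have "(\<Oplus>\<^bsub>H\<^esub>i\<in>{..<Suc m}. \<tau> (h \<otimes>\<^bsub>H\<^esub> s i) \<odot>\<^bsub>H\<^esub> t i) = 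
         \<tau> (h \<otimes>\<^bsub>H\<^esub> s m) \<odot>\<^bsub>H\<^esub> t m \<oplus>\<^bsub>H\<^esub> (\<Oplus>\<^bsub>H\<^esub>i\<in>{..<m}. \<tau> (h \<otimes>\<^bsub>H\<^esub> s i) \<odot>\<^bsub>H\<^esub> t i)"
        unfolding lessThan_Suc using Suc.prems h s t \<tau> by (intro H.finsum_insert) auto
      then show ?case using addc[OF e Suc.IH] Suc.prems by simp
    qed
    from this[OF le_refl] show ?thesis using expand_t[OF h] by simp
  qed
  have uniq: "i = i'" if "i \<in> I" "i' \<in> I" "j \<in> J" "j' \<in> J" "i \<oplus>\<^bsub>H\<^esub> j = i' \<oplus>\<^bsub>H\<^esub> j'" for i i' j j'
  proof -
    have cl: "i \<in> carrier H" "i' \<in> carrier H" "j \<in> carrier H" "j' \<in> carrier H" using that Ic J'(1) by auto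
    have nj: "\<ominus>\<^bsub>H\<^esub> j \<in> J" using J'(4)[of "\<ominus>\<^bsub>R\<^esub> \<one>\<^bsub>R\<^esub>" j] that cl by (simp add: HM.smult_l_minus)
    have "i \<ominus>\<^bsub>H\<^esub> i' = j' \<ominus>\<^bsub>H\<^esub> j"
    proof -
      have "i \<ominus>\<^bsub>H\<^esub> i' = (i \<oplus>\<^bsub>H\<^esub> j) \<oplus>\<^bsub>H\<^esub> (\<ominus>\<^bsub>H\<^esub> j \<oplus>\<^bsub>H\<^esub> \<ominus>\<^bsub>H\<^esub> i')" 
        using cl by (simp add: H.minus_eq H.a_assoc H.r_neg1 H.r_neg2)
      also have "\<dots> = (i' \<oplus>\<^bsub>H\<^esub> j') \<oplus>\<^bsub>H\<^esub> (\<ominus>\<^bsub>H\<^esub> i' \<oplus>\<^bsub>H\<^esub> \<ominus>\<^bsub>H\<^esub> j)" 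
        using that(5) cl by (simp add: H.a_comm)
      also have "\<dots> = j' \<ominus>\<^bsub>H\<^esub> j" 
        using cl by (simp add: H.minus_eq H.a_assoc H.a_comm[of i' j'] H.r_neg1 H.r_neg2)
      finally show ?thesis .
    qed
    moreover have "i \<ominus>\<^bsub>H\<^esub> i' \<in> I" unfolding H.minus_eq using that by (simp add: I.a_closed I.a_inv_closed)
    moreover have "j' \<ominus>\<^bsub>H\<^esub> j \<in> J" unfolding H.minus_eq using that nj J'(3) by simp
    ultimately have "i \<ominus>\<^bsub>H\<^esub> i' = \<zero>\<^bsub>H\<^esub>" using J(2) by auto
    then show ?thesis using cl by simp
  qed
  \<comment> \<open>The projection onto \<open>I\<close> along \<open>J\<close>, well defined by
    \<open>uniq\<close>.\<close>
  define \<pi> where "\<pi> h = (THE i. i \<in> I \<and> (\<exists>j\<in>J. h = i \<oplus>\<^bsub>H\<^esub> j))" for h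
  have \<pi>_eq: "\<pi> (i \<oplus>\<^bsub>H\<^esub> j) = i" if "i \<in> I" "j \<in> J" for i j
    unfolding \<pi>_def by (rule the_equality) (use that uniq in blast)+
  have \<pi>_I: "\<pi> h \<in> I" if "h \<in> carrier H" for h using ex[OF that] \<pi>_eq by auto
  have \<pi>_fix: "\<pi> x = x" if "x \<in> I" for x using \<pi>_eq[OF that J'(2)] Ic[OF that] by simp
  have \<pi>_lin: "lin R (sym_bimod H) (sym_bimod H) \<pi>"
  proof (rule linI)
    show "\<pi> x \<in> carrier (sym_bimod H)" if "x \<in> carrier (sym_bimod H)" for x using \<pi>_I that Ic by simp
    fix x assume x: "x \<in> carrier (sym_bimod H)"
    then obtain i j where ij: "i \<in> I" "j \<in> J" "x = i \<oplus>\<^bsub>H\<^esub> j" using ex[of x] by auto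
    note cl = Ic[OF ij(1)] subsetD[OF J'(1) ij(2)]
    show "\<pi> (lact (sym_bimod H) r x) = lact (sym_bimod H) r (\<pi> x)" if "r \<in> carrier R" for r
      using ij cl that \<pi>_eq Is J'(4) by (simp add: HM.smult_r_distr)
    fix y assume y: "y \<in> carrier (sym_bimod H)"
    then obtain i' j' where ij': "i' \<in> I" "j' \<in> J" "y = i' \<oplus>\<^bsub>H\<^esub> j'" using ex[of y] by auto
    note cl' = Ic[OF ij'(1)] subsetD[OF J'(1) ij'(2)]
    have "x \<oplus>\<^bsub>H\<^esub> y = (i \<oplus>\<^bsub>H\<^esub> i') \<oplus>\<^bsub>H\<^esub> (j \<oplus>\<^bsub>H\<^esub> j')" using ij ij' cl cl' by (simp add: H.a_ac)
    then have "\<pi> (x \<oplus>\<^bsub>H\<^esub> y) = i \<oplus>\<^bsub>H\<^esub> i'" using ij ij' \<pi>_eq J'(3) by (simp add: I.a_closed)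
    then show "\<pi> (x \<oplus>\<^bsub>sym_bimod H\<^esub> y) = \<pi> x \<oplus>\<^bsub>sym_bimod H\<^esub> \<pi> y" using ij ij' \<pi>_eq by simp
  qed
  note \<pi>_cl = linD(2)[OF \<pi>_lin, simplified] and \<pi>_add = linD(3)[OF \<pi>_lin, simplified] and \<pi>_sm = linD(4)[OF \<pi>_lin, simplified]
  define \<rho> where "\<rho> h = (\<Oplus>\<^bsub>H\<^esub>i\<in>{..<n}. s i \<otimes>\<^bsub>H\<^esub> \<pi> (t i \<otimes>\<^bsub>H\<^esub> h))" for h
  have \<rho>_cl: "\<rho> h \<in> carrier H" if "h \<in> carrier H" for h
    unfolding \<rho>_def using that s t \<pi>_cl by (intro H.finsum_closed) auto
  have sumI: "(\<Oplus>\<^bsub>H\<^esub>i\<in>{..<m}. u i) \<in> I" if "\<And>i. i < m \<Longrightarrow> u i \<in> I" for m :: nat and u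
    using that
  proof (induction m)
    case (Suc m)
    have "(\<Oplus>\<^bsub>H\<^esub>i\<in>{..<Suc m}. u i) = u m \<oplus>\<^bsub>H\<^esub> (\<Oplus>\<^bsub>H\<^esub>i\<in>{..<m}. u i)"
      unfolding lessThan_Suc using Suc.prems Ic by (intro H.finsum_insert) auto
    then show ?case using Suc by (simp add: I.a_closed)
  qed simp
  have \<rho>_I: "\<rho> h \<in> I" if "h \<in> carrier H" for h
    unfolding \<rho>_def using that s t \<pi>_I Im by (intro sumI) auto
  have \<rho>_fix: "\<rho> x = c \<odot>\<^bsub>H\<^esub> x" if x: "x \<in> I" for x
  proof -
    have "\<rho> x = (\<Oplus>\<^bsub>H\<^esub>i\<in>{..<n}. s i \<otimes>\<^bsub>H\<^esub> t i \<otimes>\<^bsub>H\<^esub> x)"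
      unfolding \<rho>_def using x s t Ic[OF x] by (intro H.finsum_cong') (auto simp: \<pi>_fix Im H.m_assoc)
    also have "\<dots> = c \<odot>\<^bsub>H\<^esub> x" using s t Ic[OF x] casimir c by (simp add: H.finsum_ldistr[symmetric] Pi_def sm)
    finally show ?thesis .
  qed
  have \<rho>_add: "\<rho> (x \<oplus>\<^bsub>H\<^esub> y) = \<rho> x \<oplus>\<^bsub>H\<^esub> \<rho> y" if "x \<in> carrier H" "y \<in> carrier H" for x y
  proof -
    have "\<rho> (x \<oplus>\<^bsub>H\<^esub> y) = (\<Oplus>\<^bsub>H\<^esub>i\<in>{..<n}. s i \<otimes>\<^bsub>H\<^esub> \<pi> (t i \<otimes>\<^bsub>H\<^esub> x) \<oplus>\<^bsub>H\<^esub> s i \<otimes>\<^bsub>H\<^esub> \<pi> (t i \<otimes>\<^bsub>H\<^esub> y))"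
      unfolding \<rho>_def using that s t \<pi>_cl by (intro H.finsum_cong') (auto simp: H.r_distr \<pi>_add)
    also have "\<dots> = \<rho> x \<oplus>\<^bsub>H\<^esub> \<rho> y"
      unfolding \<rho>_def using that s t \<pi>_cl by (intro H.finsum_addf) auto
    finally show ?thesis .
  qed
  have \<rho>_mult: "\<rho> (g \<otimes>\<^bsub>H\<^esub> h) = g \<otimes>\<^bsub>H\<^esub> \<rho> h" if g: "g \<in> carrier H" and h: "h \<in> carrier H" for g h
  proof -
    \<comment> \<open>\<open>?q i j\<close> is at once the coefficient of \<open>t j\<close> in the
      product of \<open>t i\<close> and \<open>g\<close> and that of \<open>s i\<close> in the
      product of \<open>g\<close> and \<open>s j\<close>. Hence \<open>g\<close> passes through the
      Casimir element.\<close>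
    let ?q = "\<lambda>i j. \<tau> (t i \<otimes>\<^bsub>H\<^esub> (g \<otimes>\<^bsub>H\<^esub> s j))"
    have q: "?q i j \<in> carrier R" if "i < n" "j < n" for i j using that s t g \<tau> by simp
    let ?w = "\<lambda>i j. (?q i j \<odot>\<^bsub>H\<^esub> s i) \<otimes>\<^bsub>H\<^esub> \<pi> (t j \<otimes>\<^bsub>H\<^esub> h)"
    have w: "?w i j \<in> carrier H" if "i < n" "j < n" for i j using that s t h q \<pi>_cl by simp
    have 1: "s i \<otimes>\<^bsub>H\<^esub> \<pi> (t i \<otimes>\<^bsub>H\<^esub> (g \<otimes>\<^bsub>H\<^esub> h)) = (\<Oplus>\<^bsub>H\<^esub>j\<in>{..<n}. ?w i j)" if i: "i < n" for i
    proof -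
      have "t i \<otimes>\<^bsub>H\<^esub> g = (\<Oplus>\<^bsub>H\<^esub>j\<in>{..<n}. \<tau> (t i \<otimes>\<^bsub>H\<^esub> g \<otimes>\<^bsub>H\<^esub> s j) \<odot>\<^bsub>H\<^esub> t j)"
        by (rule expand_t[symmetric]) (use t[OF i] g in simp)
      also have "\<dots> = (\<Oplus>\<^bsub>H\<^esub>j\<in>{..<n}. ?q i j \<odot>\<^bsub>H\<^esub> t j)"
        using i s t g \<tau> by (intro H.finsum_cong') (auto simp: H.m_assoc)
      finally have "t i \<otimes>\<^bsub>H\<^esub> (g \<otimes>\<^bsub>H\<^esub> h) = (\<Oplus>\<^bsub>H\<^esub>j\<in>{..<n}. ?q i j \<odot>\<^bsub>H\<^esub> t j) \<otimes>\<^bsub>H\<^esub> h"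
        using H.m_assoc[OF t[OF i] g h] by simp
      also have "\<dots> = (\<Oplus>\<^bsub>H\<^esub>j\<in>{..<n}. (?q i j \<odot>\<^bsub>H\<^esub> t j) \<otimes>\<^bsub>H\<^esub> h)"
        using q i t h by (intro H.finsum_ldistr) auto
      finally have "s i \<otimes>\<^bsub>H\<^esub> \<pi> (t i \<otimes>\<^bsub>H\<^esub> (g \<otimes>\<^bsub>H\<^esub> h)) = s i \<otimes>\<^bsub>H\<^esub> \<pi> (\<Oplus>\<^bsub>H\<^esub>j\<in>{..<n}. (?q i j \<odot>\<^bsub>H\<^esub> t j) \<otimes>\<^bsub>H\<^esub> h)" by simp
      also have "\<dots> = (\<Oplus>\<^bsub>H\<^esub>j\<in>{..<n}. s i \<otimes>\<^bsub>H\<^esub> \<pi> ((?q i j \<odot>\<^bsub>H\<^esub> t j) \<otimes>\<^bsub>H\<^esub> h))"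
        by (rule additive_finsum[OF H.abelian_group_axioms H.abelian_group_axioms])
           (use i s t h q \<pi>_cl \<pi>_add in \<open>auto intro!: additiveI simp: H.r_distr\<close>)
      also have "\<dots> = (\<Oplus>\<^bsub>H\<^esub>j\<in>{..<n}. ?w i j)"
        using i s t h q \<pi>_cl w by (intro H.finsum_cong') (auto simp: sm \<pi>_sm)
      finally show ?thesis .
    qed
    have 2: "g \<otimes>\<^bsub>H\<^esub> (s j \<otimes>\<^bsub>H\<^esub> \<pi> (t j \<otimes>\<^bsub>H\<^esub> h)) = (\<Oplus>\<^bsub>H\<^esub>i\<in>{..<n}. ?w i j)" if j: "j < n" for j
    proof -
      have "g \<otimes>\<^bsub>H\<^esub> (s j \<otimes>\<^bsub>H\<^esub> \<pi> (t j \<otimes>\<^bsub>H\<^esub> h)) = (\<Oplus>\<^bsub>H\<^esub>i\<in>{..<n}. ?q i j \<odot>\<^bsub>H\<^esub> s i) \<otimes>\<^bsub>H\<^esub> \<pi> (t j \<otimes>\<^bsub>H\<^esub> h)"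
        using expand_s[of "g \<otimes>\<^bsub>H\<^esub> s j"] g s t j h \<pi>_cl by (simp add: H.m_assoc)
      also have "\<dots> = (\<Oplus>\<^bsub>H\<^esub>i\<in>{..<n}. ?w i j)"
        using q j s t h \<pi>_cl by (intro H.finsum_ldistr) auto
      finally show ?thesis .
    qed
    have "\<rho> (g \<otimes>\<^bsub>H\<^esub> h) = (\<Oplus>\<^bsub>H\<^esub>i\<in>{..<n}. \<Oplus>\<^bsub>H\<^esub>j\<in>{..<n}. ?w i j)"
      unfolding \<rho>_def by (rule H.finsum_cong'[OF refl]) (use 1 w in \<open>auto intro!: H.finsum_closed\<close>)
    also have "\<dots> = (\<Oplus>\<^bsub>H\<^esub>j\<in>{..<n}. \<Oplus>\<^bsub>H\<^esub>i\<in>{..<n}. ?w i j)"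
      by (rule H.finsum_swap) (use w in auto)
    also have "\<dots> = (\<Oplus>\<^bsub>H\<^esub>j\<in>{..<n}. g \<otimes>\<^bsub>H\<^esub> (s j \<otimes>\<^bsub>H\<^esub> \<pi> (t j \<otimes>\<^bsub>H\<^esub> h)))"
      by (rule H.finsum_cong'[OF refl]) (use 2 g s t h \<pi>_cl in auto)
    also have "\<dots> = g \<otimes>\<^bsub>H\<^esub> \<rho> h"
      unfolding \<rho>_def using g s t h \<pi>_cl by (intro H.finsum_rdistr[symmetric]) auto
    finally show ?thesis .
  qed
  let ?J = "{h \<in> carrier H. \<rho> h = \<zero>\<^bsub>H\<^esub>}"
  have \<rho>0: "\<rho> \<zero>\<^bsub>H\<^esub> = \<zero>\<^bsub>H\<^esub>" using \<rho>_mult[of "\<zero>\<^bsub>H\<^esub>" "\<zero>\<^bsub>H\<^esub>"] \<rho>_cl[of "\<zero>\<^bsub>H\<^esub>"] by simp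
  have \<rho>_neg: "\<rho> (\<ominus>\<^bsub>H\<^esub> h) = \<ominus>\<^bsub>H\<^esub> \<rho> h" if "h \<in> carrier H" for h
    using \<rho>_mult[of "\<ominus>\<^bsub>H\<^esub> \<one>\<^bsub>H\<^esub>" h] that \<rho>_cl by (simp add: H.l_minus)
  have "additive_subgroup ?J H"
    by (rule additive_subgroup.intro, unfold_locales)
       (use \<rho>_add \<rho>0 \<rho>_neg in \<open>auto simp: a_inv_def[symmetric]\<close>)
  then have LJ: "left_ideal ?J H" unfolding left_ideal_def using \<rho>_mult by auto
  have "I <+>\<^bsub>H\<^esub> ?J = carrier H"
  proof
    show "I <+>\<^bsub>H\<^esub> ?J \<subseteq> carrier H" using Ic by (auto simp: set_add_def set_mult_def)
    show "carrier H \<subseteq> I <+>\<^bsub>H\<^esub> ?J"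
    proof
      fix h assume h: "h \<in> carrier H"
      \<comment> \<open>As \<open>\<rho>\<close> is multiplication by \<open>c\<close> on
        \<open>I\<close>, dividing by \<open>c\<close> turns it into a projection.\<close>
      let ?i = "c' \<odot>\<^bsub>H\<^esub> \<rho> h"
      have i: "?i \<in> I" "?i \<in> carrier H" using \<rho>_I[OF h] Is c' Ic by auto
      have "\<rho> ?i = \<rho> h" using \<rho>_fix[OF i(1)] c c' \<rho>_cl[OF h] by (simp add: HM.smult_assoc1[symmetric] R.m_comm)
      then have "\<rho> (h \<ominus>\<^bsub>H\<^esub> ?i) = \<zero>\<^bsub>H\<^esub>"
        using h i \<rho>_cl[OF h] by (simp add: H.minus_eq \<rho>_add \<rho>_neg H.r_neg)
      then have "h \<ominus>\<^bsub>H\<^esub> ?i \<in> ?J" using h i by simp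
      moreover have "h = ?i \<oplus>\<^bsub>H\<^esub> (h \<ominus>\<^bsub>H\<^esub> ?i)" 
        using h i(2) by (simp add: H.minus_eq H.a_lcomm[of ?i h] H.r_neg)
      ultimately show "h \<in> I <+>\<^bsub>H\<^esub> ?J" using i(1) unfolding set_add_def set_mult_def by auto
    qed
  qed
  moreover have "I \<inter> ?J = {\<zero>\<^bsub>H\<^esub>}"
  proof -
    have "x = \<zero>\<^bsub>H\<^esub>" if x: "x \<in> I" "\<rho> x = \<zero>\<^bsub>H\<^esub>" for x
    proof -
      have "c' \<odot>\<^bsub>H\<^esub> (c \<odot>\<^bsub>H\<^esub> x) = \<zero>\<^bsub>H\<^esub>" using x \<rho>_fix c' by simp
      then show ?thesis using c c' Ic[OF x(1)] by (simp add: HM.smult_assoc1[symmetric])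
    qed
    then show ?thesis using \<rho>0 by auto
  qed
  ultimately show "\<exists>J. left_ideal J H \<and> I <+>\<^bsub>H\<^esub> J = carrier H \<and> I \<inter> J = {\<zero>\<^bsub>H\<^esub>}"
    using LJ by blast
qed

section \<open>Frobenius extensions and the basic construction\<close>

declare tensor_simps [simp del] id_apply [simp del]

section \<open>The bimodule \<open>M \<otimes> M\<close> of a ring extension\<close>

locale ring_ext =
  fixes N :: "'n ring" and M :: "'m ring" and \<iota> :: "'n \<Rightarrow> 'm"
  assumes ext: "ring_extension N M \<iota>"
begin

sublocale N: ring N using ext by (simp add: ring_extension_def)
sublocale M: ring M using ext by (simp add: ring_extension_def)

lemma iota_hom: "\<iota> \<in> ring_hom N M" using ext by (simp add: ring_extension_def)

lemma iota_simps [simp]: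
  "m \<in> carrier N \<Longrightarrow> \<iota> m \<in> carrier M"
  "\<iota> \<one>\<^bsub>N\<^esub> = \<one>\<^bsub>M\<^esub>"
  using ring_hom_closed[OF iota_hom] ring_hom_one[OF iota_hom] by auto

lemma iota_mult: "m \<in> carrier N \<Longrightarrow> n \<in> carrier N \<Longrightarrow> \<iota> (m \<otimes>\<^bsub>N\<^esub> n) = \<iota> m \<otimes>\<^bsub>M\<^esub> \<iota> n"
  and iota_add: "m \<in> carrier N \<Longrightarrow> n \<in> carrier N \<Longrightarrow> \<iota> (m \<oplus>\<^bsub>N\<^esub> n) = \<iota> m \<oplus>\<^bsub>M\<^esub> \<iota> n"
  using ring_hom_mult[OF iota_hom] ring_hom_add[OF iota_hom] by auto

abbreviation (input) "T \<equiv> sq N M \<iota>"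
abbreviation (input) "pure \<equiv> sq_pure N M \<iota>"
abbreviation (input) "UL \<equiv> ring_bimod M id \<iota>"
abbreviation (input) "UR \<equiv> ring_bimod M \<iota> id"

lemma M_bimod_abelian: "abelian_group (ring_bimod M l r)"
  by (rule abelian_group_cong[OF M.abelian_group_axioms]) auto

lemma tens: "tensorable N UL UR"
  by (simp add: tensorable_def M_bimod_abelian)

sublocale T: abelian_group T by (rule tensor_abelian[OF tens])

lemma pure_cl [simp]: "a \<in> carrier M \<Longrightarrow> b \<in> carrier M \<Longrightarrow> pure a b \<in> carrier T"
  using pure_closed[OF tens, of a b] by simp

lemma pure_add [simp]:
  "a \<in> carrier M \<Longrightarrow> a' \<in> carrier M \<Longrightarrow> b \<in> carrier M \<Longrightarrow> pure (a \<oplus>\<^bsub>M\<^esub> a') b = pure a b \<oplus>\<^bsub>T\<^esub> pure a' b"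
  "a \<in> carrier M \<Longrightarrow> b \<in> carrier M \<Longrightarrow> b' \<in> carrier M \<Longrightarrow> pure a (b \<oplus>\<^bsub>M\<^esub> b') = pure a b \<oplus>\<^bsub>T\<^esub> pure a b'"
  using pure_add_left[OF tens, of a a' b] pure_add_right[OF tens, of a b b'] by (simp_all add: tensor_simps)

lemma pure_bal: "a \<in> carrier M \<Longrightarrow> n \<in> carrier N \<Longrightarrow> b \<in> carrier M \<Longrightarrow>
    pure (a \<otimes>\<^bsub>M\<^esub> \<iota> n) b = pure a (\<iota> n \<otimes>\<^bsub>M\<^esub> b)"
  using pure_balance[OF tens, of a n b] by (simp add: id_apply)

lemma balI:
  assumes "abelian_group Z" "\<And>a b. a \<in> carrier M \<Longrightarrow> b \<in> carrier M \<Longrightarrow> f a b \<in> carrier Z"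
    and "\<And>a a' b. a \<in> carrier M \<Longrightarrow> a' \<in> carrier M \<Longrightarrow> b \<in> carrier M \<Longrightarrow> f (a \<oplus>\<^bsub>M\<^esub> a') b = f a b \<oplus>\<^bsub>Z\<^esub> f a' b"
    and "\<And>a b b'. a \<in> carrier M \<Longrightarrow> b \<in> carrier M \<Longrightarrow> b' \<in> carrier M \<Longrightarrow> f a (b \<oplus>\<^bsub>M\<^esub> b') = f a b \<oplus>\<^bsub>Z\<^esub> f a b'"
    and "\<And>a n b. a \<in> carrier M \<Longrightarrow> n \<in> carrier N \<Longrightarrow> b \<in> carrier M \<Longrightarrow> f (a \<otimes>\<^bsub>M\<^esub> \<iota> n) b = f a (\<iota> n \<otimes>\<^bsub>M\<^esub> b)"
  shows "balanced N UL UR Z f"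
  by (intro balancedI additiveI) (use assms in \<open>auto simp: id_apply\<close>)

lemma bal_lift:
  assumes "abelian_group Z" "balanced N UL UR Z f"
  shows "a \<in> carrier M \<Longrightarrow> b \<in> carrier M \<Longrightarrow> tensor_lift Z f (pure a b) = f a b"
    and "t \<in> carrier T \<Longrightarrow> tensor_lift Z f t \<in> carrier Z"
    and "s \<in> carrier T \<Longrightarrow> t \<in> carrier T \<Longrightarrow> tensor_lift Z f (s \<oplus>\<^bsub>T\<^esub> t) = tensor_lift Z f s \<oplus>\<^bsub>Z\<^esub> tensor_lift Z f t"
  using lift_pure[OF tens assms] lift_additive[OF tens assms] by (auto simp: additive_def)

lemma tens_eqI:
  assumes "t \<in> carrier T" "abelian_group Z"
    and "\<And>t. t \<in> carrier T \<Longrightarrow> F t \<in> carrier Z" "\<And>t. t \<in> carrier T \<Longrightarrow> G t \<in> carrier Z"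
    and "\<And>s t. s \<in> carrier T \<Longrightarrow> t \<in> carrier T \<Longrightarrow> F (s \<oplus>\<^bsub>T\<^esub> t) = F s \<oplus>\<^bsub>Z\<^esub> F t"
    and "\<And>s t. s \<in> carrier T \<Longrightarrow> t \<in> carrier T \<Longrightarrow> G (s \<oplus>\<^bsub>T\<^esub> t) = G s \<oplus>\<^bsub>Z\<^esub> G t"
    and "\<And>a b. a \<in> carrier M \<Longrightarrow> b \<in> carrier M \<Longrightarrow> F (pure a b) = G (pure a b)"
  shows "F t = G t"
  by (rule tensor_additive_eqI[OF tens assms(2) _ _ _ assms(1)]) (use assms in \<open>auto intro!: additiveI\<close>)

lemma lact_simps [simp]:
  assumes m: "m \<in> carrier M"
  shows "a \<in> carrier M \<Longrightarrow> b \<in> carrier M \<Longrightarrow> lact T m (pure a b) = pure (m \<otimes>\<^bsub>M\<^esub> a) b"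
    and "t \<in> carrier T \<Longrightarrow> lact T m t \<in> carrier T"
    and "s \<in> carrier T \<Longrightarrow> t \<in> carrier T \<Longrightarrow> lact T m (s \<oplus>\<^bsub>T\<^esub> t) = lact T m s \<oplus>\<^bsub>T\<^esub> lact T m t"
proof -
  have "additive UL UL (lact UL m)" using m by (auto intro!: additiveI simp: id_apply M.r_distr)
  moreover have "lact UL m (ract UL a n) = ract UL (lact UL m a) n" if "a \<in> carrier UL" "n \<in> carrier N" for a n
    using that m by (simp add: id_apply M.m_assoc)
  ultimately have l: "additive T T (lact T m)" 
    "\<And>a b. a \<in> carrier M \<Longrightarrow> b \<in> carrier M \<Longrightarrow> lact T m (pure a b) = pure (m \<otimes>\<^bsub>M\<^esub> a) b"
    using tensor_lact[OF tens, of m] by (auto simp: id_apply)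
  show "a \<in> carrier M \<Longrightarrow> b \<in> carrier M \<Longrightarrow> lact T m (pure a b) = pure (m \<otimes>\<^bsub>M\<^esub> a) b"
    by (rule l(2))
  show "t \<in> carrier T \<Longrightarrow> lact T m t \<in> carrier T"
    by (rule additive_closed[OF l(1)])
  show "s \<in> carrier T \<Longrightarrow> t \<in> carrier T \<Longrightarrow> lact T m (s \<oplus>\<^bsub>T\<^esub> t) = lact T m s \<oplus>\<^bsub>T\<^esub> lact T m t"
    by (rule additive_add[OF l(1)])
qed

lemma ract_simps [simp]:
  assumes m: "m \<in> carrier M"
  shows "a \<in> carrier M \<Longrightarrow> b \<in> carrier M \<Longrightarrow> ract T (pure a b) m = pure a (b \<otimes>\<^bsub>M\<^esub> m)"
    and "t \<in> carrier T \<Longrightarrow> ract T t m \<in> carrier T"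
    and "s \<in> carrier T \<Longrightarrow> t \<in> carrier T \<Longrightarrow> ract T (s \<oplus>\<^bsub>T\<^esub> t) m = ract T s m \<oplus>\<^bsub>T\<^esub> ract T t m"
proof -
  have "additive UR UR (\<lambda>b. ract UR b m)" using m by (auto intro!: additiveI simp: id_apply M.l_distr)
  moreover have "ract UR (lact UR n b) m = lact UR n (ract UR b m)" if "b \<in> carrier UR" "n \<in> carrier N" for b n
    using that m by (simp add: id_apply M.m_assoc)
  ultimately have l: "additive T T (\<lambda>t. ract T t m)" 
    "\<And>a b. a \<in> carrier M \<Longrightarrow> b \<in> carrier M \<Longrightarrow> ract T (pure a b) m = pure a (b \<otimes>\<^bsub>M\<^esub> m)"
    using tensor_ract[OF tens, of m] by (auto simp: id_apply)
  show "a \<in> carrier M \<Longrightarrow> b \<in> carrier M \<Longrightarrow> ract T (pure a b) m = pure a (b \<otimes>\<^bsub>M\<^esub> m)"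
    by (rule l(2))
  show "t \<in> carrier T \<Longrightarrow> ract T t m \<in> carrier T"
    by (rule additive_closed[OF l(1)])
  show "s \<in> carrier T \<Longrightarrow> t \<in> carrier T \<Longrightarrow> ract T (s \<oplus>\<^bsub>T\<^esub> t) m = ract T s m \<oplus>\<^bsub>T\<^esub> ract T t m"
    by (rule additive_add[OF l(1)])
qed

lemma T_bimod:
  assumes "m \<in> carrier M" "m' \<in> carrier M" "t \<in> carrier T"
  shows "lact T m (ract T t m') = ract T (lact T m t) m'"
    and "lact T (m \<otimes>\<^bsub>M\<^esub> m') t = lact T m (lact T m' t)"
    and "ract T t (m \<otimes>\<^bsub>M\<^esub> m') = ract T (ract T t m) m'"
    and "lact T (m \<oplus>\<^bsub>M\<^esub> m') t = lact T m t \<oplus>\<^bsub>T\<^esub> lact T m' t"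
    and "ract T t (m \<oplus>\<^bsub>M\<^esub> m') = ract T t m \<oplus>\<^bsub>T\<^esub> ract T t m'"
  by (rule tens_eqI[OF assms(3) T.abelian_group_axioms];
      use assms(1,2) in \<open>simp add: M.m_assoc M.l_distr M.r_distr T.a_ac\<close>)+

lemma T_one [simp]:
  assumes "t \<in> carrier T"
  shows "lact T \<one>\<^bsub>M\<^esub> t = t" "ract T t \<one>\<^bsub>M\<^esub> = t"
  by (rule tens_eqI[OF assms(1) T.abelian_group_axioms]; simp)+

lemma lact_zero [simp]: "m \<in> carrier M \<Longrightarrow> lact T m \<zero>\<^bsub>T\<^esub> = \<zero>\<^bsub>T\<^esub>"
  by (rule additive_zero[OF T.abelian_group_axioms T.abelian_group_axioms]) (auto intro: additiveI)

lemma ract_zero [simp]: "m \<in> carrier M \<Longrightarrow> ract T \<zero>\<^bsub>T\<^esub> m = \<zero>\<^bsub>T\<^esub>"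
  by (rule additive_zero[OF T.abelian_group_axioms T.abelian_group_axioms, where f = "\<lambda>t. ract T t m"]) (auto intro: additiveI)

lemma T_sum:
  assumes "abelian_group Z" "\<And>t. t \<in> carrier T \<Longrightarrow> F t \<in> carrier Z"
    and "\<And>s t. s \<in> carrier T \<Longrightarrow> t \<in> carrier T \<Longrightarrow> F (s \<oplus>\<^bsub>T\<^esub> t) = F s \<oplus>\<^bsub>Z\<^esub> F t"
    and "\<And>i. i < n \<Longrightarrow> g i \<in> carrier T"
  shows "F (\<Oplus>\<^bsub>T\<^esub>i\<in>{..<n::nat}. g i) = (\<Oplus>\<^bsub>Z\<^esub>i\<in>{..<n}. F (g i))"
  by (rule additive_finsum[OF T.abelian_group_axioms assms(1)]) (use assms in \<open>auto intro: additiveI\<close>)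

lemma M_sum:
  assumes "abelian_group Z" "\<And>t. t \<in> carrier M \<Longrightarrow> F t \<in> carrier Z"
    and "\<And>s t. s \<in> carrier M \<Longrightarrow> t \<in> carrier M \<Longrightarrow> F (s \<oplus>\<^bsub>M\<^esub> t) = F s \<oplus>\<^bsub>Z\<^esub> F t"
    and "\<And>i. i < n \<Longrightarrow> g i \<in> carrier M"
  shows "F (\<Oplus>\<^bsub>M\<^esub>i\<in>{..<n::nat}. g i) = (\<Oplus>\<^bsub>Z\<^esub>i\<in>{..<n}. F (g i))"
  by (rule additive_finsum[OF M.abelian_group_axioms assms(1)]) (use assms in \<open>auto intro: additiveI\<close>)

lemma mu_bal: "balanced N UL UR M (\<lambda>x y. x \<otimes>\<^bsub>M\<^esub> y)"
  by (rule balI[OF M.abelian_group_axioms]) (auto simp: M.l_distr M.r_distr M.m_assoc)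

lemma mu_simps [simp]:
  "a \<in> carrier M \<Longrightarrow> b \<in> carrier M \<Longrightarrow> sq_mult M (pure a b) = a \<otimes>\<^bsub>M\<^esub> b"
  "t \<in> carrier T \<Longrightarrow> sq_mult M t \<in> carrier M"
  "s \<in> carrier T \<Longrightarrow> t \<in> carrier T \<Longrightarrow> sq_mult M (s \<oplus>\<^bsub>T\<^esub> t) = sq_mult M s \<oplus>\<^bsub>M\<^esub> sq_mult M t"
  unfolding sq_mult_def by (rule bal_lift[OF M.abelian_group_axioms mu_bal]; assumption)+

lemma mu_act:
  assumes "m \<in> carrier M" "t \<in> carrier T"
  shows "sq_mult M (lact T m t) = m \<otimes>\<^bsub>M\<^esub> sq_mult M t" "sq_mult M (ract T t m) = sq_mult M t \<otimes>\<^bsub>M\<^esub> m"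
  by (rule tens_eqI[OF assms(2) M.abelian_group_axioms];
      use assms(1) in \<open>simp add: M.m_assoc M.l_distr M.r_distr\<close>)+

text \<open>Linearity over \<open>N\<close> on the side that faces the tensor sign: this is what
  makes \<open>f \<otimes> g\<close> well defined for \<open>f\<close> right linear and
  \<open>g\<close> left linear.\<close>

definition rlin :: "('m \<Rightarrow> 'm) \<Rightarrow> bool" where
  "rlin f \<longleftrightarrow> additive M M f \<and> (\<forall>a\<in>carrier M. \<forall>n\<in>carrier N. f (a \<otimes>\<^bsub>M\<^esub> \<iota> n) = f a \<otimes>\<^bsub>M\<^esub> \<iota> n)"

definition llin :: "('m \<Rightarrow> 'm) \<Rightarrow> bool" where
  "llin f \<longleftrightarrow> additive M M f \<and> (\<forall>a\<in>carrier M. \<forall>n\<in>carrier N. f (\<iota> n \<otimes>\<^bsub>M\<^esub> a) = \<iota> n \<otimes>\<^bsub>M\<^esub> f a)"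

lemma rlinD:
  assumes "rlin f"
  shows "a \<in> carrier M \<Longrightarrow> f a \<in> carrier M"
    "a \<in> carrier M \<Longrightarrow> b \<in> carrier M \<Longrightarrow> f (a \<oplus>\<^bsub>M\<^esub> b) = f a \<oplus>\<^bsub>M\<^esub> f b"
    "a \<in> carrier M \<Longrightarrow> n \<in> carrier N \<Longrightarrow> f (a \<otimes>\<^bsub>M\<^esub> \<iota> n) = f a \<otimes>\<^bsub>M\<^esub> \<iota> n"
  using assms by (auto simp: rlin_def additive_def)

lemma llinD:
  assumes "llin f"
  shows "a \<in> carrier M \<Longrightarrow> f a \<in> carrier M"
    "a \<in> carrier M \<Longrightarrow> b \<in> carrier M \<Longrightarrow> f (a \<oplus>\<^bsub>M\<^esub> b) = f a \<oplus>\<^bsub>M\<^esub> f b"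
    "a \<in> carrier M \<Longrightarrow> n \<in> carrier N \<Longrightarrow> f (\<iota> n \<otimes>\<^bsub>M\<^esub> a) = \<iota> n \<otimes>\<^bsub>M\<^esub> f a"
  using assms by (auto simp: llin_def additive_def)

definition tmap :: "('m \<Rightarrow> 'm) \<Rightarrow> ('m \<Rightarrow> 'm) \<Rightarrow> ('m, 'm) tens \<Rightarrow> ('m, 'm) tens" where
  "tmap f g = tensor_lift T (\<lambda>a b. pure (f a) (g b))"

lemma tmap_simps:
  assumes f: "rlin f" and g: "llin g"
  shows "a \<in> carrier M \<Longrightarrow> b \<in> carrier M \<Longrightarrow> tmap f g (pure a b) = pure (f a) (g b)"
    and "t \<in> carrier T \<Longrightarrow> tmap f g t \<in> carrier T"
    and "s \<in> carrier T \<Longrightarrow> t \<in> carrier T \<Longrightarrow> tmap f g (s \<oplus>\<^bsub>T\<^esub> t) = tmap f g s \<oplus>\<^bsub>T\<^esub> tmap f g t"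
proof -
  have b: "balanced N UL UR T (\<lambda>a b. pure (f a) (g b))"
    by (rule balI[OF T.abelian_group_axioms]) (auto simp: rlinD[OF f] llinD[OF g] pure_bal)
  show "a \<in> carrier M \<Longrightarrow> b \<in> carrier M \<Longrightarrow> tmap f g (pure a b) = pure (f a) (g b)"
    "t \<in> carrier T \<Longrightarrow> tmap f g t \<in> carrier T"
    "s \<in> carrier T \<Longrightarrow> t \<in> carrier T \<Longrightarrow> tmap f g (s \<oplus>\<^bsub>T\<^esub> t) = tmap f g s \<oplus>\<^bsub>T\<^esub> tmap f g t"
    unfolding tmap_def by (rule bal_lift[OF T.abelian_group_axioms b]; assumption)+
qed

lemma lin_id: "rlin (\<lambda>a. a)" "llin (\<lambda>a. a)"
  by (auto simp: rlin_def llin_def additive_def)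

text \<open>Brings the lifts in the definitions of the pairing and of the coproduct of A into the
  form used afterwards: map the two factors, then multiply.\<close>

lemma mul_lift:
  assumes f: "rlin f" and g: "llin g" and t: "t \<in> carrier T"
  shows "tensor_lift M (\<lambda>a b. f a \<otimes>\<^bsub>M\<^esub> g b) t = sq_mult M (tmap f g t)"
proof -
  have b: "balanced N UL UR M (\<lambda>a b. f a \<otimes>\<^bsub>M\<^esub> g b)"
    by (rule balI[OF M.abelian_group_axioms])
       (auto simp: rlinD[OF f] llinD[OF g] M.l_distr M.r_distr M.m_assoc)
  note bl = bal_lift[OF M.abelian_group_axioms b] and tm = tmap_simps[OF f g]
  show ?thesis
    by (rule tens_eqI[OF t M.abelian_group_axioms]) 
       (simp_all add: bl tm rlinD[OF f] llinD[OF g])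
qed

end

section \<open>The basic construction for a Frobenius extension\<close>

locale frob_ext = ring_ext +
  fixes E :: "'b \<Rightarrow> 'a" and k :: nat and x y :: "nat \<Rightarrow> 'b"
  assumes frob: "frobenius_system N M \<iota> E k x y"
begin

lemma E_closed [simp]: "a \<in> carrier M \<Longrightarrow> E a \<in> carrier N"
  and E_add: "a \<in> carrier M \<Longrightarrow> b \<in> carrier M \<Longrightarrow> E (a \<oplus>\<^bsub>M\<^esub> b) = E a \<oplus>\<^bsub>N\<^esub> E b"
  and E_left: "a \<in> carrier M \<Longrightarrow> n \<in> carrier N \<Longrightarrow> E (\<iota> n \<otimes>\<^bsub>M\<^esub> a) = n \<otimes>\<^bsub>N\<^esub> E a"
  and E_right: "a \<in> carrier M \<Longrightarrow> n \<in> carrier N \<Longrightarrow> E (a \<otimes>\<^bsub>M\<^esub> \<iota> n) = E a \<otimes>\<^bsub>N\<^esub> n"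
  and xy [simp]: "i < k \<Longrightarrow> x i \<in> carrier M" "i < k \<Longrightarrow> y i \<in> carrier M"
  and frob1: "m \<in> carrier M \<Longrightarrow> (\<Oplus>\<^bsub>M\<^esub>i\<in>{..<k}. x i \<otimes>\<^bsub>M\<^esub> \<iota> (E (y i \<otimes>\<^bsub>M\<^esub> m))) = m"
  and frob2: "m \<in> carrier M \<Longrightarrow> (\<Oplus>\<^bsub>M\<^esub>i\<in>{..<k}. \<iota> (E (m \<otimes>\<^bsub>M\<^esub> x i)) \<otimes>\<^bsub>M\<^esub> y i) = m"
  using frob by (auto simp: frobenius_system_def bimod_hom_def id_apply)

text \<open>\<open>E\<close> followed by the inclusion of \<open>N\<close>: as an endomorphism of
  \<open>M\<close> it keeps all calculations in one ring.\<close>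

definition eps :: "'b \<Rightarrow> 'b" where "eps m = \<iota> (E m)"

lemma eps_simps [simp]:
  "a \<in> carrier M \<Longrightarrow> eps a \<in> carrier M"
  "a \<in> carrier M \<Longrightarrow> b \<in> carrier M \<Longrightarrow> eps (a \<oplus>\<^bsub>M\<^esub> b) = eps a \<oplus>\<^bsub>M\<^esub> eps b"
  "a \<in> carrier M \<Longrightarrow> n \<in> carrier N \<Longrightarrow> eps (\<iota> n \<otimes>\<^bsub>M\<^esub> a) = \<iota> n \<otimes>\<^bsub>M\<^esub> eps a"
  "a \<in> carrier M \<Longrightarrow> n \<in> carrier N \<Longrightarrow> eps (a \<otimes>\<^bsub>M\<^esub> \<iota> n) = eps a \<otimes>\<^bsub>M\<^esub> \<iota> n"
  by (auto simp: eps_def E_add E_left E_right iota_mult iota_add)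

lemma eps_assoc [simp]:
  "a \<in> carrier M \<Longrightarrow> b \<in> carrier M \<Longrightarrow> n \<in> carrier N \<Longrightarrow> eps (a \<otimes>\<^bsub>M\<^esub> (b \<otimes>\<^bsub>M\<^esub> \<iota> n)) = eps (a \<otimes>\<^bsub>M\<^esub> b) \<otimes>\<^bsub>M\<^esub> \<iota> n"
  "a \<in> carrier M \<Longrightarrow> b \<in> carrier M \<Longrightarrow> n \<in> carrier N \<Longrightarrow> eps (\<iota> n \<otimes>\<^bsub>M\<^esub> a \<otimes>\<^bsub>M\<^esub> b) = \<iota> n \<otimes>\<^bsub>M\<^esub> eps (a \<otimes>\<^bsub>M\<^esub> b)"
  using eps_simps(4)[of "a \<otimes>\<^bsub>M\<^esub> b" n] eps_simps(3)[of "a \<otimes>\<^bsub>M\<^esub> b" n] by (simp_all add: M.m_assoc)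

lemma eps_bal: "a \<in> carrier M \<Longrightarrow> b \<in> carrier M \<Longrightarrow> c \<in> carrier M \<Longrightarrow>
    pure (a \<otimes>\<^bsub>M\<^esub> eps c) b = pure a (eps c \<otimes>\<^bsub>M\<^esub> b)"
  by (simp add: eps_def pure_bal)

lemmas frob_eps = frob1[folded eps_def] frob2[folded eps_def]

definition M1 :: "('b, 'b) tens ring" where "M1 = jones_ring N M \<iota> E k x y"
definition j :: "'b \<Rightarrow> ('b, 'b) tens" where "j = jones_incl N M \<iota> k x y"
definition u :: "('b, 'b) tens" where "u = (\<Oplus>\<^bsub>T\<^esub>i\<in>{..<k}. pure (x i) (y i))"

text \<open>\<open>act\<close> identifies \<open>M \<otimes> M\<close> with \<open>End(M\<^sub>N)\<close>, \<open>coact\<close> with \<open>End(\<^sub>NM)\<close>.\<close>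

definition act :: "('b, 'b) tens \<Rightarrow> 'b \<Rightarrow> 'b" where
  "act t m = tensor_lift M (\<lambda>a b. a \<otimes>\<^bsub>M\<^esub> eps (b \<otimes>\<^bsub>M\<^esub> m)) t"

definition coact :: "('b, 'b) tens \<Rightarrow> 'b \<Rightarrow> 'b" where
  "coact t m = tensor_lift M (\<lambda>a b. eps (m \<otimes>\<^bsub>M\<^esub> a) \<otimes>\<^bsub>M\<^esub> b) t"

lemma u_cl [simp]: "u \<in> carrier T"
  unfolding u_def by (rule T.finsum_closed) auto

lemma M1_simps [simp]:
  "carrier M1 = carrier T" "\<zero>\<^bsub>M1\<^esub> = \<zero>\<^bsub>T\<^esub>" "add M1 = add T" "\<one>\<^bsub>M1\<^esub> = u"
  by (simp_all add: M1_def jones_ring_def u_def)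

lemma act_bal:
  assumes "m \<in> carrier M"
  shows "balanced N UL UR M (\<lambda>a b. a \<otimes>\<^bsub>M\<^esub> eps (b \<otimes>\<^bsub>M\<^esub> m))"
  by (rule balI[OF M.abelian_group_axioms])
     (use assms in \<open>auto simp: M.l_distr M.r_distr M.m_assoc\<close>)

lemma act_simps [simp]:
  assumes "m \<in> carrier M"
  shows "a \<in> carrier M \<Longrightarrow> b \<in> carrier M \<Longrightarrow> act (pure a b) m = a \<otimes>\<^bsub>M\<^esub> eps (b \<otimes>\<^bsub>M\<^esub> m)"
    and "t \<in> carrier T \<Longrightarrow> act t m \<in> carrier M"
    and "s \<in> carrier T \<Longrightarrow> t \<in> carrier T \<Longrightarrow> act (s \<oplus>\<^bsub>T\<^esub> t) m = act s m \<oplus>\<^bsub>M\<^esub> act t m"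
  unfolding act_def by (rule bal_lift[OF M.abelian_group_axioms act_bal[OF assms]]; assumption)+

lemma coact_bal:
  assumes "m \<in> carrier M"
  shows "balanced N UL UR M (\<lambda>a b. eps (m \<otimes>\<^bsub>M\<^esub> a) \<otimes>\<^bsub>M\<^esub> b)"
  by (rule balI[OF M.abelian_group_axioms])
     (use assms in \<open>auto simp: M.l_distr M.r_distr M.m_assoc[symmetric]\<close>)

lemma coact_simps [simp]:
  assumes "m \<in> carrier M"
  shows "a \<in> carrier M \<Longrightarrow> b \<in> carrier M \<Longrightarrow> coact (pure a b) m = eps (m \<otimes>\<^bsub>M\<^esub> a) \<otimes>\<^bsub>M\<^esub> b"
    and "t \<in> carrier T \<Longrightarrow> coact t m \<in> carrier M"
    and "s \<in> carrier T \<Longrightarrow> t \<in> carrier T \<Longrightarrow> coact (s \<oplus>\<^bsub>T\<^esub> t) m = coact s m \<oplus>\<^bsub>M\<^esub> coact t m"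
  unfolding coact_def by (rule bal_lift[OF M.abelian_group_axioms coact_bal[OF assms]]; assumption)+

lemma act_props:
  assumes "t \<in> carrier T" "m \<in> carrier M" "m' \<in> carrier M"
  shows "act t (m \<oplus>\<^bsub>M\<^esub> m') = act t m \<oplus>\<^bsub>M\<^esub> act t m'"
    and "act (lact T m t) m' = m \<otimes>\<^bsub>M\<^esub> act t m'"
    and "act (ract T t m) m' = act t (m \<otimes>\<^bsub>M\<^esub> m')"
    and "coact t (m \<oplus>\<^bsub>M\<^esub> m') = coact t m \<oplus>\<^bsub>M\<^esub> coact t m'"
    and "coact (ract T t m) m' = coact t m' \<otimes>\<^bsub>M\<^esub> m"
    and "coact (lact T m t) m' = coact t (m' \<otimes>\<^bsub>M\<^esub> m)"
  by (rule tens_eqI[OF assms(1) M.abelian_group_axioms];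
      use assms(2,3) in \<open>simp add: M.m_assoc M.l_distr M.r_distr M.a_ac\<close>)+

lemma act_rlin: "t \<in> carrier T \<Longrightarrow> rlin (act t)"
  unfolding rlin_def
proof (intro conjI ballI)
  assume t: "t \<in> carrier T"
  show "additive M M (act t)" using t by (intro additiveI) (auto simp: act_props)
  fix a n assume "a \<in> carrier M" "n \<in> carrier N"
  then show "act t (a \<otimes>\<^bsub>M\<^esub> \<iota> n) = act t a \<otimes>\<^bsub>M\<^esub> \<iota> n"
    by (intro tens_eqI[OF t M.abelian_group_axioms, where F = "\<lambda>t. act t (a \<otimes>\<^bsub>M\<^esub> \<iota> n)" and G = "\<lambda>t. act t a \<otimes>\<^bsub>M\<^esub> \<iota> n"])
       (simp_all add: M.m_assoc M.l_distr)
qed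

lemma coact_llin: "t \<in> carrier T \<Longrightarrow> llin (coact t)"
  unfolding llin_def
proof (intro conjI ballI)
  assume t: "t \<in> carrier T"
  show "additive M M (coact t)" using t by (intro additiveI) (auto simp: act_props)
  fix a n assume "a \<in> carrier M" "n \<in> carrier N"
  then show "coact t (\<iota> n \<otimes>\<^bsub>M\<^esub> a) = \<iota> n \<otimes>\<^bsub>M\<^esub> coact t a"
    by (intro tens_eqI[OF t M.abelian_group_axioms, where F = "\<lambda>t. coact t (\<iota> n \<otimes>\<^bsub>M\<^esub> a)" and G = "\<lambda>t. \<iota> n \<otimes>\<^bsub>M\<^esub> coact t a"])
       (simp_all add: M.m_assoc[symmetric] M.r_distr)
qed

text \<open>The inverses of \<open>act\<close> and \<open>coact\<close>; that they are inverse is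
  the dual basis property of the Frobenius system.\<close>

definition U1 :: "('b \<Rightarrow> 'b) \<Rightarrow> ('b, 'b) tens" where "U1 f = (\<Oplus>\<^bsub>T\<^esub>i\<in>{..<k}. pure (f (x i)) (y i))"
definition U2 :: "('b \<Rightarrow> 'b) \<Rightarrow> ('b, 'b) tens" where "U2 f = (\<Oplus>\<^bsub>T\<^esub>i\<in>{..<k}. pure (x i) (f (y i)))"

lemma U1_tmap:
  assumes f: "rlin f"
  shows "U1 f = tmap f (\<lambda>a. a) u"
proof -
  have "tmap f (\<lambda>a. a) u = (\<Oplus>\<^bsub>T\<^esub>i\<in>{..<k}. tmap f (\<lambda>a. a) (pure (x i) (y i)))"
    unfolding u_def by (rule T_sum[OF T.abelian_group_axioms]) (simp_all add: tmap_simps f lin_id)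
  also have "\<dots> = U1 f"
    unfolding U1_def by (rule T.finsum_cong') (simp_all add: tmap_simps f lin_id rlinD[OF f] Pi_def)
  finally show ?thesis by simp
qed

lemma U2_tmap:
  assumes f: "llin f"
  shows "U2 f = tmap (\<lambda>a. a) f u"
proof -
  have "tmap (\<lambda>a. a) f u = (\<Oplus>\<^bsub>T\<^esub>i\<in>{..<k}. tmap (\<lambda>a. a) f (pure (x i) (y i)))"
    unfolding u_def by (rule T_sum[OF T.abelian_group_axioms]) (simp_all add: tmap_simps f lin_id)
  also have "\<dots> = U2 f"
    unfolding U2_def by (rule T.finsum_cong') (simp_all add: tmap_simps f lin_id llinD[OF f] Pi_def)
  finally show ?thesis by simp
qed

lemma U1_cl [simp]: "rlin f \<Longrightarrow> U1 f \<in> carrier T" by (simp add: U1_tmap tmap_simps lin_id)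
lemma U2_cl [simp]: "llin f \<Longrightarrow> U2 f \<in> carrier T" by (simp add: U2_tmap tmap_simps lin_id)

text \<open>The values of \<open>eps\<close> come from \<open>N\<close> and cross the tensor sign,
  after which the second dual basis identity sums up the right factor.\<close>

lemma U1_act [simp]:
  assumes t: "t \<in> carrier T"
  shows "U1 (act t) = t"
proof (rule tens_eqI[OF t T.abelian_group_axioms, where F = "\<lambda>t. U1 (act t)"])
  fix a b assume ab: "a \<in> carrier M" "b \<in> carrier M"
  have "U1 (act (pure a b)) = (\<Oplus>\<^bsub>T\<^esub>i\<in>{..<k}. pure a (eps (b \<otimes>\<^bsub>M\<^esub> x i) \<otimes>\<^bsub>M\<^esub> y i))"
    unfolding U1_def using ab by (intro T.finsum_cong') (auto simp: eps_bal)
  also have "\<dots> = pure a (\<Oplus>\<^bsub>M\<^esub>i\<in>{..<k}. eps (b \<otimes>\<^bsub>M\<^esub> x i) \<otimes>\<^bsub>M\<^esub> y i)"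
    by (rule M_sum[OF T.abelian_group_axioms, symmetric]) (use ab in auto)
  also have "\<dots> = pure a b" using ab frob_eps by simp
  finally show "U1 (act (pure a b)) = pure a b" .
next
  fix s t assume st: "s \<in> carrier T" "t \<in> carrier T"
  have "U1 (act (s \<oplus>\<^bsub>T\<^esub> t)) = (\<Oplus>\<^bsub>T\<^esub>i\<in>{..<k}. pure (act s (x i)) (y i) \<oplus>\<^bsub>T\<^esub> pure (act t (x i)) (y i))"
    unfolding U1_def using st by (intro T.finsum_cong') auto
  also have "\<dots> = U1 (act s) \<oplus>\<^bsub>T\<^esub> U1 (act t)"
    unfolding U1_def using st by (intro T.finsum_addf) auto
  finally show "U1 (act (s \<oplus>\<^bsub>T\<^esub> t)) = U1 (act s) \<oplus>\<^bsub>T\<^esub> U1 (act t)" .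
qed (auto simp: act_rlin)

lemma U2_coact [simp]:
  assumes t: "t \<in> carrier T"
  shows "U2 (coact t) = t"
proof (rule tens_eqI[OF t T.abelian_group_axioms, where F = "\<lambda>t. U2 (coact t)"])
  fix a b assume ab: "a \<in> carrier M" "b \<in> carrier M"
  have "U2 (coact (pure a b)) = (\<Oplus>\<^bsub>T\<^esub>i\<in>{..<k}. pure (x i \<otimes>\<^bsub>M\<^esub> eps (y i \<otimes>\<^bsub>M\<^esub> a)) b)"
    unfolding U2_def using ab by (intro T.finsum_cong') (auto simp: eps_bal)
  also have "\<dots> = pure (\<Oplus>\<^bsub>M\<^esub>i\<in>{..<k}. x i \<otimes>\<^bsub>M\<^esub> eps (y i \<otimes>\<^bsub>M\<^esub> a)) b"
    by (rule M_sum[OF T.abelian_group_axioms, symmetric, where F = "\<lambda>a. pure a b"]) (use ab in auto)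
  also have "\<dots> = pure a b" using ab frob_eps by simp
  finally show "U2 (coact (pure a b)) = pure a b" .
next
  fix s t assume st: "s \<in> carrier T" "t \<in> carrier T"
  have "U2 (coact (s \<oplus>\<^bsub>T\<^esub> t)) = (\<Oplus>\<^bsub>T\<^esub>i\<in>{..<k}. pure (x i) (coact s (y i)) \<oplus>\<^bsub>T\<^esub> pure (x i) (coact t (y i)))"
    unfolding U2_def using st by (intro T.finsum_cong') auto
  also have "\<dots> = U2 (coact s) \<oplus>\<^bsub>T\<^esub> U2 (coact t)"
    unfolding U2_def using st by (intro T.finsum_addf) auto
  finally show "U2 (coact (s \<oplus>\<^bsub>T\<^esub> t)) = U2 (coact s) \<oplus>\<^bsub>T\<^esub> U2 (coact t)" .
qed (auto simp: coact_llin)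

lemma act_U1:
  assumes f: "rlin f" and m: "m \<in> carrier M"
  shows "act (U1 f) m = f m"
proof -
  have "act (U1 f) m = (\<Oplus>\<^bsub>M\<^esub>i\<in>{..<k}. act (pure (f (x i)) (y i)) m)"
    unfolding U1_def by (rule T_sum[OF M.abelian_group_axioms, where F = "\<lambda>t. act t m"]) (use f m rlinD in auto)
  also have "\<dots> = (\<Oplus>\<^bsub>M\<^esub>i\<in>{..<k}. f (x i \<otimes>\<^bsub>M\<^esub> eps (y i \<otimes>\<^bsub>M\<^esub> m)))"
    using m rlinD[OF f] by (intro M.finsum_cong') (auto simp: eps_def)
  also have "\<dots> = f (\<Oplus>\<^bsub>M\<^esub>i\<in>{..<k}. x i \<otimes>\<^bsub>M\<^esub> eps (y i \<otimes>\<^bsub>M\<^esub> m))"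
    by (rule M_sum[OF M.abelian_group_axioms, symmetric]) (use f m rlinD in auto)
  finally show ?thesis using m frob_eps by simp
qed

lemma coact_U2:
  assumes f: "llin f" and m: "m \<in> carrier M"
  shows "coact (U2 f) m = f m"
proof -
  have "coact (U2 f) m = (\<Oplus>\<^bsub>M\<^esub>i\<in>{..<k}. coact (pure (x i) (f (y i))) m)"
    unfolding U2_def by (rule T_sum[OF M.abelian_group_axioms, where F = "\<lambda>t. coact t m"]) (use f m llinD in auto)
  also have "\<dots> = (\<Oplus>\<^bsub>M\<^esub>i\<in>{..<k}. f (eps (m \<otimes>\<^bsub>M\<^esub> x i) \<otimes>\<^bsub>M\<^esub> y i))"
    using m llinD[OF f] by (intro M.finsum_cong') (auto simp: eps_def)
  also have "\<dots> = f (\<Oplus>\<^bsub>M\<^esub>i\<in>{..<k}. eps (m \<otimes>\<^bsub>M\<^esub> x i) \<otimes>\<^bsub>M\<^esub> y i)"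
    by (rule M_sum[OF M.abelian_group_axioms, symmetric]) (use f m llinD in auto)
  finally show ?thesis using m frob_eps by simp
qed

lemma U1_cong: "(\<And>a. a \<in> carrier M \<Longrightarrow> f a = g a) \<Longrightarrow> rlin g \<Longrightarrow> U1 f = U1 g"
  unfolding U1_def by (rule T.finsum_cong') (auto simp: rlinD)

lemma U2_cong: "(\<And>a. a \<in> carrier M \<Longrightarrow> f a = g a) \<Longrightarrow> llin g \<Longrightarrow> U2 f = U2 g"
  unfolding U2_def by (rule T.finsum_cong') (auto simp: llinD)

lemma act_eqI:
  assumes "s \<in> carrier T" "t \<in> carrier T" "\<And>m. m \<in> carrier M \<Longrightarrow> act s m = act t m"
  shows "s = t"
  using U1_cong[of "act s" "act t"] assms act_rlin by simp

lemma act_u [simp]: "m \<in> carrier M \<Longrightarrow> act u m = m"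
  using act_U1[OF lin_id(1)] U1_def[of "\<lambda>a. a"] u_def by simp

text \<open>\<open>u\<close> acts as the identity, so both sides act as left multiplication by
  \<open>m\<close>.\<close>

lemma u_casimir: "m \<in> carrier M \<Longrightarrow> lact T m u = ract T u m"
  by (rule act_eqI) (auto simp: act_props)

lemma eps_assoc2 [simp]:
  assumes "a \<in> carrier M" "b \<in> carrier M" "c \<in> carrier M"
  shows "eps (a \<otimes>\<^bsub>M\<^esub> (b \<otimes>\<^bsub>M\<^esub> eps c)) = eps (a \<otimes>\<^bsub>M\<^esub> b) \<otimes>\<^bsub>M\<^esub> eps c"
    and "eps (eps c \<otimes>\<^bsub>M\<^esub> a \<otimes>\<^bsub>M\<^esub> b) = eps c \<otimes>\<^bsub>M\<^esub> eps (a \<otimes>\<^bsub>M\<^esub> b)"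
  using eps_assoc[of a b "E c"] assms by (simp_all add: eps_def)

text \<open>Left multiplication by the pure tensor of \<open>a\<close> and \<open>b\<close> in
  \<open>M\<^sub>1\<close>: the inner one of the two nested lifts that define the product.\<close>

definition jinner :: "'b \<Rightarrow> 'b \<Rightarrow> ('b, 'b) tens \<Rightarrow> ('b, 'b) tens" where
  "jinner a b = tensor_lift T (\<lambda>c d. pure (a \<otimes>\<^bsub>M\<^esub> eps (b \<otimes>\<^bsub>M\<^esub> c)) d)"

lemma jinner_bal:
  assumes "a \<in> carrier M" "b \<in> carrier M"
  shows "balanced N UL UR T (\<lambda>c d. pure (a \<otimes>\<^bsub>M\<^esub> eps (b \<otimes>\<^bsub>M\<^esub> c)) d)"
  by (rule balI[OF T.abelian_group_axioms])
     (use assms in \<open>simp_all add: M.r_distr M.m_assoc[symmetric] pure_bal[symmetric]\<close>)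

lemma jinner_simps [simp]:
  assumes "a \<in> carrier M" "b \<in> carrier M"
  shows "c \<in> carrier M \<Longrightarrow> d \<in> carrier M \<Longrightarrow> jinner a b (pure c d) = pure (a \<otimes>\<^bsub>M\<^esub> eps (b \<otimes>\<^bsub>M\<^esub> c)) d"
    and "t \<in> carrier T \<Longrightarrow> jinner a b t \<in> carrier T"
    and "s \<in> carrier T \<Longrightarrow> t \<in> carrier T \<Longrightarrow> jinner a b (s \<oplus>\<^bsub>T\<^esub> t) = jinner a b s \<oplus>\<^bsub>T\<^esub> jinner a b t"
  unfolding jinner_def by (rule bal_lift[OF T.abelian_group_axioms jinner_bal[OF assms]]; assumption)+

lemma jouter_bal:
  assumes t: "t \<in> carrier T"
  shows "balanced N UL UR T (\<lambda>a b. jinner a b t)"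
proof (rule balI[OF T.abelian_group_axioms])
  fix a a' b assume a: "a \<in> carrier M" "a' \<in> carrier M" "b \<in> carrier M"
  show "jinner (a \<oplus>\<^bsub>M\<^esub> a') b t = jinner a b t \<oplus>\<^bsub>T\<^esub> jinner a' b t"
    by (rule tens_eqI[OF t T.abelian_group_axioms, where F = "jinner (a \<oplus>\<^bsub>M\<^esub> a') b" and G = "\<lambda>t. jinner a b t \<oplus>\<^bsub>T\<^esub> jinner a' b t"])
       (use a in \<open>simp_all add: M.l_distr T.a_ac\<close>)
  show "jinner b (a \<oplus>\<^bsub>M\<^esub> a') t = jinner b a t \<oplus>\<^bsub>T\<^esub> jinner b a' t"
    by (rule tens_eqI[OF t T.abelian_group_axioms, where F = "jinner b (a \<oplus>\<^bsub>M\<^esub> a')" and G = "\<lambda>t. jinner b a t \<oplus>\<^bsub>T\<^esub> jinner b a' t"])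
       (use a in \<open>simp_all add: M.l_distr M.r_distr T.a_ac\<close>)
next
  fix a n b assume a: "a \<in> carrier M" "n \<in> carrier N" "b \<in> carrier M"
  show "jinner (a \<otimes>\<^bsub>M\<^esub> \<iota> n) b t = jinner a (\<iota> n \<otimes>\<^bsub>M\<^esub> b) t"
    by (rule tens_eqI[OF t T.abelian_group_axioms, where F = "jinner (a \<otimes>\<^bsub>M\<^esub> \<iota> n) b" and G = "jinner a (\<iota> n \<otimes>\<^bsub>M\<^esub> b)"])
       (use a in \<open>simp_all add: M.m_assoc\<close>)
qed (use t in simp_all)

lemma M1_mult: "s \<otimes>\<^bsub>M1\<^esub> t = tensor_lift T (\<lambda>a b. jinner a b t) s"
  by (simp add: M1_def jones_ring_def jinner_def eps_def)

lemma M1_mult_simps [simp]: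
  assumes t: "t \<in> carrier T"
  shows "a \<in> carrier M \<Longrightarrow> b \<in> carrier M \<Longrightarrow> pure a b \<otimes>\<^bsub>M1\<^esub> t = jinner a b t"
    and "s \<in> carrier T \<Longrightarrow> s \<otimes>\<^bsub>M1\<^esub> t \<in> carrier T"
    and "s \<in> carrier T \<Longrightarrow> s' \<in> carrier T \<Longrightarrow> (s \<oplus>\<^bsub>T\<^esub> s') \<otimes>\<^bsub>M1\<^esub> t = s \<otimes>\<^bsub>M1\<^esub> t \<oplus>\<^bsub>T\<^esub> s' \<otimes>\<^bsub>M1\<^esub> t"
  unfolding M1_mult by (rule bal_lift[OF T.abelian_group_axioms jouter_bal[OF t]]; assumption)+

lemma M1_mult_add_right [simp]:
  assumes "s \<in> carrier T" "t \<in> carrier T" "t' \<in> carrier T"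
  shows "s \<otimes>\<^bsub>M1\<^esub> (t \<oplus>\<^bsub>T\<^esub> t') = s \<otimes>\<^bsub>M1\<^esub> t \<oplus>\<^bsub>T\<^esub> s \<otimes>\<^bsub>M1\<^esub> t'"
  by (rule tens_eqI[OF assms(1) T.abelian_group_axioms, where F = "\<lambda>s. s \<otimes>\<^bsub>M1\<^esub> (t \<oplus>\<^bsub>T\<^esub> t')" and G = "\<lambda>s. s \<otimes>\<^bsub>M1\<^esub> t \<oplus>\<^bsub>T\<^esub> s \<otimes>\<^bsub>M1\<^esub> t'"])
     (use assms in \<open>simp_all add: T.a_ac\<close>)

lemma act_jinner:
  assumes "a \<in> carrier M" "b \<in> carrier M" "m \<in> carrier M" "t \<in> carrier T"
  shows "act (jinner a b t) m = a \<otimes>\<^bsub>M\<^esub> eps (b \<otimes>\<^bsub>M\<^esub> act t m)"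
  by (rule tens_eqI[OF assms(4) M.abelian_group_axioms, where F = "\<lambda>t. act (jinner a b t) m" and G = "\<lambda>t. a \<otimes>\<^bsub>M\<^esub> eps (b \<otimes>\<^bsub>M\<^esub> act t m)"])
     (use assms in \<open>simp_all add: M.r_distr M.m_assoc\<close>)

lemma act_mult:
  assumes "s \<in> carrier T" "t \<in> carrier T" "m \<in> carrier M"
  shows "act (s \<otimes>\<^bsub>M1\<^esub> t) m = act s (act t m)"
  by (rule tens_eqI[OF assms(1) M.abelian_group_axioms, where F = "\<lambda>s. act (s \<otimes>\<^bsub>M1\<^esub> t) m" and G = "\<lambda>s. act s (act t m)"])
     (use assms in \<open>simp_all add: act_jinner\<close>)

lemma M1_abelian: "abelian_group M1"
  by (rule abelian_group_cong[OF T.abelian_group_axioms]) auto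

text \<open>Faithfulness of the action reduces the ring axioms to composition of maps.\<close>

lemma M1_ring: "ring M1"
  by (rule ringI[OF M1_abelian], rule monoidI)
     (simp_all, (rule act_eqI; simp add: act_mult)+)

sublocale M1: ring M1 by (rule M1_ring)

lemma M1_finsum: "finsum M1 = finsum T"
  by (rule finsum_cong_struct) auto

lemma j_eq: "m \<in> carrier M \<Longrightarrow> j m = lact T m u"
  unfolding j_def jones_incl_def u_def
  by (subst T_sum[OF T.abelian_group_axioms, where F = "lact T m"]) (simp_all, rule T.finsum_cong', simp_all add: Pi_def)

lemma j_cl [simp]: "m \<in> carrier M \<Longrightarrow> j m \<in> carrier T" by (simp add: j_eq)

lemma act_j [simp]: "m \<in> carrier M \<Longrightarrow> m' \<in> carrier M \<Longrightarrow> act (j m) m' = m \<otimes>\<^bsub>M\<^esub> m'"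
  by (simp add: j_eq act_props)

text \<open>Elements of \<open>M\<close> multiply in \<open>M\<^sub>1\<close> through the bimodule
  structure of \<open>M \<otimes> M\<close>. Products with \<open>j m\<close> are turned into
  actions by this rule from here on.\<close>

lemma j_mult [simp]:
  assumes "m \<in> carrier M" "t \<in> carrier T"
  shows "j m \<otimes>\<^bsub>M1\<^esub> t = lact T m t" "t \<otimes>\<^bsub>M1\<^esub> j m = ract T t m"
  by (rule act_eqI; use assms in \<open>simp add: act_mult act_props\<close>)+

lemma M1_ext: "ring_extension M M1 j"
  unfolding ring_extension_def
proof (intro conjI M.ring_axioms M1_ring ring_hom_memI)
  fix a b assume ab: "a \<in> carrier M" "b \<in> carrier M"
  show "j a \<in> carrier M1" using ab by simp
  show "j (a \<otimes>\<^bsub>M\<^esub> b) = j a \<otimes>\<^bsub>M1\<^esub> j b" by (rule act_eqI) (use ab in \<open>simp_all add: act_props M.m_assoc\<close>)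
  show "j (a \<oplus>\<^bsub>M\<^esub> b) = j a \<oplus>\<^bsub>M1\<^esub> j b" by (rule act_eqI) (use ab in \<open>simp_all add: M.l_distr\<close>)
next
  show "j \<one>\<^bsub>M\<^esub> = \<one>\<^bsub>M1\<^esub>" by (rule act_eqI) simp_all
qed

text \<open>The two dual basis sums are \<open>U2 (coact t)\<close> and \<open>U1 (act t)\<close>.
  Since \<open>M\<^sub>1|M\<close> is again a Frobenius extension with a system of the same kind,
  the whole theory can be instantiated a second time, which gives \<open>M\<^sub>2\<close>.\<close>

lemma M1_frobenius:
  "frobenius_system M M1 j (sq_mult M) k (\<lambda>i. pure (x i) \<one>\<^bsub>M\<^esub>) (\<lambda>i. pure \<one>\<^bsub>M\<^esub> (y i))"
  unfolding frobenius_system_def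
proof (intro conjI ballI)
  show "sq_mult M \<in> bimod_hom M M (ring_bimod M1 j j) (ring_bimod M id id)"
    by (auto simp: bimod_hom_def mu_act id_apply)
  show "(\<lambda>i. pure (x i) \<one>\<^bsub>M\<^esub>) \<in> {..<k} \<rightarrow> carrier M1" "(\<lambda>i. pure \<one>\<^bsub>M\<^esub> (y i)) \<in> {..<k} \<rightarrow> carrier M1"
    by simp_all
  fix t assume t: "t \<in> carrier M1"
  then have t': "t \<in> carrier T" by simp
  have 1: "ract T (pure (x i) \<one>\<^bsub>M\<^esub>) (sq_mult M (pure \<one>\<^bsub>M\<^esub> (y i) \<otimes>\<^bsub>M1\<^esub> t)) = pure (x i) (coact t (y i))" if i: "i < k" for i
    by (rule tens_eqI[OF t' T.abelian_group_axioms, where F = "\<lambda>t. ract T (pure (x i) \<one>\<^bsub>M\<^esub>) (sq_mult M (pure \<one>\<^bsub>M\<^esub> (y i) \<otimes>\<^bsub>M1\<^esub> t))" and G = "\<lambda>t. pure (x i) (coact t (y i))"])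
       (use i in \<open>simp_all add: T_bimod\<close>)
  have "(\<Oplus>\<^bsub>T\<^esub>i\<in>{..<k}. pure (x i) \<one>\<^bsub>M\<^esub> \<otimes>\<^bsub>M1\<^esub> j (sq_mult M (pure \<one>\<^bsub>M\<^esub> (y i) \<otimes>\<^bsub>M1\<^esub> t))) = U2 (coact t)"
    unfolding U2_def by (rule T.finsum_cong') (use t' 1 in \<open>simp_all del: M1_mult_simps(1)\<close>)
  then show "(\<Oplus>\<^bsub>M1\<^esub>i\<in>{..<k}. pure (x i) \<one>\<^bsub>M\<^esub> \<otimes>\<^bsub>M1\<^esub> j (sq_mult M (pure \<one>\<^bsub>M\<^esub> (y i) \<otimes>\<^bsub>M1\<^esub> t))) = t"
    using t' by (simp add: M1_finsum)
  have 2: "lact T (sq_mult M (t \<otimes>\<^bsub>M1\<^esub> pure (x i) \<one>\<^bsub>M\<^esub>)) (pure \<one>\<^bsub>M\<^esub> (y i)) = pure (act t (x i)) (y i)" if i: "i < k" for i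
    by (rule tens_eqI[OF t' T.abelian_group_axioms, where F = "\<lambda>t. lact T (sq_mult M (t \<otimes>\<^bsub>M1\<^esub> pure (x i) \<one>\<^bsub>M\<^esub>)) (pure \<one>\<^bsub>M\<^esub> (y i))" and G = "\<lambda>t. pure (act t (x i)) (y i)"])
       (use i in \<open>simp_all add: T_bimod\<close>)
  have "(\<Oplus>\<^bsub>T\<^esub>i\<in>{..<k}. j (sq_mult M (t \<otimes>\<^bsub>M1\<^esub> pure (x i) \<one>\<^bsub>M\<^esub>)) \<otimes>\<^bsub>M1\<^esub> pure \<one>\<^bsub>M\<^esub> (y i)) = U1 (act t)"
    unfolding U1_def by (rule T.finsum_cong') (use t' 2 in \<open>simp_all del: lact_simps(1)\<close>)
  then show "(\<Oplus>\<^bsub>M1\<^esub>i\<in>{..<k}. j (sq_mult M (t \<otimes>\<^bsub>M1\<^esub> pure (x i) \<one>\<^bsub>M\<^esub>)) \<otimes>\<^bsub>M1\<^esub> pure \<one>\<^bsub>M\<^esub> (y i)) = t"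
    using t' by (simp add: M1_finsum)
qed

lemma M1_frob_ext: "frob_ext M M1 j (sq_mult M) k (\<lambda>i. pure (x i) \<one>\<^bsub>M\<^esub>) (\<lambda>i. pure \<one>\<^bsub>M\<^esub> (y i))"
  by (intro frob_ext.intro ring_ext.intro frob_ext_axioms.intro M1_ext M1_frobenius)

section \<open>Bimodule endomorphisms and the centralizer of \<open>N\<close> in
  \<open>M\<^sub>1\<close>\<close>

definition nend :: "('b \<Rightarrow> 'b) \<Rightarrow> bool" where "nend f \<longleftrightarrow> rlin f \<and> llin f"

text \<open>\<open>nend\<close> leaves extensionality aside, so that \<open>act t\<close> and plain
  abstractions qualify; maps are restricted to the carrier only on entering the algebra A.\<close>

lemma End_carrier: "f \<in> carrier (End_alg N M \<iota>) \<longleftrightarrow> nend f \<and> f \<in> extensional (carrier M)"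
  by (auto simp: End_alg_def bimod_hom_def nend_def rlin_def llin_def additive_def)

definition Cas :: "('b, 'b) tens set" where
  "Cas = {t \<in> carrier T. \<forall>n\<in>carrier N. lact T (\<iota> n) t = ract T t (\<iota> n)}"

text \<open>\<open>j (\<iota> n)\<close> multiplies as the action of \<open>n\<close>. The
  centralizer in \<open>M\<^sub>1\<close> and the algebra B therefore share their underlying set,
  but not their products.\<close>

lemma centralizer_M1: "ext_centralizer N M1 (j \<circ> \<iota>) = Cas"
  unfolding ext_centralizer_def Cas_def by auto

lemma Cas_D [simp]: "t \<in> Cas \<Longrightarrow> t \<in> carrier T"
  and Cas_comm: "t \<in> Cas \<Longrightarrow> n \<in> carrier N \<Longrightarrow> lact T (\<iota> n) t = ract T t (\<iota> n)"
  by (auto simp: Cas_def)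

lemma act_nend: "t \<in> Cas \<Longrightarrow> nend (act t)"
  unfolding nend_def llin_def using act_rlin act_props Cas_comm
  by (auto simp: rlin_def) (metis Cas_D act_props(2,3) iota_simps(1))

lemma coact_nend: "t \<in> Cas \<Longrightarrow> nend (coact t)"
  unfolding nend_def rlin_def using coact_llin act_props Cas_comm
  by (auto simp: llin_def) (metis Cas_D act_props(5,6) iota_simps(1))

lemma nendD:
  assumes "nend f"
  shows "rlin f" "llin f" "a \<in> carrier M \<Longrightarrow> f a \<in> carrier M"
    "a \<in> carrier M \<Longrightarrow> b \<in> carrier M \<Longrightarrow> f (a \<oplus>\<^bsub>M\<^esub> b) = f a \<oplus>\<^bsub>M\<^esub> f b"
    "a \<in> carrier M \<Longrightarrow> n \<in> carrier N \<Longrightarrow> f (a \<otimes>\<^bsub>M\<^esub> \<iota> n) = f a \<otimes>\<^bsub>M\<^esub> \<iota> n"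
    "a \<in> carrier M \<Longrightarrow> n \<in> carrier N \<Longrightarrow> f (\<iota> n \<otimes>\<^bsub>M\<^esub> a) = \<iota> n \<otimes>\<^bsub>M\<^esub> f a"
  using assms unfolding nend_def by (auto simp: rlinD llinD)

lemma U1_Cas: 
  assumes f: "nend f" 
  shows "U1 f \<in> Cas"
  unfolding Cas_def
proof (intro CollectI conjI ballI)
  note f' = nendD[OF f]
  show c: "U1 f \<in> carrier T" using f' by simp
  fix n assume n: "n \<in> carrier N"
  show "lact T (\<iota> n) (U1 f) = ract T (U1 f) (\<iota> n)"
    by (rule act_eqI) (use n c f' in \<open>simp_all add: act_props act_U1\<close>)
qed

lemma coact_eqI:
  assumes "s \<in> carrier T" "t \<in> carrier T" "\<And>m. m \<in> carrier M \<Longrightarrow> coact s m = coact t m"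
  shows "s = t"
  using U2_cong[of "coact s" "coact t"] assms coact_llin by simp

lemma U2_Cas: 
  assumes f: "nend f" 
  shows "U2 f \<in> Cas"
  unfolding Cas_def
proof (intro CollectI conjI ballI)
  note f' = nendD[OF f]
  show c: "U2 f \<in> carrier T" using f' by simp
  fix n assume n: "n \<in> carrier N"
  show "lact T (\<iota> n) (U2 f) = ract T (U2 f) (\<iota> n)"
    by (rule coact_eqI) (use n c f' in \<open>simp_all add: act_props coact_U2\<close>)
qed

lemma U1_add:
  assumes "rlin f" "rlin g"
  shows "U1 (\<lambda>a\<in>carrier M. f a \<oplus>\<^bsub>M\<^esub> g a) = U1 f \<oplus>\<^bsub>T\<^esub> U1 g"
proof -
  have "U1 (\<lambda>a\<in>carrier M. f a \<oplus>\<^bsub>M\<^esub> g a) = (\<Oplus>\<^bsub>T\<^esub>i\<in>{..<k}. pure (f (x i)) (y i) \<oplus>\<^bsub>T\<^esub> pure (g (x i)) (y i))"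
    unfolding U1_def by (rule T.finsum_cong') (use rlinD[OF assms(1)] rlinD[OF assms(2)] in \<open>simp_all add: Pi_def\<close>)
  also have "\<dots> = U1 f \<oplus>\<^bsub>T\<^esub> U1 g"
    unfolding U1_def by (rule T.finsum_addf) (use rlinD[OF assms(1)] rlinD[OF assms(2)] in \<open>simp_all add: Pi_def\<close>)
  finally show ?thesis .
qed

text \<open>Products in \<open>M\<^sub>1\<close> act by composition, and the action is
  faithful.\<close>

lemma U1_comp:
  assumes f: "rlin f" and g: "rlin g"
  shows "U1 (\<lambda>a\<in>carrier M. f (g a)) = U1 f \<otimes>\<^bsub>M1\<^esub> U1 g"
proof -
  have fg: "rlin (\<lambda>a. f (g a))"
    using f g by (auto simp: rlin_def additive_def Pi_def)
  have "U1 (\<lambda>a\<in>carrier M. f (g a)) = U1 (\<lambda>a. f (g a))" by (rule U1_cong) (use fg in auto)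
  also have "\<dots> = U1 f \<otimes>\<^bsub>M1\<^esub> U1 g"
    by (rule act_eqI) (use f g fg rlinD[OF g] in \<open>simp_all add: act_mult act_U1\<close>)
  finally show ?thesis .
qed

lemma U1_bij: "bij_betw U1 (carrier (End_alg N M \<iota>)) Cas"
proof (rule bij_betwI)
  show "U1 \<in> carrier (End_alg N M \<iota>) \<rightarrow> Cas" using U1_Cas by (auto simp: End_carrier)
  show "(\<lambda>t. restrict (act t) (carrier M)) \<in> Cas \<rightarrow> carrier (End_alg N M \<iota>)"
  proof
    fix t assume "t \<in> Cas"
    from nendD[OF act_nend[OF this]] show "restrict (act t) (carrier M) \<in> carrier (End_alg N M \<iota>)"
      by (auto simp: End_carrier nend_def rlin_def llin_def additive_def)
  qed
  show "restrict (act (U1 f)) (carrier M) = f" if "f \<in> carrier (End_alg N M \<iota>)" for f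
    using that by (intro extensionalityI[of _ "carrier M"]) (auto simp: End_carrier nend_def act_U1)
  show "U1 (restrict (act t) (carrier M)) = t" if "t \<in> Cas" for t
    using that U1_cong[of "restrict (act t) (carrier M)" "act t"] by (simp add: act_rlin)
qed

end

section \<open>Depth two extensions with trivial centralizer\<close>

text \<open>The depth two condition enters only through the quasibasis, and biseparability only through
  separability, which makes the index \<open>\<Sum> x\<^sub>i y\<^sub>i\<close> a nonzero scalar, and splitting, which does the
  same for \<open>E(1)\<close>.\<close>

locale d2_frobenius_ext = frob_ext +
  fixes q :: nat and b :: "nat \<Rightarrow> ('b, 'b) tens" and \<beta> :: "nat \<Rightarrow> 'b \<Rightarrow> 'b"
  assumes triv: "trivial_centralizer N M \<iota>"
    and sep: "separable_ext N M \<iota>" and split: "split_ext N M \<iota>"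
    and qb: "left_D2_quasibasis N M \<iota> q b \<beta>"
begin

section \<open>The ground field inside the extension\<close>

abbreviation (input) "R \<equiv> cent_ring N M \<iota>"

sublocale R: field R using triv by (simp add: trivial_centralizer_def)

lemma R_simps [simp]:
  "a \<otimes>\<^bsub>R\<^esub> c = a \<otimes>\<^bsub>M\<^esub> c" "a \<oplus>\<^bsub>R\<^esub> c = a \<oplus>\<^bsub>M\<^esub> c" "\<one>\<^bsub>R\<^esub> = \<one>\<^bsub>M\<^esub>" "\<zero>\<^bsub>R\<^esub> = \<zero>\<^bsub>M\<^esub>"
  by (simp_all add: cent_ring_def)

lemma R_iff: "r \<in> carrier R \<longleftrightarrow> r \<in> carrier M \<and> (\<forall>n\<in>carrier N. r \<otimes>\<^bsub>M\<^esub> \<iota> n = \<iota> n \<otimes>\<^bsub>M\<^esub> r)"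
  by (auto simp: cent_ring_def ext_centralizer_def)

lemma R_M [simp]: "r \<in> carrier R \<Longrightarrow> r \<in> carrier M" by (simp add: R_iff)

lemma R_center: "carrier R = ring_center M"
  using triv by (simp add: trivial_centralizer_def cent_ring_def)

lemma R_comm: "r \<in> carrier R \<Longrightarrow> m \<in> carrier M \<Longrightarrow> m \<otimes>\<^bsub>M\<^esub> r = r \<otimes>\<^bsub>M\<^esub> m"
  unfolding R_center ring_center_def mem_Collect_eq by metis

text \<open>Triviality of the centralizer also on the side of \<open>N\<close>: because scalars come
  from \<open>N\<close>, the \<open>N\<close>-bimodule maps are linear over R, and scalars cross the
  tensor sign.\<close>

lemma R_iota:
  assumes "r \<in> carrier R"
  obtains n where "n \<in> carrier N" "r = \<iota> n"
proof -
  have "\<iota> ` ring_center N = carrier R"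
    using triv by (simp add: trivial_centralizer_def cent_ring_def bij_betw_def)
  then obtain n where "n \<in> ring_center N" "r = \<iota> n" using assms by blast
  then show ?thesis using that unfolding ring_center_def by blast
qed

lemma R_sum:
  assumes "f \<in> I \<rightarrow> carrier R"
  shows "finsum R f I = finsum M f I"
  using assms
proof (induction I rule: infinite_finite_induct)
  case (insert i I)
  then have "f i \<in> carrier R" "f \<in> I \<rightarrow> carrier R" by auto
  then show ?case using insert by (simp add: R.finsum_insert M.finsum_insert Pi_def)
qed auto

lemma R_sum_cl: "(\<And>i. i \<in> I \<Longrightarrow> f i \<in> carrier R) \<Longrightarrow> finsum M f I \<in> carrier R"
  using R.finsum_closed[of f I] R_sum[of f I] by (simp add: Pi_def)

lemma nend_R:
  assumes f: "nend f" and r: "r \<in> carrier R" and m: "m \<in> carrier M"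
  shows "f (r \<otimes>\<^bsub>M\<^esub> m) = r \<otimes>\<^bsub>M\<^esub> f m" "f (m \<otimes>\<^bsub>M\<^esub> r) = r \<otimes>\<^bsub>M\<^esub> f m"
proof -
  obtain n where n: "n \<in> carrier N" "r = \<iota> n" by (rule R_iota[OF r])
  show "f (r \<otimes>\<^bsub>M\<^esub> m) = r \<otimes>\<^bsub>M\<^esub> f m" unfolding n using n m nendD[OF f] by simp
  then show "f (m \<otimes>\<^bsub>M\<^esub> r) = r \<otimes>\<^bsub>M\<^esub> f m" using R_comm[OF r m] by simp
qed

lemma R_act:
  assumes r: "r \<in> carrier R" and t: "t \<in> carrier T"
  shows "ract T t r = lact T r t"
proof (rule tens_eqI[OF t T.abelian_group_axioms, where F = "\<lambda>t. ract T t r" and G = "lact T r"])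
  obtain n where n: "n \<in> carrier N" "r = \<iota> n" by (rule R_iota[OF r])
  fix a c assume ac: "a \<in> carrier M" "c \<in> carrier M"
  then show "ract T (pure a c) r = lact T r (pure a c)"
    using R_comm[OF r ac(1), symmetric] R_comm[OF r ac(2)] n pure_bal[OF ac(1) n(1) ac(2)] by simp
qed (use r in simp_all)

lemma tmap_lact:
  assumes f: "rlin f" and g: "llin g" and t: "t \<in> carrier T" and m: "m \<in> carrier M"
  shows "tmap (\<lambda>a. a) g (lact T m t) = lact T m (tmap (\<lambda>a. a) g t)"
    and "tmap f (\<lambda>a. a) (ract T t m) = ract T (tmap f (\<lambda>a. a) t) m"
  by (rule tens_eqI[OF t T.abelian_group_axioms, where F = "\<lambda>t. tmap (\<lambda>a. a) g (lact T m t)" and G = "\<lambda>t. lact T m (tmap (\<lambda>a. a) g t)"],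
      use f g m in \<open>simp_all add: tmap_simps lin_id llinD\<close>,
      rule tens_eqI[OF t T.abelian_group_axioms, where F = "\<lambda>t. tmap f (\<lambda>a. a) (ract T t m)" and G = "\<lambda>t. ract T (tmap f (\<lambda>a. a) t) m"],
      simp_all add: tmap_simps lin_id rlinD)

lemma tmap_comp:
  assumes "rlin f" "llin g" "rlin f'" "llin g'" and t: "t \<in> carrier T"
  shows "tmap f g (tmap f' g' t) = tmap (\<lambda>a. f (f' a)) (\<lambda>a. g (g' a)) t"
proof -
  have 1: "rlin (\<lambda>a. f (f' a))" "llin (\<lambda>a. g (g' a))"
    using assms by (auto simp: rlin_def llin_def additive_def Pi_def)
  show ?thesis
    by (rule tens_eqI[OF t T.abelian_group_axioms, where F = "\<lambda>t. tmap f g (tmap f' g' t)" and G = "tmap (\<lambda>a. f (f' a)) (\<lambda>a. g (g' a))"])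
       (use assms 1 in \<open>simp_all add: tmap_simps rlinD llinD\<close>)
qed

lemma nend_comp: "nend f \<Longrightarrow> nend g \<Longrightarrow> nend (\<lambda>a. f (g a))"
  by (auto simp: nend_def rlin_def llin_def additive_def Pi_def)

lemma nend_id: "nend (\<lambda>a. a)" by (simp add: nend_def lin_id)

lemma tmap_Cas:
  assumes f: "nend f" and g: "nend g" and t: "t \<in> Cas"
  shows "tmap f g t \<in> Cas"
  unfolding Cas_def
proof (intro CollectI conjI ballI)
  note fg = nendD(1)[OF f] nendD(2)[OF g]
  note s = tmap_simps[OF fg] 
  show "tmap f g t \<in> carrier T" using s t by simp
  fix n assume n: "n \<in> carrier N"
  have "lact T (\<iota> n) (tmap f g t) = tmap f g (lact T (\<iota> n) t)"
    by (rule tens_eqI[OF Cas_D[OF t] T.abelian_group_axioms, where F = "\<lambda>t. lact T (\<iota> n) (tmap f g t)" and G = "\<lambda>t. tmap f g (lact T (\<iota> n) t)"])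
       (use n s nendD[OF f] nendD[OF g] in simp_all)
  also have "\<dots> = tmap f g (ract T t (\<iota> n))" using t n Cas_comm by simp
  also have "\<dots> = ract T (tmap f g t) (\<iota> n)"
    by (rule tens_eqI[OF Cas_D[OF t] T.abelian_group_axioms, where G = "\<lambda>t. ract T (tmap f g t) (\<iota> n)" and F = "\<lambda>t. tmap f g (ract T t (\<iota> n))"])
       (use n s nendD[OF f] nendD[OF g] in simp_all)
  finally show "lact T (\<iota> n) (tmap f g t) = ract T (tmap f g t) (\<iota> n)" .
qed

text \<open>Multiplication is a bimodule map, so a tensor that commutes with \<open>N\<close> goes
  to an element that commutes with \<open>N\<close>. This is why the pairings take values in
  R.\<close>

lemma mu_Cas [simp]:
  assumes "t \<in> Cas"
  shows "sq_mult M t \<in> carrier R"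
proof -
  have "sq_mult M t \<otimes>\<^bsub>M\<^esub> \<iota> n = \<iota> n \<otimes>\<^bsub>M\<^esub> sq_mult M t" if n: "n \<in> carrier N" for n
    using arg_cong[OF Cas_comm[OF assms n], of "sq_mult M"] assms n by (simp add: mu_act)
  then show ?thesis using assms by (simp add: R_iff)
qed

text \<open>The pairings \<open>\<langle>t, f\<rangle> = t\<^sup>1 f(t\<^sup>2)\<close> and \<open>[f, t] = f(t\<^sup>1) t\<^sup>2\<close>.\<close>

definition pr :: "('b \<Rightarrow> 'b) \<Rightarrow> ('b, 'b) tens \<Rightarrow> 'b" where "pr f t = sq_mult M (tmap (\<lambda>a. a) f t)"
definition pl :: "('b \<Rightarrow> 'b) \<Rightarrow> ('b, 'b) tens \<Rightarrow> 'b" where "pl f t = sq_mult M (tmap f (\<lambda>a. a) t)"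

lemma pr_simps:
  assumes "llin f"
  shows "a \<in> carrier M \<Longrightarrow> c \<in> carrier M \<Longrightarrow> pr f (pure a c) = a \<otimes>\<^bsub>M\<^esub> f c"
    "t \<in> carrier T \<Longrightarrow> pr f t \<in> carrier M"
    "s \<in> carrier T \<Longrightarrow> t \<in> carrier T \<Longrightarrow> pr f (s \<oplus>\<^bsub>T\<^esub> t) = pr f s \<oplus>\<^bsub>M\<^esub> pr f t"
    "t \<in> carrier T \<Longrightarrow> m \<in> carrier M \<Longrightarrow> pr f (lact T m t) = m \<otimes>\<^bsub>M\<^esub> pr f t"
  using assms by (simp_all add: pr_def tmap_simps lin_id llinD tmap_lact(1)[OF lin_id(1)] mu_act)

lemma pl_simps:
  assumes "rlin f"
  shows "a \<in> carrier M \<Longrightarrow> c \<in> carrier M \<Longrightarrow> pl f (pure a c) = f a \<otimes>\<^bsub>M\<^esub> c"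
    "t \<in> carrier T \<Longrightarrow> pl f t \<in> carrier M"
    "s \<in> carrier T \<Longrightarrow> t \<in> carrier T \<Longrightarrow> pl f (s \<oplus>\<^bsub>T\<^esub> t) = pl f s \<oplus>\<^bsub>M\<^esub> pl f t"
    "t \<in> carrier T \<Longrightarrow> m \<in> carrier M \<Longrightarrow> pl f (ract T t m) = pl f t \<otimes>\<^bsub>M\<^esub> m"
  using assms by (simp_all add: pl_def tmap_simps lin_id rlinD tmap_lact(2)[OF _ lin_id(2)] mu_act)

lemma pr_R [simp]: "nend f \<Longrightarrow> t \<in> Cas \<Longrightarrow> pr f t \<in> carrier R"
  unfolding pr_def by (intro mu_Cas tmap_Cas nend_id)

lemma pl_R [simp]: "nend f \<Longrightarrow> t \<in> Cas \<Longrightarrow> pl f t \<in> carrier R"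
  unfolding pl_def by (intro mu_Cas tmap_Cas nend_id)

lemma pr_tmap: 
  assumes "rlin f" "llin g" "llin h" "t \<in> carrier T"
  shows "pr h (tmap f g t) = sq_mult M (tmap f (\<lambda>a. h (g a)) t)"
  unfolding pr_def using tmap_comp[OF lin_id(1) assms(3) assms(1,2,4)] by simp

lemma pl_tmap: 
  assumes "rlin f" "llin g" "rlin h" "t \<in> carrier T"
  shows "pl h (tmap f g t) = sq_mult M (tmap (\<lambda>a. h (f a)) g t)"
  unfolding pl_def using tmap_comp[OF assms(3) lin_id(2) assms(1,2,4)] by simp

lemma pr_id [simp]: "t \<in> carrier T \<Longrightarrow> pr (\<lambda>a. a) t = sq_mult M t"
  by (rule tens_eqI[OF _ M.abelian_group_axioms, where F = "pr (\<lambda>a. a)" and G = "sq_mult M"]) (simp_all add: pr_simps lin_id)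

lemma pr_cong:
  assumes "t \<in> carrier T" "llin f" "\<And>a. a \<in> carrier M \<Longrightarrow> f a = g a"
  shows "pr f t = pr g t"
proof -
  have g: "llin g" using assms by (auto simp: llin_def additive_def Pi_def)
  show ?thesis
    by (rule tens_eqI[OF assms(1) M.abelian_group_axioms, where F = "pr f" and G = "pr g"]) (simp_all add: pr_simps assms g)
qed

lemma pl_cong:
  assumes "t \<in> carrier T" "rlin f" "\<And>a. a \<in> carrier M \<Longrightarrow> f a = g a"
  shows "pl f t = pl g t"
proof -
  have g: "rlin g" using assms by (auto simp: rlin_def additive_def Pi_def)
  show ?thesis
    by (rule tens_eqI[OF assms(1) M.abelian_group_axioms, where F = "pl f" and G = "pl g"]) (simp_all add: pl_simps assms g)
qed

lemma u_Cas [simp]: "u \<in> Cas"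
  using U1_Cas[OF nend_id] by (simp add: U1_def u_def)

lemma mu_U1: "rlin f \<Longrightarrow> sq_mult M (U1 f) = pl f u"
  by (simp add: U1_tmap pl_def)

lemma mu_U2: "llin f \<Longrightarrow> sq_mult M (U2 f) = pr f u"
  by (simp add: U2_tmap pr_def)

section \<open>The index and \<open>E(1)\<close> as nonzero scalars\<close>

definition lam :: 'b where "lam = sq_mult M u"
definition epsone :: 'b where "epsone = eps \<one>\<^bsub>M\<^esub>"

lemma lam_R [simp]: "lam \<in> carrier R" by (simp add: lam_def)

lemma lam_sum: "lam = (\<Oplus>\<^bsub>M\<^esub>i\<in>{..<k}. x i \<otimes>\<^bsub>M\<^esub> y i)"
proof -
  have "lam = (\<Oplus>\<^bsub>M\<^esub>i\<in>{..<k}. sq_mult M (pure (x i) (y i)))"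
    unfolding lam_def u_def by (rule T_sum[OF M.abelian_group_axioms]) simp_all
  also have "\<dots> = (\<Oplus>\<^bsub>M\<^esub>i\<in>{..<k}. x i \<otimes>\<^bsub>M\<^esub> y i)" by (rule M.finsum_cong') auto
  finally show ?thesis .
qed

text \<open>The action of a separability element is right multiplication by a scalar
  \<open>r\<close>, so by faithfulness the element is \<open>lact T r u\<close>. Applying the
  multiplication map gives \<open>1 = r lam\<close>.\<close>

lemma lam_nonzero: "lam \<noteq> \<zero>\<^bsub>M\<^esub>"
proof
  assume 0: "lam = \<zero>\<^bsub>M\<^esub>"
  obtain \<sigma> where \<sigma>: "\<sigma> \<in> bimod_hom M M (ring_bimod M id id) T" "\<And>m. m \<in> carrier M \<Longrightarrow> sq_mult M (\<sigma> m) = m"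
    using sep by (auto simp: separable_ext_def)
  define c where "c = \<sigma> \<one>\<^bsub>M\<^esub>"
  have c: "c \<in> carrier T" "sq_mult M c = \<one>\<^bsub>M\<^esub>" using \<sigma> by (auto simp: c_def bimod_hom_def)
  have cc: "lact T m c = ract T c m" if m: "m \<in> carrier M" for m
  proof -
    have "\<sigma> (m \<otimes>\<^bsub>M\<^esub> \<one>\<^bsub>M\<^esub>) = lact T m c" "\<sigma> (\<one>\<^bsub>M\<^esub> \<otimes>\<^bsub>M\<^esub> m) = ract T c m"
      using \<sigma>(1) m unfolding bimod_hom_def c_def ring_bimod_simps id_apply by blast+
    then show ?thesis using m by simp
  qed
  define r where "r = act c \<one>\<^bsub>M\<^esub>"
  have r: "r \<in> carrier M" using c by (simp add: r_def)
  have ac: "act c m = m \<otimes>\<^bsub>M\<^esub> r" if m: "m \<in> carrier M" for m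
    using act_props(3)[OF c(1) m, of "\<one>\<^bsub>M\<^esub>"] act_props(2)[OF c(1) m, of "\<one>\<^bsub>M\<^esub>"] cc[OF m] m by (simp add: r_def)
  \<comment> \<open>The action of \<open>c\<close> is right linear over \<open>N\<close> and at the
    same time right multiplication by \<open>r\<close>; comparing both at the image of
    \<open>n\<close> shows that \<open>r\<close> centralizes \<open>N\<close>.\<close>
  have rR: "r \<in> carrier R" unfolding R_iff
  proof (intro conjI ballI r)
    fix n assume n: "n \<in> carrier N"
    have "act c (\<one>\<^bsub>M\<^esub> \<otimes>\<^bsub>M\<^esub> \<iota> n) = r \<otimes>\<^bsub>M\<^esub> \<iota> n" using rlinD(3)[OF act_rlin[OF c(1)] M.one_closed n] by (simp add: r_def)
    then show "r \<otimes>\<^bsub>M\<^esub> \<iota> n = \<iota> n \<otimes>\<^bsub>M\<^esub> r" using ac n by simp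
  qed
  have "c = lact T r u"
    by (rule act_eqI) (use c r ac R_comm[OF rR] in \<open>simp_all add: act_props\<close>)
  then have "\<one>\<^bsub>M\<^esub> = r \<otimes>\<^bsub>M\<^esub> lam" using c r by (simp add: mu_act lam_def)
  then have "\<one>\<^bsub>M\<^esub> = \<zero>\<^bsub>M\<^esub>" using 0 r by simp
  then show False using R.one_not_zero by simp
qed

lemma R_cancel:
  assumes "r \<in> carrier R" "s \<in> carrier R" "c \<in> carrier R" "c \<noteq> \<zero>\<^bsub>M\<^esub>" "r \<otimes>\<^bsub>M\<^esub> c = s \<otimes>\<^bsub>M\<^esub> c"
  shows "r = s"
  using R.m_rcancel[of c r s] assms by simp

lemma eps_nend: "nend eps"
  by (auto simp: nend_def rlin_def llin_def additive_def)

lemma nend_one [simp]: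
  assumes "nend f"
  shows "f \<one>\<^bsub>M\<^esub> \<in> carrier R"
  unfolding R_iff using nendD[OF assms] nendD(5,6)[OF assms M.one_closed] by simp

lemma epsone_R [simp]: "epsone \<in> carrier R" 
  unfolding epsone_def by (rule nend_one[OF eps_nend])

text \<open>Expanding the projection onto the summand \<open>N\<close> along the Frobenius system
  shows its value at 1 to be a scalar multiple of E(1), whereas the splitting makes that value
  invertible.\<close>

lemma epsone_nonzero: "epsone \<noteq> \<zero>\<^bsub>M\<^esub>"
proof
  assume 0: "epsone = \<zero>\<^bsub>M\<^esub>"
  obtain V :: "('a, 'a, 'b) bimod" and f where V: "bimodule N N V"
    and f: "f \<in> bimod_hom N N (bimod_sum (ring_bimod N id id) V) (ring_bimod M \<iota> \<iota>)"
      "bij_betw f (carrier (bimod_sum (ring_bimod N id id) V)) (carrier M)"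
    using split by (auto simp: split_ext_def direct_summand_def bimod_iso_def)
  interpret V: abelian_group V using V by (simp add: bimodule_def)
  have cS: "carrier (bimod_sum (ring_bimod N id id) V) = carrier N \<times> carrier V" by (simp add: bimod_sum_def)
  have Vl: "lact V n v \<in> carrier V" "ract V v n \<in> carrier V" if "n \<in> carrier N" "v \<in> carrier V" for n v
    using V that by (auto simp: bimodule_def)
  have V0: "lact V n \<zero>\<^bsub>V\<^esub> = \<zero>\<^bsub>V\<^esub>" "ract V \<zero>\<^bsub>V\<^esub> n = \<zero>\<^bsub>V\<^esub>" if n: "n \<in> carrier N" for n
    by (rule additive_zero[OF V.abelian_group_axioms V.abelian_group_axioms, where f = "lact V n"],
        use V n in \<open>force simp: bimodule_def intro!: additiveI\<close>,
        rule additive_zero[OF V.abelian_group_axioms V.abelian_group_axioms, where f = "\<lambda>v. ract V v n"],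
        use V n in \<open>force simp: bimodule_def intro!: additiveI\<close>)
  have fl: "f (n \<otimes>\<^bsub>N\<^esub> a, lact V n v) = \<iota> n \<otimes>\<^bsub>M\<^esub> f (a, v)" "f (a \<otimes>\<^bsub>N\<^esub> n, ract V v n) = f (a, v) \<otimes>\<^bsub>M\<^esub> \<iota> n"
    and fa: "f (a \<oplus>\<^bsub>N\<^esub> a', v \<oplus>\<^bsub>V\<^esub> v') = f (a, v) \<oplus>\<^bsub>M\<^esub> f (a', v')"
    if "n \<in> carrier N" "a \<in> carrier N" "v \<in> carrier V" "a' \<in> carrier N" "v' \<in> carrier V" for n a a' v v'
    using f(1) that by (auto simp: bimod_hom_def bimod_sum_def id_apply)
  have fc: "f (a, v) \<in> carrier M" if "a \<in> carrier N" "v \<in> carrier V" for a v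
    using f(2) that by (auto simp: bij_betw_def cS)
  define g where "g m = fst (inv_into (carrier N \<times> carrier V) f m)" for m
  have gf: "g (f (a, v)) = a" if "a \<in> carrier N" "v \<in> carrier V" for a v
    using f(2) that by (simp add: g_def bij_betw_def cS inv_into_f_f)
  have ob: "\<exists>a v. a \<in> carrier N \<and> v \<in> carrier V \<and> m = f (a, v)" if "m \<in> carrier M" for m
    using f(2) that unfolding bij_betw_def cS by blast
  have gn: "nend (\<lambda>m. \<iota> (g m))"
    unfolding nend_def rlin_def llin_def
  proof (intro conjI ballI additiveI)
    fix m assume m: "m \<in> carrier M"
    then obtain a v where av: "a \<in> carrier N" "v \<in> carrier V" "m = f (a, v)" using ob by blast
    show "\<iota> (g m) \<in> carrier M" using av gf by simp
    show "\<iota> (g m) \<in> carrier M" by fact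
    fix n assume n: "n \<in> carrier N"
    show "\<iota> (g (m \<otimes>\<^bsub>M\<^esub> \<iota> n)) = \<iota> (g m) \<otimes>\<^bsub>M\<^esub> \<iota> n"
      using av n gf fl(2)[of n a v a v] Vl gf[of "a \<otimes>\<^bsub>N\<^esub> n" "ract V v n"] by (simp add: iota_mult)
    show "\<iota> (g (\<iota> n \<otimes>\<^bsub>M\<^esub> m)) = \<iota> n \<otimes>\<^bsub>M\<^esub> \<iota> (g m)"
      using av n gf fl(1)[of n a v a v] Vl gf[of "n \<otimes>\<^bsub>N\<^esub> a" "lact V n v"] by (simp add: iota_mult)
  next
    fix m m' assume m: "m \<in> carrier M" "m' \<in> carrier M"
    then obtain a v a' v' where av: "a \<in> carrier N" "v \<in> carrier V" "m = f (a, v)" "a' \<in> carrier N" "v' \<in> carrier V" "m' = f (a', v')" using ob by meson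
    show "\<iota> (g (m \<oplus>\<^bsub>M\<^esub> m')) = \<iota> (g m) \<oplus>\<^bsub>M\<^esub> \<iota> (g m')"
      using av gf fa[of a a v a' v'] gf[of "a \<oplus>\<^bsub>N\<^esub> a'" "v \<oplus>\<^bsub>V\<^esub> v'"] by (simp add: iota_add)
    then show "\<iota> (g (m \<oplus>\<^bsub>M\<^esub> m')) = \<iota> (g m) \<oplus>\<^bsub>M\<^esub> \<iota> (g m')" .
  qed
  \<comment> \<open>The generator of the summand. The splitting is an abstract isomorphism, so
    \<open>w\<close> may differ from 1; but it is a scalar, and the projection \<open>g\<close>
    sends it to 1.\<close>
  define w where "w = f (\<one>\<^bsub>N\<^esub>, \<zero>\<^bsub>V\<^esub>)"
  have w: "w \<in> carrier R" unfolding R_iff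
  proof (intro conjI ballI)
    show "w \<in> carrier M" using fc by (simp add: w_def)
    fix n assume n: "n \<in> carrier N"
    show "w \<otimes>\<^bsub>M\<^esub> \<iota> n = \<iota> n \<otimes>\<^bsub>M\<^esub> w"
      using fl[of n "\<one>\<^bsub>N\<^esub>" "\<zero>\<^bsub>V\<^esub>" "\<one>\<^bsub>N\<^esub>" "\<zero>\<^bsub>V\<^esub>"] n V0 by (simp add: w_def)
  qed
  have 1: "w \<otimes>\<^bsub>M\<^esub> \<iota> (g \<one>\<^bsub>M\<^esub>) = \<one>\<^bsub>M\<^esub>"
    using nend_R(1)[OF gn w M.one_closed] w gf[of "\<one>\<^bsub>N\<^esub>" "\<zero>\<^bsub>V\<^esub>"] by (simp add: w_def)
  let ?h = "\<lambda>m. \<iota> (g m)"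
  \<comment> \<open>\<open>r\<close> is the scalar \<open>\<Sum> x\<^sub>i ?h(y\<^sub>i)\<close>,
    and the claim to be reached is \<open>?h(1) = r E(1)\<close>.\<close>
  define r where "r = pr ?h u"
  have r: "r \<in> carrier R" using gn by (simp add: r_def)
  note gl = nendD(2)[OF gn]
  have "?h \<one>\<^bsub>M\<^esub> = coact (U2 ?h) \<one>\<^bsub>M\<^esub>" by (simp add: coact_U2[OF gl])
  also have "\<dots> = eps (sq_mult M (U2 ?h))"
  proof -
    have "coact (U2 ?h) \<one>\<^bsub>M\<^esub> = (\<Oplus>\<^bsub>M\<^esub>i\<in>{..<k}. eps (x i) \<otimes>\<^bsub>M\<^esub> ?h (y i))"
      unfolding U2_def
      by (subst T_sum[OF M.abelian_group_axioms, where F = "\<lambda>t. coact t \<one>\<^bsub>M\<^esub>"])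
         (simp_all add: nendD[OF gn], rule M.finsum_cong', simp_all add: nendD[OF gn])
    moreover have "eps (sq_mult M (U2 ?h)) = (\<Oplus>\<^bsub>M\<^esub>i\<in>{..<k}. eps (x i) \<otimes>\<^bsub>M\<^esub> ?h (y i))"
    proof -
      have gi: "g (y i) \<in> carrier N" if "i < k" for i using ob[of "y i"] gf that by auto
      show ?thesis unfolding U2_def
        by (subst T_sum[OF M.abelian_group_axioms, where F = "\<lambda>t. eps (sq_mult M t)"])
           (simp_all add: nendD[OF gn], rule M.finsum_cong', simp_all add: nendD[OF gn] gi)
    qed
    ultimately show ?thesis by simp
  qed
  also have "\<dots> = eps (r \<otimes>\<^bsub>M\<^esub> \<one>\<^bsub>M\<^esub>)" using r by (simp add: mu_U2[OF gl] r_def)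
  also have "\<dots> = r \<otimes>\<^bsub>M\<^esub> epsone" using nend_R(1)[OF eps_nend r M.one_closed] by (simp add: epsone_def)
  also have "\<dots> = \<zero>\<^bsub>M\<^esub>" using 0 r by simp
  finally have "\<one>\<^bsub>M\<^esub> = \<zero>\<^bsub>M\<^esub>" using 1 w by simp
  then show False using R.one_not_zero by simp
qed

text \<open>Evaluating \<open>\<Sum> x\<^sub>j f(y\<^sub>j x\<^sub>i) y\<^sub>i\<close> in two ways shows that both sides agree after multiplication
  with the index \<open>\<Sum> x\<^sub>i y\<^sub>i\<close>.\<close>

lemma traces_agree:
  assumes f: "nend f"
  shows "sq_mult M (U1 f) = sq_mult M (U2 f)"
proof -
  note f' = nendD[OF f]
  have L: "pl f u \<in> carrier R" "pr f u \<in> carrier R"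
    by (rule pl_R[OF f u_Cas], rule pr_R[OF f u_Cas])
  define F where "F t = (\<Oplus>\<^bsub>M\<^esub>i\<in>{..<k}. x i \<otimes>\<^bsub>M\<^esub> pl f (lact T (y i) t))" for t
  have "F u = (\<Oplus>\<^bsub>M\<^esub>i\<in>{..<k}. pl f u \<otimes>\<^bsub>M\<^esub> (x i \<otimes>\<^bsub>M\<^esub> y i))"
    unfolding F_def
  proof (rule M.finsum_cong'[OF refl])
    fix i assume i: "i \<in> {..<k}"
    then have "x i \<otimes>\<^bsub>M\<^esub> pl f (lact T (y i) u) = x i \<otimes>\<^bsub>M\<^esub> pl f u \<otimes>\<^bsub>M\<^esub> y i"
      using f' L by (simp add: u_casimir pl_simps M.m_assoc)
    then show "x i \<otimes>\<^bsub>M\<^esub> pl f (lact T (y i) u) = pl f u \<otimes>\<^bsub>M\<^esub> (x i \<otimes>\<^bsub>M\<^esub> y i)"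
      using i L by (simp add: R_comm[OF L(1)] M.m_assoc)
  qed (use L in simp)
  also have "\<dots> = pl f u \<otimes>\<^bsub>M\<^esub> lam"
    unfolding lam_sum using L by (intro M.finsum_rdistr[symmetric]) auto
  finally have 1: "F u = pl f u \<otimes>\<^bsub>M\<^esub> lam" .
  have "F u = pr f u \<otimes>\<^bsub>M\<^esub> sq_mult M u"
  proof (rule tens_eqI[OF u_cl M.abelian_group_axioms, where F = F and G = "\<lambda>t. pr f u \<otimes>\<^bsub>M\<^esub> sq_mult M t"])
    show "F t \<in> carrier M" if "t \<in> carrier T" for t
      unfolding F_def using that f' by (intro M.finsum_closed) (auto simp: pl_simps)
    show "F (s \<oplus>\<^bsub>T\<^esub> t) = F s \<oplus>\<^bsub>M\<^esub> F t" if "s \<in> carrier T" "t \<in> carrier T" for s t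
    proof -
      have "F (s \<oplus>\<^bsub>T\<^esub> t) = (\<Oplus>\<^bsub>M\<^esub>i\<in>{..<k}. x i \<otimes>\<^bsub>M\<^esub> pl f (lact T (y i) s) \<oplus>\<^bsub>M\<^esub> x i \<otimes>\<^bsub>M\<^esub> pl f (lact T (y i) t))"
        unfolding F_def by (rule M.finsum_cong') (use that f' in \<open>auto simp: pl_simps M.r_distr\<close>)
      also have "\<dots> = F s \<oplus>\<^bsub>M\<^esub> F t"
        unfolding F_def by (rule M.finsum_addf) (use that f' in \<open>auto simp: pl_simps\<close>)
      finally show ?thesis .
    qed
    fix a c assume ac: "a \<in> carrier M" "c \<in> carrier M"
    have "F (pure a c) = (\<Oplus>\<^bsub>M\<^esub>i\<in>{..<k}. x i \<otimes>\<^bsub>M\<^esub> f (y i \<otimes>\<^bsub>M\<^esub> a) \<otimes>\<^bsub>M\<^esub> c)"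
      unfolding F_def by (rule M.finsum_cong') (use ac f' in \<open>auto simp: pl_simps M.m_assoc\<close>)
    also have "\<dots> = (\<Oplus>\<^bsub>M\<^esub>i\<in>{..<k}. x i \<otimes>\<^bsub>M\<^esub> f (y i \<otimes>\<^bsub>M\<^esub> a)) \<otimes>\<^bsub>M\<^esub> c"
      by (rule M.finsum_ldistr[symmetric]) (use ac f' in auto)
    also have "(\<Oplus>\<^bsub>M\<^esub>i\<in>{..<k}. x i \<otimes>\<^bsub>M\<^esub> f (y i \<otimes>\<^bsub>M\<^esub> a)) = pr f (ract T u a)"
      unfolding u_def
      by (subst T_sum[OF M.abelian_group_axioms, where F = "\<lambda>t. pr f (ract T t a)"])
         (use ac f' in \<open>simp_all add: pr_simps\<close>, rule M.finsum_cong', use ac f' in \<open>simp_all add: pr_simps\<close>)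
    also have "\<dots> = pr f u \<otimes>\<^bsub>M\<^esub> a"
      unfolding u_casimir[OF ac(1), symmetric] using f' ac R_comm[OF L(2) ac(1)] by (simp add: pr_simps)
    finally show "F (pure a c) = pr f u \<otimes>\<^bsub>M\<^esub> sq_mult M (pure a c)" using ac L by (simp add: M.m_assoc)
  qed (use f' L in \<open>simp_all add: M.r_distr\<close>)
  then have "pl f u \<otimes>\<^bsub>M\<^esub> lam = pr f u \<otimes>\<^bsub>M\<^esub> lam" using 1 by (simp add: lam_def)
  then have "pl f u = pr f u" using R_cancel[OF L lam_R lam_nonzero] by simp
  then show ?thesis using f' by (simp add: mu_U1 mu_U2)
qed

lemma R_closed [simp]:
  "r \<in> carrier R \<Longrightarrow> s \<in> carrier R \<Longrightarrow> r \<oplus>\<^bsub>M\<^esub> s \<in> carrier R"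
  "r \<in> carrier R \<Longrightarrow> s \<in> carrier R \<Longrightarrow> r \<otimes>\<^bsub>M\<^esub> s \<in> carrier R"
  "\<one>\<^bsub>M\<^esub> \<in> carrier R" "\<zero>\<^bsub>M\<^esub> \<in> carrier R"
  using R.a_closed[of r s] R.m_closed[of r s] R.one_closed R.zero_closed by simp_all

section \<open>The algebra structures of A and B\<close>

definition AA where "AA = End_bialg N M \<iota> q b \<beta>"
definition BB where "BB = Cas_bialg N M \<iota> q b \<beta>"

lemma AA_simps:
  "carrier AA = carrier (End_alg N M \<iota>)"
  "f \<otimes>\<^bsub>AA\<^esub> g = (\<lambda>a\<in>carrier M. f (g a))" "\<one>\<^bsub>AA\<^esub> = (\<lambda>a\<in>carrier M. a)" "\<zero>\<^bsub>AA\<^esub> = (\<lambda>a\<in>carrier M. \<zero>\<^bsub>M\<^esub>)"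
  "f \<oplus>\<^bsub>AA\<^esub> g = (\<lambda>a\<in>carrier M. f a \<oplus>\<^bsub>M\<^esub> g a)" "r \<odot>\<^bsub>AA\<^esub> f = (\<lambda>a\<in>carrier M. r \<otimes>\<^bsub>M\<^esub> f a)"
  "sym_bimod AA = sym_bimod (End_alg N M \<iota>)"
  by (simp_all add: AA_def End_bialg_def Let_def module.extend_def bialg.fields_def End_alg_def compose_def sym_bimod_def)

lemma AA_iff: "f \<in> carrier AA \<longleftrightarrow> nend f \<and> f \<in> extensional (carrier M)"
  by (simp add: AA_simps End_carrier)

lemma AA_nend [simp]: "f \<in> carrier AA \<Longrightarrow> nend f" by (simp add: AA_iff)

lemma AA_eqI:
  assumes "f \<in> carrier AA" "g \<in> carrier AA" "\<And>a. a \<in> carrier M \<Longrightarrow> f a = g a"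
  shows "f = g"
  using assms by (intro extensionalityI[of _ "carrier M"]) (auto simp: AA_iff)

lemma nend_cong:
  assumes "nend f" "\<And>a. a \<in> carrier M \<Longrightarrow> f a = g a"
  shows "nend g"
  using assms by (auto simp: nend_def rlin_def llin_def additive_def Pi_def)

lemma AA_restrict [simp]: "nend f \<Longrightarrow> restrict f (carrier M) \<in> carrier AA"
  by (auto simp: AA_iff intro: nend_cong)

lemma nend_add:
  assumes "nend f" "nend g"
  shows "nend (\<lambda>a. f a \<oplus>\<^bsub>M\<^esub> g a)"
  unfolding nend_def rlin_def llin_def
  using nendD(3-)[OF assms(1)] nendD(3-)[OF assms(2)]
  by (auto intro!: additiveI simp: M.l_distr M.r_distr M.a_ac)

lemma nend_minus:
  assumes "nend f"
  shows "nend (\<lambda>a. \<ominus>\<^bsub>M\<^esub> f a)"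
  unfolding nend_def rlin_def llin_def
  using nendD(3-)[OF assms(1)]
  by (auto intro!: additiveI simp: M.l_minus M.r_minus M.minus_add)

lemma nend_smult:
  assumes "nend f" and r: "r \<in> carrier R"
  shows "nend (\<lambda>a. r \<otimes>\<^bsub>M\<^esub> f a)"
proof -
  note D = nendD(3-)[OF assms(1)]
  have c: "\<iota> n \<otimes>\<^bsub>M\<^esub> (r \<otimes>\<^bsub>M\<^esub> f a) = r \<otimes>\<^bsub>M\<^esub> (\<iota> n \<otimes>\<^bsub>M\<^esub> f a)" if "a \<in> carrier M" "n \<in> carrier N" for a n
    using that r D R_comm[OF r, of "\<iota> n"] by (simp flip: M.m_assoc)
  show ?thesis
    unfolding nend_def rlin_def llin_def
    using D r c by (auto intro!: additiveI simp: M.r_distr M.m_assoc)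
qed

lemma nend_zero: "nend (\<lambda>a. \<zero>\<^bsub>M\<^esub>)"
  unfolding nend_def rlin_def llin_def by (auto intro!: additiveI)

lemma AA_closed:
  "f \<in> carrier AA \<Longrightarrow> g \<in> carrier AA \<Longrightarrow> f \<otimes>\<^bsub>AA\<^esub> g \<in> carrier AA" "\<one>\<^bsub>AA\<^esub> \<in> carrier AA" "\<zero>\<^bsub>AA\<^esub> \<in> carrier AA"
  "f \<in> carrier AA \<Longrightarrow> g \<in> carrier AA \<Longrightarrow> f \<oplus>\<^bsub>AA\<^esub> g \<in> carrier AA"
  "r \<in> carrier R \<Longrightarrow> f \<in> carrier AA \<Longrightarrow> r \<odot>\<^bsub>AA\<^esub> f \<in> carrier AA"
  unfolding AA_simps(2-6) by (simp_all add: nend_add nend_smult nend_comp nend_id nend_zero)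

lemma AA_apply:
  assumes "a \<in> carrier M"
  shows "(f \<otimes>\<^bsub>AA\<^esub> g) a = f (g a)" "\<one>\<^bsub>AA\<^esub> a = a" "\<zero>\<^bsub>AA\<^esub> a = \<zero>\<^bsub>M\<^esub>" "(f \<oplus>\<^bsub>AA\<^esub> g) a = f a \<oplus>\<^bsub>M\<^esub> g a"
    "(r \<odot>\<^bsub>AA\<^esub> f) a = r \<otimes>\<^bsub>M\<^esub> f a"
  using assms by (simp_all add: AA_simps)

lemma AA_abelian: "abelian_group AA"
proof (rule abelian_groupI)
  show "\<exists>g\<in>carrier AA. g \<oplus>\<^bsub>AA\<^esub> f = \<zero>\<^bsub>AA\<^esub>" if f: "f \<in> carrier AA" for f
  proof (rule bexI[of _ "\<lambda>a\<in>carrier M. \<ominus>\<^bsub>M\<^esub> f a"])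
    show g: "(\<lambda>a\<in>carrier M. \<ominus>\<^bsub>M\<^esub> f a) \<in> carrier AA" using f nend_minus[of f] by simp
    show "(\<lambda>a\<in>carrier M. \<ominus>\<^bsub>M\<^esub> f a) \<oplus>\<^bsub>AA\<^esub> f = \<zero>\<^bsub>AA\<^esub>"
      by (rule AA_eqI) (use f g AA_closed nendD(3)[OF AA_nend[OF f]] in \<open>simp_all add: AA_apply M.l_neg\<close>)
  qed
qed (simp_all add: AA_closed, (rule AA_eqI; simp add: AA_closed AA_apply nendD M.a_ac)+)

lemma AA_assoc_algebra: "assoc_algebra R AA"
  unfolding assoc_algebra_def
proof (intro conjI ballI)
  show "ring AA"
    by (rule ringI[OF AA_abelian], rule monoidI)
       (simp_all add: AA_closed, (rule AA_eqI; simp add: AA_closed AA_apply nendD)+)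
  show "module R AA"
    by (rule moduleI[OF R.is_cring AA_abelian])
       (simp_all add: AA_closed, (rule AA_eqI; simp add: AA_closed AA_apply nendD M.l_distr M.r_distr M.m_assoc)+)
  fix r f g assume "r \<in> carrier R" "f \<in> carrier AA" "g \<in> carrier AA"
  then show "(r \<odot>\<^bsub>AA\<^esub> f) \<otimes>\<^bsub>AA\<^esub> g = r \<odot>\<^bsub>AA\<^esub> (f \<otimes>\<^bsub>AA\<^esub> g)" "f \<otimes>\<^bsub>AA\<^esub> (r \<odot>\<^bsub>AA\<^esub> g) = r \<odot>\<^bsub>AA\<^esub> (f \<otimes>\<^bsub>AA\<^esub> g)"
    by (intro AA_eqI; simp add: AA_closed AA_apply nendD nend_R)+
qed

text \<open>In tensor notation \<open>t \<mapsto> t\<^sup>1 c\<^sup>1 \<otimes> c\<^sup>2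
  t\<^sup>2\<close>: the product of B with its second argument taken from all of
  \<open>M \<otimes> M\<close>. Extended in this way it is a bimodule endomorphism, which later
  yields the isomorphism with the centralizer in \<open>M\<^sub>2\<close>.\<close>

definition ins :: "('b, 'b) tens \<Rightarrow> ('b, 'b) tens \<Rightarrow> ('b, 'b) tens" where
  "ins c = tensor_lift T (\<lambda>a a'. lact T a (ract T c a'))"

lemma ins_bal:
  assumes c: "c \<in> Cas"
  shows "balanced N UL UR T (\<lambda>a a'. lact T a (ract T c a'))"
  by (rule balI[OF T.abelian_group_axioms])
     (use c in \<open>simp_all add: T_bimod Cas_comm\<close>)

lemma ins_simps [simp]:
  assumes "c \<in> Cas"
  shows "a \<in> carrier M \<Longrightarrow> a' \<in> carrier M \<Longrightarrow> ins c (pure a a') = lact T a (ract T c a')"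
    "t \<in> carrier T \<Longrightarrow> ins c t \<in> carrier T"
    "s \<in> carrier T \<Longrightarrow> t \<in> carrier T \<Longrightarrow> ins c (s \<oplus>\<^bsub>T\<^esub> t) = ins c s \<oplus>\<^bsub>T\<^esub> ins c t"
  unfolding ins_def by (rule bal_lift[OF T.abelian_group_axioms ins_bal[OF assms]]; assumption)+

lemma ins_lact:
  assumes "c \<in> Cas" "m \<in> carrier M" "t \<in> carrier T"
  shows "ins c (lact T m t) = lact T m (ins c t)" "ins c (ract T t m) = ract T (ins c t) m"
proof -
  show "ins c (lact T m t) = lact T m (ins c t)"
    by (rule tens_eqI[OF assms(3) T.abelian_group_axioms, where F = "\<lambda>t. ins c (lact T m t)" and G = "\<lambda>t. lact T m (ins c t)"])
       (use assms in \<open>simp_all add: T_bimod\<close>)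
  show "ins c (ract T t m) = ract T (ins c t) m"
    by (rule tens_eqI[OF assms(3) T.abelian_group_axioms, where F = "\<lambda>t. ins c (ract T t m)" and G = "\<lambda>t. ract T (ins c t) m"])
       (use assms in \<open>simp_all add: T_bimod\<close>)
qed

lemma ins_Cas [simp]:
  assumes "c \<in> Cas" "t \<in> Cas"
  shows "ins c t \<in> Cas"
  unfolding Cas_def using assms ins_lact[OF assms(1), symmetric] by (simp add: Cas_comm)

lemma Cas_mult:
  assumes c: "c \<in> Cas" and t: "t \<in> carrier T"
  shows "tensor_lift T (\<lambda>x' y'. tensor_lift T (\<lambda>x y. pure (x' \<otimes>\<^bsub>M\<^esub> x) (y \<otimes>\<^bsub>M\<^esub> y')) c) t = ins c t"
  unfolding ins_def
proof (rule lift_cong[OF tens T.abelian_group_axioms ins_bal[OF c] _ t, symmetric])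
  fix a a' assume "a \<in> carrier UL" "a' \<in> carrier UR"
  then have a: "a \<in> carrier M" "a' \<in> carrier M" by simp_all
  have bal: "balanced N UL UR T (\<lambda>x y. pure (a \<otimes>\<^bsub>M\<^esub> x) (y \<otimes>\<^bsub>M\<^esub> a'))"
    by (rule balI[OF T.abelian_group_axioms])
       (use a in \<open>simp_all add: M.l_distr M.r_distr M.m_assoc pure_bal[symmetric]\<close>)
  note bl = bal_lift[OF T.abelian_group_axioms bal]
  show "lact T a (ract T c a') = tensor_lift T (\<lambda>x y. pure (a \<otimes>\<^bsub>M\<^esub> x) (y \<otimes>\<^bsub>M\<^esub> a')) c"
    by (rule tens_eqI[OF Cas_D[OF c] T.abelian_group_axioms, where F = "\<lambda>c. lact T a (ract T c a')"])
       (use a in \<open>simp_all add: bl\<close>)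
qed

lemma BB_simps:
  "carrier BB = Cas" "c \<in> Cas \<Longrightarrow> t \<in> carrier T \<Longrightarrow> c \<otimes>\<^bsub>BB\<^esub> t = ins c t" "\<one>\<^bsub>BB\<^esub> = pure \<one>\<^bsub>M\<^esub> \<one>\<^bsub>M\<^esub>" "\<zero>\<^bsub>BB\<^esub> = \<zero>\<^bsub>T\<^esub>"
  "add BB = add T" "smult BB = lact T" "sym_bimod BB = sym_bimod (Cas_alg N M \<iota>)"
  by (simp_all add: BB_def Cas_bialg_def Let_def module.extend_def bialg.fields_def Cas_alg_def Cas_def[symmetric] Cas_mult sym_bimod_def)

lemma Cas_closed [simp]:
  "s \<in> Cas \<Longrightarrow> t \<in> Cas \<Longrightarrow> s \<oplus>\<^bsub>T\<^esub> t \<in> Cas" "\<zero>\<^bsub>T\<^esub> \<in> Cas" "pure \<one>\<^bsub>M\<^esub> \<one>\<^bsub>M\<^esub> \<in> Cas"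
  "r \<in> carrier R \<Longrightarrow> t \<in> Cas \<Longrightarrow> lact T r t \<in> Cas"
proof -
  show "s \<in> Cas \<Longrightarrow> t \<in> Cas \<Longrightarrow> s \<oplus>\<^bsub>T\<^esub> t \<in> Cas" "\<zero>\<^bsub>T\<^esub> \<in> Cas"
    by (simp_all add: Cas_def del: Cas_D)
  show "pure \<one>\<^bsub>M\<^esub> \<one>\<^bsub>M\<^esub> \<in> Cas"
    using pure_bal[OF M.one_closed _ M.one_closed] by (simp add: Cas_def del: Cas_D)
  assume r: "r \<in> carrier R" and t: "t \<in> Cas"
  show "lact T r t \<in> Cas" unfolding Cas_def
  proof (intro CollectI conjI ballI)
    fix n assume n: "n \<in> carrier N"
    have "lact T (\<iota> n) (lact T r t) = lact T (\<iota> n \<otimes>\<^bsub>M\<^esub> r) t"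
      using r t n by (intro T_bimod(2)[symmetric]) auto
    also have "\<iota> n \<otimes>\<^bsub>M\<^esub> r = r \<otimes>\<^bsub>M\<^esub> \<iota> n" using R_comm[OF r] n by simp
    also have "lact T (r \<otimes>\<^bsub>M\<^esub> \<iota> n) t = lact T r (lact T (\<iota> n) t)"
      using r t n by (intro T_bimod(2)) auto
    also have "\<dots> = lact T r (ract T t (\<iota> n))" unfolding Cas_comm[OF t n] ..
    also have "\<dots> = ract T (lact T r t) (\<iota> n)" using r t n by (intro T_bimod(1)) auto
    finally show "lact T (\<iota> n) (lact T r t) = ract T (lact T r t) (\<iota> n)" .
  qed (use r t in simp)
qed

lemma ins_add_left [simp]:
  assumes "c \<in> Cas" "c' \<in> Cas" "t \<in> carrier T"
  shows "ins (c \<oplus>\<^bsub>T\<^esub> c') t = ins c t \<oplus>\<^bsub>T\<^esub> ins c' t"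
  by (rule tens_eqI[OF assms(3) T.abelian_group_axioms, where F = "ins (c \<oplus>\<^bsub>T\<^esub> c')" and G = "\<lambda>t. ins c t \<oplus>\<^bsub>T\<^esub> ins c' t"])
     (use assms in \<open>simp_all add: T.a_ac\<close>)

lemma ins_R_left [simp]:
  assumes "c \<in> Cas" "r \<in> carrier R" "t \<in> carrier T"
  shows "ins (lact T r c) t = lact T r (ins c t)"
proof (rule tens_eqI[OF assms(3) T.abelian_group_axioms, where F = "ins (lact T r c)" and G = "\<lambda>t. lact T r (ins c t)"])
  fix a a' assume a: "a \<in> carrier M" "a' \<in> carrier M"
  then have "lact T a (lact T r c) = lact T r (lact T a c)"
    using T_bimod(2)[of a r c] T_bimod(2)[of r a c] assms R_comm[OF assms(2) a(1)] by simp
  then show "ins (lact T r c) (pure a a') = lact T r (ins c (pure a a'))"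
    using assms a by (simp add: T_bimod(1))
qed (use assms in simp_all)

lemma ins_assoc:
  assumes "c \<in> Cas" "c' \<in> Cas" "t \<in> carrier T"
  shows "ins (ins c c') t = ins c (ins c' t)"
  by (rule tens_eqI[OF assms(3) T.abelian_group_axioms, where F = "ins (ins c c')" and G = "\<lambda>t. ins c (ins c' t)"])
     (use assms in \<open>simp_all add: ins_lact\<close>)

lemma ins_one [simp]:
  "t \<in> carrier T \<Longrightarrow> ins (pure \<one>\<^bsub>M\<^esub> \<one>\<^bsub>M\<^esub>) t = t" "c \<in> Cas \<Longrightarrow> ins c (pure \<one>\<^bsub>M\<^esub> \<one>\<^bsub>M\<^esub>) = c"
proof -
  assume t: "t \<in> carrier T"
  show "ins (pure \<one>\<^bsub>M\<^esub> \<one>\<^bsub>M\<^esub>) t = t"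
    by (rule tens_eqI[OF t T.abelian_group_axioms, where F = "ins (pure \<one>\<^bsub>M\<^esub> \<one>\<^bsub>M\<^esub>)" and G = "\<lambda>t. t"]) simp_all
qed simp

lemma BB_abelian: "abelian_group BB"
proof (rule abelian_groupI)
  show "\<exists>s\<in>carrier BB. s \<oplus>\<^bsub>BB\<^esub> t = \<zero>\<^bsub>BB\<^esub>" if t: "t \<in> carrier BB" for t
  proof (rule bexI[of _ "\<ominus>\<^bsub>T\<^esub> t"])
    have t': "t \<in> Cas" using t by (simp add: BB_simps)
    then show "\<ominus>\<^bsub>T\<^esub> t \<oplus>\<^bsub>BB\<^esub> t = \<zero>\<^bsub>BB\<^esub>" by (simp add: BB_simps T.l_neg)
    \<comment> \<open>Closure of \<open>Cas\<close> under negation is derived from its closure under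
      scalars, the negative of \<open>t\<close> being its multiple by -1.\<close>
    have "lact T (\<ominus>\<^bsub>R\<^esub> \<one>\<^bsub>R\<^esub>) t \<oplus>\<^bsub>T\<^esub> t = \<zero>\<^bsub>T\<^esub>"
    proof -
      have "lact T (\<ominus>\<^bsub>R\<^esub> \<one>\<^bsub>R\<^esub>) t \<oplus>\<^bsub>T\<^esub> lact T \<one>\<^bsub>M\<^esub> t = lact T (\<ominus>\<^bsub>R\<^esub> \<one>\<^bsub>R\<^esub> \<oplus>\<^bsub>R\<^esub> \<one>\<^bsub>R\<^esub>) t"
        using t' R.a_inv_closed[OF R.one_closed] by (simp add: T_bimod del: T_one)
      also have "\<dots> = lact T \<zero>\<^bsub>M\<^esub> t" using R.l_neg[OF R.one_closed] by simp
      also have "\<dots> = \<zero>\<^bsub>T\<^esub>"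
        by (rule additive_zero[OF M.abelian_group_axioms T.abelian_group_axioms, of "\<lambda>m. lact T m t"])
          (use t' in \<open>auto simp: T_bimod intro!: additiveI\<close>)
      finally show ?thesis using t' by simp
    qed
    then have "\<ominus>\<^bsub>T\<^esub> t = lact T (\<ominus>\<^bsub>R\<^esub> \<one>\<^bsub>R\<^esub>) t"
      using t' R.a_inv_closed[OF R.one_closed] by (intro T.minus_equality) auto
    then show "\<ominus>\<^bsub>T\<^esub> t \<in> carrier BB" using t' R.a_inv_closed[OF R.one_closed] by (simp add: BB_simps)
  qed
qed (simp_all add: BB_simps T.a_ac)

lemma BB_assoc_algebra: "assoc_algebra R BB"
  unfolding assoc_algebra_def
proof (intro conjI ballI)
  show "ring BB"
    by (rule ringI[OF BB_abelian], rule monoidI) (simp_all add: BB_simps ins_assoc)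
  show "module R BB"
    by (rule moduleI[OF R.is_cring BB_abelian]) (simp_all add: BB_simps T_bimod)
  fix r s t assume "r \<in> carrier R" "s \<in> carrier BB" "t \<in> carrier BB"
  then show "(r \<odot>\<^bsub>BB\<^esub> s) \<otimes>\<^bsub>BB\<^esub> t = r \<odot>\<^bsub>BB\<^esub> (s \<otimes>\<^bsub>BB\<^esub> t)" "s \<otimes>\<^bsub>BB\<^esub> (r \<odot>\<^bsub>BB\<^esub> t) = r \<odot>\<^bsub>BB\<^esub> (s \<otimes>\<^bsub>BB\<^esub> t)"
    by (simp_all add: BB_simps ins_lact)
qed

sublocale A: ring AA using AA_assoc_algebra by (simp add: assoc_algebra_def)
sublocale B: ring BB using BB_assoc_algebra by (simp add: assoc_algebra_def)

lemma BB_finsum: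
  assumes "f \<in> I \<rightarrow> Cas"
  shows "finsum BB f I = finsum T f I"
  using assms
proof (induction I rule: infinite_finite_induct)
  case (insert i I)
  then have "f i \<in> Cas" "f \<in> I \<rightarrow> Cas" by auto
  then show ?case using insert by (simp add: B.finsum_insert T.finsum_insert Pi_def BB_simps)
qed (auto simp: BB_simps)

lemma AA_finsum_apply:
  assumes "\<And>i. i < n \<Longrightarrow> f i \<in> carrier AA" and a: "a \<in> carrier M"
  shows "(\<Oplus>\<^bsub>AA\<^esub>i\<in>{..<n::nat}. f i) a = (\<Oplus>\<^bsub>M\<^esub>i\<in>{..<n}. f i a)"
  by (rule additive_finsum[OF A.abelian_group_axioms M.abelian_group_axioms, where f = "\<lambda>f. f a"])
     (use assms in \<open>auto intro!: additiveI simp: AA_apply nendD\<close>)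

section \<open>Expansions along the quasibasis\<close>

lemma b_Cas [simp]: "i < q \<Longrightarrow> b i \<in> Cas"
  and beta_AA [simp]: "i < q \<Longrightarrow> \<beta> i \<in> carrier AA"
  and quasi: "m \<in> carrier M \<Longrightarrow> (\<Oplus>\<^bsub>T\<^esub>i\<in>{..<q}. ract T (b i) (\<beta> i m)) = pure m \<one>\<^bsub>M\<^esub>"
  using qb by (auto simp: left_D2_quasibasis_def Cas_alg_def Cas_def[symmetric] AA_simps)

lemma beta_nend [simp]: "i < q \<Longrightarrow> nend (\<beta> i)" by simp

lemma beta_cl [simp]: "i < q \<Longrightarrow> m \<in> carrier M \<Longrightarrow> \<beta> i m \<in> carrier M"
  by (simp add: nendD)

lemma quasi_map:
  assumes "abelian_group Z" "\<And>t. t \<in> carrier T \<Longrightarrow> F t \<in> carrier Z"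
    and "\<And>s t. s \<in> carrier T \<Longrightarrow> t \<in> carrier T \<Longrightarrow> F (s \<oplus>\<^bsub>T\<^esub> t) = F s \<oplus>\<^bsub>Z\<^esub> F t" and m: "m \<in> carrier M"
  shows "(\<Oplus>\<^bsub>Z\<^esub>i\<in>{..<q}. F (ract T (b i) (\<beta> i m))) = F (pure m \<one>\<^bsub>M\<^esub>)"
  by (subst quasi[OF m, symmetric], rule T_sum[OF assms(1-3), symmetric]) (use m in auto)

text \<open>Apply \<open>f\<close> to the left factor of the quasibasis identity and multiply the
  two factors.\<close>

lemma quasi_fun:
  assumes f: "rlin f" and m: "m \<in> carrier M"
  shows "(\<Oplus>\<^bsub>M\<^esub>i\<in>{..<q}. pl f (b i) \<otimes>\<^bsub>M\<^esub> \<beta> i m) = f m"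
proof -
  have "(\<Oplus>\<^bsub>M\<^esub>i\<in>{..<q}. pl f (b i) \<otimes>\<^bsub>M\<^esub> \<beta> i m) = (\<Oplus>\<^bsub>M\<^esub>i\<in>{..<q}. pl f (ract T (b i) (\<beta> i m)))"
    by (rule M.finsum_cong') (use f m in \<open>auto simp: pl_simps\<close>)
  also have "\<dots> = f m"
    by (subst quasi_map[OF M.abelian_group_axioms]) (use f m in \<open>simp_all add: pl_simps rlinD\<close>)
  finally show ?thesis .
qed

text \<open>On the pure tensor of \<open>a\<close> and \<open>c\<close> the coefficients are
  \<open>\<beta>\<^sub>i(a) c\<close>, so this is the quasibasis identity at \<open>a\<close>,
  multiplied by \<open>c\<close> from the right.\<close>

lemma quasi_tens:
  assumes t: "t \<in> carrier T"
  shows "(\<Oplus>\<^bsub>T\<^esub>i\<in>{..<q}. ract T (b i) (pl (\<beta> i) t)) = t"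
proof (rule tens_eqI[OF t T.abelian_group_axioms, where F = "\<lambda>t. \<Oplus>\<^bsub>T\<^esub>i\<in>{..<q}. ract T (b i) (pl (\<beta> i) t)" and G = "\<lambda>t. t"])
  note pl = pl_simps[OF nendD(1)[OF beta_nend]]
  show "(\<Oplus>\<^bsub>T\<^esub>i\<in>{..<q}. ract T (b i) (pl (\<beta> i) t)) \<in> carrier T" if "t \<in> carrier T" for t
    using that by (intro T.finsum_closed) (simp add: pl)
  show "(\<Oplus>\<^bsub>T\<^esub>i\<in>{..<q}. ract T (b i) (pl (\<beta> i) (s \<oplus>\<^bsub>T\<^esub> t))) =
     (\<Oplus>\<^bsub>T\<^esub>i\<in>{..<q}. ract T (b i) (pl (\<beta> i) s)) \<oplus>\<^bsub>T\<^esub> (\<Oplus>\<^bsub>T\<^esub>i\<in>{..<q}. ract T (b i) (pl (\<beta> i) t))"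
    if "s \<in> carrier T" "t \<in> carrier T" for s t
  proof -
    have "(\<Oplus>\<^bsub>T\<^esub>i\<in>{..<q}. ract T (b i) (pl (\<beta> i) (s \<oplus>\<^bsub>T\<^esub> t))) =
      (\<Oplus>\<^bsub>T\<^esub>i\<in>{..<q}. ract T (b i) (pl (\<beta> i) s) \<oplus>\<^bsub>T\<^esub> ract T (b i) (pl (\<beta> i) t))"
      by (rule T.finsum_cong') (use that in \<open>simp_all add: pl T_bimod\<close>)
    also have "\<dots> = (\<Oplus>\<^bsub>T\<^esub>i\<in>{..<q}. ract T (b i) (pl (\<beta> i) s)) \<oplus>\<^bsub>T\<^esub> (\<Oplus>\<^bsub>T\<^esub>i\<in>{..<q}. ract T (b i) (pl (\<beta> i) t))"
      by (rule T.finsum_addf) (use that in \<open>simp_all add: pl\<close>)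
    finally show ?thesis .
  qed
  fix a c assume ac: "a \<in> carrier M" "c \<in> carrier M"
  have "(\<Oplus>\<^bsub>T\<^esub>i\<in>{..<q}. ract T (b i) (pl (\<beta> i) (pure a c))) = (\<Oplus>\<^bsub>T\<^esub>i\<in>{..<q}. ract T (ract T (b i) (\<beta> i a)) c)"
    by (rule T.finsum_cong') (use ac in \<open>simp_all add: pl T_bimod\<close>)
  also have "\<dots> = pure a c"
    by (subst quasi_map[OF T.abelian_group_axioms, where F = "\<lambda>t. ract T t c"]) (use ac in simp_all)
  finally show "(\<Oplus>\<^bsub>T\<^esub>i\<in>{..<q}. ract T (b i) (pl (\<beta> i) (pure a c))) = pure a c" .
qed simp_all

lemma quasi_Cas:
  assumes t: "t \<in> Cas"
  shows "(\<Oplus>\<^bsub>T\<^esub>i\<in>{..<q}. lact T (pl (\<beta> i) t) (b i)) = t"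
proof -
  have "(\<Oplus>\<^bsub>T\<^esub>i\<in>{..<q}. lact T (pl (\<beta> i) t) (b i)) = (\<Oplus>\<^bsub>T\<^esub>i\<in>{..<q}. ract T (b i) (pl (\<beta> i) t))"
    by (rule T.finsum_cong') (use t in \<open>simp_all add: R_act\<close>)
  then show ?thesis using quasi_tens t by simp
qed

text \<open>\<open>sB\<close> and \<open>SA\<close> below are the adjoints relating the pairings \<open>pr\<close> and \<open>pl\<close>; they are the antipodes of \<open>B\<close>
  and \<open>A\<close>.\<close>

definition sB :: "('b, 'b) tens \<Rightarrow> ('b, 'b) tens" where "sB t = U2 (act t)"
definition d :: "nat \<Rightarrow> ('b, 'b) tens" where "d i = sB (b i)"

lemma sB_Cas [simp]: "t \<in> Cas \<Longrightarrow> sB t \<in> Cas"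
  unfolding sB_def by (intro U2_Cas act_nend)

lemma d_Cas [simp]: "i < q \<Longrightarrow> d i \<in> Cas" by (simp add: d_def)

text \<open>Both sides are traces of \<open>g\<close> after \<open>f\<close>, one taken in the right
  and one in the left factor. This is where the equality of the two traces enters the theory of the
  pairings.\<close>

lemma pr_U2:
  assumes f: "nend f" and g: "nend g"
  shows "pr g (U2 f) = pl g (U1 f)"
proof -
  have gf: "nend (\<lambda>a. g (f a))" using nend_comp[OF g f] .
  have "pr g (U2 f) = sq_mult M (U2 (\<lambda>a. g (f a)))"
    using nendD(1,2)[OF f] nendD(1,2)[OF g] nendD(2)[OF gf]
    by (simp add: U2_tmap pr_tmap lin_id)
  also have "\<dots> = sq_mult M (U1 (\<lambda>a. g (f a)))" by (rule traces_agree[OF gf, symmetric])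
  also have "\<dots> = pl g (U1 f)"
    using nendD(1,2)[OF f] nendD(1,2)[OF g] nendD(1)[OF gf]
    by (simp add: U1_tmap pl_tmap lin_id)
  finally show ?thesis .
qed

lemma pr_sB: "nend g \<Longrightarrow> t \<in> Cas \<Longrightarrow> pr g (sB t) = pl g t"
  unfolding sB_def by (subst pr_U2) (simp_all add: act_nend)

lemma pr_pl: "nend g \<Longrightarrow> t \<in> Cas \<Longrightarrow> pr g t = pl g (U1 (coact t))"
  using pr_U2[OF coact_nend, of t g] by simp

lemma sB_U1_coact: "t \<in> Cas \<Longrightarrow> sB (U1 (coact t)) = t"
proof -
  assume t: "t \<in> Cas"
  have "U2 (act (U1 (coact t))) = U2 (coact t)"
    by (rule U2_cong) (use nendD(1,2)[OF coact_nend[OF t]] in \<open>simp_all add: act_U1\<close>)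
  then show ?thesis using t by (simp add: sB_def)
qed

text \<open>\<open>sB\<close> exchanges the two identifications of tensors with maps, so identities
  involving it are best tested through the faithful \<open>coact\<close>.\<close>

lemma coact_sB: "t \<in> Cas \<Longrightarrow> m \<in> carrier M \<Longrightarrow> coact (sB t) m = act t m"
  unfolding sB_def using nendD(2)[OF act_nend] by (simp add: coact_U2)

lemma sB_add: "s \<in> Cas \<Longrightarrow> t \<in> Cas \<Longrightarrow> sB (s \<oplus>\<^bsub>T\<^esub> t) = sB s \<oplus>\<^bsub>T\<^esub> sB t"
  by (rule coact_eqI) (simp_all add: coact_sB)

lemma coact_R: 
  assumes r: "r \<in> carrier R" and t: "t \<in> carrier T" and m: "m \<in> carrier M"
  shows "coact (lact T r t) m = r \<otimes>\<^bsub>M\<^esub> coact t m"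
  using R_act[OF r t, symmetric] act_props(5)[OF t R_M[OF r] m] R_comm[OF r, of "coact t m"] t m by simp

lemma sB_R: "r \<in> carrier R \<Longrightarrow> t \<in> Cas \<Longrightarrow> sB (lact T r t) = lact T r (sB t)"
  by (rule coact_eqI) (simp_all add: coact_sB coact_R act_props)

lemma dual_expand_A:
  assumes f: "f \<in> carrier AA"
  shows "(\<Oplus>\<^bsub>AA\<^esub>i\<in>{..<q}. pr f (d i) \<odot>\<^bsub>AA\<^esub> \<beta> i) = f"
proof (rule AA_eqI)
  have c: "pr f (d i) \<odot>\<^bsub>AA\<^esub> \<beta> i \<in> carrier AA" if "i < q" for i
    using that f by (intro AA_closed) auto
  then show "(\<Oplus>\<^bsub>AA\<^esub>i\<in>{..<q}. pr f (d i) \<odot>\<^bsub>AA\<^esub> \<beta> i) \<in> carrier AA" by (intro A.finsum_closed) auto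
  fix a assume a: "a \<in> carrier M"
  have "(\<Oplus>\<^bsub>AA\<^esub>i\<in>{..<q}. pr f (d i) \<odot>\<^bsub>AA\<^esub> \<beta> i) a = (\<Oplus>\<^bsub>M\<^esub>i\<in>{..<q}. (pr f (d i) \<odot>\<^bsub>AA\<^esub> \<beta> i) a)"
    by (rule AA_finsum_apply[OF _ a]) (rule c)
  also have "\<dots> = (\<Oplus>\<^bsub>M\<^esub>i\<in>{..<q}. pl f (b i) \<otimes>\<^bsub>M\<^esub> \<beta> i a)"
    by (rule M.finsum_cong') (use a f in \<open>simp_all add: AA_apply d_def pr_sB\<close>)
  finally show "(\<Oplus>\<^bsub>AA\<^esub>i\<in>{..<q}. pr f (d i) \<odot>\<^bsub>AA\<^esub> \<beta> i) a = f a"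
    using quasi_fun[OF nendD(1)[OF AA_nend[OF f]] a] by simp
qed (rule f)

lemma dual_expand_B:
  assumes t: "t \<in> Cas"
  shows "(\<Oplus>\<^bsub>BB\<^esub>i\<in>{..<q}. pr (\<beta> i) t \<odot>\<^bsub>BB\<^esub> d i) = t"
proof -
  \<comment> \<open>The preimage of \<open>t\<close> under \<open>sB\<close>. Expanding it along the
    \<open>b i\<close> and applying \<open>sB\<close> produces the expansion of \<open>t\<close>
    along the \<open>d i\<close>.\<close>
  define s where "s = U1 (coact t)"
  have s: "s \<in> Cas" unfolding s_def by (rule U1_Cas[OF coact_nend[OF t]])
  have "(\<Oplus>\<^bsub>BB\<^esub>i\<in>{..<q}. pr (\<beta> i) t \<odot>\<^bsub>BB\<^esub> d i) = (\<Oplus>\<^bsub>BB\<^esub>i\<in>{..<q}. sB (lact T (pl (\<beta> i) s) (b i)))"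
    by (rule B.finsum_cong') (use s t in \<open>simp_all add: BB_simps sB_R d_def pr_pl s_def[symmetric]\<close>)
  also have "\<dots> = sB (\<Oplus>\<^bsub>BB\<^esub>i\<in>{..<q}. lact T (pl (\<beta> i) s) (b i))"
    by (rule additive_finsum[OF B.abelian_group_axioms B.abelian_group_axioms, symmetric])
       (use s in \<open>auto intro!: additiveI simp: BB_simps sB_add\<close>)
  also have "(\<Oplus>\<^bsub>BB\<^esub>i\<in>{..<q}. lact T (pl (\<beta> i) s) (b i)) = s"
    using quasi_Cas[OF s] s by (subst BB_finsum) auto
  finally show ?thesis using sB_U1_coact[OF t] by (simp add: s_def)
qed

lemma pr_ops:
  assumes "llin f" "llin g" "t \<in> carrier T"
  shows "pr (\<lambda>a\<in>carrier M. f a \<oplus>\<^bsub>M\<^esub> g a) t = pr f t \<oplus>\<^bsub>M\<^esub> pr g t"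
proof -
  have l: "llin (\<lambda>a\<in>carrier M. f a \<oplus>\<^bsub>M\<^esub> g a)"
    using llinD[OF assms(1)] llinD[OF assms(2)] unfolding llin_def
    by (auto intro!: additiveI simp: M.a_ac M.r_distr)
  show ?thesis
    by (rule tens_eqI[OF assms(3) M.abelian_group_axioms, where F = "pr (\<lambda>a\<in>carrier M. f a \<oplus>\<^bsub>M\<^esub> g a)" and G = "\<lambda>t. pr f t \<oplus>\<^bsub>M\<^esub> pr g t"])
       (use assms llinD[OF assms(1)] llinD[OF assms(2)] in \<open>simp_all add: pr_simps l M.r_distr M.a_ac\<close>)
qed

lemma pr_smult:
  assumes f: "nend f" and r: "r \<in> carrier R" and t: "t \<in> carrier T"
  shows "pr (\<lambda>a\<in>carrier M. r \<otimes>\<^bsub>M\<^esub> f a) t = r \<otimes>\<^bsub>M\<^esub> pr f t"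
proof -
  have l: "llin (\<lambda>a\<in>carrier M. r \<otimes>\<^bsub>M\<^esub> f a)"
    using nend_cong[OF nend_smult[OF f r], of "\<lambda>a\<in>carrier M. r \<otimes>\<^bsub>M\<^esub> f a"] by (simp add: nendD)
  show ?thesis
  proof (rule tens_eqI[OF t M.abelian_group_axioms, where F = "pr (\<lambda>a\<in>carrier M. r \<otimes>\<^bsub>M\<^esub> f a)" and G = "\<lambda>t. r \<otimes>\<^bsub>M\<^esub> pr f t"])
    fix a c assume ac: "a \<in> carrier M" "c \<in> carrier M"
    then show "pr (\<lambda>a\<in>carrier M. r \<otimes>\<^bsub>M\<^esub> f a) (pure a c) = r \<otimes>\<^bsub>M\<^esub> pr f (pure a c)"
      using nendD[OF f] r R_comm[OF r ac(1)] by (simp add: pr_simps l flip: M.m_assoc)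
  qed (use nendD[OF f] r in \<open>simp_all add: pr_simps l M.r_distr\<close>)
qed

lemma dual_alg_AB: "dual_alg R AA BB pr q \<beta> d"
proof (rule dual_alg.intro[OF R.is_cring], unfold_locales)
  show "assoc_algebra R AA" "assoc_algebra R BB" by (rule AA_assoc_algebra BB_assoc_algebra)+
  fix f g :: "'b \<Rightarrow> 'b" and s t :: "('b, 'b) tens" and r
  assume f: "f \<in> carrier AA" and t: "t \<in> carrier BB"
  then have t': "t \<in> Cas" by (simp add: BB_simps)
  show "pr f t \<in> carrier R" using f t' by simp
  show "pr (f \<oplus>\<^bsub>AA\<^esub> g) t = pr f t \<oplus>\<^bsub>R\<^esub> pr g t" if "g \<in> carrier AA"
    using f t' that by (simp add: AA_simps(5) pr_ops nendD)
  show "pr f (t \<oplus>\<^bsub>BB\<^esub> s) = pr f t \<oplus>\<^bsub>R\<^esub> pr f s" if "s \<in> carrier BB"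
    using f t' that by (simp add: BB_simps pr_simps nendD)
  show "pr (r \<odot>\<^bsub>AA\<^esub> f) t = r \<otimes>\<^bsub>R\<^esub> pr f t" if "r \<in> carrier R"
    using f t' that by (simp add: AA_simps(6) pr_smult)
  show "pr f (r \<odot>\<^bsub>BB\<^esub> t) = r \<otimes>\<^bsub>R\<^esub> pr f t" if "r \<in> carrier R"
    using f t' that by (simp add: BB_simps pr_simps nendD)
qed (simp_all add: dual_expand_A dual_expand_B, simp_all add: BB_simps dual_expand_B[unfolded BB_simps])

end

section \<open>Transposed multiplications and the Hopf algebra identities for A\<close>

context d2_frobenius_ext
begin

sublocale D: dual_alg R AA BB pr q \<beta> d by (rule dual_alg_AB)
sublocale DS: dual_alg R BB AA "\<lambda>t f. pr f t" q d \<beta> by (rule D.dual_alg_swap)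

lemma tens_additive_eqI:
  assumes "additive T Z F" "additive T Z G" "abelian_group Z" "t \<in> carrier T"
    and "\<And>a c. a \<in> carrier M \<Longrightarrow> c \<in> carrier M \<Longrightarrow> F (pure a c) = G (pure a c)"
  shows "F t = G t"
  by (rule tensor_additive_eqI[OF tens assms(3,1,2) _ assms(4)]) (use assms(5) in simp)

text \<open>In tensor notation \<open>dl f s\<close> is
  \<open>m \<mapsto> f(m s\<^sup>1) s\<^sup>2\<close>, and \<open>dr s f\<close> is
  \<open>m \<mapsto> s\<^sup>1 f(s\<^sup>2 m)\<close>. At \<open>s = b i\<close> the former is the
  left leg of the coproduct of \<open>f\<close>.\<close>

definition dl :: "('b \<Rightarrow> 'b) \<Rightarrow> ('b, 'b) tens \<Rightarrow> 'b \<Rightarrow> 'b" where "dl f s m = pl f (lact T m s)"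
definition dr :: "('b, 'b) tens \<Rightarrow> ('b \<Rightarrow> 'b) \<Rightarrow> 'b \<Rightarrow> 'b" where "dr s f m = pr f (ract T s m)"

lemma pl_iota:
  assumes f: "nend f" and n: "n \<in> carrier N" and t: "t \<in> carrier T"
  shows "pl f (lact T (\<iota> n) t) = \<iota> n \<otimes>\<^bsub>M\<^esub> pl f t"
  by (rule tens_eqI[OF t M.abelian_group_axioms, where F = "\<lambda>t. pl f (lact T (\<iota> n) t)" and G = "\<lambda>t. \<iota> n \<otimes>\<^bsub>M\<^esub> pl f t"])
     (use n nendD[OF f] in \<open>simp_all add: pl_simps M.m_assoc M.r_distr\<close>)

lemma pr_iota:
  assumes f: "nend f" and n: "n \<in> carrier N" and t: "t \<in> carrier T"
  shows "pr f (ract T t (\<iota> n)) = pr f t \<otimes>\<^bsub>M\<^esub> \<iota> n"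
  by (rule tens_eqI[OF t M.abelian_group_axioms, where F = "\<lambda>t. pr f (ract T t (\<iota> n))" and G = "\<lambda>t. pr f t \<otimes>\<^bsub>M\<^esub> \<iota> n"])
     (use n nendD[OF f] in \<open>simp_all add: pr_simps M.m_assoc M.l_distr\<close>)

lemma dl_simps:
  assumes f: "nend f" and s: "s \<in> carrier T"
  shows "llin (dl f s)" "m \<in> carrier M \<Longrightarrow> dl f s m \<in> carrier M"
proof -
  show "m \<in> carrier M \<Longrightarrow> dl f s m \<in> carrier M" using nendD[OF f] s by (simp add: dl_def pl_simps)
  show "llin (dl f s)" unfolding llin_def dl_def
    using nendD[OF f] s by (auto intro!: additiveI simp: pl_simps T_bimod(2,4) pl_iota[OF f])
qed

lemma dr_simps:
  assumes f: "nend f" and s: "s \<in> carrier T"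
  shows "rlin (dr s f)" "m \<in> carrier M \<Longrightarrow> dr s f m \<in> carrier M"
proof -
  show "m \<in> carrier M \<Longrightarrow> dr s f m \<in> carrier M" using nendD[OF f] s by (simp add: dr_def pr_simps)
  show "rlin (dr s f)" unfolding rlin_def dr_def
    using nendD[OF f] s by (auto intro!: additiveI simp: pr_simps T_bimod(3,5) pr_iota[OF f])
qed

lemma dl_nend [simp]:
  assumes f: "nend f" and s: "s \<in> Cas"
  shows "nend (dl f s)"
proof -
  have "dl f s (a \<otimes>\<^bsub>M\<^esub> \<iota> n) = dl f s a \<otimes>\<^bsub>M\<^esub> \<iota> n" if "a \<in> carrier M" "n \<in> carrier N" for a n
    using that s nendD[OF f] by (simp add: dl_def T_bimod(1,2) Cas_comm pl_simps)
  then show ?thesis using dl_simps[OF f Cas_D[OF s]] unfolding nend_def rlin_def llin_def by auto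
qed

lemma dr_nend [simp]:
  assumes f: "nend f" and s: "s \<in> Cas"
  shows "nend (dr s f)"
proof -
  have "dr s f (\<iota> n \<otimes>\<^bsub>M\<^esub> a) = \<iota> n \<otimes>\<^bsub>M\<^esub> dr s f a" if "a \<in> carrier M" "n \<in> carrier N" for a n
    using that s nendD[OF f] by (simp add: dr_def T_bimod(3) Cas_comm[symmetric] T_bimod(1)[symmetric] pr_simps)
  then show ?thesis using dr_simps[OF f Cas_D[OF s]] unfolding nend_def rlin_def llin_def by auto
qed

text \<open>Both sides are \<open>t\<^sup>1 f(t\<^sup>2 s\<^sup>1) s\<^sup>2\<close>.\<close>

lemma pr_dl:
  assumes f: "nend f" and s: "s \<in> carrier T" and t: "t \<in> carrier T"
  shows "pr (dl f s) t = pl (dr t f) s"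
proof (rule tens_eqI[OF t M.abelian_group_axioms, where F = "pr (dl f s)" and G = "\<lambda>t. pl (dr t f) s"])
  note D = nendD[OF f]
  note dl = dl_simps[OF f s]
  have ad: "pl (dr (t \<oplus>\<^bsub>T\<^esub> t') f) s = pl (dr t f) s \<oplus>\<^bsub>M\<^esub> pl (dr t' f) s"
    if t: "t \<in> carrier T" "t' \<in> carrier T" for t t'
  proof (rule tens_eqI[OF s M.abelian_group_axioms, where F = "pl (dr (t \<oplus>\<^bsub>T\<^esub> t') f)" and G = "\<lambda>s. pl (dr t f) s \<oplus>\<^bsub>M\<^esub> pl (dr t' f) s"])
    have "dr (t \<oplus>\<^bsub>T\<^esub> t') f a = dr t f a \<oplus>\<^bsub>M\<^esub> dr t' f a" if "a \<in> carrier M" for a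
      using t that D by (simp add: dr_def pr_simps)
    then show "pl (dr (t \<oplus>\<^bsub>T\<^esub> t') f) (pure a c) = pl (dr t f) (pure a c) \<oplus>\<^bsub>M\<^esub> pl (dr t' f) (pure a c)" 
      if "a \<in> carrier M" "c \<in> carrier M" for a c
      using t that by (simp add: pl_simps dr_simps[OF f] M.l_distr)
  qed (use t in \<open>simp_all add: pl_simps dr_simps[OF f] M.a_ac\<close>)
  then show "\<And>t t'. t \<in> carrier T \<Longrightarrow> t' \<in> carrier T \<Longrightarrow> pl (dr (t \<oplus>\<^bsub>T\<^esub> t') f) s = pl (dr t f) s \<oplus>\<^bsub>M\<^esub> pl (dr t' f) s" .
  fix a c assume ac: "a \<in> carrier M" "c \<in> carrier M"
  have drv: "dr (pure a c) f m = a \<otimes>\<^bsub>M\<^esub> f (c \<otimes>\<^bsub>M\<^esub> m)" if "m \<in> carrier M" for m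
    using ac D that by (simp add: dr_def pr_simps)
  have "a \<otimes>\<^bsub>M\<^esub> dl f s c = pl (dr (pure a c) f) s"
    by (rule tens_eqI[OF s M.abelian_group_axioms, where F = "\<lambda>s. a \<otimes>\<^bsub>M\<^esub> dl f s c"])
       (use ac D in \<open>simp_all add: dl_simps[OF f] dr_simps[OF f] pl_simps dl_def drv M.r_distr M.m_assoc\<close>)
  then show "pr (dl f s) (pure a c) = pl (dr (pure a c) f) s" using ac by (simp add: pr_simps dl)
qed (use f s in \<open>simp_all add: pr_simps pl_simps dl_simps dr_simps\<close>)

lemma pr_dr:
  assumes f: "nend f" and s: "s \<in> Cas" and t: "t \<in> carrier T"
  shows "pr (dr s f) t = pr f (ins s t)"
  by (rule tens_eqI[OF t M.abelian_group_axioms, where F = "pr (dr s f)" and G = "\<lambda>t. pr f (ins s t)"])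
     (use f s nendD[OF f] nendD[OF dr_nend[OF f s]] in \<open>simp_all add: pr_simps, simp add: dr_def\<close>)

text \<open>Moved across the form, \<open>dl\<close> becomes right multiplication by
  \<open>sB s\<close>. As \<open>d i\<close> is \<open>sB (b i)\<close>, the left legs
  \<open>dl f (b i)\<close> of the coproduct are the abstract elements
  \<open>D.hr f (d i)\<close>.\<close>

lemma pr_dl_ins:
  assumes f: "nend f" and s: "s \<in> Cas" and t: "t \<in> Cas"
  shows "pr (dl f s) t = pr f (ins t (sB s))"
proof -
  have "pr (dl f s) t = pr (dr t f) (sB s)" using f s t by (simp add: pr_dl pr_sB)
  then show ?thesis using f s t by (simp add: pr_dr)
qed

lemma pr_restrict: "t \<in> carrier T \<Longrightarrow> nend f \<Longrightarrow> pr (restrict f (carrier M)) t = pr f t"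
  by (rule pr_cong[symmetric]) (auto simp: nendD)

lemma pl_restrict: "t \<in> carrier T \<Longrightarrow> nend f \<Longrightarrow> pl (restrict f (carrier M)) t = pl f t"
  by (rule pl_cong[symmetric]) (auto simp: nendD)

lemma hr_AA:
  assumes f: "f \<in> carrier AA" and i: "i < q"
  shows "D.hr f (d i) = restrict (dl f (b i)) (carrier M)"
proof (rule D.H_eqI)
  show "D.hr f (d i) \<in> carrier AA" using f i by simp
  show "restrict (dl f (b i)) (carrier M) \<in> carrier AA" using f i by simp
  fix t assume "t \<in> carrier BB"
  then have t: "t \<in> Cas" by (simp add: BB_simps)
  show "pr (D.hr f (d i)) t = pr (restrict (dl f (b i)) (carrier M)) t"
    using f i t by (simp add: D.p_hr BB_simps pr_restrict pr_dl_ins d_def)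
qed

lemma hl_AA:
  assumes f: "f \<in> carrier AA" and s: "s \<in> Cas"
  shows "D.hl s f = restrict (dr s f) (carrier M)"
proof (rule D.H_eqI)
  show "D.hl s f \<in> carrier AA" using f s by (simp add: BB_simps)
  show "restrict (dr s f) (carrier M) \<in> carrier AA" using f s by simp
  fix t assume "t \<in> carrier BB"
  then have t: "t \<in> Cas" by (simp add: BB_simps)
  show "pr (D.hl s f) t = pr (restrict (dr s f) (carrier M)) t"
    using f s t by (simp add: D.p_hl BB_simps pr_restrict pr_dr)
qed

text \<open>The functional that multiplies by \<open>t\<close> and then pairs with \<open>f\<close>
  is expanded in the dual bases. In effect, the coproduct of A is the transpose of the product of
  B.\<close>

lemma pr_ins_expand:
  assumes f: "nend f" and t: "t \<in> Cas" and t': "t' \<in> Cas"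
  shows "(\<Oplus>\<^bsub>M\<^esub>i\<in>{..<q}. pr (dl f (b i)) t \<otimes>\<^bsub>M\<^esub> pr (\<beta> i) t') = pr f (ins t t')"
proof -
  have "pr f (ins t t') = (\<Oplus>\<^bsub>R\<^esub>i\<in>{..<q}. pr (\<beta> i) t' \<otimes>\<^bsub>R\<^esub> pr f (ins t (d i)))"
    by (rule DS.form_expand[of "\<lambda>t'. pr f (ins t t')"])
       (use f t t' nendD[OF f] in \<open>auto intro!: linI simp: BB_simps(1-6) pr_simps ins_lact id_apply\<close>)
  also have "\<dots> = (\<Oplus>\<^bsub>M\<^esub>i\<in>{..<q}. pr (\<beta> i) t' \<otimes>\<^bsub>M\<^esub> pr f (ins t (d i)))"
    using f t t' by (subst R_sum) (auto simp: Pi_def)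
  also have "\<dots> = (\<Oplus>\<^bsub>M\<^esub>i\<in>{..<q}. pr (dl f (b i)) t \<otimes>\<^bsub>M\<^esub> pr (\<beta> i) t')"
    by (rule M.finsum_cong') (use f t t' in \<open>auto simp: pr_dl_ins d_def intro!: R_comm\<close>)
  finally show ?thesis by simp
qed

text \<open>The module algebra property of \<open>M\<close> over A, with \<open>dl f (b i)\<close>
  and \<open>\<beta> i\<close> as the legs of the coproduct of \<open>f\<close>. It is
  \<open>quasi_fun\<close> for the right linear map \<open>z \<mapsto> f(m z)\<close>.\<close>

lemma quasi_mult:
  assumes f: "nend f" and m: "m \<in> carrier M" "m' \<in> carrier M"
  shows "(\<Oplus>\<^bsub>M\<^esub>i\<in>{..<q}. dl f (b i) m \<otimes>\<^bsub>M\<^esub> \<beta> i m') = f (m \<otimes>\<^bsub>M\<^esub> m')"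
proof -
  have g: "rlin (\<lambda>z. f (m \<otimes>\<^bsub>M\<^esub> z))"
    using nendD[OF f] m by (auto simp: rlin_def M.r_distr M.m_assoc[symmetric] intro!: additiveI)
  have "dl f (b i) m = pl (\<lambda>z. f (m \<otimes>\<^bsub>M\<^esub> z)) (b i)" if i: "i < q" for i
    unfolding dl_def
    by (rule tens_eqI[OF Cas_D[OF b_Cas[OF i]] M.abelian_group_axioms, where F = "\<lambda>t. pl f (lact T m t)"])
       (use m nendD[OF f] g in \<open>simp_all add: pl_simps\<close>)
  then have "(\<Oplus>\<^bsub>M\<^esub>i\<in>{..<q}. dl f (b i) m \<otimes>\<^bsub>M\<^esub> \<beta> i m') = (\<Oplus>\<^bsub>M\<^esub>i\<in>{..<q}. pl (\<lambda>z. f (m \<otimes>\<^bsub>M\<^esub> z)) (b i) \<otimes>\<^bsub>M\<^esub> \<beta> i m')"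
    by (intro M.finsum_cong') (use m g in \<open>auto simp: pl_simps\<close>)
  then show ?thesis using quasi_fun[OF g m(2)] by simp
qed

text \<open>In effect, the coproduct of B is the transpose of composition. Expand
  \<open>t\<^sup>1 \<otimes> g(t\<^sup>2)\<close> along the \<open>b l\<close>: the coefficient
  \<open>\<beta>\<^sub>l(t\<^sup>1) g(t\<^sup>2)\<close> is the pairing of \<open>g\<close> with
  \<open>\<beta>\<^sub>l(t\<^sup>1) \<otimes> t\<^sup>2\<close>.\<close>

lemma pr_comp_expand:
  assumes f: "nend f" and g: "nend g" and t: "t \<in> Cas"
  shows "(\<Oplus>\<^bsub>M\<^esub>l\<in>{..<q}. pr f (b l) \<otimes>\<^bsub>M\<^esub> pr g (tmap (\<beta> l) (\<lambda>a. a) t)) = pr (\<lambda>a. f (g a)) t"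
proof -
  define s where "s = tmap (\<lambda>a. a) g t"
  have s: "s \<in> Cas" unfolding s_def by (rule tmap_Cas[OF nend_id g t])
  note D = nendD(1,2)[OF f] nendD(1,2)[OF g]
  have 1: "pl (\<beta> l) s = pr g (tmap (\<beta> l) (\<lambda>a. a) t)" if "l < q" for l
    using t that D nendD[OF beta_nend[OF that]] by (simp add: s_def pl_tmap pr_tmap lin_id)
  have "pr (\<lambda>a. f (g a)) t = pr f s"
    using t D nendD[OF nend_comp[OF f g]] unfolding s_def by (subst pr_tmap) (auto simp: lin_id pr_def)
  also have "\<dots> = pr f (\<Oplus>\<^bsub>T\<^esub>l\<in>{..<q}. lact T (pl (\<beta> l) s) (b l))" using quasi_Cas[OF s] by simp
  also have "\<dots> = (\<Oplus>\<^bsub>M\<^esub>l\<in>{..<q}. pr f (lact T (pl (\<beta> l) s) (b l)))"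
    by (rule T_sum[OF M.abelian_group_axioms]) (use D s in \<open>simp_all add: pr_simps\<close>)
  also have "\<dots> = (\<Oplus>\<^bsub>M\<^esub>l\<in>{..<q}. pr f (b l) \<otimes>\<^bsub>M\<^esub> pr g (tmap (\<beta> l) (\<lambda>a. a) t))"
  proof (rule M.finsum_cong'[OF refl])
    fix l assume "l \<in> {..<q}"
    then have l: "l < q" by simp
    have c: "tmap (\<beta> l) (\<lambda>a. a) t \<in> Cas" by (rule tmap_Cas[OF beta_nend[OF l] nend_id t])
    show "pr f (lact T (pl (\<beta> l) s) (b l)) = pr f (b l) \<otimes>\<^bsub>M\<^esub> pr g (tmap (\<beta> l) (\<lambda>a. a) t)"
      using D s l c g f R_comm[OF pr_R[OF g c], of "pr f (b l)"] by (simp add: pr_simps 1)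
  qed (use f g t in \<open>simp add: Pi_def tmap_Cas nend_id\<close>)
  finally show ?thesis by simp
qed

definition SA :: "('b \<Rightarrow> 'b) \<Rightarrow> 'b \<Rightarrow> 'b" where "SA f = D.rep (\<lambda>t. pl f t)"

lemma pl_R_lin:
  assumes "nend f" "r \<in> carrier R" "t \<in> carrier T"
  shows "pl f (lact T r t) = r \<otimes>\<^bsub>M\<^esub> pl f t"
  using assms nendD[OF assms(1)] R_comm[OF assms(2), of "pl f t"] by (simp add: R_act[symmetric] pl_simps)

lemma SA_props:
  assumes f: "f \<in> carrier AA"
  shows "SA f \<in> carrier AA" "t \<in> Cas \<Longrightarrow> pr (SA f) t = pl f t"
proof -
  show "SA f \<in> carrier AA" unfolding SA_def by (rule D.rep_closed) (use f in \<open>simp add: BB_simps\<close>)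
  show "t \<in> Cas \<Longrightarrow> pr (SA f) t = pl f t"
    unfolding SA_def using f
    by (intro D.p_rep linI) (auto simp: BB_simps(1-6) pl_simps nendD pl_R_lin id_apply)
qed

lemma pl_ops:
  assumes "rlin f" "rlin g" "t \<in> carrier T"
  shows "pl (\<lambda>a\<in>carrier M. f a \<oplus>\<^bsub>M\<^esub> g a) t = pl f t \<oplus>\<^bsub>M\<^esub> pl g t"
proof -
  have l: "rlin (\<lambda>a\<in>carrier M. f a \<oplus>\<^bsub>M\<^esub> g a)"
    using rlinD[OF assms(1)] rlinD[OF assms(2)] unfolding rlin_def
    by (auto intro!: additiveI simp: M.a_ac M.l_distr)
  show ?thesis
    by (rule tens_eqI[OF assms(3) M.abelian_group_axioms, where F = "pl (\<lambda>a\<in>carrier M. f a \<oplus>\<^bsub>M\<^esub> g a)" and G = "\<lambda>t. pl f t \<oplus>\<^bsub>M\<^esub> pl g t"])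
       (use assms rlinD[OF assms(1)] rlinD[OF assms(2)] in \<open>simp_all add: pl_simps l M.l_distr M.a_ac\<close>)
qed

lemma pl_smult:
  assumes f: "nend f" and r: "r \<in> carrier R" and t: "t \<in> carrier T"
  shows "pl (\<lambda>a\<in>carrier M. r \<otimes>\<^bsub>M\<^esub> f a) t = r \<otimes>\<^bsub>M\<^esub> pl f t"
proof -
  have l: "rlin (\<lambda>a\<in>carrier M. r \<otimes>\<^bsub>M\<^esub> f a)"
    using nend_cong[OF nend_smult[OF f r], of "\<lambda>a\<in>carrier M. r \<otimes>\<^bsub>M\<^esub> f a"] by (simp add: nendD)
  show ?thesis
    by (rule tens_eqI[OF t M.abelian_group_axioms, where F = "pl (\<lambda>a\<in>carrier M. r \<otimes>\<^bsub>M\<^esub> f a)" and G = "\<lambda>t. r \<otimes>\<^bsub>M\<^esub> pl f t"])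
       (use nendD[OF f] r in \<open>simp_all add: pl_simps l M.r_distr M.m_assoc\<close>)
qed

lemma SA_lin: "lin R (sym_bimod AA) (sym_bimod AA) SA"
proof (rule linI)
  fix f assume "f \<in> carrier (sym_bimod AA)"
  then have f: "f \<in> carrier AA" by simp
  show "SA f \<in> carrier (sym_bimod AA)" using SA_props f by simp
  show "SA (lact (sym_bimod AA) r f) = lact (sym_bimod AA) r (SA f)" if r: "r \<in> carrier R" for r
  proof (rule D.H_eqI)
    have rf: "r \<odot>\<^bsub>AA\<^esub> f \<in> carrier AA" by (rule AA_closed(5)[OF r f])
    show "SA (lact (sym_bimod AA) r f) \<in> carrier AA" using SA_props rf by simp
    show "lact (sym_bimod AA) r (SA f) \<in> carrier AA" using SA_props f r AA_closed by simp
    show "pr (SA (lact (sym_bimod AA) r f)) t = pr (lact (sym_bimod AA) r (SA f)) t" if "t \<in> carrier BB" for t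
      using that f r rf SA_props[OF f] SA_props[OF rf]
      by (simp add: BB_simps) (simp add: AA_simps pl_smult pr_smult)
  qed
  fix g assume "g \<in> carrier (sym_bimod AA)"
  then have g: "g \<in> carrier AA" by simp
  show "SA (f \<oplus>\<^bsub>sym_bimod AA\<^esub> g) = SA f \<oplus>\<^bsub>sym_bimod AA\<^esub> SA g"
  proof (rule D.H_eqI)
    have fg: "f \<oplus>\<^bsub>AA\<^esub> g \<in> carrier AA" by (rule AA_closed(4)[OF f g])
    show "SA (f \<oplus>\<^bsub>sym_bimod AA\<^esub> g) \<in> carrier AA" using SA_props fg by simp
    show "SA f \<oplus>\<^bsub>sym_bimod AA\<^esub> SA g \<in> carrier AA" using SA_props f g AA_closed by simp
    show "pr (SA (f \<oplus>\<^bsub>sym_bimod AA\<^esub> g)) t = pr (SA f \<oplus>\<^bsub>sym_bimod AA\<^esub> SA g) t" if "t \<in> carrier BB" for t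
      using that f g fg SA_props[OF f] SA_props[OF g] SA_props[OF fg] 
      by (simp add: BB_simps) (simp add: AA_simps pl_ops pr_ops nendD)
  qed
qed

lemma pr_AA_mult:
  assumes "nend f" "nend g" "t \<in> carrier T"
  shows "pr (f \<otimes>\<^bsub>AA\<^esub> g) t = pr f (tmap (\<lambda>a. a) g t)"
proof -
  have "pr (f \<otimes>\<^bsub>AA\<^esub> g) t = pr (\<lambda>a. f (g a)) t"
    unfolding AA_simps by (rule pr_restrict[OF assms(3) nend_comp[OF assms(1,2)]])
  also have "\<dots> = pr f (tmap (\<lambda>a. a) g t)"
    using assms nendD(1,2)[OF assms(1)] nendD(1,2)[OF assms(2)] by (subst pr_tmap) (auto simp: lin_id pr_def)
  finally show ?thesis .
qed

text \<open>The module algebra property in the right factor: \<open>g\<close> of the product of two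
  right factors splits along the coproduct of \<open>g\<close>.\<close>

lemma tmap_ins:
  assumes g: "nend g" and t: "t \<in> Cas" and t': "t' \<in> carrier T"
  shows "tmap (\<lambda>a. a) g (ins t t') = (\<Oplus>\<^bsub>T\<^esub>j\<in>{..<q}. ins (tmap (\<lambda>a. a) (dl g (b j)) t) (tmap (\<lambda>a. a) (\<beta> j) t'))"
proof (rule tens_additive_eqI[OF _ _ T.abelian_group_axioms t', where F = "\<lambda>t'. tmap (\<lambda>a. a) g (ins t t')"])
  note G = nendD[OF g]
  have dj: "nend (dl g (b j))" if "j < q" for j using that g by simp
  note DJ = nendD[OF dj] and BJ = nendD[OF beta_nend]
  have tj: "tmap (\<lambda>a. a) (dl g (b j)) t \<in> Cas" if "j < q" for j
    by (rule tmap_Cas[OF nend_id dj[OF that] t])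
  show "additive T T (\<lambda>t'. tmap (\<lambda>a. a) g (ins t t'))"
    using t G by (intro additiveI) (simp_all add: tmap_simps lin_id)
  show "additive T T (\<lambda>t'. \<Oplus>\<^bsub>T\<^esub>j\<in>{..<q}. ins (tmap (\<lambda>a. a) (dl g (b j)) t) (tmap (\<lambda>a. a) (\<beta> j) t'))"
    by (rule additive_finsum_pw[OF T.abelian_group_axioms], rule additiveI)
       (use tj in \<open>simp_all add: tmap_simps lin_id BJ\<close>)
  fix a c assume ac: "a \<in> carrier M" "c \<in> carrier M"
  have 1: "tmap (\<lambda>a. a) g (ract T t c) = (\<Oplus>\<^bsub>T\<^esub>j\<in>{..<q}. ract T (tmap (\<lambda>a. a) (dl g (b j)) t) (\<beta> j c))"
  proof (rule tens_additive_eqI[OF _ _ T.abelian_group_axioms Cas_D[OF t], where F = "\<lambda>t. tmap (\<lambda>a. a) g (ract T t c)"])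
    show "additive T T (\<lambda>t. tmap (\<lambda>a. a) g (ract T t c))"
      using ac G by (intro additiveI) (simp_all add: tmap_simps lin_id)
    show "additive T T (\<lambda>t. \<Oplus>\<^bsub>T\<^esub>j\<in>{..<q}. ract T (tmap (\<lambda>a. a) (dl g (b j)) t) (\<beta> j c))"
      by (rule additive_finsum_pw[OF T.abelian_group_axioms], rule additiveI)
         (use ac in \<open>simp_all add: tmap_simps lin_id DJ\<close>)
    fix p0 q0 assume p: "p0 \<in> carrier M" "q0 \<in> carrier M"
    have "(\<Oplus>\<^bsub>T\<^esub>j\<in>{..<q}. ract T (tmap (\<lambda>a. a) (dl g (b j)) (pure p0 q0)) (\<beta> j c)) =
      (\<Oplus>\<^bsub>T\<^esub>j\<in>{..<q}. pure p0 (dl g (b j) q0 \<otimes>\<^bsub>M\<^esub> \<beta> j c))"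
      by (rule T.finsum_cong') (use ac p in \<open>simp_all add: tmap_simps lin_id DJ\<close>)
    also have "\<dots> = pure p0 (\<Oplus>\<^bsub>M\<^esub>j\<in>{..<q}. dl g (b j) q0 \<otimes>\<^bsub>M\<^esub> \<beta> j c)"
      by (rule M_sum[OF T.abelian_group_axioms, symmetric]) (use ac p in \<open>simp_all add: DJ\<close>)
    finally show "tmap (\<lambda>a. a) g (ract T (pure p0 q0) c) = (\<Oplus>\<^bsub>T\<^esub>j\<in>{..<q}. ract T (tmap (\<lambda>a. a) (dl g (b j)) (pure p0 q0)) (\<beta> j c))"
      using ac p G by (simp add: quasi_mult[OF g] tmap_simps lin_id)
  qed
  have "(\<Oplus>\<^bsub>T\<^esub>j\<in>{..<q}. ins (tmap (\<lambda>a. a) (dl g (b j)) t) (tmap (\<lambda>a. a) (\<beta> j) (pure a c))) =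
    (\<Oplus>\<^bsub>T\<^esub>j\<in>{..<q}. lact T a (ract T (tmap (\<lambda>a. a) (dl g (b j)) t) (\<beta> j c)))"
    by (rule T.finsum_cong') (use ac tj in \<open>simp_all add: tmap_simps lin_id BJ\<close>)
  also have "\<dots> = lact T a (\<Oplus>\<^bsub>T\<^esub>j\<in>{..<q}. ract T (tmap (\<lambda>a. a) (dl g (b j)) t) (\<beta> j c))"
    by (rule T_sum[OF T.abelian_group_axioms, symmetric]) (use ac tj in simp_all)
  also have "\<dots> = tmap (\<lambda>a. a) g (ins t (pure a c))"
    using 1 ac t G by (simp add: tmap_lact lin_id)
  finally show "tmap (\<lambda>a. a) g (ins t (pure a c)) = (\<Oplus>\<^bsub>T\<^esub>j\<in>{..<q}. ins (tmap (\<lambda>a. a) (dl g (b j)) t) (tmap (\<lambda>a. a) (\<beta> j) (pure a c)))"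
    by simp
qed

text \<open>Composition with \<open>g\<close> is moved onto the tensor and distributed over the
  product by \<open>tmap_ins\<close>; the remaining pairing with \<open>f\<close> is split by
  \<open>pr_ins_expand\<close>.\<close>

lemma compat_AA:
  assumes f: "f \<in> carrier AA" and g: "g \<in> carrier AA" and t: "t \<in> Cas" and t': "t' \<in> Cas"
  shows "pr (f \<otimes>\<^bsub>AA\<^esub> g) (t \<otimes>\<^bsub>BB\<^esub> t') = (\<Oplus>\<^bsub>R\<^esub>i\<in>{..<q}. \<Oplus>\<^bsub>R\<^esub>j\<in>{..<q}.
    pr (D.hr f (d i) \<otimes>\<^bsub>AA\<^esub> D.hr g (d j)) t \<otimes>\<^bsub>R\<^esub> pr (\<beta> i \<otimes>\<^bsub>AA\<^esub> \<beta> j) t')"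
proof -
  have nf: "nend f" and ng: "nend g" using f g by simp_all
  let ?s = "\<lambda>j. tmap (\<lambda>a. a) (dl g (b j)) t" and ?s' = "\<lambda>j. tmap (\<lambda>a. a) (\<beta> j) t'"
  have s: "?s j \<in> Cas" "?s' j \<in> Cas" if "j < q" for j
    using tmap_Cas[OF nend_id _ t, of "dl g (b j)"] tmap_Cas[OF nend_id _ t', of "\<beta> j"] that ng by simp_all
  let ?w = "\<lambda>i j. pr (dl f (b i)) (?s j) \<otimes>\<^bsub>M\<^esub> pr (\<beta> i) (?s' j)"
  have w: "?w i j \<in> carrier R" if "i < q" "j < q" for i j using that s nf by simp
  have wM: "?w i j \<in> carrier M" if "i < q" "j < q" for i j using w[OF that] by simp
  have w2: "pr (D.hr f (d i) \<otimes>\<^bsub>AA\<^esub> D.hr g (d j)) t \<otimes>\<^bsub>R\<^esub> pr (\<beta> i \<otimes>\<^bsub>AA\<^esub> \<beta> j) t' = ?w i j" if ij: "i < q" "j < q" for i j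
  proof -
    have n: "nend (dl f (b i))" "nend (dl g (b j))" using ij nf ng by simp_all
    have r: "nend (restrict (dl f (b i)) (carrier M))" "nend (restrict (dl g (b j)) (carrier M))"
      using AA_restrict[OF n(1)] AA_restrict[OF n(2)] AA_nend by blast+
    have "D.hr f (d i) \<otimes>\<^bsub>AA\<^esub> D.hr g (d j) = dl f (b i) \<otimes>\<^bsub>AA\<^esub> dl g (b j)"
      unfolding hr_AA[OF f ij(1)] hr_AA[OF g ij(2)] AA_simps(2) using n nendD(3) by (intro restrict_ext) simp
    then show ?thesis using t t' n ij by (simp add: pr_AA_mult)
  qed
  have "pr (f \<otimes>\<^bsub>AA\<^esub> g) (t \<otimes>\<^bsub>BB\<^esub> t') = pr f (tmap (\<lambda>a. a) g (ins t t'))"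
    using t t' nf ng by (simp add: BB_simps pr_AA_mult)
  also have "\<dots> = pr f (\<Oplus>\<^bsub>T\<^esub>j\<in>{..<q}. ins (?s j) (?s' j))"
    using tmap_ins[OF ng t] t' by simp
  also have "\<dots> = (\<Oplus>\<^bsub>M\<^esub>j\<in>{..<q}. pr f (ins (?s j) (?s' j)))"
    by (rule T_sum[OF M.abelian_group_axioms]) (use s nendD[OF nf] in \<open>simp_all add: pr_simps\<close>)
  also have "\<dots> = (\<Oplus>\<^bsub>M\<^esub>j\<in>{..<q}. \<Oplus>\<^bsub>M\<^esub>i\<in>{..<q}. ?w i j)"
    by (rule M.finsum_cong') (use s nf wM in \<open>auto simp: pr_ins_expand intro!: M.finsum_closed\<close>)
  also have "\<dots> = (\<Oplus>\<^bsub>M\<^esub>i\<in>{..<q}. \<Oplus>\<^bsub>M\<^esub>j\<in>{..<q}. ?w i j)"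
    by (rule M.finsum_swap) (use wM in auto)
  also have "\<dots> = (\<Oplus>\<^bsub>R\<^esub>i\<in>{..<q}. \<Oplus>\<^bsub>R\<^esub>j\<in>{..<q}. ?w i j)"
  proof -
    have "(\<Oplus>\<^bsub>R\<^esub>j\<in>{..<q}. ?w i j) = (\<Oplus>\<^bsub>M\<^esub>j\<in>{..<q}. ?w i j)" if "i < q" for i
      by (rule R_sum) (use w that in auto)
    moreover have "(\<Oplus>\<^bsub>M\<^esub>j\<in>{..<q}. ?w i j) \<in> carrier R" if "i < q" for i
      by (rule R_sum_cl) (use w that in auto)
    moreover have "(\<Oplus>\<^bsub>R\<^esub>i\<in>{..<q}. \<Oplus>\<^bsub>R\<^esub>j\<in>{..<q}. ?w i j) = (\<Oplus>\<^bsub>M\<^esub>i\<in>{..<q}. \<Oplus>\<^bsub>R\<^esub>j\<in>{..<q}. ?w i j)"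
      by (rule R_sum) (use calculation in auto)
    ultimately show ?thesis by (simp only:) (rule M.finsum_cong'[symmetric], auto)
  qed
  also have "\<dots> = (\<Oplus>\<^bsub>R\<^esub>i\<in>{..<q}. \<Oplus>\<^bsub>R\<^esub>j\<in>{..<q}.
    pr (D.hr f (d i) \<otimes>\<^bsub>AA\<^esub> D.hr g (d j)) t \<otimes>\<^bsub>R\<^esub> pr (\<beta> i \<otimes>\<^bsub>AA\<^esub> \<beta> j) t')"
    by (rule R.finsum2_cong[symmetric]) (use w w2 in auto)
  finally show ?thesis .
qed

lemma pr_AA_one: "t \<in> carrier T \<Longrightarrow> pr \<one>\<^bsub>AA\<^esub> t = sq_mult M t"
  unfolding AA_simps by (simp add: pr_restrict nend_id)

lemma pr_BB_one: "nend f \<Longrightarrow> pr f \<one>\<^bsub>BB\<^esub> = f \<one>\<^bsub>M\<^esub>"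
  using nendD by (simp add: BB_simps(3) pr_simps)

text \<open>The antipode turns the right pairing into the left one. The sum then applies the two
  legs of the coproduct of \<open>f\<close> to \<open>t\<^sup>1\<close> and
  \<open>t\<^sup>2\<close>, which is \<open>f(t\<^sup>1 t\<^sup>2)\<close> by the module algebra
  property, and \<open>t\<^sup>1 t\<^sup>2\<close> is a scalar.\<close>

lemma left_antipode_AA:
  assumes f: "f \<in> carrier AA" and t: "t \<in> Cas"
  shows "(\<Oplus>\<^bsub>R\<^esub>j\<in>{..<q}. pr (SA (D.hr f (d j)) \<otimes>\<^bsub>AA\<^esub> \<beta> j) t) = pr f \<one>\<^bsub>BB\<^esub> \<otimes>\<^bsub>R\<^esub> pr \<one>\<^bsub>AA\<^esub> t"
proof -
  have nf: "nend f" using f by simp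
  note nd = nendD[OF nf]
  have g: "nend (dl f (b j))" "restrict (dl f (b j)) (carrier M) \<in> carrier AA" if "j < q" for j using that nf by simp_all
  note G = nendD[OF g(1)] and BJ = nendD[OF beta_nend]
  have s: "tmap (\<lambda>a. a) (\<beta> j) t \<in> Cas" if "j < q" for j by (rule tmap_Cas[OF nend_id beta_nend[OF that] t])
  have 1: "pr (SA (D.hr f (d j)) \<otimes>\<^bsub>AA\<^esub> \<beta> j) t = sq_mult M (tmap (dl f (b j)) (\<beta> j) t)" if j: "j < q" for j
  proof -
    have "pr (SA (D.hr f (d j)) \<otimes>\<^bsub>AA\<^esub> \<beta> j) t = pl (restrict (dl f (b j)) (carrier M)) (tmap (\<lambda>a. a) (\<beta> j) t)"
      unfolding hr_AA[OF f j] using SA_props[OF g(2)[OF j]] s[OF j] t j by (simp add: pr_AA_mult)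
    also have "\<dots> = pl (dl f (b j)) (tmap (\<lambda>a. a) (\<beta> j) t)"
      using s[OF j] g(1)[OF j] by (simp add: pl_restrict)
    also have "\<dots> = sq_mult M (tmap (dl f (b j)) (\<beta> j) t)"
      using t G[OF j] BJ[OF j] by (simp add: pl_tmap lin_id)
    finally show ?thesis .
  qed
  have "(\<Oplus>\<^bsub>R\<^esub>j\<in>{..<q}. pr (SA (D.hr f (d j)) \<otimes>\<^bsub>AA\<^esub> \<beta> j) t) = (\<Oplus>\<^bsub>R\<^esub>j\<in>{..<q}. sq_mult M (tmap (dl f (b j)) (\<beta> j) t))"
    by (rule R.finsum_cong') (use 1 t g in \<open>auto intro!: mu_Cas tmap_Cas\<close>)
  also have "\<dots> = (\<Oplus>\<^bsub>M\<^esub>j\<in>{..<q}. sq_mult M (tmap (dl f (b j)) (\<beta> j) t))"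
    by (rule R_sum) (use t g in \<open>auto intro!: mu_Cas tmap_Cas\<close>)
  also have "\<dots> = f (sq_mult M t)"
  proof (rule tens_additive_eqI[OF _ _ M.abelian_group_axioms Cas_D[OF t], where G = "\<lambda>t. f (sq_mult M t)"])
    show "additive T M (\<lambda>t. \<Oplus>\<^bsub>M\<^esub>j\<in>{..<q}. sq_mult M (tmap (dl f (b j)) (\<beta> j) t))"
      by (rule additive_finsum_pw[OF M.abelian_group_axioms], rule additiveI)
         (use G BJ in \<open>simp_all add: tmap_simps\<close>)
    show "additive T M (\<lambda>t. f (sq_mult M t))" by (rule additiveI) (simp_all add: nd)
    fix a c assume ac: "a \<in> carrier M" "c \<in> carrier M"
    have "(\<Oplus>\<^bsub>M\<^esub>j\<in>{..<q}. sq_mult M (tmap (dl f (b j)) (\<beta> j) (pure a c))) = (\<Oplus>\<^bsub>M\<^esub>j\<in>{..<q}. dl f (b j) a \<otimes>\<^bsub>M\<^esub> \<beta> j c)"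
      by (rule M.finsum_cong') (use ac G BJ in \<open>simp_all add: tmap_simps\<close>)
    then show "(\<Oplus>\<^bsub>M\<^esub>j\<in>{..<q}. sq_mult M (tmap (dl f (b j)) (\<beta> j) (pure a c))) = f (sq_mult M (pure a c))"
      using ac quasi_mult[OF nf ac] by simp
  qed
  also have "\<dots> = sq_mult M t \<otimes>\<^bsub>M\<^esub> f \<one>\<^bsub>M\<^esub>"
    using nend_R(1)[OF nf mu_Cas[OF t] M.one_closed] t by simp
  also have "\<dots> = f \<one>\<^bsub>M\<^esub> \<otimes>\<^bsub>M\<^esub> sq_mult M t" 
    by (rule R_comm) (use nf t in simp_all)
  finally show ?thesis using nf t by (simp add: pr_AA_one pr_BB_one)
qed

text \<open>Here the antipode is the inner map of a composition and does not meet the pairing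
  directly, so the composition is first split by the coproduct of B. The dual bases then remove the
  \<open>\<beta> j\<close>, and what is left is the sum of \<open>b\<^sub>l\<^sup>1
  f(b\<^sub>l\<^sup>2 \<beta>\<^sub>l(t\<^sup>1)) t\<^sup>2\<close>, which the quasibasis identity
  evaluates.\<close>

lemma right_antipode_AA:
  assumes f: "f \<in> carrier AA" and t: "t \<in> Cas"
  shows "(\<Oplus>\<^bsub>R\<^esub>j\<in>{..<q}. pr (\<beta> j \<otimes>\<^bsub>AA\<^esub> SA (D.hl (d j) f)) t) = pr f \<one>\<^bsub>BB\<^esub> \<otimes>\<^bsub>R\<^esub> pr \<one>\<^bsub>AA\<^esub> t"
proof -
  have nf: "nend f" using f by simp
  note nd = nendD[OF nf] and BJ = nendD[OF beta_nend]
  let ?s = "\<lambda>l. tmap (\<beta> l) (\<lambda>a. a) t"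
  have s: "?s l \<in> Cas" if "l < q" for l by (rule tmap_Cas[OF beta_nend[OF that] nend_id t])
  have g: "restrict (dr c f) (carrier M) \<in> carrier AA" if "c \<in> Cas" for c using that nf by simp
  let ?w = "\<lambda>j l. pr (\<beta> j) (b l) \<otimes>\<^bsub>M\<^esub> pr (dl f (?s l)) (d j)"
  have w: "?w j l \<in> carrier R" if "j < q" "l < q" for j l using that s nf by simp
  have 1: "pr (\<beta> j \<otimes>\<^bsub>AA\<^esub> SA (D.hl (d j) f)) t = (\<Oplus>\<^bsub>R\<^esub>l\<in>{..<q}. ?w j l)" if j: "j < q" for j
  proof -
    let ?g = "SA (restrict (dr (d j) f) (carrier M))"
    have gA: "?g \<in> carrier AA" using SA_props(1)[OF g] j by simp
    have ng: "nend ?g" by (rule AA_nend[OF gA])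
    have "pr (\<beta> j \<otimes>\<^bsub>AA\<^esub> SA (D.hl (d j) f)) t = pr (\<lambda>a. \<beta> j (?g a)) t"
      unfolding hl_AA[OF f d_Cas[OF j]] AA_simps(2)
      by (rule pr_restrict[OF Cas_D[OF t] nend_comp[OF beta_nend[OF j] ng]])
    also have "\<dots> = (\<Oplus>\<^bsub>M\<^esub>l\<in>{..<q}. pr (\<beta> j) (b l) \<otimes>\<^bsub>M\<^esub> pr ?g (?s l))"
      by (rule pr_comp_expand[symmetric]; (rule ng | use j t in simp))
    also have "\<dots> = (\<Oplus>\<^bsub>M\<^esub>l\<in>{..<q}. ?w j l)"
    proof (rule M.finsum_cong'[OF refl])
      fix l assume "l \<in> {..<q}"
      then have l: "l < q" by simp
      have "pr ?g (?s l) = pl (restrict (dr (d j) f) (carrier M)) (?s l)"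
        by (rule SA_props(2)[OF g[OF d_Cas[OF j]] s[OF l]])
      also have "\<dots> = pl (dr (d j) f) (?s l)" using s[OF l] nf j by (simp add: pl_restrict)
      also have "\<dots> = pr (dl f (?s l)) (d j)" using nf s[OF l] j by (simp add: pr_dl)
      finally show "pr (\<beta> j) (b l) \<otimes>\<^bsub>M\<^esub> pr ?g (?s l) = ?w j l" by simp
    qed (use w[OF j] in auto)
    also have "\<dots> = (\<Oplus>\<^bsub>R\<^esub>l\<in>{..<q}. ?w j l)" by (rule R_sum[symmetric]) (use w[OF j] in auto)
    finally show ?thesis .
  qed
  have "(\<Oplus>\<^bsub>R\<^esub>j\<in>{..<q}. pr (\<beta> j \<otimes>\<^bsub>AA\<^esub> SA (D.hl (d j) f)) t) = (\<Oplus>\<^bsub>R\<^esub>j\<in>{..<q}. \<Oplus>\<^bsub>R\<^esub>l\<in>{..<q}. ?w j l)"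
    by (rule R.finsum_cong') (use 1 w in \<open>auto intro!: R.finsum_closed\<close>)
  also have "\<dots> = (\<Oplus>\<^bsub>R\<^esub>l\<in>{..<q}. \<Oplus>\<^bsub>R\<^esub>j\<in>{..<q}. ?w j l)"
    by (rule R.finsum_swap) (use w in auto)
  \<comment> \<open>For fixed \<open>l\<close> the sum over \<open>j\<close> is the expansion in the
    dual bases of the pairing of \<open>dl f (?s l)\<close> with \<open>b l\<close>.\<close>
  also have "\<dots> = (\<Oplus>\<^bsub>R\<^esub>l\<in>{..<q}. pr (dl f (?s l)) (b l))"
  proof (rule R.finsum_cong'[OF refl])
    show "(\<lambda>l. pr (dl f (?s l)) (b l)) \<in> {..<q} \<rightarrow> carrier R" using nf s by simp
    fix l assume "l \<in> {..<q}"
    then have l: "l < q" by simp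
    have n: "nend (dl f (?s l))" using nf s[OF l] by simp
    have "pr (dl f (?s l)) (b l) = (\<Oplus>\<^bsub>R\<^esub>j\<in>{..<q}. pr (\<beta> j) (b l) \<otimes>\<^bsub>R\<^esub> pr (dl f (?s l)) (d j))"
      by (rule DS.form_expand)
         (use n l nendD[OF n] in \<open>auto intro!: linI simp: BB_simps(1-6) pr_simps id_apply\<close>)
    then show "(\<Oplus>\<^bsub>R\<^esub>j\<in>{..<q}. ?w j l) = pr (dl f (?s l)) (b l)" by simp
  qed
  also have "\<dots> = (\<Oplus>\<^bsub>M\<^esub>l\<in>{..<q}. pr (dl f (?s l)) (b l))"
    by (rule R_sum) (use nf s in simp)
  also have "\<dots> = (\<Oplus>\<^bsub>M\<^esub>l\<in>{..<q}. sq_mult M (tmap (\<lambda>a. dr (b l) f (\<beta> l a)) (\<lambda>a. a) t))"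
  proof (rule M.finsum_cong'[OF refl])
    fix l assume "l \<in> {..<q}"
    then have l: "l < q" by simp
    then show "pr (dl f (?s l)) (b l) = sq_mult M (tmap (\<lambda>a. dr (b l) f (\<beta> l a)) (\<lambda>a. a) t)"
      using nf s[OF l] t BJ[OF l] nendD[OF dr_nend[OF nf b_Cas[OF l]]] by (simp add: pr_dl pl_tmap lin_id)
  qed (use nf t in \<open>simp add: Pi_def tmap_Cas nend_comp nend_id\<close>)
  also have "\<dots> = f \<one>\<^bsub>M\<^esub> \<otimes>\<^bsub>M\<^esub> sq_mult M t"
  proof (rule tens_additive_eqI[OF _ _ M.abelian_group_axioms Cas_D[OF t], where G = "\<lambda>t. f \<one>\<^bsub>M\<^esub> \<otimes>\<^bsub>M\<^esub> sq_mult M t"])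
    have n: "nend (\<lambda>a. dr (b l) f (\<beta> l a))" if "l < q" for l
      by (rule nend_comp[of "dr (b l) f" "\<beta> l"]) (use that nf in simp_all)
    note n' = nendD[OF n]
    show "additive T M (\<lambda>t. \<Oplus>\<^bsub>M\<^esub>l\<in>{..<q}. sq_mult M (tmap (\<lambda>a. dr (b l) f (\<beta> l a)) (\<lambda>a. a) t))"
      by (rule additive_finsum_pw[OF M.abelian_group_axioms], rule additiveI)
         (use n' in \<open>simp_all add: tmap_simps lin_id\<close>)
    show "additive T M (\<lambda>t. f \<one>\<^bsub>M\<^esub> \<otimes>\<^bsub>M\<^esub> sq_mult M t)" by (rule additiveI) (simp_all add: nd M.r_distr)
    fix a c assume ac: "a \<in> carrier M" "c \<in> carrier M"
    have "(\<Oplus>\<^bsub>M\<^esub>l\<in>{..<q}. sq_mult M (tmap (\<lambda>a. dr (b l) f (\<beta> l a)) (\<lambda>a. a) (pure a c))) = (\<Oplus>\<^bsub>M\<^esub>l\<in>{..<q}. pr f (ract T (b l) (\<beta> l a)) \<otimes>\<^bsub>M\<^esub> c)"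
      by (rule M.finsum_cong') (use ac n' nd in \<open>simp_all add: tmap_simps lin_id pr_simps, simp add: dr_def\<close>)
    also have "\<dots> = (\<Oplus>\<^bsub>M\<^esub>l\<in>{..<q}. pr f (ract T (b l) (\<beta> l a))) \<otimes>\<^bsub>M\<^esub> c"
      by (rule M.finsum_ldistr[symmetric]) (use ac nd in \<open>simp_all add: pr_simps Pi_def\<close>)
    \<comment> \<open>Under the pairing with \<open>f\<close> the quasibasis identity at
      \<open>a\<close> becomes \<open>a f(1)\<close>, where \<open>f(1)\<close> is a scalar.\<close>
    also have "(\<Oplus>\<^bsub>M\<^esub>l\<in>{..<q}. pr f (ract T (b l) (\<beta> l a))) = a \<otimes>\<^bsub>M\<^esub> f \<one>\<^bsub>M\<^esub>"
      by (subst quasi_map[OF M.abelian_group_axioms, where F = "pr f"]) (use ac nd in \<open>simp_all add: pr_simps\<close>)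
    also have "a \<otimes>\<^bsub>M\<^esub> f \<one>\<^bsub>M\<^esub> = f \<one>\<^bsub>M\<^esub> \<otimes>\<^bsub>M\<^esub> a" by (rule R_comm) (use nf ac in simp_all)
    finally show "(\<Oplus>\<^bsub>M\<^esub>l\<in>{..<q}. sq_mult M (tmap (\<lambda>a. dr (b l) f (\<beta> l a)) (\<lambda>a. a) (pure a c))) = f \<one>\<^bsub>M\<^esub> \<otimes>\<^bsub>M\<^esub> sq_mult M (pure a c)"
      using ac nd by (simp add: M.m_assoc)
  qed
  finally show ?thesis using nf t by (simp add: pr_AA_one pr_BB_one)
qed

text \<open>\<open>t\<^sup>1 t\<^sup>2\<close> is central in \<open>M\<close>, so it can be pulled
  out from between the two factors of \<open>t'\<close>.\<close>

lemma mu_ins: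
  assumes t: "t \<in> Cas" and t': "t' \<in> carrier T"
  shows "sq_mult M (ins t t') = sq_mult M t \<otimes>\<^bsub>M\<^esub> sq_mult M t'"
proof (rule tens_eqI[OF t' M.abelian_group_axioms, where F = "\<lambda>t'. sq_mult M (ins t t')" and G = "\<lambda>t'. sq_mult M t \<otimes>\<^bsub>M\<^esub> sq_mult M t'"])
  fix a c assume "a \<in> carrier M" "c \<in> carrier M"
  then show "sq_mult M (ins t (pure a c)) = sq_mult M t \<otimes>\<^bsub>M\<^esub> sq_mult M (pure a c)"
    using t R_comm[OF mu_Cas[OF t], of a] by (simp add: mu_act flip: M.m_assoc)
qed (use t in \<open>simp_all add: M.r_distr\<close>)

lemma dual_hopf_AB: "dual_hopf R AA BB pr q \<beta> d SA"
proof (rule dual_hopf.intro[OF dual_alg_AB], unfold_locales)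
  show "lin R (sym_bimod AA) (sym_bimod AA) SA" by (rule SA_lin)
  fix f g t t' assume "f \<in> carrier AA" "g \<in> carrier AA" "t \<in> carrier BB" "t' \<in> carrier BB"
  then show "pr (f \<otimes>\<^bsub>AA\<^esub> g) (t \<otimes>\<^bsub>BB\<^esub> t') = (\<Oplus>\<^bsub>R\<^esub>i\<in>{..<q}. \<Oplus>\<^bsub>R\<^esub>j\<in>{..<q}.
    pr (D.hr f (d i) \<otimes>\<^bsub>AA\<^esub> D.hr g (d j)) t \<otimes>\<^bsub>R\<^esub> pr (\<beta> i \<otimes>\<^bsub>AA\<^esub> \<beta> j) t')"
    by (intro compat_AA) (simp_all add: BB_simps(1))
next
  fix f t assume "f \<in> carrier AA" "t \<in> carrier BB"
  then have f: "f \<in> carrier AA" and t: "t \<in> Cas" by (simp_all add: BB_simps(1))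
  show "(\<Oplus>\<^bsub>R\<^esub>j\<in>{..<q}. pr (SA (D.hr f (d j)) \<otimes>\<^bsub>AA\<^esub> \<beta> j) t) = pr f \<one>\<^bsub>BB\<^esub> \<otimes>\<^bsub>R\<^esub> pr \<one>\<^bsub>AA\<^esub> t"
    by (rule left_antipode_AA[OF f t])
  show "(\<Oplus>\<^bsub>R\<^esub>j\<in>{..<q}. pr (\<beta> j \<otimes>\<^bsub>AA\<^esub> SA (D.hl (d j) f)) t) = pr f \<one>\<^bsub>BB\<^esub> \<otimes>\<^bsub>R\<^esub> pr \<one>\<^bsub>AA\<^esub> t"
    by (rule right_antipode_AA[OF f t])
next
  fix t t' assume "t \<in> carrier BB" "t' \<in> carrier BB"
  then show "pr \<one>\<^bsub>AA\<^esub> (t \<otimes>\<^bsub>BB\<^esub> t') = pr \<one>\<^bsub>AA\<^esub> t \<otimes>\<^bsub>R\<^esub> pr \<one>\<^bsub>AA\<^esub> t'"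
    by (simp add: BB_simps(1,2) pr_AA_one mu_ins)
next
  fix f g assume fg: "f \<in> carrier AA" "g \<in> carrier AA"
  have "f (g \<one>\<^bsub>M\<^esub>) = g \<one>\<^bsub>M\<^esub> \<otimes>\<^bsub>M\<^esub> f \<one>\<^bsub>M\<^esub>"
    using nend_R(1)[of f "g \<one>\<^bsub>M\<^esub>" "\<one>\<^bsub>M\<^esub>"] fg by simp
  also have "\<dots> = f \<one>\<^bsub>M\<^esub> \<otimes>\<^bsub>M\<^esub> g \<one>\<^bsub>M\<^esub>" by (rule R_comm) (use fg in simp_all)
  finally show "pr (f \<otimes>\<^bsub>AA\<^esub> g) \<one>\<^bsub>BB\<^esub> = pr f \<one>\<^bsub>BB\<^esub> \<otimes>\<^bsub>R\<^esub> pr g \<one>\<^bsub>BB\<^esub>"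
    using fg AA_nend[OF AA_closed(1)[OF fg]] by (simp add: pr_BB_one AA_apply)
next
  show "pr \<one>\<^bsub>AA\<^esub> \<one>\<^bsub>BB\<^esub> = \<one>\<^bsub>R\<^esub>" by (simp add: BB_simps(3) pr_AA_one)
qed

section \<open>The coproducts of A and B as transposes\<close>

lemma AA_comult: "comult AA f = (\<Oplus>\<^bsub>tensor2 R AA\<^esub>i\<in>{..<q}. pure2 R AA
    (\<lambda>m\<in>carrier M. tensor_lift M (\<lambda>x y. f (m \<otimes>\<^bsub>M\<^esub> x) \<otimes>\<^bsub>M\<^esub> y) (b i)) (\<beta> i))"
  and AA_counit: "counit AA f = f \<one>\<^bsub>M\<^esub>"
  unfolding AA_simps(7) by (simp_all add: AA_def End_bialg_def Let_def module.extend_def bialg.fields_def)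

lemma BB_comult: "comult BB t = (\<Oplus>\<^bsub>tensor2 R BB\<^esub>i\<in>{..<q}. pure2 R BB (b i) (tmap (\<beta> i) (\<lambda>a. a) t))"
  and BB_counit: "counit BB t = sq_mult M t"
  unfolding BB_simps(7) by (simp_all add: BB_def Cas_bialg_def Let_def module.extend_def bialg.fields_def tmap_def)

lemma AA_comult_dl:
  assumes f: "f \<in> carrier AA"
  shows "comult AA f = (\<Oplus>\<^bsub>tensor2 R AA\<^esub>i\<in>{..<q}. pure2 R AA (restrict (dl f (b i)) (carrier M)) (\<beta> i))"
proof -
  have nf: "nend f" using f by simp
  interpret TA: abelian_group "tensor2 R AA" by (rule sym_modD[OF D.VV_sym])
  have "(\<lambda>m\<in>carrier M. tensor_lift M (\<lambda>x y. f (m \<otimes>\<^bsub>M\<^esub> x) \<otimes>\<^bsub>M\<^esub> y) (b i)) = restrict (dl f (b i)) (carrier M)" if i: "i < q" for i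
  proof (rule restrict_ext)
    fix m assume m: "m \<in> carrier M"
    have g: "rlin (\<lambda>z. f (m \<otimes>\<^bsub>M\<^esub> z))"
      using nendD[OF nf] m by (auto simp: rlin_def M.r_distr M.m_assoc[symmetric] intro!: additiveI)
    have "tensor_lift M (\<lambda>x y. f (m \<otimes>\<^bsub>M\<^esub> x) \<otimes>\<^bsub>M\<^esub> y) (b i) = pl (\<lambda>z. f (m \<otimes>\<^bsub>M\<^esub> z)) (b i)"
      unfolding pl_def by (rule mul_lift[OF g lin_id(2)]) (use i in simp)
    also have "\<dots> = dl f (b i) m"
      unfolding dl_def
      by (rule tens_eqI[OF Cas_D[OF b_Cas[OF i]] M.abelian_group_axioms, where G = "\<lambda>t. pl f (lact T m t)"])
         (use m nendD[OF nf] g in \<open>simp_all add: pl_simps\<close>)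
    finally show "tensor_lift M (\<lambda>x y. f (m \<otimes>\<^bsub>M\<^esub> x) \<otimes>\<^bsub>M\<^esub> y) (b i) = dl f (b i) m" .
  qed
  then show ?thesis unfolding AA_comult
    by (intro TA.finsum_cong') (use nf in \<open>auto simp: tensor_simps\<close>)
qed

lemma dual_coalg_A: "dual_coalg R AA BB pr q \<beta> d"
proof (rule dual_coalg.intro[OF dual_alg_AB], unfold_locales)
  interpret TA: abelian_group "tensor2 R AA" by (rule sym_modD[OF D.VV_sym])
  fix f assume f: "f \<in> carrier AA"
  then have nf: "nend f" by simp
  have cl: "pure2 R AA (restrict (dl f (b i)) (carrier M)) (\<beta> i) \<in> carrier (tensor2 R AA)" if "i < q" for i
    using that nf by (simp add: tensor_simps)
  show "comult AA f \<in> carrier (tensor2 R AA)"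
    unfolding AA_comult_dl[OF f] by (rule TA.finsum_closed) (use cl in auto)
  show "counit AA f = pr f \<one>\<^bsub>BB\<^esub>" using nf by (simp add: AA_counit pr_BB_one)
  fix t t' assume "t \<in> carrier BB" "t' \<in> carrier BB"
  then have t: "t \<in> Cas" "t' \<in> Cas" "t \<in> carrier BB" "t' \<in> carrier BB" by (simp_all add: BB_simps(1))
  have "D.P2 t t' (comult AA f) = (\<Oplus>\<^bsub>ring_bimod R id id\<^esub>i\<in>{..<q}. D.P2 t t' (pure2 R AA (restrict (dl f (b i)) (carrier M)) (\<beta> i)))"
    unfolding AA_comult_dl[OF f] by (rule D.lin_finsum[OF D.VV_sym D.R_sym D.P2_lin[OF t(3,4)]]) (use cl in auto)
  also have "\<dots> = (\<Oplus>\<^bsub>R\<^esub>i\<in>{..<q}. pr (dl f (b i)) t \<otimes>\<^bsub>R\<^esub> pr (\<beta> i) t')"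
    unfolding D.finsum_RR by (rule R.finsum_cong') (use nf t in \<open>simp_all add: pr_restrict Pi_def\<close>)
  also have "\<dots> = (\<Oplus>\<^bsub>M\<^esub>i\<in>{..<q}. pr (dl f (b i)) t \<otimes>\<^bsub>M\<^esub> pr (\<beta> i) t')"
    by (subst R_sum) (use nf t in \<open>simp_all add: Pi_def\<close>)
  also have "\<dots> = pr f (t \<otimes>\<^bsub>BB\<^esub> t')"
    using pr_ins_expand[OF nf t(1,2)] t by (simp add: BB_simps(2))
  finally show "D.P2 t t' (comult AA f) = pr f (t \<otimes>\<^bsub>BB\<^esub> t')" .
qed

lemma dual_coalg_B: "dual_coalg R BB AA (\<lambda>t f. pr f t) q d \<beta>"
proof (rule dual_coalg.intro[OF D.dual_alg_swap], unfold_locales)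
  interpret TB: abelian_group "tensor2 R BB" by (rule sym_modD[OF DS.VV_sym])
  fix t assume "t \<in> carrier BB"
  then have t: "t \<in> Cas" by (simp add: BB_simps(1))
  have s: "tmap (\<beta> l) (\<lambda>a. a) t \<in> Cas" if "l < q" for l by (rule tmap_Cas[OF beta_nend[OF that] nend_id t])
  have cl: "pure2 R BB (b i) (tmap (\<beta> i) (\<lambda>a. a) t) \<in> carrier (tensor2 R BB)" if "i < q" for i
    using that s by (simp add: tensor_simps BB_simps(1))
  show "comult BB t \<in> carrier (tensor2 R BB)"
    unfolding BB_comult by (rule TB.finsum_closed) (use cl in auto)
  show "counit BB t = pr \<one>\<^bsub>AA\<^esub> t" using t by (simp add: BB_counit pr_AA_one)
  fix f g assume f: "f \<in> carrier AA" "g \<in> carrier AA"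
  have "DS.P2 f g (comult BB t) = (\<Oplus>\<^bsub>ring_bimod R id id\<^esub>i\<in>{..<q}. DS.P2 f g (pure2 R BB (b i) (tmap (\<beta> i) (\<lambda>a. a) t)))"
    unfolding BB_comult by (rule DS.lin_finsum[OF DS.VV_sym DS.R_sym DS.P2_lin[OF f]]) (use cl in auto)
  also have "\<dots> = (\<Oplus>\<^bsub>R\<^esub>i\<in>{..<q}. pr f (b i) \<otimes>\<^bsub>R\<^esub> pr g (tmap (\<beta> i) (\<lambda>a. a) t))"
    unfolding DS.finsum_RR by (rule R.finsum_cong') (use f s in \<open>simp_all add: Pi_def BB_simps(1)\<close>)
  also have "\<dots> = (\<Oplus>\<^bsub>M\<^esub>i\<in>{..<q}. pr f (b i) \<otimes>\<^bsub>M\<^esub> pr g (tmap (\<beta> i) (\<lambda>a. a) t))"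
    by (subst R_sum) (use f s in \<open>simp_all add: Pi_def\<close>)
  also have "\<dots> = pr (f \<otimes>\<^bsub>AA\<^esub> g) t"
    using f t by (simp add: pr_comp_expand AA_simps(2) pr_restrict nend_comp)
  finally show "DS.P2 f g (comult BB t) = pr (f \<otimes>\<^bsub>AA\<^esub> g) t" .
qed

section \<open>Frobenius algebra structures on A and B\<close>

lemma pl_AA_mult:
  assumes "nend f" "nend g" "t \<in> carrier T"
  shows "pl (f \<otimes>\<^bsub>AA\<^esub> g) t = pl f (tmap g (\<lambda>a. a) t)"
proof -
  have "pl (f \<otimes>\<^bsub>AA\<^esub> g) t = pl (\<lambda>a. f (g a)) t"
    unfolding AA_simps by (rule pl_restrict[OF assms(3) nend_comp[OF assms(1,2)]])
  also have "\<dots> = pl f (tmap g (\<lambda>a. a) t)"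
    using assms nendD(1,2)[OF assms(1)] nendD(1,2)[OF assms(2)] by (subst pl_tmap) (auto simp: lin_id pl_def)
  finally show ?thesis .
qed

text \<open>The functional is the trace \<open>f \<mapsto> \<Sum> f(x\<^sub>i) y\<^sub>i\<close>,
  with dual bases \<open>act (b i)\<close> and \<open>\<beta> i\<close>. Their Casimir element
  multiplies to \<open>a \<mapsto> a E(1)\<close>, since the sum of the
  \<open>b\<^sub>i \<beta>\<^sub>i(a)\<close> is \<open>a \<otimes> 1\<close>.\<close>

lemma semisimple_A: "semisimple_ring AA"
proof (rule semisimple_if_frobenius[OF R.field_axioms AA_assoc_algebra, where n = q and t = \<beta> and c = epsone
      and s = "\<lambda>i. restrict (act (b i)) (carrier M)" and \<tau> = "\<lambda>f. pl f u"])
  have n: "nend (act (b i))" if "i < q" for i using act_nend that by simp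
  show s: "restrict (act (b i)) (carrier M) \<in> carrier AA" if "i < q" for i using n that by simp
  have sn: "nend (restrict (act (b i)) (carrier M))" if "i < q" for i using s[OF that] by simp
  show "epsone \<noteq> \<zero>\<^bsub>R\<^esub>" using epsone_nonzero by simp
  show "pl f u \<in> carrier R" if "f \<in> carrier AA" for f using that by simp
  fix f assume f: "f \<in> carrier AA"
  then have nf: "nend f" by simp
  have U: "tmap f (\<lambda>a. a) u = U1 f" if "nend f" for f using nendD[OF that] by (simp add: U1_tmap)
  \<comment> \<open>Composing with \<open>act (b i)\<close> turns the trace into
    \<open>pl f (b i)\<close>, because \<open>U1\<close> undoes \<open>act\<close>.\<close>
  have 1: "pl (f \<otimes>\<^bsub>AA\<^esub> restrict (act (b i)) (carrier M)) u = pl f (b i)" if i: "i < q" for i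
  proof -
    have "U1 (restrict (act (b i)) (carrier M)) = U1 (act (b i))"
      by (rule U1_cong) (use i in \<open>simp_all add: act_rlin\<close>)
    then show ?thesis using i nf sn[OF i] by (simp add: pl_AA_mult U)
  qed
  show "(\<Oplus>\<^bsub>AA\<^esub>i\<in>{..<q}. pl (f \<otimes>\<^bsub>AA\<^esub> restrict (act (b i)) (carrier M)) u \<odot>\<^bsub>AA\<^esub> \<beta> i) = f"
  proof -
    have "(\<Oplus>\<^bsub>AA\<^esub>i\<in>{..<q}. pl (f \<otimes>\<^bsub>AA\<^esub> restrict (act (b i)) (carrier M)) u \<odot>\<^bsub>AA\<^esub> \<beta> i) = (\<Oplus>\<^bsub>AA\<^esub>i\<in>{..<q}. pr f (d i) \<odot>\<^bsub>AA\<^esub> \<beta> i)"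
      by (rule A.finsum_cong') (use nf in \<open>simp_all add: 1 d_def pr_sB AA_closed Pi_def\<close>)
    then show ?thesis using dual_expand_A[OF f] by simp
  qed
  have 2: "pl (\<beta> i \<otimes>\<^bsub>AA\<^esub> f) u = pl (\<beta> i) (U1 f)" if i: "i < q" for i
    using i nf by (simp add: pl_AA_mult U)
  have UC: "U1 f \<in> Cas" by (rule U1_Cas[OF nf])
  show "(\<Oplus>\<^bsub>AA\<^esub>i\<in>{..<q}. pl (\<beta> i \<otimes>\<^bsub>AA\<^esub> f) u \<odot>\<^bsub>AA\<^esub> restrict (act (b i)) (carrier M)) = f"
  proof (rule AA_eqI)
    have c: "pl (\<beta> i \<otimes>\<^bsub>AA\<^esub> f) u \<odot>\<^bsub>AA\<^esub> restrict (act (b i)) (carrier M) \<in> carrier AA" if "i < q" for i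
      using that s UC by (simp add: 2 AA_closed)
    then show "(\<Oplus>\<^bsub>AA\<^esub>i\<in>{..<q}. pl (\<beta> i \<otimes>\<^bsub>AA\<^esub> f) u \<odot>\<^bsub>AA\<^esub> restrict (act (b i)) (carrier M)) \<in> carrier AA"
      by (intro A.finsum_closed) auto
    fix a assume a: "a \<in> carrier M"
    have "(\<Oplus>\<^bsub>AA\<^esub>i\<in>{..<q}. pl (\<beta> i \<otimes>\<^bsub>AA\<^esub> f) u \<odot>\<^bsub>AA\<^esub> restrict (act (b i)) (carrier M)) a = 
      (\<Oplus>\<^bsub>M\<^esub>i\<in>{..<q}. (pl (\<beta> i \<otimes>\<^bsub>AA\<^esub> f) u \<odot>\<^bsub>AA\<^esub> restrict (act (b i)) (carrier M)) a)"
      by (rule AA_finsum_apply[OF _ a]) (rule c)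
    also have "\<dots> = (\<Oplus>\<^bsub>M\<^esub>i\<in>{..<q}. act (lact T (pl (\<beta> i) (U1 f)) (b i)) a)"
      by (rule M.finsum_cong') (use a UC in \<open>simp_all add: AA_apply 2 act_props Pi_def\<close>)
    also have "\<dots> = act (\<Oplus>\<^bsub>T\<^esub>i\<in>{..<q}. lact T (pl (\<beta> i) (U1 f)) (b i)) a"
      by (rule T_sum[OF M.abelian_group_axioms, where F = "\<lambda>t. act t a", symmetric]) (use a UC in simp_all)
    also have "\<dots> = f a" using quasi_Cas[OF UC] nendD[OF nf] a by (simp add: act_U1)
    finally show "(\<Oplus>\<^bsub>AA\<^esub>i\<in>{..<q}. pl (\<beta> i \<otimes>\<^bsub>AA\<^esub> f) u \<odot>\<^bsub>AA\<^esub> restrict (act (b i)) (carrier M)) a = f a" .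
  qed (rule f)
next
  have s: "restrict (act (b i)) (carrier M) \<in> carrier AA" if "i < q" for i using act_nend that by simp
  show "(\<Oplus>\<^bsub>AA\<^esub>i\<in>{..<q}. restrict (act (b i)) (carrier M) \<otimes>\<^bsub>AA\<^esub> \<beta> i) = epsone \<odot>\<^bsub>AA\<^esub> \<one>\<^bsub>AA\<^esub>"
  proof (rule AA_eqI)
    have c: "restrict (act (b i)) (carrier M) \<otimes>\<^bsub>AA\<^esub> \<beta> i \<in> carrier AA" if "i < q" for i
      using that s by (simp add: AA_closed)
    then show "(\<Oplus>\<^bsub>AA\<^esub>i\<in>{..<q}. restrict (act (b i)) (carrier M) \<otimes>\<^bsub>AA\<^esub> \<beta> i) \<in> carrier AA"
      by (intro A.finsum_closed) auto
    show "epsone \<odot>\<^bsub>AA\<^esub> \<one>\<^bsub>AA\<^esub> \<in> carrier AA" by (simp add: AA_closed)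
    fix a assume a: "a \<in> carrier M"
    have "(\<Oplus>\<^bsub>AA\<^esub>i\<in>{..<q}. restrict (act (b i)) (carrier M) \<otimes>\<^bsub>AA\<^esub> \<beta> i) a = 
      (\<Oplus>\<^bsub>M\<^esub>i\<in>{..<q}. (restrict (act (b i)) (carrier M) \<otimes>\<^bsub>AA\<^esub> \<beta> i) a)"
      by (rule AA_finsum_apply[OF _ a]) (rule c)
    also have "\<dots> = (\<Oplus>\<^bsub>M\<^esub>i\<in>{..<q}. act (ract T (b i) (\<beta> i a)) \<one>\<^bsub>M\<^esub>)"
      by (rule M.finsum_cong') (use a in \<open>simp_all add: AA_apply act_props Pi_def\<close>)
    also have "\<dots> = a \<otimes>\<^bsub>M\<^esub> epsone"
      by (subst quasi_map[OF M.abelian_group_axioms, where F = "\<lambda>t. act t \<one>\<^bsub>M\<^esub>"]) (use a in \<open>simp_all add: epsone_def\<close>)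
    also have "\<dots> = epsone \<otimes>\<^bsub>M\<^esub> a" by (rule R_comm) (use a in simp_all)
    finally show "(\<Oplus>\<^bsub>AA\<^esub>i\<in>{..<q}. restrict (act (b i)) (carrier M) \<otimes>\<^bsub>AA\<^esub> \<beta> i) a = (epsone \<odot>\<^bsub>AA\<^esub> \<one>\<^bsub>AA\<^esub>) a"
      using a by (simp add: AA_apply)
  qed
qed simp_all

text \<open>The functional is \<open>t \<mapsto> E(t\<^sup>1) t\<^sup>2\<close>, with dual bases
  \<open>b i\<close> and \<open>\<Sum> x\<^sub>j \<otimes> \<beta>\<^sub>i(y\<^sub>j)\<close>. In
  the product of the Casimir element the sum over \<open>i\<close> is a quasibasis sum for each
  \<open>y\<^sub>j\<close>, which leaves
  \<open>\<Sum> x\<^sub>j y\<^sub>j \<otimes> 1\<close>.\<close>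

lemma semisimple_B: "semisimple_ring BB"
proof (rule semisimple_if_frobenius[OF R.field_axioms BB_assoc_algebra, where n = q and s = b and c = lam
      and t = "\<lambda>i. U2 (\<beta> i)" and \<tau> = "\<lambda>t. coact t \<one>\<^bsub>M\<^esub>"])
  have tC: "U2 (\<beta> i) \<in> Cas" if "i < q" for i using U2_Cas that by simp
  then show "U2 (\<beta> i) \<in> carrier BB" if "i < q" for i using that by (simp add: BB_simps(1))
  show "lam \<noteq> \<zero>\<^bsub>R\<^esub>" using lam_nonzero by simp
  show "coact h \<one>\<^bsub>M\<^esub> \<in> carrier R" if "h \<in> carrier BB" for h
    using that coact_nend by (simp add: BB_simps(1))
  \<comment> \<open>Multiplication by \<open>h\<close> turns the functional into a left pairing, so
    the two expansions reduce to \<open>quasi_fun\<close> and \<open>quasi_Cas\<close>.\<close>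
  have form: "coact (ins h t) \<one>\<^bsub>M\<^esub> = pl (coact h) t" if h: "h \<in> Cas" and t: "t \<in> carrier T" for h t
    by (rule tens_eqI[OF t M.abelian_group_axioms, where F = "\<lambda>t. coact (ins h t) \<one>\<^bsub>M\<^esub>" and G = "pl (coact h)"])
       (use h nendD[OF coact_nend[OF h]] in \<open>simp_all add: pl_simps act_props\<close>)
  fix h assume "h \<in> carrier BB"
  then have h: "h \<in> Cas" by (simp add: BB_simps(1))
  have nh: "nend (coact h)" by (rule coact_nend[OF h])
  show "(\<Oplus>\<^bsub>BB\<^esub>i\<in>{..<q}. coact (h \<otimes>\<^bsub>BB\<^esub> b i) \<one>\<^bsub>M\<^esub> \<odot>\<^bsub>BB\<^esub> U2 (\<beta> i)) = h"
  proof -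
    have c: "lact T (pl (coact h) (b i)) (U2 (\<beta> i)) \<in> Cas" if "i < q" for i using that tC nh by simp
    have "(\<Oplus>\<^bsub>BB\<^esub>i\<in>{..<q}. coact (h \<otimes>\<^bsub>BB\<^esub> b i) \<one>\<^bsub>M\<^esub> \<odot>\<^bsub>BB\<^esub> U2 (\<beta> i)) = (\<Oplus>\<^bsub>BB\<^esub>i\<in>{..<q}. lact T (pl (coact h) (b i)) (U2 (\<beta> i)))"
      by (rule B.finsum_cong') (use c h in \<open>simp_all add: BB_simps(1,2,6) form\<close>)
    also have "\<dots> = (\<Oplus>\<^bsub>T\<^esub>i\<in>{..<q}. lact T (pl (coact h) (b i)) (U2 (\<beta> i)))"
      by (rule BB_finsum) (use c in auto)
    also have "\<dots> = h"
    proof (rule coact_eqI)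
      show "(\<Oplus>\<^bsub>T\<^esub>i\<in>{..<q}. lact T (pl (coact h) (b i)) (U2 (\<beta> i))) \<in> carrier T"
        by (rule T.finsum_closed) (use c in auto)
      fix m assume m: "m \<in> carrier M"
      have "coact (\<Oplus>\<^bsub>T\<^esub>i\<in>{..<q}. lact T (pl (coact h) (b i)) (U2 (\<beta> i))) m = (\<Oplus>\<^bsub>M\<^esub>i\<in>{..<q}. coact (lact T (pl (coact h) (b i)) (U2 (\<beta> i))) m)"
        by (rule T_sum[OF M.abelian_group_axioms, where F = "\<lambda>t. coact t m"]) (use m c in simp_all)
      also have "\<dots> = (\<Oplus>\<^bsub>M\<^esub>i\<in>{..<q}. pl (coact h) (b i) \<otimes>\<^bsub>M\<^esub> \<beta> i m)"
        by (rule M.finsum_cong') (use m nh tC nendD[OF beta_nend] in \<open>simp_all add: coact_R coact_U2 Pi_def\<close>)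
      also have "\<dots> = coact h m" by (rule quasi_fun[OF nendD(1)[OF nh] m])
      finally show "coact (\<Oplus>\<^bsub>T\<^esub>i\<in>{..<q}. lact T (pl (coact h) (b i)) (U2 (\<beta> i))) m = coact h m" .
    qed (use h in simp)
    finally show ?thesis .
  qed
  show "(\<Oplus>\<^bsub>BB\<^esub>i\<in>{..<q}. coact (U2 (\<beta> i) \<otimes>\<^bsub>BB\<^esub> h) \<one>\<^bsub>M\<^esub> \<odot>\<^bsub>BB\<^esub> b i) = h"
  proof -
    have 1: "pl (coact (U2 (\<beta> i))) h = pl (\<beta> i) h" if "i < q" for i
      by (rule pl_cong) (use h that tC nendD[OF beta_nend[OF that]] nendD(1)[OF coact_nend[OF tC[OF that]]] in \<open>simp_all add: coact_U2\<close>)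
    have "(\<Oplus>\<^bsub>BB\<^esub>i\<in>{..<q}. coact (U2 (\<beta> i) \<otimes>\<^bsub>BB\<^esub> h) \<one>\<^bsub>M\<^esub> \<odot>\<^bsub>BB\<^esub> b i) = (\<Oplus>\<^bsub>BB\<^esub>i\<in>{..<q}. lact T (pl (\<beta> i) h) (b i))"
      by (rule B.finsum_cong') (use h tC in \<open>simp_all add: BB_simps(1,2,6) form 1\<close>)
    also have "\<dots> = (\<Oplus>\<^bsub>T\<^esub>i\<in>{..<q}. lact T (pl (\<beta> i) h) (b i))"
      by (rule BB_finsum) (use h in auto)
    finally show ?thesis using quasi_Cas[OF h] by simp
  qed
next
  have tC: "U2 (\<beta> i) \<in> Cas" if "i < q" for i using U2_Cas that by simp
  have c: "ins (b i) (U2 (\<beta> i)) \<in> Cas" if "i < q" for i using tC that by simp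
  have "(\<Oplus>\<^bsub>BB\<^esub>i\<in>{..<q}. b i \<otimes>\<^bsub>BB\<^esub> U2 (\<beta> i)) = (\<Oplus>\<^bsub>T\<^esub>i\<in>{..<q}. ins (b i) (U2 (\<beta> i)))"
    by (rule trans[OF B.finsum_cong'[OF refl] BB_finsum]) (use c tC in \<open>simp_all add: BB_simps(1,2) Pi_def\<close>)
  also have "\<dots> = (\<Oplus>\<^bsub>T\<^esub>i\<in>{..<q}. \<Oplus>\<^bsub>T\<^esub>j\<in>{..<k}. lact T (x j) (ract T (b i) (\<beta> i (y j))))"
  proof (rule T.finsum_cong'[OF refl])
    fix i assume "i \<in> {..<q}"
    then have i: "i < q" by simp
    have "ins (b i) (U2 (\<beta> i)) = (\<Oplus>\<^bsub>T\<^esub>j\<in>{..<k}. ins (b i) (pure (x j) (\<beta> i (y j))))"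
      unfolding U2_def by (rule T_sum[OF T.abelian_group_axioms]) (use i in simp_all)
    also have "\<dots> = (\<Oplus>\<^bsub>T\<^esub>j\<in>{..<k}. lact T (x j) (ract T (b i) (\<beta> i (y j))))"
      by (rule T.finsum_cong') (use i in \<open>simp_all add: Pi_def\<close>)
    finally show "ins (b i) (U2 (\<beta> i)) = (\<Oplus>\<^bsub>T\<^esub>j\<in>{..<k}. lact T (x j) (ract T (b i) (\<beta> i (y j))))" .
  qed (auto intro!: T.finsum_closed)
  also have "\<dots> = (\<Oplus>\<^bsub>T\<^esub>j\<in>{..<k}. \<Oplus>\<^bsub>T\<^esub>i\<in>{..<q}. lact T (x j) (ract T (b i) (\<beta> i (y j))))"
    by (rule T.finsum_swap) simp_all
  also have "\<dots> = (\<Oplus>\<^bsub>T\<^esub>j\<in>{..<k}. pure (x j \<otimes>\<^bsub>M\<^esub> y j) \<one>\<^bsub>M\<^esub>)"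
  proof (rule T.finsum_cong'[OF refl])
    fix j assume "j \<in> {..<k}"
    then show "(\<Oplus>\<^bsub>T\<^esub>i\<in>{..<q}. lact T (x j) (ract T (b i) (\<beta> i (y j)))) = pure (x j \<otimes>\<^bsub>M\<^esub> y j) \<one>\<^bsub>M\<^esub>"
      by (subst quasi_map[OF T.abelian_group_axioms, where F = "lact T (x j)"]) simp_all
  qed auto
  also have "\<dots> = pure lam \<one>\<^bsub>M\<^esub>"
    unfolding lam_sum by (rule M_sum[OF T.abelian_group_axioms, where F = "\<lambda>a. pure a \<one>\<^bsub>M\<^esub>", symmetric]) simp_all
  finally show "(\<Oplus>\<^bsub>BB\<^esub>i\<in>{..<q}. b i \<otimes>\<^bsub>BB\<^esub> U2 (\<beta> i)) = lam \<odot>\<^bsub>BB\<^esub> \<one>\<^bsub>BB\<^esub>"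
    by (simp add: BB_simps(3,6))
qed (simp_all add: BB_simps(1))

end

section \<open>The second step of the Jones tower\<close>

context d2_frobenius_ext
begin

interpretation J: frob_ext M M1 j "sq_mult M" k "\<lambda>i. pure (x i) \<one>\<^bsub>M\<^esub>" "\<lambda>i. pure \<one>\<^bsub>M\<^esub> (y i)"
  by (rule M1_frob_ext)

definition chi where "chi t = J.U1 (ins t)"

lemma ins_J_nend: "t \<in> Cas \<Longrightarrow> J.nend (ins t)"
  unfolding J.nend_def J.rlin_def J.llin_def
  by (auto intro!: additiveI simp: ins_lact)

lemma J_act_chi [simp]: "t \<in> Cas \<Longrightarrow> w \<in> carrier T \<Longrightarrow> J.act (chi t) w = ins t w"
  unfolding chi_def using J.nendD(1)[OF ins_J_nend] by (simp add: J.act_U1)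

lemma chi_Cas [simp]: "t \<in> Cas \<Longrightarrow> chi t \<in> J.Cas"
  unfolding chi_def by (rule J.U1_Cas[OF ins_J_nend])

lemma chi_eqI:
  assumes "v \<in> J.Cas" "w \<in> J.Cas" "\<And>t. t \<in> carrier T \<Longrightarrow> J.act v t = J.act w t"
  shows "v = w"
  by (rule J.act_eqI) (use assms in simp_all)

text \<open>A bimodule endomorphism of \<open>M \<otimes> M\<close> is determined by its value at
  \<open>1 \<otimes> 1\<close>, and this value commutes with \<open>N\<close>. Evaluation there is
  the inverse.\<close>

lemma chi_bij: "bij_betw chi Cas J.Cas"
proof (rule bij_betwI)
  show "chi \<in> Cas \<rightarrow> J.Cas" by simp
  have nd: "J.nend (J.act w)" if "w \<in> J.Cas" for w by (rule J.act_nend[OF that])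
  have c: "J.act w (pure \<one>\<^bsub>M\<^esub> \<one>\<^bsub>M\<^esub>) \<in> Cas" if "w \<in> J.Cas" for w
  proof -
    have "lact T (\<iota> n) (J.act w (pure \<one>\<^bsub>M\<^esub> \<one>\<^bsub>M\<^esub>)) = ract T (J.act w (pure \<one>\<^bsub>M\<^esub> \<one>\<^bsub>M\<^esub>)) (\<iota> n)" if n: "n \<in> carrier N" for n
      using J.nendD(5)[OF nd[OF \<open>w \<in> J.Cas\<close>], of "pure \<one>\<^bsub>M\<^esub> \<one>\<^bsub>M\<^esub>" "\<iota> n"]
        J.nendD(6)[OF nd[OF \<open>w \<in> J.Cas\<close>], of "pure \<one>\<^bsub>M\<^esub> \<one>\<^bsub>M\<^esub>" "\<iota> n"]
        J.nendD(3)[OF nd[OF \<open>w \<in> J.Cas\<close>], of "pure \<one>\<^bsub>M\<^esub> \<one>\<^bsub>M\<^esub>"]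
        n pure_bal[of "\<one>\<^bsub>M\<^esub>" n "\<one>\<^bsub>M\<^esub>"] by simp
    then show ?thesis using J.nendD(3)[OF nd[OF that], of "pure \<one>\<^bsub>M\<^esub> \<one>\<^bsub>M\<^esub>"] by (simp add: Cas_def del: Cas_D)
  qed
  then show "(\<lambda>w. J.act w (pure \<one>\<^bsub>M\<^esub> \<one>\<^bsub>M\<^esub>)) \<in> J.Cas \<rightarrow> Cas" by simp
  show "J.act (chi t) (pure \<one>\<^bsub>M\<^esub> \<one>\<^bsub>M\<^esub>) = t" if "t \<in> Cas" for t using that by simp
  show "chi (J.act w (pure \<one>\<^bsub>M\<^esub> \<one>\<^bsub>M\<^esub>)) = w" if w: "w \<in> J.Cas" for w
  proof (rule chi_eqI[OF chi_Cas[OF c[OF w]] w])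
    note D = J.nendD(3-)[OF nd[OF w]]
    let ?c = "J.act w (pure \<one>\<^bsub>M\<^esub> \<one>\<^bsub>M\<^esub>)"
    fix t assume t: "t \<in> carrier T"
    have "ins ?c t = J.act w t"
    proof (rule tens_eqI[OF t T.abelian_group_axioms, where F = "ins ?c" and G = "J.act w"])
      fix a a' assume a: "a \<in> carrier M" "a' \<in> carrier M"
      have "J.act w (lact T a (ract T (pure \<one>\<^bsub>M\<^esub> \<one>\<^bsub>M\<^esub>) a')) = lact T a (ract T ?c a')"
        using a D(3)[of "pure \<one>\<^bsub>M\<^esub> \<one>\<^bsub>M\<^esub>" a'] D(4)[of "ract T (pure \<one>\<^bsub>M\<^esub> \<one>\<^bsub>M\<^esub>) a'" a] D(1)[of "pure \<one>\<^bsub>M\<^esub> \<one>\<^bsub>M\<^esub>"]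
        by (simp del: ract_simps(1) lact_simps(1))
      then show "ins ?c (pure a a') = J.act w (pure a a')" using a c[OF w] by simp
    qed (use D c[OF w] in simp_all)
    then show "J.act (chi ?c) t = J.act w t" using c[OF w] t by simp
  qed
qed

definition HA where "HA = hatA_bialg N M \<iota> E k x y"
definition HB where "HB = hatB_bialg N M \<iota> E k x y"

lemma jones_fold:
  "jones_ring N M \<iota> E k x y = M1" "jones_incl N M \<iota> k x y = j"
  "jones_ring2 N M \<iota> E k x y = J.M1" "jones_incl2 N M \<iota> E k x y = J.j"
  "jones_elt N M \<iota> = pure \<one>\<^bsub>M\<^esub> \<one>\<^bsub>M\<^esub>" "jones_elt2 N M \<iota> E k x y = J.pure u u"
  by (simp_all add: M1_def[symmetric] j_def[symmetric] J.M1_def J.j_def jones_ring2_def jones_incl2_def jones_elt_def jones_elt2_def)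

lemma HA_simps:
  "carrier HA = Cas" "f \<otimes>\<^bsub>HA\<^esub> g = f \<otimes>\<^bsub>M1\<^esub> g" "\<one>\<^bsub>HA\<^esub> = u" "\<zero>\<^bsub>HA\<^esub> = \<zero>\<^bsub>T\<^esub>" "add HA = add T"
  "r \<odot>\<^bsub>HA\<^esub> f = j r \<otimes>\<^bsub>M1\<^esub> f"
  by (simp_all add: HA_def hatA_bialg_def hatA_alg_def cent_alg_def Let_def module.extend_def bialg.fields_def jones_fold centralizer_M1)

lemma HB_simps:
  "carrier HB = J.Cas" "f \<otimes>\<^bsub>HB\<^esub> g = f \<otimes>\<^bsub>J.M1\<^esub> g" "\<one>\<^bsub>HB\<^esub> = J.u" "\<zero>\<^bsub>HB\<^esub> = \<zero>\<^bsub>J.T\<^esub>" "add HB = add J.T"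
  "r \<odot>\<^bsub>HB\<^esub> f = J.j (j r) \<otimes>\<^bsub>J.M1\<^esub> f"
  by (simp_all add: HB_def hatB_bialg_def hatB_alg_def cent_alg_def Let_def module.extend_def bialg.fields_def jones_fold J.centralizer_M1)

lemma isoA: "alg_iso R AA HA U1"
  unfolding alg_iso_def
proof (intro conjI ballI)
  show "bij_betw U1 (carrier AA) (carrier HA)" using U1_bij by (simp add: AA_simps(1) HA_simps)
  show "U1 \<one>\<^bsub>AA\<^esub> = \<one>\<^bsub>HA\<^esub>"
    unfolding HA_simps AA_simps(3) by (rule act_eqI) (use act_U1[of "\<lambda>a\<in>carrier M. a"] A.one_closed nendD(1)[OF AA_nend, of "\<one>\<^bsub>AA\<^esub>"] in \<open>simp_all add: AA_simps(3)\<close>)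
  show "U1 \<zero>\<^bsub>AA\<^esub> = \<zero>\<^bsub>HA\<^esub>"
    by (rule additive_zero[OF A.abelian_group_axioms T.abelian_group_axioms, of U1, folded HA_simps(4)])
       (rule additiveI, auto simp: AA_simps(5) U1_add nendD)
  fix f g assume fg: "f \<in> carrier AA" "g \<in> carrier AA"
  then show "U1 (f \<oplus>\<^bsub>AA\<^esub> g) = U1 f \<oplus>\<^bsub>HA\<^esub> U1 g" "U1 (f \<otimes>\<^bsub>AA\<^esub> g) = U1 f \<otimes>\<^bsub>HA\<^esub> U1 g"
    using nendD(1)[OF AA_nend] by (simp_all add: HA_simps AA_simps(2,5) U1_add U1_comp)
next
  fix r f assume rf: "r \<in> carrier R" "f \<in> carrier AA"
  note D = nendD(1,3)[OF AA_nend[OF rf(2)]] nendD(1)[OF AA_nend[OF AA_closed(5)[OF rf]]]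
  show "U1 (r \<odot>\<^bsub>AA\<^esub> f) = r \<odot>\<^bsub>HA\<^esub> U1 f"
    by (rule act_eqI) (use rf D in \<open>simp_all add: HA_simps act_props act_U1 AA_apply\<close>)
qed

text \<open>All identities are compared through the faithful action of \<open>M\<^sub>2\<close> on
  \<open>M\<^sub>1\<close>, under which \<open>chi t\<close> becomes \<open>ins t\<close>.\<close>

lemma isoB: "alg_iso R BB HB chi"
  unfolding alg_iso_def
proof (intro conjI ballI)
  show "bij_betw chi (carrier BB) (carrier HB)" using chi_bij by (simp add: BB_simps(1) HB_simps)
  show "chi \<one>\<^bsub>BB\<^esub> = \<one>\<^bsub>HB\<^esub>"
    unfolding HB_simps BB_simps(3) by (rule J.act_eqI) simp_all
  have add: "chi (s \<oplus>\<^bsub>T\<^esub> t) = chi s \<oplus>\<^bsub>J.T\<^esub> chi t" if "s \<in> Cas" "t \<in> Cas" for s t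
    by (rule J.act_eqI) (use that in simp_all)
  show "chi \<zero>\<^bsub>BB\<^esub> = \<zero>\<^bsub>HB\<^esub>"
    by (rule additive_zero[OF B.abelian_group_axioms J.T.abelian_group_axioms, of chi, folded HB_simps(4)])
       (rule additiveI, simp_all add: BB_simps(1,5) add)
  fix s t assume st: "s \<in> carrier BB" "t \<in> carrier BB"
  then show "chi (s \<oplus>\<^bsub>BB\<^esub> t) = chi s \<oplus>\<^bsub>HB\<^esub> chi t"
    by (simp add: BB_simps(1,5) HB_simps add)
  have st': "s \<in> Cas" "t \<in> Cas" using st by (simp_all add: BB_simps(1))
  have "chi (ins s t) = chi s \<otimes>\<^bsub>J.M1\<^esub> chi t"
    by (rule J.act_eqI) (use st' in \<open>simp_all add: J.act_mult ins_assoc\<close>)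
  then show "chi (s \<otimes>\<^bsub>BB\<^esub> t) = chi s \<otimes>\<^bsub>HB\<^esub> chi t" using st' by (simp add: BB_simps(2) HB_simps)
next
  fix r t assume "r \<in> carrier R" "t \<in> carrier BB"
  then have rt: "r \<in> carrier R" "t \<in> Cas" by (simp_all add: BB_simps(1))
  have "chi (lact T r t) = J.j (j r) \<otimes>\<^bsub>J.M1\<^esub> chi t"
    by (rule J.act_eqI) (use rt in \<open>simp_all add: J.act_props\<close>)
  then show "chi (r \<odot>\<^bsub>BB\<^esub> t) = r \<odot>\<^bsub>HB\<^esub> chi t" by (simp add: BB_simps(6) HB_simps)
qed

text \<open>Evaluates the next Frobenius homomorphism on a product in \<open>M\<^sub>1\<close> whose
  left factor is pure. The Kadison--Nikshych form needs this here and one step higher in the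
  tower.\<close>

lemma mu_jinner:
  assumes "a \<in> carrier M" "c \<in> carrier M" "t \<in> carrier T"
  shows "sq_mult M (jinner a c t) = a \<otimes>\<^bsub>M\<^esub> coact t c"
  by (rule tens_eqI[OF assms(3) M.abelian_group_axioms, where F = "\<lambda>t. sq_mult M (jinner a c t)" and G = "\<lambda>t. a \<otimes>\<^bsub>M\<^esub> coact t c"])
     (use assms in \<open>simp_all add: M.r_distr M.m_assoc\<close>)

lemma J_mu_jinner:
  assumes "a \<in> carrier T" "c \<in> carrier T" "w \<in> carrier J.T"
  shows "sq_mult M1 (J.jinner a c w) = a \<otimes>\<^bsub>M1\<^esub> J.coact w c"
  by (rule J.tens_eqI[OF assms(3) M1_abelian, where F = "\<lambda>w. sq_mult M1 (J.jinner a c w)" and G = "\<lambda>w. a \<otimes>\<^bsub>M1\<^esub> J.coact w c"])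
     (use assms J.mu_simps J.coact_simps J.jinner_simps J.eps_simps(1) in \<open>simp_all add: M1.m_assoc\<close>)

lemma J_coact_chi:
  assumes t: "t \<in> Cas" and e: "e \<in> carrier T"
  shows "J.coact (chi t) e = (\<Oplus>\<^bsub>T\<^esub>i\<in>{..<k}. pure (sq_mult M (e \<otimes>\<^bsub>M1\<^esub> lact T (x i) t)) (y i))"
proof -
  have "J.coact (chi t) e = (\<Oplus>\<^bsub>M1\<^esub>i\<in>{..<k}. J.coact (J.pure (ins t (pure (x i) \<one>\<^bsub>M\<^esub>)) (pure \<one>\<^bsub>M\<^esub> (y i))) e)"
    unfolding chi_def J.U1_def
    by (rule J.T_sum[OF M1_abelian, where F = "\<lambda>w. J.coact w e"])
       (use e t J.pure_cl J.coact_simps in simp_all)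
  also have "\<dots> = (\<Oplus>\<^bsub>M1\<^esub>i\<in>{..<k}. pure (sq_mult M (e \<otimes>\<^bsub>M1\<^esub> lact T (x i) t)) (y i))"
    by (rule M1.finsum_cong') (use e t J.coact_simps in \<open>simp_all add: J.eps_def Pi_def\<close>)
  finally show ?thesis by (simp add: M1_finsum)
qed

text \<open>\<open>U1 f\<close> acts as \<open>f\<close>, so by faithfulness left multiplication by
  it applies \<open>f\<close> to the left factor.\<close>

lemma U1_mult_tmap:
  assumes f: "rlin f" and s: "s \<in> carrier T"
  shows "U1 f \<otimes>\<^bsub>M1\<^esub> s = tmap f (\<lambda>a. a) s"
proof (rule act_eqI)
  note tm = tmap_simps[OF f lin_id(2)]
  fix m assume m: "m \<in> carrier M"
  have "act (tmap f (\<lambda>a. a) s) m = f (act s m)"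
    by (rule tens_eqI[OF s M.abelian_group_axioms, where F = "\<lambda>s. act (tmap f (\<lambda>a. a) s) m" and G = "\<lambda>s. f (act s m)"])
       (use f m rlinD[OF f] in \<open>simp_all add: tm eps_def\<close>)
  then show "act (U1 f \<otimes>\<^bsub>M1\<^esub> s) m = act (tmap f (\<lambda>a. a) s) m" using f s m by (simp add: act_mult act_U1)
qed (use f s tmap_simps[OF f lin_id(2)] in simp_all)

text \<open>In \<open>M\<^sub>2\<close> the product \<open>a e\<^sub>2 e\<^sub>1\<close> is the pure
  tensor \<open>a \<otimes> e\<^sub>1\<close>, so the Frobenius homomorphism to
  \<open>M\<^sub>1\<close> gives \<open>a\<close> times the coaction of \<open>chi t\<close> on
  \<open>e\<^sub>1\<close>, which is \<open>U1 (coact t)\<close>. The outer one gives the left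
  pairing of \<open>f\<close> with it, and \<open>pr_pl\<close> identifies this with
  \<open>pr f t\<close>.\<close>

lemma KN_form_eq:
  assumes f: "nend f" and t: "t \<in> Cas"
  shows "KN_form N M \<iota> E k x y (U1 f) (chi t) = pr f t"
proof -
  let ?e = "pure \<one>\<^bsub>M\<^esub> \<one>\<^bsub>M\<^esub>"
  note f' = nendD[OF f] and ct = coact_nend[OF t]
  have U: "U1 f \<in> carrier T" using f' by simp
  have w: "chi t \<in> carrier J.T" using t by simp
  have c: "J.coact (chi t) ?e = U1 (coact t)"
    unfolding J_coact_chi[OF t pure_cl[OF M.one_closed M.one_closed]] U1_def
    by (rule T.finsum_cong') (use t in \<open>simp_all add: mu_jinner act_props Pi_def\<close>)
  have "J.j (U1 f) \<otimes>\<^bsub>J.M1\<^esub> J.pure u u \<otimes>\<^bsub>J.M1\<^esub> J.j ?e = J.pure (U1 f) ?e"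
    using U M1.l_one M1.r_one J.pure_cl by (simp add: J.j_mult J.lact_simps J.ract_simps del: M1_mult_simps(1))
  then have "KN_form N M \<iota> E k x y (U1 f) (chi t) = sq_mult M (sq_mult M1 (J.pure (U1 f) ?e \<otimes>\<^bsub>J.M1\<^esub> chi t))"
    by (simp add: KN_form_def Let_def jones_fold)
  also have "\<dots> = sq_mult M (U1 f \<otimes>\<^bsub>M1\<^esub> U1 (coact t))"
    using U w J.M1_mult_simps(1) by (simp add: J_mu_jinner c)
  also have "\<dots> = pl f (U1 (coact t))" using f' nendD[OF ct] by (simp add: U1_mult_tmap pl_def)
  also have "\<dots> = pr f t" by (rule pr_pl[OF f t, symmetric])
  finally show ?thesis .
qed

lemma KN_form_iso: "f \<in> carrier AA \<Longrightarrow> t \<in> carrier BB \<Longrightarrow> KN_form N M \<iota> E k x y (U1 f) (chi t) = pr f t"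
  by (simp add: KN_form_eq BB_simps(1))

text \<open>The coaction is now on the unit \<open>u\<close> in place of \<open>e\<^sub>1\<close>.
  Multiplying out gives \<open>x\<^sub>i\<close> times the scalar
  \<open>t\<^sup>1 t\<^sup>2\<close>, which comes out of the sum. This computes the counit of the
  centralizer in \<open>M\<^sub>2\<close>.\<close>

lemma E2_chi:
  assumes t: "t \<in> Cas"
  shows "sq_mult M1 (J.pure u u \<otimes>\<^bsub>J.M1\<^esub> chi t) = lact T (sq_mult M t) u"
proof -
  have w: "chi t \<in> carrier J.T" using t by simp
  have "sq_mult M1 (J.pure u u \<otimes>\<^bsub>J.M1\<^esub> chi t) = J.coact (chi t) u"
    using w J.M1_mult_simps(1) J.coact_simps(2) M1.l_one by (simp add: J_mu_jinner)
  also have "\<dots> = (\<Oplus>\<^bsub>T\<^esub>i\<in>{..<k}. lact T (sq_mult M t) (pure (x i) (y i)))"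
    unfolding J_coact_chi[OF t u_cl]
    by (rule T.finsum_cong') (use t M1.l_one R_comm[OF mu_Cas[OF t]] in \<open>simp_all add: mu_act Pi_def\<close>)
  also have "\<dots> = lact T (sq_mult M t) u"
    unfolding u_def by (rule T_sum[OF T.abelian_group_axioms, symmetric]) (use t in simp_all)
  finally show ?thesis .
qed

section \<open>Hopf duality of the two centralizers in the tower\<close>

lemma dual_hopf_hat: "dual_hopf R HA HB (KN_form N M \<iota> E k x y) q (U1 \<circ> \<beta>) (chi \<circ> d)
    (\<lambda>a. U1 (SA (inv_into (carrier AA) U1 a)))"
  by (rule dual_hopf_transport[OF dual_hopf_AB isoA isoB KN_form_iso])

lemma dual_coalg_hatA: "dual_coalg R HA HB (KN_form N M \<iota> E k x y) q (U1 \<circ> \<beta>) (chi \<circ> d)"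
proof -
  interpret h: dual_hopf R HA HB "KN_form N M \<iota> E k x y" q "U1 \<circ> \<beta>" "chi \<circ> d" "\<lambda>a. U1 (SA (inv_into (carrier AA) U1 a))"
    by (rule dual_hopf_hat)
  show ?thesis
    by (rule h.dual_coalgI)
       (simp_all add: HA_def HB_def hatA_bialg_def hatB_bialg_def Let_def module.extend_def bialg.fields_def sym_bimod_def)
qed

lemma dual_coalg_hatB: "dual_coalg R HB HA (\<lambda>w a. KN_form N M \<iota> E k x y a w) q (chi \<circ> d) (U1 \<circ> \<beta>)"
proof -
  interpret h: dual_hopf R HA HB "KN_form N M \<iota> E k x y" q "U1 \<circ> \<beta>" "chi \<circ> d" "\<lambda>a. U1 (SA (inv_into (carrier AA) U1 a))"
    by (rule dual_hopf_hat)
  show ?thesis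
  proof (rule h.sw.dual_coalgI)
    fix w assume "w \<in> carrier HB"
    then obtain t where t': "t \<in> carrier BB" and w: "w = chi t" using alg_iso_obtain[OF isoB] by blast
    then have t: "t \<in> Cas" by (simp add: BB_simps(1))
    have 1: "KN_form N M \<iota> E k x y \<one>\<^bsub>HA\<^esub> w = sq_mult M t"
      using KN_form_iso[OF A.one_closed t'] t by (simp add: w alg_isoD(5)[OF isoA] pr_AA_one)
    \<comment> \<open>The description asks for a scalar whose multiple of the unit of
      \<open>M\<^sub>1\<close> is the image of \<open>e\<^sub>2 w\<close>; \<open>E2_chi\<close>
      supplies \<open>t\<^sup>1 t\<^sup>2\<close>.\<close>
    have "counit HB w = (THE r. r \<in> carrier R \<and> lact T (sq_mult M t) u = lact T r u)"
      unfolding HB_def hatB_bialg_def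
      by (simp add: Let_def module.extend_def bialg.fields_def hatA_alg_def cent_alg_def jones_fold w E2_chi[OF t] cong: conj_cong)
    also have "\<dots> = sq_mult M t"
    proof (rule the_equality)
      fix r assume r: "r \<in> carrier R \<and> lact T (sq_mult M t) u = lact T r u"
      \<comment> \<open>Uniqueness: letting both sides act on 1 recovers the scalar.\<close>
      then have "act (lact T (sq_mult M t) u) \<one>\<^bsub>M\<^esub> = act (lact T r u) \<one>\<^bsub>M\<^esub>" by simp
      then show "r = sq_mult M t" using conjunct1[OF r] t by (simp add: act_props)
    qed (use t in simp)
    finally show "counit HB w = KN_form N M \<iota> E k x y \<one>\<^bsub>HA\<^esub> w" using 1 by simp
  qed (simp add: HA_def HB_def hatA_bialg_def hatB_bialg_def Let_def module.extend_def bialg.fields_def sym_bimod_def)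
qed

lemma BA_pairing_eq: "t \<in> carrier BB \<Longrightarrow> f \<in> carrier AA \<Longrightarrow> BA_pairing M t f = pr f t"
  using mul_lift[OF lin_id(1) nendD(2)[OF AA_nend], of f t] by (simp add: BA_pairing_def pr_def BB_simps(1))

text \<open>Only the agreement of \<open>BA_pairing M\<close> with \<open>pr\<close> on the carriers
  is available, so the structure is carried over along identity maps, which amounts to exchanging
  the form. The pair is swapped beforehand to put B on the left.\<close>

lemma hopf_dual_BA: "hopf_dual R BB AA (BA_pairing M)"
proof -
  have id: "alg_iso R H H (\<lambda>x. x)" for H :: "('b, 'z, 'w) module_scheme" by (simp add: alg_iso_def bij_betw_def)
  note h = dual_hopf_transport[OF dual_hopf.dual_hopf_swap[OF dual_hopf_AB] id id BA_pairing_eq, unfolded comp_def]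
  have a: "dual_alg R BB AA (BA_pairing M) q d \<beta>" using h by (rule dual_hopf.axioms)
  show ?thesis
    by (rule hopf_dual_if_dual_hopf[OF h dual_coalg_cong[OF dual_coalg_B a BA_pairing_eq]
          dual_coalg_cong[OF dual_coalg_A dual_alg.dual_alg_swap[OF a] BA_pairing_eq]])
qed

lemma kadison_nikshych:
  "semisimple_hopf_algebra R AA \<and> semisimple_hopf_algebra R BB \<and> hopf_dual R BB AA (BA_pairing M) \<and>
   hopf_dual R HA HB (KN_form N M \<iota> E k x y) \<and> hopf_isomorphic R AA HA \<and> hopf_isomorphic R BB HB"
proof (intro conjI)
  show BA: "hopf_dual R BB AA (BA_pairing M)" by (rule hopf_dual_BA)
  then show "semisimple_hopf_algebra R AA" "semisimple_hopf_algebra R BB"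
    using semisimple_A semisimple_B by (simp_all add: semisimple_hopf_algebra_def hopf_dual_def)
  show "hopf_dual R HA HB (KN_form N M \<iota> E k x y)"
    by (rule hopf_dual_if_dual_hopf[OF dual_hopf_hat dual_coalg_hatA dual_coalg_hatB])
  show "hopf_isomorphic R AA HA"
    by (rule hopf_isomorphic_transport[OF dual_hopf_AB dual_coalg_A isoA isoB KN_form_iso dual_coalg_hatA])
  show "hopf_isomorphic R BB HB"
    by (rule hopf_isomorphic_transport[OF dual_hopf.dual_hopf_swap[OF dual_hopf_AB] dual_coalg_B isoB isoA _ dual_coalg_hatB])
       (rule KN_form_iso)
qed

end

theorem theorem7p3:
  fixes N :: "'n ring" and M :: "'m ring" and \<iota> :: "'n \<Rightarrow> 'm"
    and E :: "'m \<Rightarrow> 'n" and k :: nat and x y :: "nat \<Rightarrow> 'm"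
    and q :: nat and b :: "nat \<Rightarrow> ('m, 'm) tens" and \<beta> :: "nat \<Rightarrow> 'm \<Rightarrow> 'm"
  assumes "ring_extension N M \<iota>"
    and "trivial_centralizer N M \<iota>"
    and "biseparable N M \<iota>"
    and "frobenius_system N M \<iota> E k x y"
    and "depth_two N M \<iota>"
    and "left_D2_quasibasis N M \<iota> q b \<beta>"
  shows "semisimple_hopf_algebra (cent_ring N M \<iota>) (End_bialg N M \<iota> q b \<beta>) \<and>
         semisimple_hopf_algebra (cent_ring N M \<iota>) (Cas_bialg N M \<iota> q b \<beta>) \<and>
         hopf_dual (cent_ring N M \<iota>) (Cas_bialg N M \<iota> q b \<beta>) (End_bialg N M \<iota> q b \<beta>)
           (BA_pairing M) \<and>
         hopf_dual (cent_ring N M \<iota>) (hatA_bialg N M \<iota> E k x y) (hatB_bialg N M \<iota> E k x y)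
           (KN_form N M \<iota> E k x y) \<and>
         hopf_isomorphic (cent_ring N M \<iota>) (End_bialg N M \<iota> q b \<beta>) (hatA_bialg N M \<iota> E k x y) \<and>
         hopf_isomorphic (cent_ring N M \<iota>) (Cas_bialg N M \<iota> q b \<beta>) (hatB_bialg N M \<iota> E k x y)"
proof -
  interpret d2_frobenius_ext N M \<iota> E k x y q b \<beta>
    using assms by (intro d2_frobenius_ext.intro frob_ext.intro ring_ext.intro frob_ext_axioms.intro d2_frobenius_ext_axioms.intro)
      (simp_all add: biseparable_def)
  show ?thesis
    using kadison_nikshych unfolding AA_def BB_def HA_def HB_def .
qed

end
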